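(* (Sufficient condition of optimality.) For the controlled backward stochastic system with delay described in the context, let assumptions (A) and (B) stated there hold. For $u(\cdot)\in\mathcal{U}$, let $(y(\cdot),z(\cdot))$ be the corresponding trajectory, write $\Theta(t)=(y(t),y_\delta(t),z(t),z_\delta(t))$, and let $p(\cdot)$ be the corresponding solution of the adjoint equation. Suppose that for $t\in[0,T]$ $$\begin{aligned} &\Big\langle H_v(t,\Theta(t),u(t),u_\delta(t),p(t))+\mathbb{E}^{\mathcal{F}_t}\Big[\int_t^{t+\delta}H_{v_\delta}(s,\Theta(s),u(s),u_\delta(s),p(s))\phi(s,t)\chi_{[0,T]}(s)ds\Big]\frac{\alpha(dt)}{dt},\,u(t)\Big\rangle\\ &=\max_{v\in U}\Big\langle H_v(t,\Theta(t),u(t),u_\delta(t),p(t))+\mathbb{E}^{\mathcal{F}_t}\Big[\int_t^{t+\delta}H_{v_\delta}(s,\Theta(s),u(s),u_\delta(s),p(s))\phi(s,t)\chi_{[0,T]}(s)ds\Big]\frac{\alpha(dt)}{dt},\,v\Big\rangle . \end{aligned}$$ Suppose moreover that $H(t,y,y_\delta,z,z_\delta,v,v_\delta,p(t))$ is a concave function of $(y,y_\delta,z,z_\delta,v,v_\delta)$ and that $\gamma$ is concave in $y$. Then $u(\cdot)$ is an optimal control, i.e. it maximizes $J$ over $\mathcal{U}$.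
   Context: **Probability setting.** $T>0$; $W$ is a standard $d$-dimensional Brownian motion on a complete probability space $(\Omega,\mathcal{F},\mathbb{P})$; $\mathbb{F}=\{\mathcal{F}_t\}_{t\ge0}$ is the filtration generated by $W$ and augmented by all $\mathbb{P}$-null sets; $\mathbb{E}^{\mathcal{F}_t}=\mathbb{E}[\cdot|\mathcal{F}_t]$. $L^p_{\mathbb{F}}(t_1,t_2;H)$ is the space of $H$-valued $\mathbb{F}$-adapted processes $h$ with $\mathbb{E}\int_{t_1}^{t_2}|h(t)|^pdt<\infty$; $L^2(\Omega,\mathcal{F}_T,\mathbb{P};\mathbb{R}^n)$ is the space of square-integrable $\mathcal{F}_T$-measurable $\mathbb{R}^n$-valued random variables. $\langle\cdot,\cdot\rangle$ is the Euclidean inner product (on $\mathbb{R}^{n\times d}$: $\mathrm{tr}(AB^\top)$). **Delay.** $0\le\delta\le T$ is the time delay; $\phi(t,s)$ is a given bounded $\mathcal{F}_s$-adapted process with $|\phi|\le M$ for a constant $M>0$; $\alpha$ is some $\sigma$-finite measure, and $\frac{\alpha(dt)}{dt}$ denotes the Radon–Nikodym derivative. For a process $x$ put $x_\delta(t)=\int_{t-\delta}^t\phi(t,s)x(s)\alpha(ds)$; this defines $y_\delta,z_\delta,v_\delta,u_\delta$. **Controls.** $U\subset\mathbb{R}^k$ is nonempty and convex; $\eta$ is the given initial path of the control. $\mathcal{U}$ is the set of admissible controls: processes $v(\cdot)$ with $v(t)=\eta(t)$ on $[-\delta,0)$, $v\in L^2_{\mathbb{F}}(0,T;\mathbb{R}^k)$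 and $v(t)\in U$ a.s. for $t\in[0,T]$. **State equation.** $f:\Omega\times[0,T]\times\mathbb{R}^n\times\mathbb{R}^n\times\mathbb{R}^{n\times d}\times\mathbb{R}^{n\times d}\times\mathbb{R}^k\times\mathbb{R}^k\to\mathbb{R}^n$ is a given measurable, $\mathbb{F}$-adapted function with $\mathbb{E}\int_0^T|f(t,0,\dots,0)|^2dt<\infty$; $\xi\in L^2(\Omega,\mathcal{F}_T,\mathbb{P};\mathbb{R}^n)$; the initial paths $\varphi$ (deterministic) and $\psi$ are given square-integrable functions. For $v\in\mathcal{U}$ the trajectory $(y^v,z^v)$ solves $$\left\{\begin{aligned}-dy(t)&=f(t,y(t),y_\delta(t),z(t),z_\delta(t),v(t),v_\delta(t))dt-z(t)dW(t),\ t\in[0,T],\\ y(T)&=\xi,\qquad y(t)=\varphi(t),\ z(t)=\psi(t),\ t\in[-\delta,0).\end{aligned}\right.$$ The delay $\delta$ is taken sufficiently small that this equation has a unique solution $(y^v,z^v)\in L^2_{\mathbb{F}}(-\delta,T;\mathbb{R}^n)\times L^2_{\mathbb{F}}(-\delta,T;\mathbb{R}^{n\times d})$ for every $v\in\mathcal{U}$. **Objective** (to be maximized over $\mathcal{U}$): $$J(v(\cdot))=\mathbb{E}\Big[\int_0^Tl(t,y^v(t),y^v_\delta(t),z^v(t),z^v_\delta(t),v(t),v_\delta(t))dt+\gamma(y^v(0))\Big],$$ with $l$ and $\gamma$ real-valued. **Assumptions.** (A) $f$ is continuously differentiable in $(y,y_\delta,z,z_\delta,v,v_\delta)$, and the partial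 derivatives $f_y,f_{y_\delta},f_z,f_{z_\delta},f_v,f_{v_\delta}$ are uniformly bounded. (B) For each $v\in\mathcal{U}$, $l(\cdot,y^v,y^v_\delta,z^v,z^v_\delta,v,v_\delta)\in L^1_{\mathbb{F}}(0,T;\mathbb{R})$; $l$ is differentiable in $(y,y_\delta,z,z_\delta,v,v_\delta)$, $\gamma$ is differentiable in $y$, and all the derivatives are bounded. **Hamiltonian.** $H(t,y,y_\delta,z,z_\delta,v,v_\delta,p)=l(t,y,y_\delta,z,z_\delta,v,v_\delta)-\langle f(t,y,y_\delta,z,z_\delta,v,v_\delta),p\rangle$ for $p\in\mathbb{R}^n$; subscripts on $H$ denote partial derivatives. **Adjoint equation.** For $v\in\mathcal{U}$, with $\Theta^v(t)=(y^v(t),y^v_\delta(t),z^v(t),z^v_\delta(t))$, the adjoint process $p^v$ is the $\mathcal{F}_t$-adapted solution of the advanced stochastic differential equation, for $t\in[0,T]$, $$\left\{\begin{aligned}dp^v(t)=&\Big\{-H_y(t,\Theta^v(t),v(t),v_\delta(t),p^v(t))\\&\ -\mathbb{E}^{\mathcal{F}_t}\Big[\int_t^{t+\delta}H_{y_\delta}(s,\Theta^v(s),v(s),v_\delta(s),p^v(s))\phi(s,t)\chi_{[0,T]}(s)ds\Big]\frac{\alpha(dt)}{dt}\Big\}dt\\&+\Big\{-H_z(t,\Theta^v(t),v(t),v_\delta(t),p^v(t))\\&\ -\mathbb{E}^{\mathcal{F}_t}\Big[\int_t^{t+\delta}H_{z_\delta}(s,\Theta^v(s),v(s),v_\delta(s),p^v(s))\phi(s,t)\chi_{[0,T]}(s)ds\Big]\frac{\alpha(dt)}{dt}\Big\}dW(t),\\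 p^v(0)=&-\gamma_y(y^v(0)).\end{aligned}\right.$$ $\chi_{[0,T]}$ is the indicator function of $[0,T]$, so that values of $p^v$ on $(T,T+\delta]$ are not needed.
   Formalization: For arbitrary σ-finite α the integral x_δ can diverge; it is assumed that α has a density with respect to dt and that x_δ converges absolutely and is square-integrable for every square-integrable adapted process x on [-δ,T]. *)

theory Defs
  imports "HOL-Probability.Probability"
begin

section \<open>Data of the control problem\<close>

text \<open>
  The arguments \<open>(y, y\<^sub>\<delta>, z, z\<^sub>\<delta>, v, v\<^sub>\<delta>)\<close> of the coefficients form one tuple. An element of
  \<open>real^'d^'n\<close> is an \<open>n \<times> d\<close> matrix, and its inner product is \<open>tr (A B\<^sup>T)\<close>.
\<close>

type_synonym ('n, 'd, 'k) args =
  "(real^'n) \<times> (real^'n) \<times> (real^'d^'n) \<times> (real^'d^'n) \<times> (real^'k) \<times> (real^'k)"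

text \<open>
  All processes take the time first and the scenario second. The coefficients \<open>f\<close>
  (\<open>driver\<close>) and \<open>l\<close> (\<open>running\<close>) may depend on the scenario.
\<close>

record ('w, 'n, 'd, 'k) delay_problem =
  prob     :: "'w measure"
  BM       :: "real \<Rightarrow> 'w \<Rightarrow> real^'d::finite"                         \<comment> \<open>\<open>W\<close>\<close>
  horizon  :: real                                                \<comment> \<open>\<open>T\<close>\<close>
  delay    :: real                                                \<comment> \<open>\<open>\<delta>\<close>\<close>
  kernel   :: "real \<Rightarrow> real \<Rightarrow> 'w \<Rightarrow> real"                         \<comment> \<open>\<open>\<phi>(t,s)\<close>\<close>
  dmeas    :: "real measure"                                      \<comment> \<open>\<open>\<alpha>\<close>\<close>
  controls :: "(real^'k::finite) set"                             \<comment> \<open>\<open>U\<close>\<close>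
  vinit    :: "real \<Rightarrow> 'w \<Rightarrow> real^'k::finite"                         \<comment> \<open>\<open>\<eta>\<close>\<close>
  yinit    :: "real \<Rightarrow> real^'n::finite"                               \<comment> \<open>\<open>\<phi>\<close>, the initial path of \<open>y\<close>\<close>
  zinit    :: "real \<Rightarrow> 'w \<Rightarrow> real^'d::finite^'n::finite"              \<comment> \<open>\<open>\<psi>\<close>\<close>
  terminal :: "'w \<Rightarrow> real^'n::finite"                              \<comment> \<open>\<open>\<xi>\<close>\<close>
  driver   :: "real \<Rightarrow> 'w \<Rightarrow> ('n::finite, 'd::finite, 'k::finite) args \<Rightarrow> real^'n::finite"
  running  :: "real \<Rightarrow> 'w \<Rightarrow> ('n::finite, 'd::finite, 'k::finite) args \<Rightarrow> real"
  initial  :: "real^'n::finite \<Rightarrow> real"                            \<comment> \<open>\<open>\<gamma>\<close>\<close>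


section \<open>Brownian motion, filtration and stochastic integral\<close>

text \<open>
  The last clause says that all components of all increments over successive intervals
  are jointly independent.
\<close>

definition brownian_motion :: "'w measure \<Rightarrow> (real \<Rightarrow> 'w \<Rightarrow> real^'d::finite) \<Rightarrow> bool" where
  "brownian_motion M W \<longleftrightarrow>
     (\<forall>t\<ge>0. W t \<in> borel_measurable M) \<and>
     (AE \<omega> in M. W 0 \<omega> = 0) \<and>
     (AE \<omega> in M. continuous_on {0..} (\<lambda>t. W t \<omega>)) \<and>
     (\<forall>s t i. 0 \<le> s \<and> s < t \<longrightarrow>
        distributed M lborel (\<lambda>\<omega>. (W t \<omega> - W s \<omega>) $ i) (normal_density 0 (sqrt (t - s)))) \<and>
     (\<forall>(m::nat) \<tau>. 0 \<le> \<tau> 0 \<and> (\<forall>j<m. \<tau> j < \<tau> (Suc j)) \<longrightarrow>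
        prob_space.indep_vars M (\<lambda>_. borel)
          (\<lambda>(i, j) \<omega>. (W (\<tau> (Suc j)) \<omega> - W (\<tau> j) \<omega>) $ i) (UNIV \<times> {..<m}))"

text \<open>
  The augmented filtration of \<open>W\<close>. At negative times it is the trivial \<open>\<sigma>\<close>-algebra of the
  events of probability 0 or 1, which coincides with \<open>\<F>\<^sub>0\<close>; adaptedness on \<open>[-\<delta>, 0)\<close> refers to it.
\<close>

definition filt :: "('w, 'n::finite, 'd::finite, 'k::finite) delay_problem \<Rightarrow> real \<Rightarrow> 'w measure" where
  "filt P t = sigma (space (prob P))
     ({BM P s -` B \<inter> space (prob P) | s B. 0 \<le> s \<and> s \<le> t \<and> B \<in> sets borel} \<union> null_sets (prob P))"

definition measurable_adapted ::
  "('w, 'n::finite, 'd::finite, 'k::finite) delay_problem \<Rightarrow> real set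
     \<Rightarrow> (real \<Rightarrow> 'w \<Rightarrow> 'h::euclidean_space) \<Rightarrow> bool" where
  "measurable_adapted P I h \<longleftrightarrow>
     (\<lambda>(t, \<omega>). h t \<omega>) \<in> borel_measurable (restrict_space borel I \<Otimes>\<^sub>M prob P) \<and>
     (\<forall>t\<in>I. h t \<in> borel_measurable (filt P t))"

text \<open>The processes in \<open>L\<^sup>p\<^sub>\<F>(I; H)\<close>.\<close>

definition LpF ::
  "('w, 'n::finite, 'd::finite, 'k::finite) delay_problem \<Rightarrow> nat \<Rightarrow> real set
     \<Rightarrow> (real \<Rightarrow> 'w \<Rightarrow> 'h::euclidean_space) \<Rightarrow> bool" where
  "LpF P p I h \<longleftrightarrow> measurable_adapted P I h \<and>
     (\<integral>\<^sup>+\<omega>. (\<integral>\<^sup>+t\<in>I. ennreal (norm (h t \<omega>) ^ p) \<partial>lborel) \<partial>prob P) < \<infinity>"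

text \<open>
  Simple integrands \<open>\<Sum>i<m. \<one>\<^bsub>(\<tau> i, \<tau> (i+1)]\<^esub> c\<^sub>i\<close> and the Ito integral over \<open>[a, b]\<close> of a process
  in \<open>L\<^sup>2\<^sub>\<F>(a, b)\<close> as the \<open>L\<^sup>2\<close>-limit of integrals of simple integrands. The predicate
  determines the integral \<open>X\<close> almost surely.
\<close>

definition simple_integrand ::
  "('w, 'n::finite, 'd::finite, 'k::finite) delay_problem \<Rightarrow> real \<Rightarrow> real
     \<Rightarrow> nat \<Rightarrow> (nat \<Rightarrow> real) \<Rightarrow> (nat \<Rightarrow> 'w \<Rightarrow> real^'d^'n) \<Rightarrow> bool" where
  "simple_integrand P a b m \<tau> c \<longleftrightarrow>
     a \<le> \<tau> 0 \<and> \<tau> m \<le> b \<and>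
     (\<forall>i<m. \<tau> i \<le> \<tau> (Suc i) \<and> c i \<in> borel_measurable (filt P (\<tau> i)) \<and>
            (\<exists>K. \<forall>\<omega>\<in>space (prob P). norm (c i \<omega>) \<le> K))"

definition simple_process ::
  "nat \<Rightarrow> (nat \<Rightarrow> real) \<Rightarrow> (nat \<Rightarrow> 'w \<Rightarrow> real^'d::finite^'n::finite) \<Rightarrow> real \<Rightarrow> 'w \<Rightarrow> real^'d^'n" where
  "simple_process m \<tau> c t \<omega> = (\<Sum>i<m. indicator {\<tau> i<..\<tau> (Suc i)} t *\<^sub>R c i \<omega>)"

definition simple_integral ::
  "(real \<Rightarrow> 'w \<Rightarrow> real^'d::finite) \<Rightarrow> nat \<Rightarrow> (nat \<Rightarrow> real) \<Rightarrow> (nat \<Rightarrow> 'w \<Rightarrow> real^'d^'n::finite)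
     \<Rightarrow> 'w \<Rightarrow> real^'n" where
  "simple_integral W m \<tau> c \<omega> = (\<Sum>i<m. c i \<omega> *v (W (\<tau> (Suc i)) \<omega> - W (\<tau> i) \<omega>))"

definition has_ito_integral ::
  "('w, 'n::finite, 'd::finite, 'k::finite) delay_problem \<Rightarrow> real \<Rightarrow> real
     \<Rightarrow> (real \<Rightarrow> 'w \<Rightarrow> real^'d^'n) \<Rightarrow> ('w \<Rightarrow> real^'n) \<Rightarrow> bool" where
  "has_ito_integral P a b h X \<longleftrightarrow>
     LpF P 2 {a..b} h \<and> X \<in> borel_measurable (prob P) \<and>
     (\<exists>m \<tau> c. (\<forall>k::nat. simple_integrand P a b (m k) (\<tau> k) (c k)) \<and>
       ((\<lambda>k. \<integral>\<^sup>+\<omega>. (\<integral>\<^sup>+t\<in>{a..b}. ennreal ((norm (simple_process (m k) (\<tau> k) (c k) t \<omega> - h t \<omega>))\<^sup>2)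
               \<partial>lborel) \<partial>prob P) \<longlonglongrightarrow> 0) \<and>
       ((\<lambda>k. \<integral>\<^sup>+\<omega>. ennreal ((norm (simple_integral (BM P) (m k) (\<tau> k) (c k) \<omega> - X \<omega>))\<^sup>2)
               \<partial>prob P) \<longlonglongrightarrow> 0))"

text \<open>Conditional expectation of a vector or matrix, taken coordinatewise.\<close>

definition cond_expectation ::
  "'w measure \<Rightarrow> 'w measure \<Rightarrow> ('w \<Rightarrow> 'h::euclidean_space) \<Rightarrow> 'w \<Rightarrow> 'h" where
  "cond_expectation M F X \<omega> = (\<Sum>b\<in>Basis. real_cond_exp M F (\<lambda>\<omega>. X \<omega> \<bullet> b) \<omega> *\<^sub>R b)"

text \<open>
  \<open>real_cond_exp\<close> picks an arbitrary version separately for each \<open>t\<close>. Inside a time or stochastic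
  integral the process \<open>t \<mapsto> E[X(t) | \<F>\<^sub>t]\<close> has to be a version that is measurable in
  \<open>(t, \<omega>)\<close>.
\<close>

definition cond_exp_process ::
  "('w, 'n::finite, 'd::finite, 'k::finite) delay_problem
     \<Rightarrow> (real \<Rightarrow> 'w \<Rightarrow> 'h::euclidean_space) \<Rightarrow> (real \<Rightarrow> 'w \<Rightarrow> 'h) \<Rightarrow> bool" where
  "cond_exp_process P X q \<longleftrightarrow>
     measurable_adapted P {0..horizon P} q \<and>
     (\<forall>t\<in>{0..horizon P}. AE \<omega> in prob P. q t \<omega> = cond_expectation (prob P) (filt P t) (X t) \<omega>)"


section \<open>Delay, admissible controls and state equation\<close>

definition delayed ::
  "('w, 'n::finite, 'd::finite, 'k::finite) delay_problem
     \<Rightarrow> (real \<Rightarrow> 'w \<Rightarrow> 'h::euclidean_space) \<Rightarrow> real \<Rightarrow> 'w \<Rightarrow> 'h" where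
  "delayed P x t \<omega> = (LINT s:{t - delay P..t}|dmeas P. kernel P t s \<omega> *\<^sub>R x s \<omega>)"

definition args_at ::
  "('w, 'n::finite, 'd::finite, 'k::finite) delay_problem
     \<Rightarrow> (real \<Rightarrow> 'w \<Rightarrow> real^'n) \<Rightarrow> (real \<Rightarrow> 'w \<Rightarrow> real^'d^'n) \<Rightarrow> (real \<Rightarrow> 'w \<Rightarrow> real^'k)
     \<Rightarrow> real \<Rightarrow> 'w \<Rightarrow> ('n, 'd, 'k) args" where
  "args_at P y z v t \<omega> =
     (y t \<omega>, delayed P y t \<omega>, z t \<omega>, delayed P z t \<omega>, v t \<omega>, delayed P v t \<omega>)"

definition admissible ::
  "('w, 'n::finite, 'd::finite, 'k::finite) delay_problem \<Rightarrow> (real \<Rightarrow> 'w \<Rightarrow> real^'k) set" where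
  "admissible P = {v.
     (\<forall>t\<in>{- delay P..<0}. \<forall>\<omega>\<in>space (prob P). v t \<omega> = vinit P t \<omega>) \<and>
     LpF P 2 {0..horizon P} v \<and>
     (\<forall>t\<in>{0..horizon P}. AE \<omega> in prob P. v t \<omega> \<in> controls P)}"

text \<open>
  \<open>(y, z)\<close> solves the state equation for the control \<open>v\<close>. The integrated form over
  \<open>[t, T]\<close> contains the terminal condition \<open>y(T) = \<xi>\<close> (take \<open>t = T\<close>).
\<close>

definition state_solution ::
  "('w, 'n::finite, 'd::finite, 'k::finite) delay_problem
     \<Rightarrow> (real \<Rightarrow> 'w \<Rightarrow> real^'k) \<Rightarrow> (real \<Rightarrow> 'w \<Rightarrow> real^'n) \<Rightarrow> (real \<Rightarrow> 'w \<Rightarrow> real^'d^'n) \<Rightarrow> bool" where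
  "state_solution P v y z \<longleftrightarrow>
     LpF P 2 {- delay P..horizon P} y \<and> LpF P 2 {- delay P..horizon P} z \<and>
     (\<forall>t\<in>{- delay P..<0}. \<forall>\<omega>\<in>space (prob P). y t \<omega> = yinit P t \<and> z t \<omega> = zinit P t \<omega>) \<and>
     (\<forall>t\<in>{0..horizon P}. \<exists>I. has_ito_integral P t (horizon P) z I \<and>
        (AE \<omega> in prob P. y t \<omega> = terminal P \<omega>
           + (LINT s:{t..horizon P}|lborel. driver P s \<omega> (args_at P y z v s \<omega>)) - I \<omega>))"

text \<open>Existence, and uniqueness as elements of \<open>L\<^sup>2\<^sub>\<F> \<times> L\<^sup>2\<^sub>\<F>\<close>.\<close>

definition state_well_posed ::
  "('w, 'n::finite, 'd::finite, 'k::finite) delay_problem \<Rightarrow> bool" where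
  "state_well_posed P \<longleftrightarrow> (\<forall>v\<in>admissible P.
     (\<exists>y z. state_solution P v y z) \<and>
     (\<forall>y z y' z'. state_solution P v y z \<longrightarrow> state_solution P v y' z' \<longrightarrow>
        (AE t in lborel. t \<in> {0..horizon P} \<longrightarrow>
           (AE \<omega> in prob P. y t \<omega> = y' t \<omega> \<and> z t \<omega> = z' t \<omega>))))"

definition trajectory ::
  "('w, 'n::finite, 'd::finite, 'k::finite) delay_problem
     \<Rightarrow> (real \<Rightarrow> 'w \<Rightarrow> real^'k) \<Rightarrow> (real \<Rightarrow> 'w \<Rightarrow> real^'n) \<times> (real \<Rightarrow> 'w \<Rightarrow> real^'d^'n)" where
  "trajectory P v = (SOME (y, z). state_solution P v y z)"

definition objective ::
  "('w, 'n::finite, 'd::finite, 'k::finite) delay_problem \<Rightarrow> (real \<Rightarrow> 'w \<Rightarrow> real^'k) \<Rightarrow> real" where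
  "objective P v = (case trajectory P v of (y, z) \<Rightarrow>
     (\<integral>\<omega>. (LINT t:{0..horizon P}|lborel. running P t \<omega> (args_at P y z v t \<omega>))
           + initial P (y 0 \<omega>) \<partial>prob P))"

definition optimal_control ::
  "('w, 'n::finite, 'd::finite, 'k::finite) delay_problem \<Rightarrow> (real \<Rightarrow> 'w \<Rightarrow> real^'k) \<Rightarrow> bool" where
  "optimal_control P u \<longleftrightarrow> is_arg_max (objective P) (\<lambda>v. v \<in> admissible P) u"


section \<open>Standing assumptions\<close>

text \<open>
  \<open>x\<^sub>\<delta>\<close> is given by an absolutely convergent integral and is square-integrable for every
  \<open>x \<in> L\<^sup>2\<^sub>\<F>(-\<delta>, T)\<close>. An arbitrary \<open>\<sigma>\<close>-finite \<open>\<alpha>\<close> with a density does not ensure this; a density that is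
  square-integrable on \<open>[-\<delta>, T]\<close> does. The scalar case gives the vector case, applied to
  the norm.
\<close>

definition delay_well_defined ::
  "('w, 'n::finite, 'd::finite, 'k::finite) delay_problem \<Rightarrow> bool" where
  "delay_well_defined P \<longleftrightarrow> (\<forall>x :: real \<Rightarrow> 'w \<Rightarrow> real. LpF P 2 {- delay P..horizon P} x \<longrightarrow>
     (\<integral>\<^sup>+\<omega>. (\<integral>\<^sup>+t\<in>{0..horizon P}.
        (\<integral>\<^sup>+s\<in>{t - delay P..t}. ennreal \<bar>kernel P t s \<omega> * x s \<omega>\<bar> \<partial>dmeas P)\<^sup>2
        \<partial>lborel) \<partial>prob P) < \<infinity>)"

definition measurable_coefficient ::
  "('w, 'n::finite, 'd::finite, 'k::finite) delay_problem
     \<Rightarrow> (real \<Rightarrow> 'w \<Rightarrow> ('n, 'd, 'k) args \<Rightarrow> 'h::euclidean_space) \<Rightarrow> bool" where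
  "measurable_coefficient P g \<longleftrightarrow>
     (\<lambda>(t, \<omega>, x). g t \<omega> x)
        \<in> borel_measurable (restrict_space borel {0..horizon P} \<Otimes>\<^sub>M prob P \<Otimes>\<^sub>M borel) \<and>
     (\<forall>t\<in>{0..horizon P}. \<forall>x. (\<lambda>\<omega>. g t \<omega> x) \<in> borel_measurable (filt P t))"

definition delay_setting ::
  "('w, 'n::finite, 'd::finite, 'k::finite) delay_problem \<Rightarrow> bool" where
  "delay_setting P \<longleftrightarrow>
     prob_space (prob P) \<and> complete_measure (prob P) \<and> brownian_motion (prob P) (BM P) \<and>
     0 < horizon P \<and> 0 \<le> delay P \<and> delay P \<le> horizon P \<and>
     \<comment> \<open>the kernel and the measure of the delay\<close>
     (\<lambda>(t, s, \<omega>). kernel P t s \<omega>) \<in> borel_measurable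
        (restrict_space borel {0..horizon P} \<Otimes>\<^sub>M restrict_space borel {- delay P..horizon P} \<Otimes>\<^sub>M prob P) \<and>
     (\<forall>t\<in>{0..horizon P}. \<forall>s\<in>{- delay P..horizon P}. kernel P t s \<in> borel_measurable (filt P s)) \<and>
     (\<exists>K>0. \<forall>t\<in>{0..horizon P}. \<forall>s\<in>{- delay P..horizon P}. \<forall>\<omega>\<in>space (prob P).
        \<bar>kernel P t s \<omega>\<bar> \<le> K) \<and>
     sets (dmeas P) = sets borel \<and> sigma_finite_measure (dmeas P) \<and>
     absolutely_continuous lborel (dmeas P) \<and>
     delay_well_defined P \<and>
     \<comment> \<open>controls, initial paths and terminal value\<close>
     controls P \<noteq> {} \<and> convex (controls P) \<and>
     LpF P 2 {- delay P..<0} (vinit P) \<and>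
     LpF P 2 {- delay P..<0} (\<lambda>t _. yinit P t) \<and>
     LpF P 2 {- delay P..<0} (zinit P) \<and>
     terminal P \<in> borel_measurable (filt P (horizon P)) \<and>
     (\<integral>\<^sup>+\<omega>. ennreal ((norm (terminal P \<omega>))\<^sup>2) \<partial>prob P) < \<infinity> \<and>
     \<comment> \<open>coefficients\<close>
     measurable_coefficient P (driver P) \<and>
     LpF P 2 {0..horizon P} (\<lambda>t \<omega>. driver P t \<omega> 0) \<and>
     measurable_coefficient P (running P) \<and>
     state_well_posed P"


section \<open>Partial derivatives and assumptions (A), (B)\<close>

definition grad :: "('a::real_inner \<Rightarrow> real) \<Rightarrow> 'a \<Rightarrow> 'a" where
  "grad g x = (THE D. GDERIV g x :> D)"

fun grad_y :: "(('n::finite, 'd::finite, 'k::finite) args \<Rightarrow> real) \<Rightarrow> ('n, 'd, 'k) args \<Rightarrow> real^'n" where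
  "grad_y g (y, yd, z, zd, v, vd) = grad (\<lambda>a. g (a, yd, z, zd, v, vd)) y"

fun grad_yd :: "(('n::finite, 'd::finite, 'k::finite) args \<Rightarrow> real) \<Rightarrow> ('n, 'd, 'k) args \<Rightarrow> real^'n" where
  "grad_yd g (y, yd, z, zd, v, vd) = grad (\<lambda>a. g (y, a, z, zd, v, vd)) yd"

fun grad_z :: "(('n::finite, 'd::finite, 'k::finite) args \<Rightarrow> real) \<Rightarrow> ('n, 'd, 'k) args \<Rightarrow> real^'d^'n" where
  "grad_z g (y, yd, z, zd, v, vd) = grad (\<lambda>a. g (y, yd, a, zd, v, vd)) z"

fun grad_zd :: "(('n::finite, 'd::finite, 'k::finite) args \<Rightarrow> real) \<Rightarrow> ('n, 'd, 'k) args \<Rightarrow> real^'d^'n" where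
  "grad_zd g (y, yd, z, zd, v, vd) = grad (\<lambda>a. g (y, yd, z, a, v, vd)) zd"

fun grad_v :: "(('n::finite, 'd::finite, 'k::finite) args \<Rightarrow> real) \<Rightarrow> ('n, 'd, 'k) args \<Rightarrow> real^'k" where
  "grad_v g (y, yd, z, zd, v, vd) = grad (\<lambda>a. g (y, yd, z, zd, a, vd)) v"

fun grad_vd :: "(('n::finite, 'd::finite, 'k::finite) args \<Rightarrow> real) \<Rightarrow> ('n, 'd, 'k) args \<Rightarrow> real^'k" where
  "grad_vd g (y, yd, z, zd, v, vd) = grad (\<lambda>a. g (y, yd, z, zd, v, a)) vd"

definition assumption_A ::
  "('w, 'n::finite, 'd::finite, 'k::finite) delay_problem \<Rightarrow> bool" where
  "assumption_A P \<longleftrightarrow>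
     (\<forall>t\<in>{0..horizon P}. \<forall>\<omega>\<in>space (prob P). \<exists>Df.
        (\<forall>x. (driver P t \<omega> has_derivative blinfun_apply (Df x)) (at x)) \<and> continuous_on UNIV Df) \<and>
     (\<exists>C. \<forall>t\<in>{0..horizon P}. \<forall>\<omega>\<in>space (prob P). \<forall>y yd z zd v vd.
        onorm (frechet_derivative (\<lambda>a. driver P t \<omega> (a, yd, z, zd, v, vd)) (at y)) \<le> C \<and>
        onorm (frechet_derivative (\<lambda>a. driver P t \<omega> (y, a, z, zd, v, vd)) (at yd)) \<le> C \<and>
        onorm (frechet_derivative (\<lambda>a. driver P t \<omega> (y, yd, a, zd, v, vd)) (at z)) \<le> C \<and>
        onorm (frechet_derivative (\<lambda>a. driver P t \<omega> (y, yd, z, a, v, vd)) (at zd)) \<le> C \<and>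
        onorm (frechet_derivative (\<lambda>a. driver P t \<omega> (y, yd, z, zd, a, vd)) (at v)) \<le> C \<and>
        onorm (frechet_derivative (\<lambda>a. driver P t \<omega> (y, yd, z, zd, v, a)) (at vd)) \<le> C)"

definition assumption_B ::
  "('w, 'n::finite, 'd::finite, 'k::finite) delay_problem \<Rightarrow> bool" where
  "assumption_B P \<longleftrightarrow>
     (\<forall>v\<in>admissible P. \<forall>y z. state_solution P v y z \<longrightarrow>
        LpF P 1 {0..horizon P} (\<lambda>t \<omega>. running P t \<omega> (args_at P y z v t \<omega>))) \<and>
     (\<forall>t\<in>{0..horizon P}. \<forall>\<omega>\<in>space (prob P). \<forall>x. running P t \<omega> differentiable (at x)) \<and>
     (\<forall>y. initial P differentiable (at y)) \<and>
     (\<exists>C. (\<forall>y. norm (grad (initial P) y) \<le> C) \<and>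
        (\<forall>t\<in>{0..horizon P}. \<forall>\<omega>\<in>space (prob P). \<forall>x.
           norm (grad_y (running P t \<omega>) x) \<le> C \<and> norm (grad_yd (running P t \<omega>) x) \<le> C \<and>
           norm (grad_z (running P t \<omega>) x) \<le> C \<and> norm (grad_zd (running P t \<omega>) x) \<le> C \<and>
           norm (grad_v (running P t \<omega>) x) \<le> C \<and> norm (grad_vd (running P t \<omega>) x) \<le> C))"


section \<open>Hamiltonian and adjoint equation\<close>

definition hamiltonian ::
  "('w, 'n::finite, 'd::finite, 'k::finite) delay_problem
     \<Rightarrow> real \<Rightarrow> 'w \<Rightarrow> real^'n \<Rightarrow> ('n, 'd, 'k) args \<Rightarrow> real" where
  "hamiltonian P t \<omega> p x = running P t \<omega> x - driver P t \<omega> x \<bullet> p"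

text \<open>
  For a partial gradient operator \<open>D\<close> (one of \<open>grad_y\<close>, ..., \<open>grad_vd\<close>), the corresponding
  derivative of \<open>H\<close> along the trajectory and the adjoint process.
\<close>

definition H_along ::
  "('w, 'n::finite, 'd::finite, 'k::finite) delay_problem
     \<Rightarrow> ((('n, 'd, 'k) args \<Rightarrow> real) \<Rightarrow> ('n, 'd, 'k) args \<Rightarrow> 'h)
     \<Rightarrow> (real \<Rightarrow> 'w \<Rightarrow> real^'n) \<Rightarrow> (real \<Rightarrow> 'w \<Rightarrow> real^'d^'n) \<Rightarrow> (real \<Rightarrow> 'w \<Rightarrow> real^'k)
     \<Rightarrow> (real \<Rightarrow> 'w \<Rightarrow> real^'n) \<Rightarrow> real \<Rightarrow> 'w \<Rightarrow> 'h" where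
  "H_along P D y z v p t \<omega> = D (hamiltonian P t \<omega> (p t \<omega>)) (args_at P y z v t \<omega>)"

text \<open>\<open>\<integral>\<^bsub>[t, t+\<delta>]\<^esub> G(s) \<phi>(s,t) \<chi>\<^bsub>[0,T]\<^esub>(s) ds\<close>\<close>

definition anticipated ::
  "('w, 'n::finite, 'd::finite, 'k::finite) delay_problem
     \<Rightarrow> (real \<Rightarrow> 'w \<Rightarrow> 'h::euclidean_space) \<Rightarrow> real \<Rightarrow> 'w \<Rightarrow> 'h" where
  "anticipated P G t \<omega> =
     (LINT s:{t..t + delay P}|lborel. (kernel P s t \<omega> * indicator {0..horizon P} s) *\<^sub>R G s \<omega>)"

definition delay_density ::
  "('w, 'n::finite, 'd::finite, 'k::finite) delay_problem \<Rightarrow> real \<Rightarrow> real" where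
  "delay_density P t = enn2real (RN_deriv lborel (dmeas P) t)"

text \<open>
  \<open>p\<close> solves the adjoint equation of the control \<open>v\<close> with trajectory \<open>(y, z)\<close>; \<open>q\<close> and \<open>r\<close>
  are the conditional expectations in the drift and in the diffusion coefficient. The initial
  condition is the case \<open>t = 0\<close>.
\<close>

definition adjoint_solution ::
  "('w, 'n::finite, 'd::finite, 'k::finite) delay_problem
     \<Rightarrow> (real \<Rightarrow> 'w \<Rightarrow> real^'k) \<Rightarrow> (real \<Rightarrow> 'w \<Rightarrow> real^'n) \<Rightarrow> (real \<Rightarrow> 'w \<Rightarrow> real^'d^'n)
     \<Rightarrow> (real \<Rightarrow> 'w \<Rightarrow> real^'n) \<Rightarrow> bool" where
  "adjoint_solution P v y z p \<longleftrightarrow>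
     LpF P 2 {0..horizon P} p \<and>
     (\<exists>q r. cond_exp_process P (anticipated P (H_along P grad_yd y z v p)) q \<and>
        cond_exp_process P (anticipated P (H_along P grad_zd y z v p)) r \<and>
        (\<forall>t\<in>{0..horizon P}. \<exists>I.
           has_ito_integral P 0 t
             (\<lambda>s \<omega>. - H_along P grad_z y z v p s \<omega> - delay_density P s *\<^sub>R r s \<omega>) I \<and>
           (AE \<omega> in prob P. p t \<omega> = - grad (initial P) (y 0 \<omega>)
              + (LINT s:{0..t}|lborel. - H_along P grad_y y z v p s \<omega> - delay_density P s *\<^sub>R q s \<omega>)
              + I \<omega>)))"

text \<open>\<open>H\<^sub>v + E[\<integral> H\<^bsub>v\<delta>\<^esub> \<phi>(s,t) \<chi> ds | \<F>\<^sub>t] \<alpha>(dt)/dt\<close>\<close>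

definition control_gradient ::
  "('w, 'n::finite, 'd::finite, 'k::finite) delay_problem
     \<Rightarrow> (real \<Rightarrow> 'w \<Rightarrow> real^'k) \<Rightarrow> (real \<Rightarrow> 'w \<Rightarrow> real^'n) \<Rightarrow> (real \<Rightarrow> 'w \<Rightarrow> real^'d^'n)
     \<Rightarrow> (real \<Rightarrow> 'w \<Rightarrow> real^'n) \<Rightarrow> real \<Rightarrow> 'w \<Rightarrow> real^'k" where
  "control_gradient P u y z p t \<omega> = H_along P grad_v y z u p t \<omega>
     + delay_density P t *\<^sub>R
       cond_expectation (prob P) (filt P t) (anticipated P (H_along P grad_vd y z u p) t) \<omega>"

end

theory Submission
  imports Defs
begin

text \<open>
  Let \<open>(y', z')\<close> be the trajectory of another control \<open>v\<close>, put \<open>\<Delta>y = y' - y\<close>, \<open>\<Delta>z = z' - z\<close>,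
  \<open>\<Delta>v = v - u\<close>, and let \<open>l', f'\<close> and \<open>l, f\<close> be the coefficients along the two trajectories. Since
  \<open>l = H + \<langle>f, p\<rangle>\<close>, concavity bounds the difference of the running gains,

  \<open>l' - l \<le> \<langle>p, f' - f\<rangle> + \<langle>H\<^sub>y, \<Delta>y\<rangle> + \<langle>H\<^bsub>y\<delta>\<^esub>, (\<Delta>y)\<^sub>\<delta>\<rangle> + \<langle>H\<^sub>z, \<Delta>z\<rangle> + \<langle>H\<^bsub>z\<delta>\<^esub>, (\<Delta>z)\<^sub>\<delta>\<rangle> + \<langle>H\<^sub>v, \<Delta>v\<rangle> + \<langle>H\<^bsub>v\<delta>\<^esub>, (\<Delta>v)\<^sub>\<delta>\<rangle>\<close>,

  and concavity of \<open>\<gamma>\<close> bounds the difference of the initial gains by \<open>-\<langle>p(0), \<Delta>y(0)\<rangle>\<close>. Three dualities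
  evaluate the expectation of this bound. Fubini shows that the operator \<open>x \<mapsto> x\<^sub>\<delta>\<close> is adjoint to the
  anticipating operator of the adjoint equation (\<open>delay_anticipation_adjoint\<close>); for an adapted \<open>x\<close>
  the anticipating integral may moreover be replaced by its conditional expectation
  (\<open>delay_duality\<close>). Finally the product formula for \<open>\<langle>p, \<Delta>y\<rangle>\<close> expresses \<open>E\<langle>p(0), \<Delta>y(0)\<rangle>\<close> by the
  drifts and diffusions of \<open>p\<close> and \<open>\<Delta>y\<close> (\<open>forward_backward_duality\<close>). The drift and the diffusion of
  \<open>p\<close> are chosen such that all terms in \<open>\<Delta>y\<close> and \<open>\<Delta>z\<close> cancel. What is left is the expected time integral of
  \<open>\<langle>H\<^sub>v + E[\<dots>|\<F>\<^sub>t] \<alpha>(dt)/dt, \<Delta>v(t)\<rangle>\<close>, which is nonpositive by the maximum condition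
  (\<open>control_variation_nonpos\<close>).

  Three points need more than this computation.

  The product formula is not derived from an Ito formula. Only its expectation is needed, and for this
  it suffices that the Ito integral is orthogonal to the past, isometric, and a martingale. These facts
  are proved for simple integrands and carried over to \<open>L\<^sup>2\<close>-limits; they rest on the independence of
  the increments of \<open>W\<close> from the augmented past, which is obtained from the joint independence of
  finitely many increments by an argument with intersection-stable generators.

  The dualities require that the coefficients of \<open>p\<close> are square integrable. The measure \<open>\<alpha>\<close> is only known
  to make \<open>x \<mapsto> x\<^sub>\<delta>\<close> map square-integrable adapted processes to square-integrable ones, so the process
  \<open>E[\<dots>|\<F>\<^sub>t] \<alpha>(dt)/dt\<close> is a priori only known to have a finite pairing with every such \<open>x\<close>. A
  nonnegative function with finite integral against all square-integrable functions of itself is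
  square integrable (\<open>square_integrable_by_duality\<close>).

  The objective refers to one arbitrarily chosen solution of the state equation for each control, while
  the adjoint equation belongs to the given solution. Uniqueness holds only up to equality almost
  everywhere, and the gain must be seen not to depend on the version (\<open>payoff_unique\<close>).
\<close>

section \<open>The Brownian filtration\<close>

lemma filt_generators_subset:
  "{BM P s -` B \<inter> space (prob P) | s B. 0 \<le> s \<and> s \<le> t \<and> B \<in> sets borel} \<union> null_sets (prob P)
     \<subseteq> Pow (space (prob P))"
  by (auto dest: sets.sets_into_space)

lemma space_filt [simp]: "space (filt P t) = space (prob P)"
  unfolding filt_def using filt_generators_subset by (rule space_measure_of)

lemma sets_filt: "sets (filt P t) = sigma_sets (space (prob P))
   ({BM P s -` B \<inter> space (prob P) | s B. 0 \<le> s \<and> s \<le> t \<and> B \<in> sets borel} \<union> null_sets (prob P))"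
  unfolding filt_def using filt_generators_subset by (rule sets_measure_of)

lemma filt_mono: "s \<le> t \<Longrightarrow> sets (filt P s) \<subseteq> sets (filt P t)"
  unfolding sets_filt by (rule sigma_sets_mono') (auto intro: order_trans)

lemma null_sets_in_filt: "A \<in> null_sets (prob P) \<Longrightarrow> A \<in> sets (filt P t)"
  unfolding sets_filt by (rule sigma_sets.Basic) auto

lemma measurable_filt_mono:
  "f \<in> measurable (filt P s) N \<Longrightarrow> s \<le> t \<Longrightarrow> f \<in> measurable (filt P t) N"
  using filt_mono[of s t P] unfolding measurable_def by auto

lemma BM_adapted:
  fixes P :: "('w, 'n::finite, 'd::finite, 'k::finite) delay_problem"
  assumes "0 \<le> s" "s \<le> t"
  shows "BM P s \<in> borel_measurable (filt P t)"
proof (rule measurableI)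
  fix B assume "B \<in> sets (borel :: (real^'d) measure)"
  then show "BM P s -` B \<inter> space (filt P t) \<in> sets (filt P t)"
    unfolding space_filt sets_filt using assms by (intro sigma_sets.Basic) blast
qed auto

locale brownian_problem =
  fixes P :: "('w, 'n::finite, 'd::finite, 'k::finite) delay_problem"
  assumes prob_space_prob: "prob_space (prob P)"
    and brownian: "brownian_motion (prob P) (BM P)"
begin

abbreviation "M \<equiv> prob P"
abbreviation "W \<equiv> BM P"

sublocale prob_space M by (rule prob_space_prob)

lemma BM_measurable: "0 \<le> t \<Longrightarrow> W t \<in> borel_measurable M"
  using brownian unfolding brownian_motion_def by auto

lemma subalgebra_filt: "subalgebra M (filt P t)"
proof -
  have "sets (filt P t) \<subseteq> sets M"
    unfolding sets_filt
    by (intro sets.sigma_sets_subset) (auto intro!: measurable_sets[OF BM_measurable])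
  then show ?thesis by (auto simp: subalgebra_def)
qed

lemma filt_measurable: "X \<in> measurable (filt P t) N \<Longrightarrow> X \<in> measurable M N"
  by (rule measurable_from_subalg[OF subalgebra_filt])

lemma sigma_finite_subalgebra_filt: "sigma_finite_subalgebra M (filt P t)"
  by (intro finite_measure_subalgebra_is_sigma_finite finite_measure_subalgebra.intro
      finite_measure_subalgebra_axioms.intro subalgebra_filt finite_measure_axioms)

text \<open>Augmentation by the null sets makes adaptedness insensitive to the choice of a version.\<close>

lemma filt_measurable_AE_cong:
  fixes X Y :: "'w \<Rightarrow> 'h::{second_countable_topology, t2_space}"
  assumes X: "X \<in> borel_measurable (filt P t)" and Y: "Y \<in> borel_measurable M"
    and XY: "AE \<omega> in M. X \<omega> = Y \<omega>"
  shows "Y \<in> borel_measurable (filt P t)"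
proof (rule measurableI)
  fix B assume B: "B \<in> sets (borel :: 'h measure)"
  obtain Z where Z: "{\<omega> \<in> space M. X \<omega> \<noteq> Y \<omega>} \<subseteq> Z" "Z \<in> null_sets M"
    using AE_E[OF XY] by (metis null_setsI)
  have Y': "Y -` B \<inter> space M \<in> sets M" using measurable_sets[OF Y B] .
  have "(Y -` B \<inter> space M) \<inter> Z \<in> null_sets M"
    using null_set_Int1[OF Z(2) Y'] by (simp add: Int_commute)
  then have 1: "(Y -` B \<inter> space M) \<inter> Z \<in> sets (filt P t)" by (rule null_sets_in_filt)
  have 2: "X -` B \<inter> space M - Z \<in> sets (filt P t)"
    using sets.Diff[OF measurable_sets[OF X B] null_sets_in_filt[OF Z(2)]] by simp
  have "Y -` B \<inter> space M = (X -` B \<inter> space M - Z) \<union> ((Y -` B \<inter> space M) \<inter> Z)"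
    using Z(1) by auto
  with sets.Un[OF 2 1] show "Y -` B \<inter> space (filt P t) \<in> sets (filt P t)" by simp
qed auto

subsection \<open>Independence of the past and the increments\<close>

definition past_cylinders :: "real \<Rightarrow> 'w set set" where
  "past_cylinders s = {{\<omega> \<in> space M. \<forall>r\<in>S. W r \<omega> \<in> B r} | S B.
     finite S \<and> S \<subseteq> {0..s} \<and> (\<forall>r. B r \<in> sets borel)}"

lemma past_cylinders_sets: "C \<in> past_cylinders s \<Longrightarrow> C \<in> sets M"
proof -
  assume "C \<in> past_cylinders s"
  then obtain S B where C: "C = {\<omega> \<in> space M. \<forall>r\<in>S. W r \<omega> \<in> B r}" "finite S" "S \<subseteq> {0..s}"
    "\<And>r. B r \<in> sets borel" unfolding past_cylinders_def by auto
  have "C = (\<Inter>r\<in>S. W r -` B r \<inter> space M) \<inter> space M" using C(1) by auto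
  moreover have "(\<Inter>r\<in>S. W r -` B r \<inter> space M) \<inter> space M \<in> sets M"
  proof (cases "S = {}")
    case False
    then have "(\<Inter>r\<in>S. W r -` B r \<inter> space M) \<in> sets M"
      using C(2,3,4) by (intro sets.finite_INT measurable_sets[OF BM_measurable]) auto
    then show ?thesis by auto
  qed auto
  ultimately show ?thesis by simp
qed

lemma past_cylinders_Int:
  assumes "C \<in> past_cylinders s" "D \<in> past_cylinders s"
  shows "C \<inter> D \<in> past_cylinders s"
proof -
  obtain S B S' B' where C: "C = {\<omega> \<in> space M. \<forall>r\<in>S. W r \<omega> \<in> B r}" "finite S" "S \<subseteq> {0..s}"
    "\<And>r. B r \<in> sets borel" and D: "D = {\<omega> \<in> space M. \<forall>r\<in>S'. W r \<omega> \<in> B' r}" "finite S'" "S' \<subseteq> {0..s}"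
    "\<And>r. B' r \<in> sets borel"
    using assms unfolding past_cylinders_def by auto
  define B'' where "B'' r = (if r \<in> S then B r else UNIV) \<inter> (if r \<in> S' then B' r else UNIV)" for r
  have "C \<inter> D = {\<omega> \<in> space M. \<forall>r\<in>S \<union> S'. W r \<omega> \<in> B'' r}"
    using C(1) D(1) by (auto simp: B''_def)
  moreover have "\<forall>r. B'' r \<in> sets borel" using C(4) D(4) by (auto simp: B''_def)
  ultimately show ?thesis using C(2,3) D(2,3) unfolding past_cylinders_def by blast
qed

text \<open>
  On a cylinder over the times \<open>0 = \<tau>\<^sub>0 < \<dots> < \<tau>\<^sub>m = s\<close> the values of \<open>W\<close> are sums of the increments
  over \<open>[\<tau>\<^sub>j, \<tau>\<^sub>j\<^sub>+\<^sub>1]\<close>, which are jointly independent of the increment over \<open>[s, t]\<close>.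
\<close>

lemma past_cylinder_indep_increment:
  assumes "0 \<le> s" "s < t" and C: "C \<in> past_cylinders s" and E: "E \<in> sets borel"
  shows "prob (C \<inter> ((\<lambda>\<omega>. W t \<omega> - W s \<omega>) -` E \<inter> space M))
           = prob C * prob ((\<lambda>\<omega>. W t \<omega> - W s \<omega>) -` E \<inter> space M)"
proof -
  obtain S B where C_def: "C = {\<omega> \<in> space M. \<forall>r\<in>S. W r \<omega> \<in> B r}" and S: "finite S" "S \<subseteq> {0..s}"
    and B: "\<And>r. B r \<in> sets borel" using C unfolding past_cylinders_def by auto
  define S' where "S' = insert 0 (insert s S)"
  define xs where "xs = sorted_list_of_set S'"
  define m where "m = length xs - 1"
  define \<tau> where "\<tau> j = (xs @ [t]) ! j" for j
  have S': "finite S'" "S' \<subseteq> {0..s}" "0 \<in> S'" "s \<in> S'" using S \<open>0 \<le> s\<close> by (auto simp: S'_def)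
  have set_xs: "set xs = S'" and xs_sorted: "sorted_wrt (<) xs" using S' by (auto simp: xs_def)
  have len: "length xs = Suc m" using set_xs S'(3) by (cases xs) (auto simp: m_def)
  have sorted: "sorted_wrt (<) (xs @ [t])"
    using xs_sorted set_xs S'(2) \<open>s < t\<close> by (auto simp: sorted_wrt_append)
  have \<tau>_less: "\<tau> i < \<tau> j" if "i < j" "j < Suc (Suc m)" for i j
    unfolding \<tau>_def using that len by (intro sorted_wrt_nth_less[OF sorted]) auto
  have \<tau>_Suc: "\<tau> (Suc m) = t" by (simp add: \<tau>_def nth_append len)
  have \<tau>_in: "\<tau> j \<in> S'" if "j \<le> m" for j
    using that len set_xs by (auto simp: \<tau>_def nth_append)
  have ex_idx: "\<exists>j\<le>m. r = \<tau> j" if r: "r \<in> S'" for r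
  proof -
    obtain j where "j < length xs" "xs ! j = r" using r set_xs by (auto simp: in_set_conv_nth)
    then show ?thesis by (intro exI[of _ j]) (auto simp: \<tau>_def nth_append len)
  qed
  have \<tau>_m: "\<tau> m = s"
  proof -
    obtain j where j: "j \<le> m" "s = \<tau> j" using ex_idx S' by blast
    have "\<tau> j \<le> \<tau> m" using \<tau>_less[of j m] j by (cases "j = m") auto
    moreover have "\<tau> m \<le> s" using \<tau>_in[of m] S'(2) by auto
    ultimately show ?thesis using j by simp
  qed
  have \<tau>_0: "\<tau> 0 = 0"
  proof -
    obtain j where j: "j \<le> m" "0 = \<tau> j" using ex_idx S' by blast
    have "\<tau> 0 \<le> \<tau> j" using \<tau>_less[of 0 j] j by (cases "j = 0") auto
    moreover have "0 \<le> \<tau> 0" using \<tau>_in[of 0] S'(2) by auto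
    ultimately show ?thesis using j by simp
  qed
  obtain idx where idx: "\<And>r. r \<in> S \<Longrightarrow> idx r \<le> m \<and> r = \<tau> (idx r)"
    using ex_idx unfolding S'_def by (metis insertCI)
  define \<Delta> where "\<Delta> = (\<lambda>(i, j) \<omega>. (W (\<tau> (Suc j)) \<omega> - W (\<tau> j) \<omega>) $ i)"
  have ind: "indep_vars (\<lambda>_. borel) \<Delta> (UNIV \<times> {..<Suc m})"
    using brownian \<tau>_0 \<tau>_less unfolding brownian_motion_def \<Delta>_def by auto
  define past where "past = (UNIV :: 'd set) \<times> {..<m}"
  define fut where "fut = (UNIV :: 'd set) \<times> {m}"
  have ind': "indep_var (PiM past (\<lambda>_. borel)) (\<lambda>\<omega>. restrict (\<lambda>i. \<Delta> i \<omega>) past)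
                        (PiM fut (\<lambda>_. borel)) (\<lambda>\<omega>. restrict (\<lambda>i. \<Delta> i \<omega>) fut)"
    by (rule indep_var_restrict[OF ind]) (auto simp: past_def fut_def)
  define vec where "vec x j = (\<Sum>i\<in>UNIV. x (i, j) *\<^sub>R axis i (1::real))" for x :: "'d \<times> nat \<Rightarrow> real" and j
  have expand: "(\<Sum>i\<in>UNIV. (x $ i) *\<^sub>R axis i (1::real)) = x" for x :: "real^'d"
    using basis_expansion[of x] by (simp add: scalar_mult_eq_scaleR)
  have vec_past: "vec (restrict (\<lambda>i. \<Delta> i \<omega>) past) j = W (\<tau> (Suc j)) \<omega> - W (\<tau> j) \<omega>" if "j < m" for j \<omega>
    using that
    by (subst expand[symmetric]) (auto simp: vec_def past_def \<Delta>_def simp del: vector_minus_component intro!: sum.cong)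
  have vec_fut: "vec (restrict (\<lambda>i. \<Delta> i \<omega>) fut) m = W t \<omega> - W s \<omega>" for \<omega>
    by (subst expand[symmetric])
       (auto simp: vec_def fut_def \<Delta>_def \<tau>_m \<tau>_Suc simp del: vector_minus_component intro!: sum.cong)
  define A where "A = {x \<in> space (PiM past (\<lambda>_. borel)). \<forall>r\<in>S. (\<Sum>j<idx r. vec x j) \<in> B r}"
  define F where "F = {x \<in> space (PiM fut (\<lambda>_. borel)). vec x m \<in> E}"
  have A: "A \<in> sets (PiM past (\<lambda>_. borel))"
  proof -
    have "(\<lambda>x. \<Sum>j<idx r. vec x j) \<in> borel_measurable (PiM past (\<lambda>_. borel))" if "r \<in> S" for r
      unfolding vec_def using idx[OF that]
      by (intro borel_measurable_sum borel_measurable_scaleR borel_measurable_const)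
         (auto simp: past_def intro!: measurable_component_singleton)
    then have "{x \<in> space (PiM past (\<lambda>_. borel)). (\<Sum>j<idx r. vec x j) \<in> B r}
        \<in> sets (PiM past (\<lambda>_. borel))" if "r \<in> S" for r
      using measurable_sets[OF _ B[of r]] that by (auto simp: vimage_def Int_def conj_commute)
    then show ?thesis unfolding A_def using S(1) by (rule sets.sets_Collect_finite_All)
  qed
  have F: "F \<in> sets (PiM fut (\<lambda>_. borel))"
  proof -
    have "(\<lambda>x. vec x m) \<in> borel_measurable (PiM fut (\<lambda>_. borel))"
      unfolding vec_def 
      by (intro borel_measurable_sum borel_measurable_scaleR borel_measurable_const)
         (auto simp: fut_def intro!: measurable_component_singleton)
    from measurable_sets[OF this E] show ?thesis
      unfolding F_def by (simp add: vimage_def Int_def conj_commute)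
  qed
  let ?X = "\<lambda>\<omega>. restrict (\<lambda>i. \<Delta> i \<omega>) past" and ?Y = "\<lambda>\<omega>. restrict (\<lambda>i. \<Delta> i \<omega>) fut"
  have meas: "?X \<in> measurable M (PiM past (\<lambda>_. borel))" "?Y \<in> measurable M (PiM fut (\<lambda>_. borel))"
    using ind' by (auto simp: indep_var_eq)
  have W0: "AE \<omega> in M. W 0 \<omega> = 0" using brownian by (auto simp: brownian_motion_def)
  have val: "(\<Sum>j<idx r. vec (?X \<omega>) j) = W r \<omega>" if "r \<in> S" "W 0 \<omega> = 0" for r \<omega>
  proof -
    have "(\<Sum>j<idx r. vec (?X \<omega>) j) = (\<Sum>j<idx r. W (\<tau> (Suc j)) \<omega> - W (\<tau> j) \<omega>)"
      using idx[OF that(1)] by (intro sum.cong vec_past) auto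
    also have "\<dots> = W (\<tau> (idx r)) \<omega> - W (\<tau> 0) \<omega>"
      by (rule sum_lessThan_telescope)
    finally show ?thesis using idx[OF that(1)] that(2) \<tau>_0 by simp
  qed
  have EF: "(\<lambda>\<omega>. W t \<omega> - W s \<omega>) -` E \<inter> space M = ?Y -` F \<inter> space M"
    using measurable_space[OF meas(2)] vec_fut by (auto simp: F_def)
  have C_AE: "AE \<omega> in M. \<omega> \<in> C \<longleftrightarrow> \<omega> \<in> ?X -` A \<inter> space M"
    using W0 AE_space
  proof eventually_elim
    case (elim \<omega>)
    then show ?case using measurable_space[OF meas(1)] by (auto simp: C_def A_def val)
  qed
  have XA: "?X -` A \<inter> space M \<in> events" by (rule measurable_sets[OF meas(1) A])
  have YF: "?Y -` F \<inter> space M \<in> events" by (rule measurable_sets[OF meas(2) F])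
  have Cs: "C \<in> events" by (rule past_cylinders_sets[OF C])
  have "prob (C \<inter> (?Y -` F \<inter> space M)) = prob ((?X -` A \<inter> space M) \<inter> (?Y -` F \<inter> space M))"
    using C_AE XA YF Cs by (intro finite_measure_eq_AE) auto
  also have "(?X -` A \<inter> space M) \<inter> (?Y -` F \<inter> space M) = (\<lambda>\<omega>. (?X \<omega>, ?Y \<omega>)) -` (A \<times> F) \<inter> space M"
    by auto
  also have "prob \<dots> = prob (?X -` A \<inter> space M) * prob (?Y -` F \<inter> space M)"
    by (rule indep_varD[OF ind' A F])
  also have "prob (?X -` A \<inter> space M) = prob C"
    using C_AE XA Cs by (intro finite_measure_eq_AE) auto
  finally show ?thesis unfolding EF .
qed

text \<open>
  The cylinders together with the null sets form an intersection-stable generator of \<open>\<F>\<^sub>s\<close>, and it is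
  enough to know the independence on such a generator.
\<close>

lemma filt_indep_increment:
  assumes "0 \<le> s" "s < t"
  shows "indep_set (sets (filt P s)) {(\<lambda>\<omega>. W t \<omega> - W s \<omega>) -` E \<inter> space M | E. E \<in> sets borel}"
proof -
  let ?D = "\<lambda>\<omega>. W t \<omega> - W s \<omega>"
  let ?\<Pi> = "past_cylinders s \<union> null_sets M"
  let ?F = "{?D -` E \<inter> space M | E. E \<in> sets borel}"
  have D: "?D \<in> borel_measurable M" using assms by (intro borel_measurable_diff BM_measurable) auto
  have "indep_set ?\<Pi> ?F"
  proof (rule indep_setI)
    show "?\<Pi> \<subseteq> events" using past_cylinders_sets by auto
    show "?F \<subseteq> events" using measurable_sets[OF D] by auto
    fix a b assume a: "a \<in> ?\<Pi>" and b: "b \<in> ?F"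
    then obtain E where E: "b = ?D -` E \<inter> space M" "E \<in> sets borel" by auto
    show "prob (a \<inter> b) = prob a * prob b"
    proof (cases "a \<in> past_cylinders s")
      case True
      then show ?thesis using past_cylinder_indep_increment[OF assms True E(2)] E(1) by simp
    next
      case False
      with a have a: "a \<in> null_sets M" by auto
      have "b \<in> events" using measurable_sets[OF D] E by auto
      then have "a \<inter> b \<in> null_sets M" using a by (intro null_set_Int2)
      with a show ?thesis by (simp add: measure_eq_0_null_sets)
    qed
  qed
  moreover have "Int_stable ?\<Pi>"
  proof (rule Int_stableI)
    fix a b assume "a \<in> ?\<Pi>" "b \<in> ?\<Pi>"
    then show "a \<inter> b \<in> ?\<Pi>"
      using past_cylinders_Int[of a s b] past_cylinders_sets[of a s] past_cylinders_sets[of b s]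
        null_set_Int1[of b M a] null_set_Int2[of a M b] null_setsD2[of a M] null_setsD2[of b M]
      by blast
  qed
  moreover have "Int_stable ?F"
  proof (rule Int_stableI)
    fix a b assume "a \<in> ?F" "b \<in> ?F"
    then obtain E E' where "a = ?D -` E \<inter> space M" "b = ?D -` E' \<inter> space M" "E \<in> sets borel" "E' \<in> sets borel"
      by auto
    then show "a \<inter> b \<in> ?F" by (intro CollectI exI[of _ "E \<inter> E'"]) auto
  qed
  ultimately have *: "indep_set (sigma_sets (space M) ?\<Pi>) (sigma_sets (space M) ?F)"
    by (rule indep_set_sigma_sets)
  have "sets (filt P s) \<subseteq> sigma_sets (space M) ?\<Pi>"
    unfolding sets_filt
  proof (rule sigma_sets_mono, rule subsetI)
    fix x assume "x \<in> {W r -` B \<inter> space M | r B. 0 \<le> r \<and> r \<le> s \<and> B \<in> sets borel} \<union> null_sets M"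
    then consider r B where "x = W r -` B \<inter> space M" "0 \<le> r" "r \<le> s" "B \<in> sets borel" | "x \<in> null_sets M"
      by auto
    then show "x \<in> sigma_sets (space M) ?\<Pi>"
    proof cases
      case 1
      have "x \<in> past_cylinders s" unfolding past_cylinders_def using 1
        by (intro CollectI exI[of _ "{r}"] exI[of _ "\<lambda>_. B"]) auto
      then show ?thesis by auto
    qed auto
  qed
  then show ?thesis
    unfolding indep_set_def
    by (intro indep_sets_mono_sets[OF *[unfolded indep_set_def]]) (auto split: bool.split)
qed

text \<open>
  Factorising the expectation of a product requires the independence in this form.
\<close>

lemma indep_var_past_increment:
  assumes "0 \<le> s" "s < t" and X: "X \<in> borel_measurable (filt P s)" and h: "h \<in> borel_measurable borel"
  shows "indep_var borel X borel (\<lambda>\<omega>. h (W t \<omega> - W s \<omega>))"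
proof -
  let ?D = "\<lambda>\<omega>. W t \<omega> - W s \<omega>"
  have D: "?D \<in> borel_measurable M" using assms by (intro borel_measurable_diff BM_measurable) auto
  have 1: "sigma_sets (space M) {X -` A \<inter> space M |A. A \<in> sets borel} \<subseteq> sets (filt P s)"
  proof -
    have "sigma_sets (space (filt P s)) {X -` A \<inter> space M |A. A \<in> sets borel} \<subseteq> sets (filt P s)"
      using measurable_sets[OF X] by (intro sets.sigma_sets_subset) auto
    then show ?thesis by simp
  qed
  let ?F = "{?D -` E \<inter> space M | E. E \<in> sets borel}"
  have F: "sets (vimage_algebra (space M) ?D borel) = ?F"
    by (rule sets_vimage_algebra2) auto
  have 2: "sigma_sets (space M) {(\<lambda>\<omega>. h (?D \<omega>)) -` A \<inter> space M |A. A \<in> sets borel} \<subseteq> ?F"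
    unfolding F[symmetric]
  proof (subst space_vimage_algebra[of "space M" ?D borel, symmetric], rule sets.sigma_sets_subset, unfold F, intro subsetI)
    fix x assume "x \<in> {(\<lambda>\<omega>. h (?D \<omega>)) -` A \<inter> space M |A. A \<in> sets borel}"
    then obtain A where "x = (\<lambda>\<omega>. h (?D \<omega>)) -` A \<inter> space M" "A \<in> sets borel" by auto
    then show "x \<in> ?F" using measurable_sets[OF h] by (intro CollectI exI[of _ "h -` A"]) auto
  qed
  show ?thesis unfolding indep_var_eq
  proof (intro conjI)
    show "random_variable borel X" by (rule filt_measurable[OF X])
    show "(\<lambda>\<omega>. h (?D \<omega>)) \<in> borel_measurable M" using D h by measurable
    show "indep_set (sigma_sets (space M) {X -` A \<inter> space M |A. A \<in> sets borel})
     (sigma_sets (space M) {(\<lambda>\<omega>. h (W t \<omega> - W s \<omega>)) -` A \<inter> space M |A. A \<in> sets borel})"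
      using 1 2 unfolding indep_set_def
      by (intro indep_sets_mono_sets[OF filt_indep_increment[OF assms(1,2), unfolded indep_set_def]])
         (auto split: bool.split)
  qed
qed

end

section \<open>Square-integrable functions\<close>

definition sq_integrable :: "'a measure \<Rightarrow> ('a \<Rightarrow> 'h::euclidean_space) \<Rightarrow> bool" where
  "sq_integrable Q f \<longleftrightarrow> f \<in> borel_measurable Q \<and> integrable Q (\<lambda>x. (norm (f x))\<^sup>2)"

lemma sq_integrable_measurable [measurable_dest]: "sq_integrable Q f \<Longrightarrow> f \<in> borel_measurable Q"
  by (simp add: sq_integrable_def)

lemma sq_integrable_iff_nn:
  "sq_integrable Q f \<longleftrightarrow> f \<in> borel_measurable Q \<and> (\<integral>\<^sup>+x. ennreal ((norm (f x))\<^sup>2) \<partial>Q) < \<infinity>"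
  unfolding sq_integrable_def by (auto simp: integrable_iff_bounded)

lemma sq_integrable_bound:
  assumes f: "integrable Q (\<lambda>x. (f x)\<^sup>2)" and g: "g \<in> borel_measurable Q" 
    and le: "AE x in Q. norm (g x) \<le> f x"
  shows "sq_integrable Q g"
  unfolding sq_integrable_def
proof (intro conjI g Bochner_Integration.integrable_bound[OF f])
  show "(\<lambda>x. (norm (g x))\<^sup>2) \<in> borel_measurable Q" using g by measurable
  show "AE x in Q. norm ((norm (g x))\<^sup>2) \<le> norm ((f x)\<^sup>2)"
    using le
  proof eventually_elim
    case (elim x)
    then show ?case by (simp add: power_mono)
  qed
qed

lemma sq_integrable_norm: "sq_integrable Q f \<Longrightarrow> sq_integrable Q (\<lambda>x. norm (f x))"
  unfolding sq_integrable_def by auto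

lemma sq_integrable_add:
  assumes "sq_integrable Q f" "sq_integrable Q g"
  shows "sq_integrable Q (\<lambda>x. f x + g x)"
  unfolding sq_integrable_def
proof (intro conjI)
  show [measurable]: "(\<lambda>x. f x + g x) \<in> borel_measurable Q"
    using assms by (auto simp: sq_integrable_def)
  show "integrable Q (\<lambda>x. (norm (f x + g x))\<^sup>2)"
  proof (rule Bochner_Integration.integrable_bound)
    show "integrable Q (\<lambda>x. 2 * (norm (f x))\<^sup>2 + 2 * (norm (g x))\<^sup>2)"
      using assms by (auto simp: sq_integrable_def)
    show "(\<lambda>x. (norm (f x + g x))\<^sup>2) \<in> borel_measurable Q" by measurable
    show "AE x in Q. norm ((norm (f x + g x))\<^sup>2) \<le> norm (2 * (norm (f x))\<^sup>2 + 2 * (norm (g x))\<^sup>2)"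
    proof (rule AE_I2)
      fix x
      have "(norm (f x + g x))\<^sup>2 \<le> (norm (f x) + norm (g x))\<^sup>2"
        by (intro power_mono norm_triangle_ineq norm_ge_zero)
      also have "\<dots> \<le> 2 * (norm (f x))\<^sup>2 + 2 * (norm (g x))\<^sup>2"
        using sum_squares_bound[of "norm (f x)" "norm (g x)"] by (simp add: power2_sum)
      finally show "norm ((norm (f x + g x))\<^sup>2) \<le> norm (2 * (norm (f x))\<^sup>2 + 2 * (norm (g x))\<^sup>2)"
        by simp
    qed
  qed
qed

lemma sq_integrable_scaleR_const: "sq_integrable Q f \<Longrightarrow> sq_integrable Q (\<lambda>x. c *\<^sub>R f x)"
  unfolding sq_integrable_def by (auto simp: power_mult_distrib)

lemma sq_integrable_minus: "sq_integrable Q f \<Longrightarrow> sq_integrable Q (\<lambda>x. - f x)"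
  using sq_integrable_scaleR_const[of Q f "-1"] by simp

lemma sq_integrable_diff:
  "sq_integrable Q f \<Longrightarrow> sq_integrable Q g \<Longrightarrow> sq_integrable Q (\<lambda>x. f x - g x)"
  using sq_integrable_add[OF _ sq_integrable_minus, of Q f g] by simp

lemma sq_integrable_zero: "sq_integrable Q (\<lambda>_. 0)"
  by (simp add: sq_integrable_def)

lemma sq_integrable_sum:
  "(\<And>i. i \<in> I \<Longrightarrow> sq_integrable Q (f i)) \<Longrightarrow> sq_integrable Q (\<lambda>x. \<Sum>i\<in>I. f i x)"
  by (induction I rule: infinite_finite_induct) (auto intro: sq_integrable_add sq_integrable_zero)

lemma sq_integrable_const: "finite_measure Q \<Longrightarrow> sq_integrable Q (\<lambda>_. c)"
  by (auto simp: sq_integrable_def finite_measure.integrable_const)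

lemma sq_integrable_cong_AE:
  assumes "sq_integrable Q f" "g \<in> borel_measurable Q" "AE x in Q. f x = g x"
  shows "sq_integrable Q g"
  using assms(1,2) by (intro sq_integrable_bound[of Q "\<lambda>x. norm (f x)"])
    (use assms(3) in \<open>auto simp: sq_integrable_def elim: AE_mp\<close>)

lemma integrable_norm_mult:
  assumes "sq_integrable Q f" "sq_integrable Q g"
  shows "integrable Q (\<lambda>x. norm (f x) * norm (g x))"
proof (rule Bochner_Integration.integrable_bound)
  show "integrable Q (\<lambda>x. (norm (f x))\<^sup>2 + (norm (g x))\<^sup>2)"
    using assms by (auto simp: sq_integrable_def)
  show "(\<lambda>x. norm (f x) * norm (g x)) \<in> borel_measurable Q"
    using assms by (auto simp: sq_integrable_def)
  show "AE x in Q. norm (norm (f x) * norm (g x)) \<le> norm ((norm (f x))\<^sup>2 + (norm (g x))\<^sup>2)"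
  proof (rule AE_I2)
    fix x
    have "2 * (norm (f x) * norm (g x)) \<le> (norm (f x))\<^sup>2 + (norm (g x))\<^sup>2"
      using sum_squares_bound[of "norm (f x)" "norm (g x)"] by (simp add: mult.assoc)
    moreover have "0 \<le> norm (f x) * norm (g x)" by simp
    ultimately have "norm (f x) * norm (g x) \<le> (norm (f x))\<^sup>2 + (norm (g x))\<^sup>2" by linarith
    then show "norm (norm (f x) * norm (g x)) \<le> norm ((norm (f x))\<^sup>2 + (norm (g x))\<^sup>2)"
      by simp
  qed
qed

lemma integrable_inner:
  assumes "sq_integrable Q f" "sq_integrable Q g"
  shows "integrable Q (\<lambda>x. f x \<bullet> g x)"
proof (rule Bochner_Integration.integrable_bound[OF integrable_norm_mult[OF assms]])
  show "(\<lambda>x. f x \<bullet> g x) \<in> borel_measurable Q" using assms by (auto simp: sq_integrable_def)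
qed (auto simp: Cauchy_Schwarz_ineq2)

lemma integrable_mult_sq:
  fixes f g :: "'a \<Rightarrow> real"
  shows "sq_integrable Q f \<Longrightarrow> sq_integrable Q g \<Longrightarrow> integrable Q (\<lambda>x. f x * g x)"
  using integrable_inner[of Q f g] by simp

lemma sq_integrable_inner_const:
  "sq_integrable Q f \<Longrightarrow> sq_integrable Q (\<lambda>x. f x \<bullet> b)"
  unfolding sq_integrable_def
proof (elim conjE, intro conjI)
  assume f: "f \<in> borel_measurable Q" "integrable Q (\<lambda>x. (norm (f x))\<^sup>2)"
  show "(\<lambda>x. f x \<bullet> b) \<in> borel_measurable Q" using f by measurable
  show "integrable Q (\<lambda>x. (norm (f x \<bullet> b))\<^sup>2)"
  proof (rule Bochner_Integration.integrable_bound[where f="\<lambda>x. (norm b)\<^sup>2 * (norm (f x))\<^sup>2"])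
    show "integrable Q (\<lambda>x. (norm b)\<^sup>2 * (norm (f x))\<^sup>2)" using f by auto
    show "(\<lambda>x. (norm (f x \<bullet> b))\<^sup>2) \<in> borel_measurable Q" using f by measurable
    show "AE x in Q. norm ((norm (f x \<bullet> b))\<^sup>2) \<le> norm ((norm b)\<^sup>2 * (norm (f x))\<^sup>2)"
    proof (rule AE_I2)
      fix x
      have "\<bar>f x \<bullet> b\<bar>\<^sup>2 \<le> (norm (f x) * norm b)\<^sup>2"
        by (intro power_mono Cauchy_Schwarz_ineq2) auto
      then show "norm ((norm (f x \<bullet> b))\<^sup>2) \<le> norm ((norm b)\<^sup>2 * (norm (f x))\<^sup>2)"
        by (simp add: power_mult_distrib mult.commute)
    qed
  qed
qed

lemma sq_integrable_imp_integrable: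
  assumes "finite_measure Q" "sq_integrable Q f"
  shows "integrable Q f"
proof (rule Bochner_Integration.integrable_bound)
  interpret finite_measure Q by fact
  show "integrable Q (\<lambda>x. (norm (f x))\<^sup>2 + 1)" using assms by (auto simp: sq_integrable_def)
  show "f \<in> borel_measurable Q" using assms by (auto simp: sq_integrable_def)
  show "AE x in Q. norm (f x) \<le> norm ((norm (f x))\<^sup>2 + 1)"
  proof (rule AE_I2)
    fix x
    have "2 * norm (f x) \<le> (norm (f x))\<^sup>2 + 1" using sum_squares_bound[of "norm (f x)" 1] by simp
    then have "norm (f x) \<le> (norm (f x))\<^sup>2 + 1" using norm_ge_zero[of "f x"] by linarith
    then show "norm (f x) \<le> norm ((norm (f x))\<^sup>2 + 1)" by simp
  qed
qed

lemma L2_Cauchy_Schwarz: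
  assumes f: "sq_integrable Q f" and g: "sq_integrable Q g"
  shows "\<bar>\<integral>x. f x \<bullet> g x \<partial>Q\<bar> \<le> sqrt (\<integral>x. (norm (f x))\<^sup>2 \<partial>Q) * sqrt (\<integral>x. (norm (g x))\<^sup>2 \<partial>Q)"
proof -
  note [measurable] = sq_integrable_measurable[OF f] sq_integrable_measurable[OF g]
  let ?I = "\<integral>x. norm (f x) * norm (g x) \<partial>Q"
  have "\<bar>\<integral>x. f x \<bullet> g x \<partial>Q\<bar> \<le> (\<integral>x. \<bar>f x \<bullet> g x\<bar> \<partial>Q)"
    by (rule integral_abs_bound)
  also have "\<dots> \<le> ?I"
    using integrable_inner[OF f g] integrable_norm_mult[OF f g]
    by (intro integral_mono integrable_abs) (auto simp: Cauchy_Schwarz_ineq2)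
  also have "?I \<le> sqrt (\<integral>x. (norm (f x))\<^sup>2 \<partial>Q) * sqrt (\<integral>x. (norm (g x))\<^sup>2 \<partial>Q)"
  proof -
    have "ennreal (?I\<^sup>2) = (\<integral>\<^sup>+x. ennreal (norm (f x)) * ennreal (norm (g x)) \<partial>Q)\<^sup>2"
      using nn_integral_eq_integral[OF integrable_norm_mult[OF f g]]
      by (simp add: ennreal_mult ennreal_power Bochner_Integration.integral_nonneg)
    also have "\<dots> \<le> (\<integral>\<^sup>+x. ennreal (norm (f x)) ^ 2 \<partial>Q) * (\<integral>\<^sup>+x. ennreal (norm (g x)) ^ 2 \<partial>Q)"
      by (rule Cauchy_Schwarz_nn_integral) auto
    also have "\<dots> = ennreal ((\<integral>x. (norm (f x))\<^sup>2 \<partial>Q) * (\<integral>x. (norm (g x))\<^sup>2 \<partial>Q))"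
      using f g by (simp add: ennreal_power nn_integral_eq_integral sq_integrable_def ennreal_mult
          Bochner_Integration.integral_nonneg)
    finally have "?I\<^sup>2 \<le> (\<integral>x. (norm (f x))\<^sup>2 \<partial>Q) * (\<integral>x. (norm (g x))\<^sup>2 \<partial>Q)"
      by (subst (asm) ennreal_le_iff) (auto intro!: mult_nonneg_nonneg Bochner_Integration.integral_nonneg)
    then show ?thesis by (simp add: real_le_rsqrt real_sqrt_mult[symmetric])
  qed
  finally show ?thesis .
qed

text \<open>
  Square integrability of all members is part of the notion, so that inner products converge along
  with their arguments.
\<close>

definition L2_tendsto :: "'a measure \<Rightarrow> (nat \<Rightarrow> 'a \<Rightarrow> 'h::euclidean_space) \<Rightarrow> ('a \<Rightarrow> 'h) \<Rightarrow> bool" where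
  "L2_tendsto Q f g \<longleftrightarrow> (\<forall>k. sq_integrable Q (f k)) \<and> sq_integrable Q g \<and>
     (\<lambda>k. \<integral>x. (norm (f k x - g x))\<^sup>2 \<partial>Q) \<longlonglongrightarrow> 0"

lemma L2_tendstoI_nn:
  assumes f: "\<And>k. sq_integrable Q (f k)" and g: "g \<in> borel_measurable Q"
    and lim: "(\<lambda>k. \<integral>\<^sup>+x. ennreal ((norm (f k x - g x))\<^sup>2) \<partial>Q) \<longlonglongrightarrow> 0"
  shows "L2_tendsto Q f g"
proof -
  have "eventually (\<lambda>k. (\<integral>\<^sup>+x. ennreal ((norm (f k x - g x))\<^sup>2) \<partial>Q) < 1) sequentially"
    using order_tendstoD(2)[OF lim, of 1] by simp
  then obtain k where "(\<integral>\<^sup>+x. ennreal ((norm (f k x - g x))\<^sup>2) \<partial>Q) < 1"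
    by (auto simp: eventually_sequentially)
  then have "sq_integrable Q (\<lambda>x. f k x - g x)"
    using f g by (auto simp: sq_integrable_iff_nn sq_integrable_measurable intro: less_trans intro!: borel_measurable_diff)
  from sq_integrable_diff[OF f[of k] this] have g': "sq_integrable Q g" by simp
  have "(\<lambda>k. enn2real (\<integral>\<^sup>+x. ennreal ((norm (f k x - g x))\<^sup>2) \<partial>Q)) \<longlonglongrightarrow> 0"
    using lim by (intro tendsto_enn2real) auto
  moreover have "enn2real (\<integral>\<^sup>+x. ennreal ((norm (f k x - g x))\<^sup>2) \<partial>Q) = (\<integral>x. (norm (f k x - g x))\<^sup>2 \<partial>Q)" for k
    using sq_integrable_diff[OF f[of k] g'] 
    by (subst integral_eq_nn_integral) (auto simp: sq_integrable_def)
  ultimately show ?thesis using f g' by (simp add: L2_tendsto_def)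
qed

lemma L2_tendsto_inner:
  assumes f: "L2_tendsto Q f f'" and g: "L2_tendsto Q g g'"
  shows "(\<lambda>k. \<integral>x. f k x \<bullet> g k x \<partial>Q) \<longlonglongrightarrow> (\<integral>x. f' x \<bullet> g' x \<partial>Q)"
proof -
  have sq: "sq_integrable Q (f k)" "sq_integrable Q f'" "sq_integrable Q (g k)" "sq_integrable Q g'" for k
    using assms by (auto simp: L2_tendsto_def)
  define nf where "nf k = sqrt (\<integral>x. (norm (f k x - f' x))\<^sup>2 \<partial>Q)" for k
  define ng where "ng k = sqrt (\<integral>x. (norm (g k x - g' x))\<^sup>2 \<partial>Q)" for k
  define F where "F = sqrt (\<integral>x. (norm (f' x))\<^sup>2 \<partial>Q)"
  define G where "G = sqrt (\<integral>x. (norm (g' x))\<^sup>2 \<partial>Q)"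
  have "nf \<longlonglongrightarrow> sqrt 0" "ng \<longlonglongrightarrow> sqrt 0"
    unfolding nf_def ng_def using assms by (intro tendsto_real_sqrt; simp add: L2_tendsto_def)+
  then have "(\<lambda>k. nf k * ng k + nf k * G + F * ng k) \<longlonglongrightarrow> 0 * 0 + 0 * G + F * 0"
    by (intro tendsto_intros) simp_all
  then have lim: "(\<lambda>k. nf k * ng k + nf k * G + F * ng k) \<longlonglongrightarrow> 0" by simp
  have "norm ((\<integral>x. f k x \<bullet> g k x \<partial>Q) - (\<integral>x. f' x \<bullet> g' x \<partial>Q)) \<le> nf k * ng k + nf k * G + F * ng k" for k
  proof -
    note df = sq_integrable_diff[OF sq(1)[of k] sq(2)] and dg = sq_integrable_diff[OF sq(3)[of k] sq(4)]
    have "(\<integral>x. f k x \<bullet> g k x \<partial>Q) - (\<integral>x. f' x \<bullet> g' x \<partial>Q) = (\<integral>x. f k x \<bullet> g k x - f' x \<bullet> g' x \<partial>Q)"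
      using sq by (intro Bochner_Integration.integral_diff[symmetric] integrable_inner)
    also have "\<dots> = (\<integral>x. (f k x - f' x) \<bullet> (g k x - g' x) + (f k x - f' x) \<bullet> g' x + f' x \<bullet> (g k x - g' x) \<partial>Q)"
      by (intro Bochner_Integration.integral_cong) (auto simp: inner_diff_left inner_diff_right)
    also have "\<dots> = (\<integral>x. (f k x - f' x) \<bullet> (g k x - g' x) \<partial>Q) + (\<integral>x. (f k x - f' x) \<bullet> g' x \<partial>Q)
        + (\<integral>x. f' x \<bullet> (g k x - g' x) \<partial>Q)"
      using sq df dg by (subst Bochner_Integration.integral_add; (intro Bochner_Integration.integrable_add integrable_inner)?)
        (auto intro!: Bochner_Integration.integral_add integrable_inner)
    finally have "\<bar>(\<integral>x. f k x \<bullet> g k x \<partial>Q) - (\<integral>x. f' x \<bullet> g' x \<partial>Q)\<bar> \<le>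
        \<bar>\<integral>x. (f k x - f' x) \<bullet> (g k x - g' x) \<partial>Q\<bar> + \<bar>\<integral>x. (f k x - f' x) \<bullet> g' x \<partial>Q\<bar>
        + \<bar>\<integral>x. f' x \<bullet> (g k x - g' x) \<partial>Q\<bar>" by linarith
    also have "\<dots> \<le> nf k * ng k + nf k * G + F * ng k"
      unfolding nf_def ng_def F_def G_def
      by (intro add_mono L2_Cauchy_Schwarz df dg sq)
    finally show ?thesis by simp
  qed
  then have "(\<lambda>k. (\<integral>x. f k x \<bullet> g k x \<partial>Q) - (\<integral>x. f' x \<bullet> g' x \<partial>Q)) \<longlonglongrightarrow> 0"
    by (intro tendsto_rabs_zero_cancel[OF tendsto_sandwich[OF _ _ tendsto_const lim]]) auto
  then show ?thesis by (simp add: LIM_zero_iff)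
qed

lemma L2_tendsto_const: "sq_integrable Q f \<Longrightarrow> L2_tendsto Q (\<lambda>_. f) f"
  by (simp add: L2_tendsto_def)

lemma L2_tendsto_near:
  assumes f: "L2_tendsto Q f f'" and g: "\<And>k. sq_integrable Q (g k)"
    and fg: "(\<lambda>k. \<integral>x. (norm (f k x - g k x))\<^sup>2 \<partial>Q) \<longlonglongrightarrow> 0"
  shows "L2_tendsto Q g f'"
proof -
  have sq: "sq_integrable Q (f k)" "sq_integrable Q f'" "sq_integrable Q (g k)" for k
    using f g by (auto simp: L2_tendsto_def)
  have "(\<lambda>k. 2 * (\<integral>x. (norm (f k x - g k x))\<^sup>2 \<partial>Q) + 2 * (\<integral>x. (norm (f k x - f' x))\<^sup>2 \<partial>Q)) \<longlonglongrightarrow> 2 * 0 + 2 * 0"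
    using f fg unfolding L2_tendsto_def by (intro tendsto_intros) auto
  then have lim: "(\<lambda>k. 2 * (\<integral>x. (norm (f k x - g k x))\<^sup>2 \<partial>Q) + 2 * (\<integral>x. (norm (f k x - f' x))\<^sup>2 \<partial>Q)) \<longlonglongrightarrow> 0"
    by simp
  have le: "(\<integral>x. (norm (g k x - f' x))\<^sup>2 \<partial>Q) \<le> 2 * (\<integral>x. (norm (f k x - g k x))\<^sup>2 \<partial>Q) + 2 * (\<integral>x. (norm (f k x - f' x))\<^sup>2 \<partial>Q)" for k
  proof -
    have int: "integrable Q (\<lambda>x. (norm (f k x - g k x))\<^sup>2)" "integrable Q (\<lambda>x. (norm (f k x - f' x))\<^sup>2)"
      "integrable Q (\<lambda>x. (norm (g k x - f' x))\<^sup>2)"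
      using sq_integrable_diff[OF sq(1) sq(3)] sq_integrable_diff[OF sq(1,2)] sq_integrable_diff[OF sq(3,2)]
      by (auto simp: sq_integrable_def)
    have "(\<integral>x. (norm (g k x - f' x))\<^sup>2 \<partial>Q) \<le> (\<integral>x. 2 * (norm (f k x - g k x))\<^sup>2 + 2 * (norm (f k x - f' x))\<^sup>2 \<partial>Q)"
    proof (intro integral_mono int Bochner_Integration.integrable_add integrable_mult_right)
      fix x
      have "(norm (g k x - f' x))\<^sup>2 \<le> (norm (f k x - g k x) + norm (f k x - f' x))\<^sup>2"
        using norm_triangle_ineq4[of "f k x - f' x" "f k x - g k x"] by (intro power_mono) auto
      also have "\<dots> \<le> 2 * (norm (f k x - g k x))\<^sup>2 + 2 * (norm (f k x - f' x))\<^sup>2"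
        using sum_squares_bound[of "norm (f k x - g k x)" "norm (f k x - f' x)"] by (simp add: power2_sum)
      finally show "(norm (g k x - f' x))\<^sup>2 \<le> 2 * (norm (f k x - g k x))\<^sup>2 + 2 * (norm (f k x - f' x))\<^sup>2" .
    qed
    also have "\<dots> = 2 * (\<integral>x. (norm (f k x - g k x))\<^sup>2 \<partial>Q) + 2 * (\<integral>x. (norm (f k x - f' x))\<^sup>2 \<partial>Q)"
      using int by simp
    finally show ?thesis .
  qed
  have "(\<lambda>k. \<integral>x. (norm (g k x - f' x))\<^sup>2 \<partial>Q) \<longlonglongrightarrow> 0"
    by (rule tendsto_sandwich[OF _ _ tendsto_const lim]) (use le in \<open>auto intro!: always_eventually\<close>)
  then show ?thesis using sq by (simp add: L2_tendsto_def)
qed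

section \<open>Moments of the increments\<close>

lemma borel_measurable_component [measurable (raw)]:
  fixes f :: "'a \<Rightarrow> ('h::euclidean_space)^'m::finite"
  assumes "f \<in> borel_measurable F"
  shows "(\<lambda>x. f x $ i) \<in> borel_measurable F"
  by (rule measurable_compose[OF assms]) (auto intro!: borel_measurable_continuous_onI continuous_intros)

lemma matrix_vector_inner:
  fixes A A' :: "real^'d::finite^'n::finite"
  shows "(A *v w) \<bullet> (A' *v w') = (\<Sum>n\<in>UNIV. \<Sum>i\<in>UNIV. \<Sum>j\<in>UNIV. (A $ n $ i * A' $ n $ j) * (w $ i * w' $ j))"
  by (simp add: inner_vec_def matrix_vector_mult_def sum_product algebra_simps)

lemma vector_matrix_inner:
  fixes A :: "real^'d::finite^'n::finite"
  shows "x \<bullet> (A *v w) = (\<Sum>n\<in>UNIV. \<Sum>i\<in>UNIV. (x $ n * A $ n $ i) * w $ i)"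
  by (simp add: inner_vec_def matrix_vector_mult_def sum_distrib_left algebra_simps)

context brownian_problem begin

lemma increment_moments:
  assumes "0 \<le> s" "s \<le> t"
  shows "integrable M (\<lambda>\<omega>. (W t \<omega> - W s \<omega>) $ i)"
    and "expectation (\<lambda>\<omega>. (W t \<omega> - W s \<omega>) $ i) = 0"
    and "integrable M (\<lambda>\<omega>. (W t \<omega> - W s \<omega>) $ i * (W t \<omega> - W s \<omega>) $ j)"
    and "expectation (\<lambda>\<omega>. (W t \<omega> - W s \<omega>) $ i * (W t \<omega> - W s \<omega>) $ j) = (if i = j then t - s else 0)"
proof -
  let ?D = "\<lambda>i \<omega>. (W t \<omega> - W s \<omega>) $ i"
  have main: "integrable M (?D i) \<and> expectation (?D i) = 0 \<and> integrable M (\<lambda>\<omega>. ?D i \<omega> * ?D j \<omega>)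
    \<and> expectation (\<lambda>\<omega>. ?D i \<omega> * ?D j \<omega>) = (if i = j then t - s else 0)"
  proof (cases "s = t")
    case False
    then have st: "s < t" using assms by simp
    then have \<sigma>: "0 < sqrt (t - s)" by simp
    have D: "distributed M lborel (?D i) (normal_density 0 (sqrt (t - s)))" for i
      using brownian \<open>0 \<le> s\<close> st unfolding brownian_motion_def by auto
    have m1: "integrable M (?D i)" for i
      using distributed_integrable[OF D[of i], of "\<lambda>x. x"] integrable_normal_moment[OF \<sigma>, of 0 1] by simp
    have e1: "expectation (?D i) = 0" for i
      by (rule normal_distributed_expectation[OF \<sigma> D])
    have m2: "integrable M (\<lambda>\<omega>. (?D i \<omega>)\<^sup>2)" for i
      using distributed_integrable[OF D[of i], of "\<lambda>x. x^2"] integrable_normal_moment[OF \<sigma>, of 0 2] by simp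
    have e2: "expectation (\<lambda>\<omega>. (?D i \<omega>)\<^sup>2) = t - s" for i
      using normal_distributed_variance[OF \<sigma> D[of i]] st by (simp only: e1) simp
    have off: "integrable M (\<lambda>\<omega>. ?D i \<omega> * ?D j \<omega>) \<and> expectation (\<lambda>\<omega>. ?D i \<omega> * ?D j \<omega>) = 0" if "i \<noteq> j"
    proof -
      define \<tau> where "\<tau> k = (if k = (0::nat) then s else t)" for k
      have "indep_vars (\<lambda>_. borel) (\<lambda>(i, j) \<omega>. (W (\<tau> (Suc j)) \<omega> - W (\<tau> j) \<omega>) $ i) (UNIV \<times> {..<1::nat})"
        using brownian \<open>0 \<le> s\<close> st unfolding brownian_motion_def
        by (elim conjE allE[of _ 1] allE[of _ \<tau>]) (auto simp: \<tau>_def)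
      from indep_var_compose[OF indep_var_restrict[OF this, of "{(i, 0)}" "{(j, 0)}"],
          of "\<lambda>x. x (i, 0)" borel "\<lambda>x. x (j, 0)" borel]
      have "indep_var borel (?D i) borel (?D j)"
        using that by (auto simp: comp_def \<tau>_def)
      from indep_var_lebesgue_integral[OF this m1 m1] indep_var_integrable[OF this m1 m1]
      show ?thesis by (simp only: e1) simp
    qed
    show ?thesis using m1 e1 m2[of i] e2[of i] off by (auto simp: power2_eq_square)
  qed auto
  from main show "integrable M (?D i)" "expectation (?D i) = 0" "integrable M (\<lambda>\<omega>. ?D i \<omega> * ?D j \<omega>)"
    "expectation (\<lambda>\<omega>. ?D i \<omega> * ?D j \<omega>) = (if i = j then t - s else 0)" by auto
qed

text \<open>
  By independence the increment may be replaced by its moments.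
\<close>

lemma past_increment_moments:
  assumes st: "0 \<le> s" "s \<le> t" and X: "X \<in> borel_measurable (filt P s)" "integrable M X"
  shows "integrable M (\<lambda>\<omega>. X \<omega> * (W t \<omega> - W s \<omega>) $ i)"
    and "expectation (\<lambda>\<omega>. X \<omega> * (W t \<omega> - W s \<omega>) $ i) = 0"
    and "integrable M (\<lambda>\<omega>. X \<omega> * ((W t \<omega> - W s \<omega>) $ i * (W t \<omega> - W s \<omega>) $ j))"
    and "expectation (\<lambda>\<omega>. X \<omega> * ((W t \<omega> - W s \<omega>) $ i * (W t \<omega> - W s \<omega>) $ j))
           = expectation X * (if i = j then t - s else 0)"
proof -
  note mom = increment_moments[OF st]
  let ?D = "\<lambda>i \<omega>. (W t \<omega> - W s \<omega>) $ i"
  have main: "integrable M (\<lambda>\<omega>. X \<omega> * ?D i \<omega>) \<and> expectation (\<lambda>\<omega>. X \<omega> * ?D i \<omega>) = 0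
    \<and> integrable M (\<lambda>\<omega>. X \<omega> * (?D i \<omega> * ?D j \<omega>))
    \<and> expectation (\<lambda>\<omega>. X \<omega> * (?D i \<omega> * ?D j \<omega>)) = expectation X * (if i = j then t - s else 0)"
  proof (cases "s = t")
    case False
    then have st': "s < t" using st by simp
    have 1: "indep_var borel X borel (?D i)"
      using indep_var_past_increment[OF st(1) st' X(1), of "\<lambda>v. v $ i"] by simp
    have 2: "indep_var borel X borel (\<lambda>\<omega>. ?D i \<omega> * ?D j \<omega>)"
      using indep_var_past_increment[OF st(1) st' X(1), of "\<lambda>v. v $ i * v $ j"] by simp
    show ?thesis
      using indep_var_integrable[OF 1 X(2) mom(1)] indep_var_lebesgue_integral[OF 1 X(2) mom(1)]
        indep_var_integrable[OF 2 X(2) mom(3)] indep_var_lebesgue_integral[OF 2 X(2) mom(3)]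
      by (simp only: mom(2) mom(4)) simp
  qed auto
  then show "integrable M (\<lambda>\<omega>. X \<omega> * ?D i \<omega>)" "expectation (\<lambda>\<omega>. X \<omega> * ?D i \<omega>) = 0"
    "integrable M (\<lambda>\<omega>. X \<omega> * (?D i \<omega> * ?D j \<omega>))"
    "expectation (\<lambda>\<omega>. X \<omega> * (?D i \<omega> * ?D j \<omega>)) = expectation X * (if i = j then t - s else 0)"
    by auto
qed

text \<open>
  The coefficients of simple integrands.
\<close>

definition bounded_at :: "real \<Rightarrow> ('w \<Rightarrow> 'h::euclidean_space) \<Rightarrow> bool" where
  "bounded_at s c \<longleftrightarrow> c \<in> borel_measurable (filt P s) \<and> (\<exists>K. \<forall>\<omega>\<in>space M. norm (c \<omega>) \<le> K)"

lemma bounded_at_mono: "bounded_at s c \<Longrightarrow> s \<le> t \<Longrightarrow> bounded_at t c"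
  unfolding bounded_at_def by (auto intro: measurable_filt_mono)

lemma bounded_at_sq: "bounded_at s c \<Longrightarrow> sq_integrable M c"
proof -
  assume "bounded_at s c"
  then obtain K where "c \<in> borel_measurable M" "\<forall>\<omega>\<in>space M. norm (c \<omega>) \<le> K"
    unfolding bounded_at_def using filt_measurable by blast
  then show ?thesis by (intro sq_integrable_bound[where f="\<lambda>_. K"]) auto
qed

lemma past_orthogonal_increment:
  fixes c :: "'w \<Rightarrow> real^'d^'n"
  assumes st: "0 \<le> s" "s \<le> t" and c: "bounded_at s c"
    and X: "X \<in> borel_measurable (filt P s)" "sq_integrable M X"
  shows "expectation (\<lambda>\<omega>. X \<omega> \<bullet> (c \<omega> *v (W t \<omega> - W s \<omega>))) = 0"
proof -
  have meas: "(\<lambda>\<omega>. X \<omega> $ n * c \<omega> $ n $ i) \<in> borel_measurable (filt P s)" for n i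
    using X(1) c[unfolded bounded_at_def, THEN conjunct1] by measurable
  obtain K where K: "\<forall>\<omega>\<in>space M. norm (c \<omega>) \<le> K" using c by (auto simp: bounded_at_def)
  have int: "integrable M (\<lambda>\<omega>. X \<omega> $ n * c \<omega> $ n $ i)" for n i
  proof (rule Bochner_Integration.integrable_bound[OF integrable_norm_mult[OF X(2) bounded_at_sq[OF c]]])
    show "(\<lambda>\<omega>. X \<omega> $ n * c \<omega> $ n $ i) \<in> borel_measurable M" by (rule filt_measurable[OF meas])
    show "AE x in M. norm (X x $ n * c x $ n $ i) \<le> norm (norm (X x) * norm (c x))"
    proof (rule AE_I2)
      fix x
      have "\<bar>c x $ n $ i\<bar> \<le> norm (c x)"
        using component_le_norm_cart[of "c x $ n" i] Finite_Cartesian_Product.norm_nth_le[of "c x" n] by linarith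
      then show "norm (X x $ n * c x $ n $ i) \<le> norm (norm (X x) * norm (c x))"
        using component_le_norm_cart[of "X x" n] by (simp add: abs_mult mult_mono)
    qed
  qed
  show ?thesis
    unfolding vector_matrix_inner
    using past_increment_moments(1,2)[OF st meas int]
    by (subst Bochner_Integration.integral_sum; (intro Bochner_Integration.integrable_sum)?)
       (simp_all add: Bochner_Integration.integral_sum)
qed

lemma step_integral_adapted:
  fixes c :: "'w \<Rightarrow> real^'d^'n"
  assumes st: "0 \<le> s" "s \<le> t" and c: "bounded_at s c"
  shows "(\<lambda>\<omega>. c \<omega> *v (W t \<omega> - W s \<omega>)) \<in> borel_measurable (filt P t)"
proof -
  have [measurable]: "c \<in> borel_measurable (filt P t)" "W t \<in> borel_measurable (filt P t)"
    "W s \<in> borel_measurable (filt P t)"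
    using c st measurable_filt_mono BM_adapted[of s t P] BM_adapted[of t t P] unfolding bounded_at_def by auto
  have "(\<lambda>\<omega>. (c \<omega> *v (W t \<omega> - W s \<omega>)) $ n) \<in> borel_measurable (filt P t)" for n
    unfolding matrix_vector_mult_def vec_lambda_beta by measurable
  then have "(\<lambda>\<omega>. (c \<omega> *v (W t \<omega> - W s \<omega>)) \<bullet> b) \<in> borel_measurable (filt P t)" if "b \<in> Basis" for b
    using that by (auto simp: Basis_vec_def inner_axis)
  then show ?thesis by (subst borel_measurable_euclidean_space) auto
qed

lemma same_step_inner:
  fixes c c' :: "'w \<Rightarrow> real^'d^'n"
  assumes st: "0 \<le> s" "s \<le> t" and c: "bounded_at s c" and c': "bounded_at s c'"
  shows "integrable M (\<lambda>\<omega>. (c \<omega> *v (W t \<omega> - W s \<omega>)) \<bullet> (c' \<omega> *v (W t \<omega> - W s \<omega>)))"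
    and "expectation (\<lambda>\<omega>. (c \<omega> *v (W t \<omega> - W s \<omega>)) \<bullet> (c' \<omega> *v (W t \<omega> - W s \<omega>)))
      = (t - s) * expectation (\<lambda>\<omega>. c \<omega> \<bullet> c' \<omega>)"
proof -
  have meas: "(\<lambda>\<omega>. c \<omega> $ n $ i * c' \<omega> $ n $ j) \<in> borel_measurable (filt P s)" for n i j
    using c[unfolded bounded_at_def, THEN conjunct1] c'[unfolded bounded_at_def, THEN conjunct1]
    by measurable
  have int: "integrable M (\<lambda>\<omega>. c \<omega> $ n $ i * c' \<omega> $ n $ j)" for n i j
  proof (rule Bochner_Integration.integrable_bound[OF integrable_norm_mult[OF bounded_at_sq[OF c] bounded_at_sq[OF c']]])
    show "(\<lambda>\<omega>. c \<omega> $ n $ i * c' \<omega> $ n $ j) \<in> borel_measurable M" by (rule filt_measurable[OF meas])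
    show "AE x in M. norm (c x $ n $ i * c' x $ n $ j) \<le> norm (norm (c x) * norm (c' x))"
    proof (rule AE_I2)
      fix x
      have "\<bar>c x $ n $ i\<bar> \<le> norm (c x)" "\<bar>c' x $ n $ j\<bar> \<le> norm (c' x)"
        using component_le_norm_cart[of "c x $ n" i] Finite_Cartesian_Product.norm_nth_le[of "c x" n]
          component_le_norm_cart[of "c' x $ n" j] Finite_Cartesian_Product.norm_nth_le[of "c' x" n] by linarith+
      then show "norm (c x $ n $ i * c' x $ n $ j) \<le> norm (norm (c x) * norm (c' x))"
        by (simp add: abs_mult mult_mono)
    qed
  qed
  note mom = past_increment_moments(3,4)[OF st meas int]
  show "integrable M (\<lambda>\<omega>. (c \<omega> *v (W t \<omega> - W s \<omega>)) \<bullet> (c' \<omega> *v (W t \<omega> - W s \<omega>)))"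
    unfolding matrix_vector_inner by (intro Bochner_Integration.integrable_sum mom)
  have "expectation (\<lambda>\<omega>. (c \<omega> *v (W t \<omega> - W s \<omega>)) \<bullet> (c' \<omega> *v (W t \<omega> - W s \<omega>)))
      = (\<Sum>n\<in>UNIV. \<Sum>i\<in>UNIV. \<Sum>j\<in>UNIV. expectation (\<lambda>\<omega>. c \<omega> $ n $ i * c' \<omega> $ n $ j) * (if i = j then t - s else 0))"
    unfolding matrix_vector_inner
    by (simp only: Bochner_Integration.integral_sum Bochner_Integration.integrable_sum mom)
  also have "\<dots> = (t - s) * (\<Sum>n\<in>UNIV. \<Sum>i\<in>UNIV. expectation (\<lambda>\<omega>. c \<omega> $ n $ i * c' \<omega> $ n $ i))"
    by (simp add: if_distrib[of "\<lambda>x. _ * x"] sum.delta sum_distrib_left mult.commute[of "expectation _"]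
        cong: if_cong)
  also have "\<dots> = (t - s) * expectation (\<lambda>\<omega>. c \<omega> \<bullet> c' \<omega>)"
    using int by (simp add: inner_vec_def Bochner_Integration.integral_sum Bochner_Integration.integrable_sum)
  finally show "expectation (\<lambda>\<omega>. (c \<omega> *v (W t \<omega> - W s \<omega>)) \<bullet> (c' \<omega> *v (W t \<omega> - W s \<omega>)))
      = (t - s) * expectation (\<lambda>\<omega>. c \<omega> \<bullet> c' \<omega>)" .
qed

lemma step_integral_sq:
  fixes c :: "'w \<Rightarrow> real^'d^'n"
  assumes st: "0 \<le> s" "s \<le> t" and c: "bounded_at s c"
  shows "sq_integrable M (\<lambda>\<omega>. c \<omega> *v (W t \<omega> - W s \<omega>))"
  using same_step_inner(1)[OF st c c] filt_measurable[OF step_integral_adapted[OF st c]]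
  by (simp add: sq_integrable_def power2_norm_eq_inner)

text \<open>
  Two steps over intervals with arbitrary overlap: cut the intervals at the larger of the two
  left end points and at the smaller of the two right end points. Of the resulting products only
  the one over the common interval has a nonzero mean.
\<close>

lemma step_inner_ordered:
  fixes c c' :: "'w \<Rightarrow> real^'d^'n"
  assumes ab: "0 \<le> a" "a \<le> b" and ab': "a \<le> a'" "a' \<le> b'"
    and c: "bounded_at a c" and c': "bounded_at a' c'"
  shows "expectation (\<lambda>\<omega>. (c \<omega> *v (W b \<omega> - W a \<omega>)) \<bullet> (c' \<omega> *v (W b' \<omega> - W a' \<omega>)))
      = max 0 (min b b' - max a a') * expectation (\<lambda>\<omega>. c \<omega> \<bullet> c' \<omega>)"
proof (cases "b \<le> a'")
  case True
  have "expectation (\<lambda>\<omega>. (c \<omega> *v (W b \<omega> - W a \<omega>)) \<bullet> (c' \<omega> *v (W b' \<omega> - W a' \<omega>))) = 0"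
    using ab ab' True
    by (intro past_orthogonal_increment[OF _ _ c'] step_integral_sq c
        measurable_filt_mono[OF step_integral_adapted[OF _ _ c]]) auto
  moreover have "max 0 (min b b' - max a a') = 0" using True ab' by auto
  ultimately show ?thesis by simp
next
  case False
  then have a'b: "a' \<le> b" by simp
  let ?m = "min b b'"
  have ord: "0 \<le> a'" "a' \<le> ?m" "0 \<le> ?m" "?m \<le> b" "?m \<le> b'" using ab ab' a'b by auto
  note ca' = bounded_at_mono[OF c ab'(1)]
  note cm = bounded_at_mono[OF ca' ord(2)] and cm' = bounded_at_mono[OF c' ord(2)]
  let ?X0 = "\<lambda>\<omega>. c \<omega> *v (W a' \<omega> - W a \<omega>)" and ?X1 = "\<lambda>\<omega>. c \<omega> *v (W ?m \<omega> - W a' \<omega>)"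
    and ?X2 = "\<lambda>\<omega>. c \<omega> *v (W b \<omega> - W ?m \<omega>)"
  let ?Y1 = "\<lambda>\<omega>. c' \<omega> *v (W ?m \<omega> - W a' \<omega>)" and ?Y2 = "\<lambda>\<omega>. c' \<omega> *v (W b' \<omega> - W ?m \<omega>)"
  let ?Y = "\<lambda>\<omega>. c' \<omega> *v (W b' \<omega> - W a' \<omega>)"
  have sq: "sq_integrable M ?X0" "sq_integrable M ?X1" "sq_integrable M ?X2" "sq_integrable M ?Y1"
    "sq_integrable M ?Y2" "sq_integrable M ?Y"
    using ab ab' ord by (auto intro!: step_integral_sq c ca' cm c' cm')
  have e: "(c \<omega> *v (W b \<omega> - W a \<omega>)) \<bullet> ?Y \<omega>
      = ?X0 \<omega> \<bullet> ?Y \<omega> + ?X1 \<omega> \<bullet> ?Y1 \<omega> + ?X1 \<omega> \<bullet> ?Y2 \<omega> + ?X2 \<omega> \<bullet> ?Y1 \<omega> + ?X2 \<omega> \<bullet> ?Y2 \<omega>" for \<omega>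
  proof -
    have "c \<omega> *v (W b \<omega> - W a \<omega>) = ?X0 \<omega> + (?X1 \<omega> + ?X2 \<omega>)"
      by (simp add: matrix_vector_right_distrib[symmetric])
    moreover have "?Y \<omega> = ?Y1 \<omega> + ?Y2 \<omega>"
      by (simp add: matrix_vector_right_distrib[symmetric])
    ultimately show ?thesis by (simp add: inner_add_left inner_add_right)
  qed
  have z0: "expectation (\<lambda>\<omega>. ?X0 \<omega> \<bullet> ?Y \<omega>) = 0"
    using ab ab' ord
    by (intro past_orthogonal_increment[OF _ _ c'] sq step_integral_adapted c) auto
  have z1: "expectation (\<lambda>\<omega>. ?X1 \<omega> \<bullet> ?Y2 \<omega>) = 0"
    using ab ab' ord
    by (intro past_orthogonal_increment[OF _ _ cm'] sq step_integral_adapted ca') auto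
  have z2: "expectation (\<lambda>\<omega>. ?X2 \<omega> \<bullet> ?Y1 \<omega>) = 0"
  proof -
    have "expectation (\<lambda>\<omega>. ?Y1 \<omega> \<bullet> ?X2 \<omega>) = 0"
      using ab ab' ord
      by (intro past_orthogonal_increment[OF _ _ cm] sq step_integral_adapted c') auto
    then show ?thesis by (simp add: inner_commute)
  qed
  have z3: "?X2 \<omega> \<bullet> ?Y2 \<omega> = 0" for \<omega> by (cases "b \<le> b'") auto
  have "expectation (\<lambda>\<omega>. (c \<omega> *v (W b \<omega> - W a \<omega>)) \<bullet> ?Y \<omega>) = expectation (\<lambda>\<omega>. ?X1 \<omega> \<bullet> ?Y1 \<omega>)"
    unfolding e z3 using sq z0 z1 z2
    by (simp add: integrable_inner)
  also have "\<dots> = (?m - a') * expectation (\<lambda>\<omega>. c \<omega> \<bullet> c' \<omega>)"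
    by (rule same_step_inner(2)[OF ord(1,2) ca' c'])
  also have "?m - a' = max 0 (min b b' - max a a')" using ord ab' by auto
  finally show ?thesis .
qed

lemma step_inner:
  fixes c c' :: "'w \<Rightarrow> real^'d^'n"
  assumes ab: "0 \<le> a" "a \<le> b" and ab': "0 \<le> a'" "a' \<le> b'"
    and c: "bounded_at a c" and c': "bounded_at a' c'"
  shows "expectation (\<lambda>\<omega>. (c \<omega> *v (W b \<omega> - W a \<omega>)) \<bullet> (c' \<omega> *v (W b' \<omega> - W a' \<omega>)))
      = max 0 (min b b' - max a a') * expectation (\<lambda>\<omega>. c \<omega> \<bullet> c' \<omega>)"
proof (cases "a \<le> a'")
  case True
  then show ?thesis using step_inner_ordered[OF ab True ab'(2) c c'] by simp
next
  case False
  then show ?thesis using step_inner_ordered[OF ab' _ ab(2) c' c]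
    by (simp add: inner_commute min.commute max.commute)
qed

end

section \<open>The Ito integral\<close>

definition time_measure :: "real \<Rightarrow> real \<Rightarrow> real measure" where
  "time_measure a b = restrict_space lborel {a..b}"

lemma space_time_measure [simp]: "space (time_measure a b) = {a..b}"
  by (simp add: time_measure_def space_restrict_space)

lemma sets_time_measure [measurable_cong]:
  "sets (time_measure a b) = sets (restrict_space borel {a..b})"
  unfolding time_measure_def by (rule sets_restrict_space_cong) simp

lemma finite_time_measure: "finite_measure (time_measure a b)"
proof
  have "emeasure (time_measure a b) {a..b} = emeasure lborel {a..b}"
    unfolding time_measure_def by (subst emeasure_restrict_space) auto
  then show "emeasure (time_measure a b) (space (time_measure a b)) \<noteq> \<infinity>"
    using emeasure_lborel_Icc_eq[of a b] by simp
qed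

lemma sigma_finite_time_measure: "sigma_finite_measure (time_measure a b)"
  using finite_time_measure finite_measure.sigma_finite_measure by blast

lemma nn_integral_time_measure:
  "(\<integral>\<^sup>+t. f t \<partial>time_measure a b) = (\<integral>\<^sup>+t\<in>{a..b}. f t \<partial>lborel)"
  unfolding time_measure_def by (subst nn_integral_restrict_space) auto

lemma integral_time_measure:
  fixes f :: "real \<Rightarrow> 'h::{banach, second_countable_topology}"
  shows "(\<integral>t. f t \<partial>time_measure a b) = (LINT t:{a..b}|lborel. f t)"
  unfolding time_measure_def set_lebesgue_integral_def by (subst integral_restrict_space) auto

lemma simple_integrand_le:
  assumes "simple_integrand P a b m \<tau> c" "i \<le> j" "j \<le> m"
  shows "\<tau> i \<le> \<tau> j"
  using assms(2,3)
proof (induction rule: dec_induct)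
  case (step n)
  then have "\<tau> n \<le> \<tau> (Suc n)" using assms(1) by (simp add: simple_integrand_def)
  with step show ?case by auto
qed auto

context brownian_problem begin

abbreviation "PM a b \<equiv> time_measure a b \<Otimes>\<^sub>M M"

text \<open>
  Processes are square-integrable, measurable and paired on the product of the time interval with
  the probability space; \<open>pairing\<close> is the inner product of \<open>L\<^sup>2([a, b] \<times> \<Omega>)\<close>.
\<close>

abbreviation "jointly_measurable a b h \<equiv> (\<lambda>(t, \<omega>). h t \<omega>) \<in> borel_measurable (PM a b)"

abbreviation "sq_process a b h \<equiv> sq_integrable (PM a b) (\<lambda>(t, \<omega>). h t \<omega>)"

abbreviation "pairing a b f g \<equiv> (\<integral>q. f (fst q) (snd q) \<bullet> g (fst q) (snd q) \<partial>PM a b)"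

lemma pair_time: "pair_sigma_finite (time_measure a b) M"
  using finite_time_measure[of a b] finite_measure.sigma_finite_measure sigma_finite_measure_axioms
  by (auto simp: pair_sigma_finite_def)

lemma finite_PM: "finite_measure (PM a b)"
  by (rule finite_measure_pair_measure[OF finite_measure_axioms finite_time_measure])

lemma space_PM: "space (PM a b) = {a..b} \<times> space M"
  by (simp add: space_pair_measure)

lemma measurable_PM_iff:
  "(\<lambda>(t, \<omega>). h t \<omega>) \<in> borel_measurable (restrict_space borel {a..b} \<Otimes>\<^sub>M M)
     \<longleftrightarrow> jointly_measurable a b h"
proof -
  have "borel_measurable (restrict_space borel {a..b} \<Otimes>\<^sub>M M) = borel_measurable (PM a b)"
    by (intro measurable_cong_sets sets_pair_measure_cong) (auto simp: sets_time_measure)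
  then show ?thesis by metis
qed

lemma nn_integral_PM:
  assumes "jointly_measurable a b F"
  shows "(\<integral>\<^sup>+\<omega>. (\<integral>\<^sup>+t\<in>{a..b}. F t \<omega> \<partial>lborel) \<partial>M) = (\<integral>\<^sup>+(t, \<omega>). F t \<omega> \<partial>PM a b)"
proof -
  interpret pair_sigma_finite "time_measure a b" M by (rule pair_time)
  show ?thesis
    using nn_integral_snd[of "\<lambda>(t, \<omega>). F t \<omega>"] assms
    by (simp add: nn_integral_time_measure[symmetric])
qed

lemma LpF_2_iff:
  "LpF P 2 {a..b} h \<longleftrightarrow> sq_process a b h
     \<and> (\<forall>t\<in>{a..b}. h t \<in> borel_measurable (filt P t))"
proof -
  have "(\<integral>\<^sup>+\<omega>. (\<integral>\<^sup>+t\<in>{a..b}. ennreal (norm (h t \<omega>) ^ 2) \<partial>lborel) \<partial>M)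
     = (\<integral>\<^sup>+x. ennreal ((norm ((\<lambda>(t, \<omega>). h t \<omega>) x))\<^sup>2) \<partial>PM a b)"
    if [measurable]: "jointly_measurable a b h"
    by (subst nn_integral_PM) (auto intro!: nn_integral_cong)
  then show ?thesis
    unfolding LpF_def measurable_adapted_def measurable_PM_iff sq_integrable_iff_nn by auto
qed

lemma simple_integrandD:
  assumes "simple_integrand P a b m \<tau> c" "i < m"
  shows "a \<le> \<tau> i" "\<tau> i \<le> \<tau> (Suc i)" "\<tau> (Suc i) \<le> b" "bounded_at (\<tau> i) (c i)"
proof -
  have "\<tau> 0 \<le> \<tau> i" "\<tau> (Suc i) \<le> \<tau> m" using simple_integrand_le[OF assms(1)] assms(2) by auto
  moreover have "a \<le> \<tau> 0" "\<tau> m \<le> b" "\<tau> i \<le> \<tau> (Suc i)" "bounded_at (\<tau> i) (c i)"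
    using assms by (auto simp: simple_integrand_def bounded_at_def)
  ultimately show "a \<le> \<tau> i" "\<tau> i \<le> \<tau> (Suc i)" "\<tau> (Suc i) \<le> b" "bounded_at (\<tau> i) (c i)"
    by auto
qed

lemma simple_integral_sq:
  assumes "simple_integrand P a b m \<tau> c" "0 \<le> a"
  shows "sq_integrable M (simple_integral W m \<tau> c)"
proof -
  have "sq_integrable M (\<lambda>\<omega>. \<Sum>i<m. c i \<omega> *v (W (\<tau> (Suc i)) \<omega> - W (\<tau> i) \<omega>))"
    using simple_integrandD[OF assms(1)] assms(2)
    by (intro sq_integrable_sum step_integral_sq) (auto intro: order_trans)
  then show ?thesis by (simp add: simple_integral_def[abs_def])
qed

lemma step_process_sq:
  fixes c :: "'w \<Rightarrow> real^'d^'n"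
  assumes "bounded_at s c"
  shows "sq_process a b (\<lambda>t \<omega>. indicator {s<..s'} t *\<^sub>R c \<omega>)"
proof -
  obtain K where c[measurable]: "c \<in> borel_measurable M" and K: "\<forall>\<omega>\<in>space M. norm (c \<omega>) \<le> K"
    using assms unfolding bounded_at_def using filt_measurable by blast
  interpret PM: finite_measure "PM a b" by (rule finite_PM)
  have "(\<lambda>t. indicator {s<..s'} t :: real) \<in> borel_measurable (time_measure a b)"
    unfolding time_measure_def by (intro measurable_restrict_space1) simp
  then have [measurable]: "jointly_measurable a b (\<lambda>t \<omega>. indicator {s<..s'} t *\<^sub>R c \<omega>)"
    by measurable
  show ?thesis
  proof (rule sq_integrable_bound[where f="\<lambda>_. K"])
    show "AE x in PM a b. norm (case x of (t, \<omega>) \<Rightarrow> indicat_real {s<..s'} t *\<^sub>R c \<omega>) \<le> K"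
    proof (rule AE_I2)
      fix x assume "x \<in> space (PM a b)"
      then obtain t \<omega> where x: "x = (t, \<omega>)" "\<omega> \<in> space M" by (auto simp: space_PM)
      have "norm (c \<omega>) \<le> K" using K x by blast
      moreover from this have "0 \<le> K" by (rule order_trans[OF norm_ge_zero])
      ultimately show "norm (case x of (t, \<omega>) \<Rightarrow> indicat_real {s<..s'} t *\<^sub>R c \<omega>) \<le> K"
        by (simp add: x indicator_def)
    qed
    show "integrable (PM a b) (\<lambda>_. K\<^sup>2)" by (rule PM.integrable_const)
  qed measurable
qed

lemma simple_process_sq:
  assumes "simple_integrand P a b m \<tau> c"
  shows "sq_process a b (simple_process m \<tau> c)"
proof -
  have "sq_integrable (PM a b) (\<lambda>x. \<Sum>i<m. (\<lambda>(t, \<omega>). indicator {\<tau> i<..\<tau> (Suc i)} t *\<^sub>R c i \<omega>) x)"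
    using simple_integrandD(4)[OF assms] by (intro sq_integrable_sum step_process_sq) auto
  then show ?thesis by (simp add: simple_process_def split_def)
qed

lemma step_process_inner:
  fixes c c' :: "'w \<Rightarrow> real^'d^'n"
  assumes c: "bounded_at s c" and c': "bounded_at s' c'"
    and le: "a \<le> s" "a \<le> s'" "r \<le> b" "r' \<le> b"
  shows "(\<integral>x. (\<lambda>(t, \<omega>). indicator {s<..r} t *\<^sub>R c \<omega>) x \<bullet> (\<lambda>(t, \<omega>). indicator {s'<..r'} t *\<^sub>R c' \<omega>) x \<partial>PM a b)
     = max 0 (min r r' - max s s') * expectation (\<lambda>\<omega>. c \<omega> \<bullet> c' \<omega>)"
proof -
  interpret pair_sigma_finite "time_measure a b" M by (rule pair_time)
  let ?F = "\<lambda>(t, \<omega>). (indicator {s<..r} t *\<^sub>R c \<omega>) \<bullet> (indicator {s'<..r'} t *\<^sub>R c' \<omega>)"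
  have e: "(\<lambda>x. (\<lambda>(t, \<omega>). indicator {s<..r} t *\<^sub>R c \<omega>) x \<bullet> (\<lambda>(t, \<omega>). indicator {s'<..r'} t *\<^sub>R c' \<omega>) x) = ?F"
    by (auto simp: fun_eq_iff)
  have int: "integrable (PM a b) ?F"
    using integrable_inner[OF step_process_sq[OF c, of a b r] step_process_sq[OF c', of a b r']] unfolding e .
  have "integral\<^sup>L (PM a b) ?F = (\<integral>t. (\<integral>\<omega>. ?F (t, \<omega>) \<partial>M) \<partial>time_measure a b)"
    using integral_fst'[OF int] by simp
  also have "\<dots> = (\<integral>t. indicator ({max s s'<..min r r'}) t * expectation (\<lambda>\<omega>. c \<omega> \<bullet> c' \<omega>) \<partial>time_measure a b)"
    by (intro Bochner_Integration.integral_cong) (auto simp: indicator_def)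
  also have "\<dots> = (\<integral>t. indicator {max s s'<..min r r'} t \<partial>time_measure a b) * expectation (\<lambda>\<omega>. c \<omega> \<bullet> c' \<omega>)"
    by simp
  also have "(\<integral>t. indicator {max s s'<..min r r'} t \<partial>time_measure a b)
      = (\<integral>t. (indicator {max s s'<..min r r'} t :: real) \<partial>lborel)"
    unfolding integral_time_measure set_lebesgue_integral_def
    using le by (intro Bochner_Integration.integral_cong) (auto simp: indicator_def)
  also have "\<dots> = max 0 (min r r' - max s s')"
    by (cases "max s s' \<le> min r r'") (auto simp: max_absorb2 max_absorb1)
  finally show ?thesis unfolding e .
qed

lemma integral_double_sum:
  fixes F :: "nat \<Rightarrow> nat \<Rightarrow> 'q \<Rightarrow> real"
  assumes "\<And>i j. i < m \<Longrightarrow> j < m' \<Longrightarrow> integrable Q (F i j)"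
  shows "(\<integral>x. (\<Sum>i<m. \<Sum>j<m'. F i j x) \<partial>Q) = (\<Sum>i<m. \<Sum>j<m'. (\<integral>x. F i j x \<partial>Q))"
proof -
  have "(\<integral>x. (\<Sum>i<m. \<Sum>j<m'. F i j x) \<partial>Q) = (\<Sum>i<m. (\<integral>x. (\<Sum>j<m'. F i j x) \<partial>Q))"
    using assms by (intro Bochner_Integration.integral_sum Bochner_Integration.integrable_sum) auto
  also have "\<dots> = (\<Sum>i<m. \<Sum>j<m'. (\<integral>x. F i j x \<partial>Q))"
    using assms by (intro sum.cong refl Bochner_Integration.integral_sum) auto
  finally show ?thesis .
qed

text \<open>
  Both sides are bilinear in the steps, which reduces the claim to \<open>step_inner\<close>.
\<close>

lemma simple_isometry:
  assumes S: "simple_integrand P a b m \<tau> c" and S': "simple_integrand P a b m' \<tau>' c'" and a: "0 \<le> a"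
  shows "expectation (\<lambda>\<omega>. simple_integral W m \<tau> c \<omega> \<bullet> simple_integral W m' \<tau>' c' \<omega>)
     = (\<integral>x. (\<lambda>(t, \<omega>). simple_process m \<tau> c t \<omega>) x \<bullet> (\<lambda>(t, \<omega>). simple_process m' \<tau>' c' t \<omega>) x \<partial>PM a b)"
proof -
  note D = simple_integrandD[OF S] and D' = simple_integrandD[OF S']
  let ?X = "\<lambda>i \<omega>. c i \<omega> *v (W (\<tau> (Suc i)) \<omega> - W (\<tau> i) \<omega>)"
  let ?Y = "\<lambda>i \<omega>. c' i \<omega> *v (W (\<tau>' (Suc i)) \<omega> - W (\<tau>' i) \<omega>)"
  let ?x = "\<lambda>i. (\<lambda>(t, \<omega>). indicator {\<tau> i<..\<tau> (Suc i)} t *\<^sub>R c i \<omega>)"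
  let ?y = "\<lambda>i. (\<lambda>(t, \<omega>). indicator {\<tau>' i<..\<tau>' (Suc i)} t *\<^sub>R c' i \<omega>)"
  have sq: "sq_integrable M (?X i)" "sq_integrable (PM a b) (?x i)" if "i < m" for i
    using D[OF that] a by (auto intro!: step_integral_sq step_process_sq)
  have sq': "sq_integrable M (?Y i)" "sq_integrable (PM a b) (?y i)" if "i < m'" for i
    using D'[OF that] a by (auto intro!: step_integral_sq step_process_sq)
  have "expectation (\<lambda>\<omega>. simple_integral W m \<tau> c \<omega> \<bullet> simple_integral W m' \<tau>' c' \<omega>)
     = expectation (\<lambda>\<omega>. \<Sum>i<m. \<Sum>j<m'. ?X i \<omega> \<bullet> ?Y j \<omega>)"
    by (simp add: simple_integral_def inner_sum_left inner_sum_right) (subst sum.swap, rule refl)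
  also have "\<dots> = (\<Sum>i<m. \<Sum>j<m'. expectation (\<lambda>\<omega>. ?X i \<omega> \<bullet> ?Y j \<omega>))"
    by (intro integral_double_sum integrable_inner sq sq')
  also have "\<dots> = (\<Sum>i<m. \<Sum>j<m'. (\<integral>x. ?x i x \<bullet> ?y j x \<partial>PM a b))"
  proof (intro sum.cong refl)
    fix i j assume "i \<in> {..<m}" "j \<in> {..<m'}"
    then have i: "i < m" and j: "j < m'" by auto
    note le = order_trans[OF a D(1)[OF i]] order_trans[OF a D'(1)[OF j]]
    show "expectation (\<lambda>\<omega>. ?X i \<omega> \<bullet> ?Y j \<omega>) = (\<integral>x. ?x i x \<bullet> ?y j x \<partial>PM a b)"
      unfolding step_inner[OF le(1) D(2)[OF i] le(2) D'(2)[OF j] D(4)[OF i] D'(4)[OF j]]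
      by (rule step_process_inner[OF D(4)[OF i] D'(4)[OF j] D(1)[OF i] D'(1)[OF j] D(3)[OF i] D'(3)[OF j], symmetric])
  qed
  also have "\<dots> = (\<integral>x. (\<Sum>i<m. \<Sum>j<m'. ?x i x \<bullet> ?y j x) \<partial>PM a b)"
    by (intro integral_double_sum[symmetric] integrable_inner sq sq')
  also have "\<dots> = (\<integral>x. (\<lambda>(t, \<omega>). simple_process m \<tau> c t \<omega>) x \<bullet> (\<lambda>(t, \<omega>). simple_process m' \<tau>' c' t \<omega>) x \<partial>PM a b)"
    unfolding simple_process_def split_beta inner_sum_left unfolding inner_sum_right ..
  finally show ?thesis .
qed

lemma simple_isometry_diff:
  assumes S: "simple_integrand P a b m \<tau> c" and S': "simple_integrand P a b m' \<tau>' c'" and a: "0 \<le> a"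
  shows "expectation (\<lambda>\<omega>. (norm (simple_integral W m \<tau> c \<omega> - simple_integral W m' \<tau>' c' \<omega>))\<^sup>2)
     = (\<integral>x. (norm ((\<lambda>(t, \<omega>). simple_process m \<tau> c t \<omega>) x - (\<lambda>(t, \<omega>). simple_process m' \<tau>' c' t \<omega>) x))\<^sup>2 \<partial>PM a b)"
proof -
  have expand: "(\<integral>x. (norm (f x - g x))\<^sup>2 \<partial>Q)
      = (\<integral>x. f x \<bullet> f x \<partial>Q) - 2 * (\<integral>x. f x \<bullet> g x \<partial>Q) + (\<integral>x. g x \<bullet> g x \<partial>Q)"
    if "sq_integrable Q f" "sq_integrable Q g" for Q :: "'q measure" and f g :: "'q \<Rightarrow> real^'m::finite^'l::finite"
  proof -
    have "(norm (f x - g x))\<^sup>2 = f x \<bullet> f x - 2 * (f x \<bullet> g x) + g x \<bullet> g x" for x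
      by (simp add: power2_norm_eq_inner inner_diff_left inner_diff_right inner_commute)
    then show ?thesis using that by (simp add: integrable_inner)
  qed
  have expand': "(\<integral>x. (norm (f x - g x))\<^sup>2 \<partial>Q)
      = (\<integral>x. f x \<bullet> f x \<partial>Q) - 2 * (\<integral>x. f x \<bullet> g x \<partial>Q) + (\<integral>x. g x \<bullet> g x \<partial>Q)"
    if "sq_integrable Q f" "sq_integrable Q g" for Q :: "'q measure" and f g :: "'q \<Rightarrow> real^'l::finite"
  proof -
    have "(norm (f x - g x))\<^sup>2 = f x \<bullet> f x - 2 * (f x \<bullet> g x) + g x \<bullet> g x" for x
      by (simp add: power2_norm_eq_inner inner_diff_left inner_diff_right inner_commute)
    then show ?thesis using that by (simp add: integrable_inner)
  qed
  show ?thesis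
    unfolding expand[OF simple_process_sq[OF S] simple_process_sq[OF S']]
      expand'[OF simple_integral_sq[OF S a] simple_integral_sq[OF S' a]]
      simple_isometry[OF S S a] simple_isometry[OF S S' a] simple_isometry[OF S' S' a] ..
qed

lemma has_ito_integralE:
  assumes "has_ito_integral P a b h X" "0 \<le> a"
  obtains m \<tau> c where "\<forall>k::nat. simple_integrand P a b (m k) (\<tau> k) (c k)"
    "L2_tendsto M (\<lambda>k. simple_integral W (m k) (\<tau> k) (c k)) X"
    "L2_tendsto (PM a b) (\<lambda>k. (\<lambda>(t, \<omega>). simple_process (m k) (\<tau> k) (c k) t \<omega>)) (\<lambda>(t, \<omega>). h t \<omega>)"
proof -
  obtain m \<tau> c where S: "\<And>k::nat. simple_integrand P a b (m k) (\<tau> k) (c k)"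
    and 1: "(\<lambda>k. \<integral>\<^sup>+\<omega>. (\<integral>\<^sup>+t\<in>{a..b}. ennreal ((norm (simple_process (m k) (\<tau> k) (c k) t \<omega> - h t \<omega>))\<^sup>2)
               \<partial>lborel) \<partial>M) \<longlonglongrightarrow> 0"
    and 2: "(\<lambda>k. \<integral>\<^sup>+\<omega>. ennreal ((norm (simple_integral W (m k) (\<tau> k) (c k) \<omega> - X \<omega>))\<^sup>2) \<partial>M) \<longlonglongrightarrow> 0"
    and h: "LpF P 2 {a..b} h" and X: "X \<in> borel_measurable M"
    using assms(1) unfolding has_ito_integral_def by auto
  have h': "sq_process a b h" using h by (simp add: LpF_2_iff)
  have "(\<integral>\<^sup>+\<omega>. (\<integral>\<^sup>+t\<in>{a..b}. ennreal ((norm (simple_process (m k) (\<tau> k) (c k) t \<omega> - h t \<omega>))\<^sup>2) \<partial>lborel) \<partial>M)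
     = (\<integral>\<^sup>+x. ennreal ((norm ((\<lambda>(t, \<omega>). simple_process (m k) (\<tau> k) (c k) t \<omega>) x - (\<lambda>(t, \<omega>). h t \<omega>) x))\<^sup>2) \<partial>PM a b)" for k
  proof (subst nn_integral_PM)
    have "(\<lambda>x. ennreal ((norm ((\<lambda>(t, \<omega>). simple_process (m k) (\<tau> k) (c k) t \<omega>) x - (\<lambda>(t, \<omega>). h t \<omega>) x))\<^sup>2)) \<in> borel_measurable (PM a b)"
      using sq_integrable_measurable[OF simple_process_sq[OF S]] sq_integrable_measurable[OF h'] by measurable
    then show "jointly_measurable a b (\<lambda>t \<omega>. ennreal ((norm (simple_process (m k) (\<tau> k) (c k) t \<omega> - h t \<omega>))\<^sup>2))"
      by (simp add: split_def)
  qed (simp add: split_def)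
  with 1 have "L2_tendsto (PM a b) (\<lambda>k. (\<lambda>(t, \<omega>). simple_process (m k) (\<tau> k) (c k) t \<omega>)) (\<lambda>(t, \<omega>). h t \<omega>)"
    using simple_process_sq[OF S] h' by (intro L2_tendstoI_nn) (auto intro: sq_integrable_measurable)
  moreover have "L2_tendsto M (\<lambda>k. simple_integral W (m k) (\<tau> k) (c k)) X"
    using 2 X simple_integral_sq[OF S assms(2)] by (intro L2_tendstoI_nn)
  ultimately show thesis using that S by blast
qed

lemma ito_sq:
  assumes "has_ito_integral P a b h X" "0 \<le> a"
  shows "sq_integrable M X" and "sq_process a b h"
  by (rule has_ito_integralE[OF assms], simp add: L2_tendsto_def)+

lemma simple_integral_orthogonal:
  assumes S: "simple_integrand P a b m \<tau> c" and a: "0 \<le> a"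
    and Y: "Y \<in> borel_measurable (filt P a)" "sq_integrable M Y"
  shows "expectation (\<lambda>\<omega>. Y \<omega> \<bullet> simple_integral W m \<tau> c \<omega>) = 0"
proof -
  note D = simple_integrandD[OF S]
  have "expectation (\<lambda>\<omega>. Y \<omega> \<bullet> simple_integral W m \<tau> c \<omega>)
    = (\<Sum>i<m. expectation (\<lambda>\<omega>. Y \<omega> \<bullet> (c i \<omega> *v (W (\<tau> (Suc i)) \<omega> - W (\<tau> i) \<omega>))))"
    unfolding simple_integral_def inner_sum_right using D a
    by (intro Bochner_Integration.integral_sum integrable_inner Y step_integral_sq) (auto intro: order_trans)
  also have "\<dots> = 0"
    using D a by (intro sum.neutral ballI past_orthogonal_increment Y measurable_filt_mono[OF Y(1)]) (auto intro: order_trans)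
  finally show ?thesis .
qed

text \<open>
  For simple integrands every step begins at or after \<open>a\<close> and is therefore orthogonal to \<open>Y\<close>.
\<close>

lemma ito_orthogonal_past:
  assumes X: "has_ito_integral P a b h X" and a: "0 \<le> a"
    and Y: "Y \<in> borel_measurable (filt P a)" "sq_integrable M Y"
  shows "expectation (\<lambda>\<omega>. Y \<omega> \<bullet> X \<omega>) = 0"
proof -
  obtain m \<tau> c where S_all: "\<forall>k::nat. simple_integrand P a b (m k) (\<tau> k) (c k)"
    and lim: "L2_tendsto M (\<lambda>k. simple_integral W (m k) (\<tau> k) (c k)) X"
    "L2_tendsto (PM a b) (\<lambda>k. (\<lambda>(t, \<omega>). simple_process (m k) (\<tau> k) (c k) t \<omega>)) (\<lambda>(t, \<omega>). h t \<omega>)"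
    by (rule has_ito_integralE[OF X a])
  note S = S_all[rule_format]
  from L2_tendsto_inner[OF L2_tendsto_const[OF Y(2)] lim(1)] show ?thesis
    using simple_integral_orthogonal[OF S a Y] by (simp add: LIMSEQ_const_iff)
qed

text \<open>
  Inner products are continuous in \<open>L\<^sup>2\<close>, so the isometry passes from simple integrands to the limit.
\<close>

lemma ito_isometry:
  assumes X: "has_ito_integral P a b h X" and Y: "has_ito_integral P a b g Y" and a: "0 \<le> a"
  shows "expectation (\<lambda>\<omega>. X \<omega> \<bullet> Y \<omega>) = (\<integral>x. (\<lambda>(t, \<omega>). h t \<omega>) x \<bullet> (\<lambda>(t, \<omega>). g t \<omega>) x \<partial>PM a b)"
proof -
  obtain m \<tau> c where S_all: "\<forall>k::nat. simple_integrand P a b (m k) (\<tau> k) (c k)"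
    and 1: "L2_tendsto M (\<lambda>k. simple_integral W (m k) (\<tau> k) (c k)) X"
    "L2_tendsto (PM a b) (\<lambda>k. (\<lambda>(t, \<omega>). simple_process (m k) (\<tau> k) (c k) t \<omega>)) (\<lambda>(t, \<omega>). h t \<omega>)"
    by (rule has_ito_integralE[OF X a])
  note S = S_all[rule_format]
  obtain m' \<tau>' c' where S'_all: "\<forall>k::nat. simple_integrand P a b (m' k) (\<tau>' k) (c' k)"
    and 2: "L2_tendsto M (\<lambda>k. simple_integral W (m' k) (\<tau>' k) (c' k)) Y"
    "L2_tendsto (PM a b) (\<lambda>k. (\<lambda>(t, \<omega>). simple_process (m' k) (\<tau>' k) (c' k) t \<omega>)) (\<lambda>(t, \<omega>). g t \<omega>)"
    by (rule has_ito_integralE[OF Y a])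
  note S' = S'_all[rule_format]
  show ?thesis
    using L2_tendsto_inner[OF 1(1) 2(1)] L2_tendsto_inner[OF 1(2) 2(2)]
    unfolding simple_isometry[OF S S' a] by (rule LIMSEQ_unique)
qed

text \<open>
  Stopping a simple integrand at time \<open>t\<close>: the steps after \<open>t\<close> become empty, and the one
  containing \<open>t\<close> is cut. The coefficients of the empty steps are replaced by 0 because they are
  not known at time \<open>t\<close>.
\<close>

lemma simple_integrand_stop:
  assumes S: "simple_integrand P 0 b m \<tau> c" and t: "0 \<le> t"
  shows "simple_integrand P 0 t m (\<lambda>i. min (\<tau> i) t) (\<lambda>i. if \<tau> i \<le> t then c i else (\<lambda>_. 0))"
  unfolding simple_integrand_def
proof (intro conjI allI impI)
  show "0 \<le> min (\<tau> 0) t" using S t by (auto simp: simple_integrand_def)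
  show "min (\<tau> m) t \<le> t" by simp
  fix i assume i: "i < m"
  show "min (\<tau> i) t \<le> min (\<tau> (Suc i)) t" using simple_integrandD(2)[OF S i] by auto
  show "(if \<tau> i \<le> t then c i else (\<lambda>_. 0)) \<in> borel_measurable (filt P (min (\<tau> i) t))"
    using S i by (auto simp: simple_integrand_def min_absorb1)
  show "\<exists>K. \<forall>\<omega>\<in>space M. norm ((if \<tau> i \<le> t then c i else (\<lambda>_. 0)) \<omega>) \<le> K"
    using S i by (auto simp: simple_integrand_def)
qed

lemma simple_process_stop:
  assumes "s \<le> t"
  shows "simple_process m (\<lambda>i. min (\<tau> i) t) (\<lambda>i. if \<tau> i \<le> t then c i else (\<lambda>_. 0)) s \<omega> = simple_process m \<tau> c s \<omega>"
  unfolding simple_process_def using assms by (intro sum.cong refl) (auto simp: indicator_def)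

lemma simple_integral_stop_orthogonal:
  assumes S: "simple_integrand P 0 b m \<tau> c" and t: "0 \<le> t"
    and Y: "Y \<in> borel_measurable (filt P t)" "sq_integrable M Y"
  shows "expectation (\<lambda>\<omega>. Y \<omega> \<bullet> simple_integral W m \<tau> c \<omega>)
    = expectation (\<lambda>\<omega>. Y \<omega> \<bullet> simple_integral W m (\<lambda>i. min (\<tau> i) t) (\<lambda>i. if \<tau> i \<le> t then c i else (\<lambda>_. 0)) \<omega>)"
proof -
  note D = simple_integrandD[OF S] and D' = simple_integrandD[OF simple_integrand_stop[OF S t]]
  have "expectation (\<lambda>\<omega>. Y \<omega> \<bullet> simple_integral W m \<tau> c \<omega>)
    = (\<Sum>i<m. expectation (\<lambda>\<omega>. Y \<omega> \<bullet> (c i \<omega> *v (W (\<tau> (Suc i)) \<omega> - W (\<tau> i) \<omega>))))"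
    unfolding simple_integral_def inner_sum_right using D
    by (intro Bochner_Integration.integral_sum integrable_inner Y step_integral_sq) auto
  also have "\<dots> = (\<Sum>i<m. expectation (\<lambda>\<omega>. Y \<omega> \<bullet> ((if \<tau> i \<le> t then c i else (\<lambda>_. 0)) \<omega>
      *v (W (min (\<tau> (Suc i)) t) \<omega> - W (min (\<tau> i) t) \<omega>))))"
  proof (intro sum.cong refl)
    fix i assume "i \<in> {..<m}"
    then have i: "i < m" by simp
    note D = D[OF i]
    show "expectation (\<lambda>\<omega>. Y \<omega> \<bullet> (c i \<omega> *v (W (\<tau> (Suc i)) \<omega> - W (\<tau> i) \<omega>)))
      = expectation (\<lambda>\<omega>. Y \<omega> \<bullet> ((if \<tau> i \<le> t then c i else (\<lambda>_. 0)) \<omega>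
          *v (W (min (\<tau> (Suc i)) t) \<omega> - W (min (\<tau> i) t) \<omega>)))"
    proof (cases "\<tau> i \<le> t")
      case False
      have "expectation (\<lambda>\<omega>. Y \<omega> \<bullet> (c i \<omega> *v (W (\<tau> (Suc i)) \<omega> - W (\<tau> i) \<omega>))) = 0"
        using D False by (intro past_orthogonal_increment Y measurable_filt_mono[OF Y(1)]) auto
      then show ?thesis using False by simp
    next
      case True
      show ?thesis
      proof (cases "\<tau> (Suc i) \<le> t")
        case True
        then show ?thesis using \<open>\<tau> i \<le> t\<close> by (simp add: min_absorb1)
      next
        case False
        have "expectation (\<lambda>\<omega>. Y \<omega> \<bullet> (c i \<omega> *v (W (\<tau> (Suc i)) \<omega> - W (\<tau> i) \<omega>)))
          = expectation (\<lambda>\<omega>. Y \<omega> \<bullet> (c i \<omega> *v (W t \<omega> - W (\<tau> i) \<omega>)) + Y \<omega> \<bullet> (c i \<omega> *v (W (\<tau> (Suc i)) \<omega> - W t \<omega>)))"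
          by (simp add: inner_add_right[symmetric] matrix_vector_right_distrib[symmetric])
        also have "\<dots> = expectation (\<lambda>\<omega>. Y \<omega> \<bullet> (c i \<omega> *v (W t \<omega> - W (\<tau> i) \<omega>)))
            + expectation (\<lambda>\<omega>. Y \<omega> \<bullet> (c i \<omega> *v (W (\<tau> (Suc i)) \<omega> - W t \<omega>)))"
          using D True False t
          by (intro Bochner_Integration.integral_add integrable_inner Y step_integral_sq bounded_at_mono[OF D(4)]) auto
        also have "expectation (\<lambda>\<omega>. Y \<omega> \<bullet> (c i \<omega> *v (W (\<tau> (Suc i)) \<omega> - W t \<omega>))) = 0"
          using D True False t
          by (intro past_orthogonal_increment Y bounded_at_mono[OF D(4)]) auto
        finally show ?thesis using True False by (simp add: min_absorb1 min_absorb2)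
      qed
    qed
  qed
  also have "\<dots> = expectation (\<lambda>\<omega>. Y \<omega> \<bullet> simple_integral W m (\<lambda>i. min (\<tau> i) t) (\<lambda>i. if \<tau> i \<le> t then c i else (\<lambda>_. 0)) \<omega>)"
    unfolding simple_integral_def inner_sum_right using D'
    by (intro Bochner_Integration.integral_sum[symmetric] integrable_inner Y step_integral_sq) auto
  finally show ?thesis .
qed

lemma integrable_PM_mono:
  fixes F :: "real \<times> 'w \<Rightarrow> real"
  assumes F: "integrable (PM 0 b) F" and nonneg: "\<And>x. 0 \<le> F x" and t: "t \<le> b"
  shows "integrable (PM 0 t) F" and "(\<integral>x. F x \<partial>PM 0 t) \<le> (\<integral>x. F x \<partial>PM 0 b)"
proof -
  interpret b: pair_sigma_finite "time_measure 0 b" M by (rule pair_time)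
  interpret t: pair_sigma_finite "time_measure 0 t" M by (rule pair_time)
  have "time_measure 0 t = restrict_space (time_measure 0 b) {0..t}"
    unfolding time_measure_def using t by (subst restrict_restrict_space) (auto simp: Int_absorb1)
  then have m: "(\<lambda>x. x) \<in> measurable (time_measure 0 t) (time_measure 0 b)"
    by (simp add: measurable_restrict_space1)
  have "(\<lambda>x. (fst x, snd x)) \<in> measurable (PM 0 t) (PM 0 b)"
    using measurable_compose[OF measurable_fst m] by (intro measurable_Pair) auto
  then have id: "(\<lambda>x. x) \<in> measurable (PM 0 t) (PM 0 b)" by simp
  have meas: "F \<in> borel_measurable (PM 0 t)"
    using measurable_compose[OF id borel_measurable_integrable[OF F]] by simp
  have "(\<integral>\<^sup>+x. F x \<partial>PM 0 t) = (\<integral>\<^sup>+\<omega>. (\<integral>\<^sup>+s. F (s, \<omega>) \<partial>time_measure 0 t) \<partial>M)"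
    using meas by (subst t.nn_integral_snd[symmetric]) auto
  also have "\<dots> \<le> (\<integral>\<^sup>+\<omega>. (\<integral>\<^sup>+s. F (s, \<omega>) \<partial>time_measure 0 b) \<partial>M)"
    unfolding nn_integral_time_measure using t
    by (intro nn_integral_mono) (auto simp: indicator_def)
  also have "\<dots> = (\<integral>\<^sup>+x. F x \<partial>PM 0 b)"
    using borel_measurable_integrable[OF F] by (subst b.nn_integral_snd[symmetric]) auto
  finally have le: "(\<integral>\<^sup>+x. F x \<partial>PM 0 t) \<le> (\<integral>\<^sup>+x. F x \<partial>PM 0 b)" .
  also have "\<dots> = ennreal (\<integral>x. F x \<partial>PM 0 b)" using F nonneg by (intro nn_integral_eq_integral) auto
  finally have le': "(\<integral>\<^sup>+x. F x \<partial>PM 0 t) \<le> ennreal (\<integral>x. F x \<partial>PM 0 b)" .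
  show int: "integrable (PM 0 t) F"
    using le' nonneg meas by (intro integrableI_nonneg) (auto simp: less_top[symmetric] top_unique intro: le_less_trans)
  have "ennreal (\<integral>x. F x \<partial>PM 0 t) \<le> ennreal (\<integral>x. F x \<partial>PM 0 b)"
    using le' nn_integral_eq_integral[OF int] nonneg by simp
  then show "(\<integral>x. F x \<partial>PM 0 t) \<le> (\<integral>x. F x \<partial>PM 0 b)"
    by (subst (asm) ennreal_le_iff) (auto intro: Bochner_Integration.integral_nonneg nonneg)
qed

text \<open>
  Testing with an \<open>\<F>\<^sub>t\<close>-measurable \<open>Y\<close>, the part of an approximating simple integral after \<open>t\<close> drops
  out. The stopped approximations converge to the integral over \<open>[0, t]\<close>, because they approximate
  the integrand there and two sequences with this property have the same limit by the isometry.
\<close>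

lemma ito_martingale:
  assumes X: "has_ito_integral P 0 b h X" and X': "has_ito_integral P 0 t h X'" and t: "0 \<le> t" "t \<le> b"
    and Y: "Y \<in> borel_measurable (filt P t)" "sq_integrable M Y"
  shows "expectation (\<lambda>\<omega>. Y \<omega> \<bullet> X \<omega>) = expectation (\<lambda>\<omega>. Y \<omega> \<bullet> X' \<omega>)"
proof -
  obtain m \<tau> c where S_all: "\<forall>k::nat. simple_integrand P 0 b (m k) (\<tau> k) (c k)"
    and 1: "L2_tendsto M (\<lambda>k. simple_integral W (m k) (\<tau> k) (c k)) X"
    "L2_tendsto (PM 0 b) (\<lambda>k. (\<lambda>(t, \<omega>). simple_process (m k) (\<tau> k) (c k) t \<omega>)) (\<lambda>(t, \<omega>). h t \<omega>)"
    by (rule has_ito_integralE[OF X order_refl])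
  note S = S_all[rule_format]
  obtain m' \<tau>' c' where S'_all: "\<forall>k::nat. simple_integrand P 0 t (m' k) (\<tau>' k) (c' k)"
    and 2: "L2_tendsto M (\<lambda>k. simple_integral W (m' k) (\<tau>' k) (c' k)) X'"
    "L2_tendsto (PM 0 t) (\<lambda>k. (\<lambda>(t, \<omega>). simple_process (m' k) (\<tau>' k) (c' k) t \<omega>)) (\<lambda>(t, \<omega>). h t \<omega>)"
    by (rule has_ito_integralE[OF X' order_refl])
  note S' = S'_all[rule_format]
  define \<sigma> where "\<sigma> k = (\<lambda>i. min (\<tau> k i) t)" for k
  define d where "d k = (\<lambda>i. if \<tau> k i \<le> t then c k i else (\<lambda>_. 0))" for k
  let ?S = "\<lambda>k. (\<lambda>(s, \<omega>). simple_process (m k) (\<sigma> k) (d k) s \<omega>)"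
  let ?R = "\<lambda>k. (\<lambda>(s, \<omega>). simple_process (m k) (\<tau> k) (c k) s \<omega>)"
  let ?S' = "\<lambda>k. (\<lambda>(s, \<omega>). simple_process (m' k) (\<tau>' k) (c' k) s \<omega>)"
  let ?h = "\<lambda>(s, \<omega>). h s \<omega>"
  have St: "simple_integrand P 0 t (m k) (\<sigma> k) (d k)" for k
    unfolding \<sigma>_def d_def by (rule simple_integrand_stop[OF S t(1)])
  have "L2_tendsto (PM 0 t) ?S ?h"
    unfolding L2_tendsto_def
  proof (intro conjI allI)
    show "sq_integrable (PM 0 t) (?S k)" for k by (rule simple_process_sq[OF St])
    show "sq_integrable (PM 0 t) ?h" using 2 by (simp add: L2_tendsto_def)
    have eq: "(\<integral>x. (norm (?S k x - ?h x))\<^sup>2 \<partial>PM 0 t) = (\<integral>x. (norm (?R k x - ?h x))\<^sup>2 \<partial>PM 0 t)" for k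
      by (intro Bochner_Integration.integral_cong refl) (auto simp: space_PM simple_process_stop \<sigma>_def d_def)
    have le: "(\<integral>x. (norm (?R k x - ?h x))\<^sup>2 \<partial>PM 0 t) \<le> (\<integral>x. (norm (?R k x - ?h x))\<^sup>2 \<partial>PM 0 b)" for k
      using sq_integrable_diff[of "PM 0 b" "?R k" ?h] 1(2) t(2)
      by (intro integrable_PM_mono(2)) (auto simp: L2_tendsto_def sq_integrable_def)
    have lim0: "(\<lambda>k. \<integral>x. (norm (?R k x - ?h x))\<^sup>2 \<partial>PM 0 b) \<longlonglongrightarrow> 0"
      using 1(2) by (simp add: L2_tendsto_def)
    show "(\<lambda>k. \<integral>x. (norm (?S k x - ?h x))\<^sup>2 \<partial>PM 0 t) \<longlonglongrightarrow> 0"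
      unfolding eq
    proof (rule tendsto_sandwich[OF _ _ tendsto_const lim0])
      show "\<forall>\<^sub>F k in sequentially. (\<integral>x. (norm (?R k x - ?h x))\<^sup>2 \<partial>PM 0 t) \<le> (\<integral>x. (norm (?R k x - ?h x))\<^sup>2 \<partial>PM 0 b)"
        by (intro always_eventually allI le)
      show "\<forall>\<^sub>F k in sequentially. 0 \<le> (\<integral>x. (norm (?R k x - ?h x))\<^sup>2 \<partial>PM 0 t)"
        by (intro always_eventually allI Bochner_Integration.integral_nonneg) simp
    qed
  qed
  note conv = this
  have sqS: "sq_integrable (PM 0 t) (?S k)" "sq_integrable (PM 0 t) (?S' k)" for k
    using simple_process_sq[OF St] simple_process_sq[OF S'] by auto
  have sqh: "sq_integrable (PM 0 t) ?h" using 2 by (simp add: L2_tendsto_def)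
  have near: "(\<lambda>k. expectation (\<lambda>\<omega>. (norm (simple_integral W (m' k) (\<tau>' k) (c' k) \<omega>
      - simple_integral W (m k) (\<sigma> k) (d k) \<omega>))\<^sup>2)) \<longlonglongrightarrow> 0"
    unfolding simple_isometry_diff[OF S' St order_refl]
  proof -
    have L: "L2_tendsto (PM 0 t) (\<lambda>k x. ?S' k x - ?S k x) (\<lambda>x. 0)"
    proof (rule L2_tendsto_near)
      show "L2_tendsto (PM 0 t) (\<lambda>k x. ?S' k x - ?h x) (\<lambda>x. 0)"
        using 2(2) sq_integrable_diff[OF sqS(2) sqh]
        by (auto simp: L2_tendsto_def sq_integrable_zero)
      show "sq_integrable (PM 0 t) (\<lambda>x. ?S' k x - ?S k x)" for k using sqS by (intro sq_integrable_diff)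
      show "(\<lambda>k. \<integral>x. (norm ((?S' k x - ?h x) - (?S' k x - ?S k x)))\<^sup>2 \<partial>PM 0 t) \<longlonglongrightarrow> 0"
        using conv by (simp add: L2_tendsto_def)
    qed
    then show "(\<lambda>k. \<integral>x. (norm (?S' k x - ?S k x))\<^sup>2 \<partial>PM 0 t) \<longlonglongrightarrow> 0"
      by (simp add: L2_tendsto_def)
  qed
  have 3: "L2_tendsto M (\<lambda>k. simple_integral W (m k) (\<sigma> k) (d k)) X'"
    by (rule L2_tendsto_near[OF 2(1) _ near]) (rule simple_integral_sq[OF St order_refl])
  have "expectation (\<lambda>\<omega>. Y \<omega> \<bullet> simple_integral W (m k) (\<tau> k) (c k) \<omega>)
      = expectation (\<lambda>\<omega>. Y \<omega> \<bullet> simple_integral W (m k) (\<sigma> k) (d k) \<omega>)" for k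
    unfolding \<sigma>_def d_def by (rule simple_integral_stop_orthogonal[OF S t(1) Y])
  with L2_tendsto_inner[OF L2_tendsto_const[OF Y(2)] 1(1)]
  have "(\<lambda>k. expectation (\<lambda>\<omega>. Y \<omega> \<bullet> simple_integral W (m k) (\<sigma> k) (d k) \<omega>))
      \<longlonglongrightarrow> expectation (\<lambda>\<omega>. Y \<omega> \<bullet> X \<omega>)" by (simp only:)
  from LIMSEQ_unique[OF this L2_tendsto_inner[OF L2_tendsto_const[OF Y(2)] 3]] show ?thesis .
qed

end

section \<open>Delayed processes\<close>

lemma measurable_curried:
  assumes "(\<lambda>(t, \<omega>). h t \<omega>) \<in> measurable (A \<Otimes>\<^sub>M B) C" "f \<in> measurable D A" "g \<in> measurable D B"
  shows "(\<lambda>x. h (f x) (g x)) \<in> measurable D C"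
  using measurable_compose[OF measurable_Pair[OF assms(2,3)] assms(1)] by simp

lemma time_measure_id: "(\<lambda>t. t) \<in> borel_measurable (time_measure a b)"
  unfolding time_measure_def by (intro measurable_restrict_space1) simp

lemma measurable_time_mono:
  assumes "a \<le> a'" "b' \<le> b"
  shows "(\<lambda>t. t) \<in> measurable (time_measure a' b') (time_measure a b)"
proof -
  have "(\<lambda>t. t) \<in> measurable (restrict_space borel {a'..b'}) (restrict_space borel {a..b})"
    using assms by (intro measurable_restrict_space2) (auto simp: space_restrict_space intro!: measurable_restrict_space1)
  then show ?thesis by (metis (no_types) measurable_cong_sets sets_time_measure)
qed

context brownian_problem begin

lemma section_measurable:
  fixes x :: "real \<Rightarrow> 'w \<Rightarrow> 'h::euclidean_space"
  assumes "jointly_measurable a b x"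
  shows "\<omega> \<in> space M \<Longrightarrow> (\<lambda>s. x s \<omega>) \<in> borel_measurable (time_measure a b)"
    and "s \<in> {a..b} \<Longrightarrow> x s \<in> borel_measurable M"
  using measurable_compose[OF measurable_Pair2' assms] measurable_compose[OF measurable_Pair1' assms, of s] by auto

lemma nn_integral_PM_fst:
  "F \<in> borel_measurable (PM a b) \<Longrightarrow>
     (\<integral>\<^sup>+t. (\<integral>\<^sup>+\<omega>. F (t, \<omega>) \<partial>M) \<partial>time_measure a b) = (\<integral>\<^sup>+p. F p \<partial>PM a b)"
  by (rule nn_integral_fst)

lemma measurable_sub_interval:
  assumes "jointly_measurable a b h" "a \<le> a'" "b' \<le> b"
  shows "jointly_measurable a' b' h"
proof -
  have "(\<lambda>x. h (fst x) (snd x)) \<in> borel_measurable (PM a' b')"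
    using assms by (intro measurable_curried[OF assms(1)] measurable_compose[OF measurable_fst measurable_time_mono]) auto
  then show ?thesis by (simp add: split_def)
qed

lemma LpF_2_sub_interval:
  assumes h: "LpF P 2 {a..b} h" and "a \<le> a'" "b' \<le> b"
  shows "LpF P 2 {a'..b'} h"
proof -
  have sq: "sq_process a b h" and ad: "\<forall>t\<in>{a..b}. h t \<in> borel_measurable (filt P t)"
    using h by (auto simp: LpF_2_iff)
  have [measurable]: "jointly_measurable a' b' h"
    by (rule measurable_sub_interval[OF sq_integrable_measurable[OF sq] assms(2,3)])
  have [measurable]: "jointly_measurable a b h"
    by (rule sq_integrable_measurable[OF sq])
  have "(\<integral>\<^sup>+(t, \<omega>). ennreal ((norm (h t \<omega>))\<^sup>2) \<partial>PM a' b') = (\<integral>\<^sup>+\<omega>. (\<integral>\<^sup>+t\<in>{a'..b'}. ennreal ((norm (h t \<omega>))\<^sup>2) \<partial>lborel) \<partial>M)"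
    by (subst nn_integral_PM) auto
  also have "\<dots> \<le> (\<integral>\<^sup>+\<omega>. (\<integral>\<^sup>+t\<in>{a..b}. ennreal ((norm (h t \<omega>))\<^sup>2) \<partial>lborel) \<partial>M)"
    using assms(2,3) by (intro nn_integral_mono) (auto simp: indicator_def)
  also have "\<dots> = (\<integral>\<^sup>+(t, \<omega>). ennreal ((norm (h t \<omega>))\<^sup>2) \<partial>PM a b)"
    by (subst nn_integral_PM) auto
  also have "\<dots> < \<infinity>" using sq by (simp add: sq_integrable_iff_nn split_def)
  finally have "sq_process a' b' h"
    by (simp add: sq_integrable_iff_nn split_def)
  then show ?thesis using ad assms(2,3) by (auto simp: LpF_2_iff)
qed

text \<open>
  The product measure controls a process only at almost every time; a fixed time may be exceptional.
\<close>

lemma AE_sections_sq_integrable: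
  assumes "sq_process a b h"
  shows "AE t in time_measure a b. sq_integrable M (h t)"
proof -
  interpret pair_sigma_finite "time_measure a b" M by (rule pair_time)
  have m[measurable]: "jointly_measurable a b h"
    by (rule sq_integrable_measurable[OF assms])
  have "integrable (PM a b) (\<lambda>(t, \<omega>). (norm (h t \<omega>))\<^sup>2)"
    using assms by (simp add: sq_integrable_def split_def)
  from AE_integrable_fst'[OF this] AE_space show ?thesis
  proof eventually_elim
    case (elim t)
    have "h t \<in> borel_measurable M"
      using measurable_compose[OF measurable_Pair1'[OF elim(2)] m] by simp
    with elim show ?case by (simp add: sq_integrable_def)
  qed
qed

text \<open>
  Fubini's theorem does not give this directly, because joint measurability in \<open>(s, \<omega>)\<close> is only known
  for the full \<open>\<sigma>\<close>-algebra. But for the integral \<open>Y\<close> and every bounded \<open>Z\<close> it gives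
  \<open>E[Z Y] = E[E[Z|\<F>\<^sub>t] Y]\<close>, which forces \<open>Y = E[Y|\<F>\<^sub>t]\<close>.
\<close>

lemma time_integral_adapted_real:
  fixes F :: "real \<Rightarrow> 'w \<Rightarrow> real"
  assumes int: "integrable (PM a b) (\<lambda>(s, \<omega>). F s \<omega>)"
    and ad: "\<And>s. s \<in> {a..b} \<Longrightarrow> F s \<in> borel_measurable (filt P t)"
  shows "(\<lambda>\<omega>. \<integral>s. F s \<omega> \<partial>time_measure a b) \<in> borel_measurable (filt P t)"
proof -
  interpret pair_sigma_finite "time_measure a b" M by (rule pair_time)
  interpret swap: pair_sigma_finite M "time_measure a b" ..
  interpret cond: sigma_finite_subalgebra M "filt P t" by (rule sigma_finite_subalgebra_filt)
  note [measurable] = borel_measurable_integrable[OF int]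
  define Y where "Y \<omega> = (\<integral>s. F s \<omega> \<partial>time_measure a b)" for \<omega>
  have "integrable (M \<Otimes>\<^sub>M time_measure a b) (\<lambda>(\<omega>, s). F s \<omega>)"
    using integrable_product_swap[OF int] by (simp add: split_def)
  from swap.integrable_fst'[OF this] have Y: "integrable M Y"
    unfolding Y_def by simp
  have Fub: "expectation (\<lambda>\<omega>. Z \<omega> * Y \<omega>) = (\<integral>s. expectation (\<lambda>\<omega>. F s \<omega> * Z \<omega>) \<partial>time_measure a b)"
    if Z[measurable]: "Z \<in> borel_measurable M" and Z1: "AE \<omega> in M. \<bar>Z \<omega>\<bar> \<le> 1"
    for Z :: "'w \<Rightarrow> real"
  proof -
    have "AE x in PM a b. \<bar>Z (snd x)\<bar> \<le> 1"
      by (rule AE_pair_measure) (use Z1 in auto)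
    then have intZ: "integrable (PM a b) (\<lambda>(s, \<omega>). F s \<omega> * Z \<omega>)"
    proof (intro Bochner_Integration.integrable_bound[OF int])
      show "jointly_measurable a b (\<lambda>s \<omega>. F s \<omega> * Z \<omega>)" by measurable
      show "AE x in PM a b. norm (case x of (s, \<omega>) \<Rightarrow> F s \<omega> * Z \<omega>) \<le> norm (case x of (s, \<omega>) \<Rightarrow> F s \<omega>)"
        using \<open>AE x in PM a b. \<bar>Z (snd x)\<bar> \<le> 1\<close>
        by eventually_elim (auto simp: abs_mult mult_left_le split: prod.splits)
    qed
    have "expectation (\<lambda>\<omega>. Z \<omega> * Y \<omega>) = expectation (\<lambda>\<omega>. \<integral>s. F s \<omega> * Z \<omega> \<partial>time_measure a b)"
      by (simp add: Y_def mult.commute)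
    also have "\<dots> = (\<integral>s. expectation (\<lambda>\<omega>. F s \<omega> * Z \<omega>) \<partial>time_measure a b)"
      by (rule Fubini_integral) (use intZ in simp)
    finally show ?thesis .
  qed
  define C where "C = real_cond_exp M (filt P t) Y"
  have C: "C \<in> borel_measurable (filt P t)" "integrable M C"
    unfolding C_def using cond.real_cond_exp_int(1)[OF Y] by auto
  have [measurable]: "C \<in> borel_measurable M" "Y \<in> borel_measurable M" using C Y by auto
  define Z where "Z \<omega> = sgn (Y \<omega> - C \<omega>)" for \<omega>
  have Z[measurable]: "Z \<in> borel_measurable M" and Zb: "\<bar>Z \<omega>\<bar> \<le> 1" for \<omega>
    unfolding Z_def by (auto simp: sgn_if)
  have Zi: "integrable M Z" using Zb by (intro integrable_const_bound[of _ 1]) auto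
  define cZ where "cZ = real_cond_exp M (filt P t) Z"
  have cZ: "cZ \<in> borel_measurable (filt P t)" by (simp add: cZ_def)
  have "Z \<omega> \<le> 1" "- 1 \<le> Z \<omega>" for \<omega> using Zb[of \<omega>] by auto
  then have cZb: "AE \<omega> in M. \<bar>cZ \<omega>\<bar> \<le> 1"
    using cond.real_cond_exp_le_c[OF Zi, of 1] cond.real_cond_exp_ge_c[OF Zi, of "-1"]
    unfolding cZ_def by (auto simp: abs_le_iff elim: AE_mp)
  have ZV: "integrable M (\<lambda>\<omega>. Z \<omega> * V \<omega>)" if "integrable M V" for V
    using Zb that by (intro Bochner_Integration.integrable_bound[OF that]) (auto simp: abs_mult mult_left_le_one_le)
  note ZY = ZV[OF Y] ZV[OF C(2)]
  have cZY: "integrable M (\<lambda>\<omega>. cZ \<omega> * Y \<omega>)"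
  proof (intro Bochner_Integration.integrable_bound[OF Y])
    show "(\<lambda>\<omega>. cZ \<omega> * Y \<omega>) \<in> borel_measurable M" by (simp add: cZ_def)
    show "AE \<omega> in M. norm (cZ \<omega> * Y \<omega>) \<le> norm (Y \<omega>)"
      using cZb by eventually_elim (simp add: abs_mult mult_left_le_one_le)
  qed
  have "expectation (\<lambda>\<omega>. Z \<omega> * Y \<omega>) = (\<integral>s. expectation (\<lambda>\<omega>. F s \<omega> * Z \<omega>) \<partial>time_measure a b)"
    by (rule Fub) (use Zb in auto)
  also have "\<dots> = (\<integral>s. expectation (\<lambda>\<omega>. F s \<omega> * cZ \<omega>) \<partial>time_measure a b)"
  proof (rule integral_cong_AE)
    show "AE s in time_measure a b. expectation (\<lambda>\<omega>. F s \<omega> * Z \<omega>) = expectation (\<lambda>\<omega>. F s \<omega> * cZ \<omega>)"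
      using AE_integrable_fst'[OF int] AE_space
    proof eventually_elim
      case (elim s)
      then have i: "integrable M (F s)" and s: "s \<in> {a..b}" by auto
      have "integrable M (\<lambda>\<omega>. F s \<omega> * Z \<omega>)"
        using Zb by (intro Bochner_Integration.integrable_bound[OF i]) (use i in \<open>auto simp: abs_mult mult_left_le\<close>)
      from cond.real_cond_exp_intg(2)[OF this ad[OF s] Z] show ?case by (simp add: cZ_def)
    qed
  qed (auto simp: cZ_def)
  also have "\<dots> = expectation (\<lambda>\<omega>. cZ \<omega> * Y \<omega>)"
    by (rule Fub[symmetric]) (use cZb in \<open>auto simp: cZ_def\<close>)
  also have "\<dots> = expectation (\<lambda>\<omega>. cZ \<omega> * C \<omega>)"
    unfolding C_def by (rule cond.real_cond_exp_intg(2)[OF cZY cZ, symmetric]) simp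
  also have "\<dots> = expectation (\<lambda>\<omega>. C \<omega> * Z \<omega>)"
    using cond.real_cond_exp_intg(2)[OF _ C(1) Z] ZY(2) by (simp add: cZ_def mult.commute)
  finally have "expectation (\<lambda>\<omega>. Z \<omega> * Y \<omega>) = expectation (\<lambda>\<omega>. Z \<omega> * C \<omega>)" by (simp add: mult.commute)
  then have "expectation (\<lambda>\<omega>. Z \<omega> * Y \<omega> - Z \<omega> * C \<omega>) = 0" using ZY by simp
  moreover have "Z \<omega> * Y \<omega> - Z \<omega> * C \<omega> = \<bar>Y \<omega> - C \<omega>\<bar>" for \<omega>
    using abs_sgn[of "Y \<omega> - C \<omega>"] by (simp add: Z_def algebra_simps)
  ultimately have "expectation (\<lambda>\<omega>. \<bar>Y \<omega> - C \<omega>\<bar>) = 0" by simp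
  then have "AE \<omega> in M. \<bar>Y \<omega> - C \<omega>\<bar> = 0"
    using Y C by (subst (asm) integral_nonneg_eq_0_iff_AE) auto
  then have "AE \<omega> in M. C \<omega> = Y \<omega>" by (auto elim: AE_mp)
  from filt_measurable_AE_cong[OF C(1) _ this] show ?thesis using Y by (simp add: Y_def[abs_def])
qed

lemma time_integral_adapted:
  fixes F :: "real \<Rightarrow> 'w \<Rightarrow> 'h::euclidean_space"
  assumes int: "integrable (PM a b) (\<lambda>(s, \<omega>). F s \<omega>)"
    and ad: "\<And>s. s \<in> {a..b} \<Longrightarrow> F s \<in> borel_measurable (filt P t)"
  shows "(\<lambda>\<omega>. \<integral>s. F s \<omega> \<partial>time_measure a b) \<in> borel_measurable (filt P t)"
proof -
  interpret pair_sigma_finite "time_measure a b" M by (rule pair_time)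
  interpret swap: pair_sigma_finite M "time_measure a b" ..
  note [measurable] = borel_measurable_integrable[OF int]
  have "integrable (M \<Otimes>\<^sub>M time_measure a b) (\<lambda>(\<omega>, s). F s \<omega>)"
    using integrable_product_swap[OF int] by (simp add: split_def)
  from swap.AE_integrable_fst'[OF this]
  have i: "AE \<omega> in M. integrable (time_measure a b) (\<lambda>s. F s \<omega>)" by simp
  have meas: "(\<lambda>\<omega>. \<integral>s. F s \<omega> \<partial>time_measure a b) \<in> borel_measurable M" by measurable
  have "(\<lambda>\<omega>. (\<integral>s. F s \<omega> \<partial>time_measure a b) \<bullet> e) \<in> borel_measurable (filt P t)" for e
  proof (rule filt_measurable_AE_cong)
    show "(\<lambda>\<omega>. \<integral>s. F s \<omega> \<bullet> e \<partial>time_measure a b) \<in> borel_measurable (filt P t)"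
    proof (rule time_integral_adapted_real)
      show "integrable (PM a b) (\<lambda>(s, \<omega>). F s \<omega> \<bullet> e)"
        using integrable_inner_left[OF int, of e] by (simp add: split_def)
      show "(\<lambda>\<omega>. F s \<omega> \<bullet> e) \<in> borel_measurable (filt P t)" if "s \<in> {a..b}" for s
        using ad[OF that] by measurable
    qed
    show "(\<lambda>\<omega>. (\<integral>s. F s \<omega> \<partial>time_measure a b) \<bullet> e) \<in> borel_measurable M" using meas by measurable
    show "AE \<omega> in M. (\<integral>s. F s \<omega> \<bullet> e \<partial>time_measure a b) = (\<integral>s. F s \<omega> \<partial>time_measure a b) \<bullet> e"
      using i by eventually_elim simp
  qed
  then show ?thesis by (subst borel_measurable_euclidean_space) auto
qed

end

locale delay_model =
  fixes P :: "('w, 'n::finite, 'd::finite, 'k::finite) delay_problem"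
  assumes setting: "delay_setting P"

sublocale delay_model \<subseteq> brownian_problem
  using setting unfolding delay_setting_def by (intro brownian_problem.intro) blast+

context delay_model begin

abbreviation "T \<equiv> horizon P"
abbreviation "\<delta> \<equiv> delay P"

lemma T_pos: "0 < T" and delay_nonneg: "0 \<le> \<delta>"
  using setting unfolding delay_setting_def by blast+

lemma delay_density_nonneg [simp]: "0 \<le> delay_density P t"
  by (simp add: delay_density_def)

lemma delay_density_measurable [measurable]: "delay_density P \<in> borel_measurable borel"
proof -
  have "(\<lambda>t. enn2real (RN_deriv lborel (dmeas P) t)) \<in> borel_measurable lborel"
    by (intro borel_measurable_enn2real borel_measurable_RN_deriv)
  then show ?thesis unfolding delay_density_def[abs_def]
    by (subst (asm) measurable_cong_sets[OF sets_lborel refl])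
qed

lemma dmeas_density: "dmeas P = density lborel (\<lambda>t. ennreal (delay_density P t))"
proof -
  have s: "sigma_finite_measure (dmeas P)" "absolutely_continuous lborel (dmeas P)" "sets (dmeas P) = sets lborel"
    using setting unfolding delay_setting_def sets_lborel by blast+
  have "AE t in lborel. RN_deriv lborel (dmeas P) t \<noteq> \<infinity>"
    by (rule sigma_finite_measure.RN_deriv_finite[OF sigma_finite_lborel s])
  then have "AE t in lborel. ennreal (delay_density P t) = RN_deriv lborel (dmeas P) t"
    by eventually_elim (simp add: delay_density_def less_top[symmetric])
  then have "density lborel (\<lambda>t. ennreal (delay_density P t)) = density lborel (RN_deriv lborel (dmeas P))"
    by (intro density_cong borel_measurable_RN_deriv) simp
  also have "\<dots> = dmeas P" by (rule sigma_finite_measure.density_RN_deriv[OF sigma_finite_lborel s(2,3)])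
  finally show ?thesis ..
qed

text \<open>The kernel of the delay with respect to Lebesgue measure.\<close>

definition delay_weight :: "real \<Rightarrow> real \<Rightarrow> 'w \<Rightarrow> real" where
  "delay_weight t s \<omega> = delay_density P s * (indicator {t - \<delta>..t} s * kernel P t s \<omega>)"

lemma kernel_measurable:
  assumes "f \<in> measurable Q (time_measure 0 T)" "g \<in> measurable Q (time_measure (-\<delta>) T)" "h \<in> measurable Q M"
  shows "(\<lambda>x. kernel P (f x) (g x) (h x)) \<in> borel_measurable Q"
proof -
  have k: "(\<lambda>(t, s, \<omega>). kernel P t s \<omega>) \<in> borel_measurable
        (restrict_space borel {0..T} \<Otimes>\<^sub>M (restrict_space borel {-\<delta>..T} \<Otimes>\<^sub>M M))"
    using setting unfolding delay_setting_def by blast+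
  have "(\<lambda>x. (f x, g x, h x)) \<in> measurable Q (restrict_space borel {0..T} \<Otimes>\<^sub>M (restrict_space borel {-\<delta>..T} \<Otimes>\<^sub>M M))"
    using assms by (intro measurable_Pair) (simp_all add: measurable_cong_sets[OF refl sets_time_measure])
  from measurable_compose[OF this k] show ?thesis by simp
qed

lemma delay_weight_measurable:
  assumes [measurable]: "f \<in> measurable Q (time_measure 0 T)" "g \<in> measurable Q (time_measure (-\<delta>) T)"
    and h: "h \<in> measurable Q M"
  shows "(\<lambda>x. delay_weight (f x) (g x) (h x)) \<in> borel_measurable Q"
proof -
  have [measurable]: "f \<in> borel_measurable Q" "g \<in> borel_measurable Q"
    using measurable_compose[OF assms(1) time_measure_id] measurable_compose[OF assms(2) time_measure_id] by auto
  have [measurable]: "(\<lambda>x. kernel P (f x) (g x) (h x)) \<in> borel_measurable Q"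
    by (rule kernel_measurable[OF assms])
  have "(\<lambda>x. delay_density P (g x) * ((if f x - \<delta> \<le> g x \<and> g x \<le> f x then 1 else 0) * kernel P (f x) (g x) (h x)))
     \<in> borel_measurable Q" by measurable
  then show ?thesis by (simp add: delay_weight_def indicator_def cong: if_cong)
qed

lemma time_section_measurable_lborel:
  fixes f :: "real \<Rightarrow> 'h::euclidean_space"
  assumes "f \<in> borel_measurable (time_measure a b)"
  shows "(\<lambda>s. indicator {a..b} s *\<^sub>R f s) \<in> borel_measurable lborel"
  using assms by (simp add: time_measure_def borel_measurable_restrict_space_iff)

lemma delayed_eq:
  fixes x :: "real \<Rightarrow> 'w \<Rightarrow> 'h::euclidean_space"
  assumes x: "jointly_measurable (-\<delta>) T x" and t: "t \<in> {0..T}" and \<omega>: "\<omega> \<in> space M"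
  shows "delayed P x t \<omega> = (\<integral>s. delay_weight t s \<omega> *\<^sub>R x s \<omega> \<partial>time_measure (-\<delta>) T)"
    and "(\<integral>\<^sup>+s\<in>{t - \<delta>..t}. ennreal \<bar>kernel P t s \<omega> * norm (x s \<omega>)\<bar> \<partial>dmeas P)
      = (\<integral>\<^sup>+s. ennreal (norm (delay_weight t s \<omega> *\<^sub>R x s \<omega>)) \<partial>time_measure (-\<delta>) T)"
proof -
  let ?g = "\<lambda>s. indicator {t - \<delta>..t} s *\<^sub>R (kernel P t s \<omega> *\<^sub>R x s \<omega>)"
  have sub: "{t - \<delta>..t} \<subseteq> {-\<delta>..T}" using t by auto
  have "(\<lambda>s. kernel P t s \<omega>) \<in> borel_measurable (time_measure (-\<delta>) T)"
    using t \<omega> by (intro kernel_measurable) auto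
  then have "(\<lambda>s. kernel P t s \<omega> *\<^sub>R x s \<omega>) \<in> borel_measurable (time_measure (-\<delta>) T)"
    using section_measurable(1)[OF x \<omega>] by measurable
  then have "(\<lambda>s. indicator {-\<delta>..T} s *\<^sub>R (kernel P t s \<omega> *\<^sub>R x s \<omega>)) \<in> borel_measurable lborel"
    by (rule time_section_measurable_lborel)
  moreover have "(indicator {t - \<delta>..t} :: real \<Rightarrow> real) \<in> borel_measurable lborel" by simp
  ultimately have "(\<lambda>s. indicator {t - \<delta>..t} s *\<^sub>R (indicator {-\<delta>..T} s *\<^sub>R (kernel P t s \<omega> *\<^sub>R x s \<omega>))) \<in> borel_measurable lborel"
    by (rule borel_measurable_scaleR[rotated])
  also have "(\<lambda>s. indicator {t - \<delta>..t} s *\<^sub>R (indicator {-\<delta>..T} s *\<^sub>R (kernel P t s \<omega> *\<^sub>R x s \<omega>))) = ?g"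
  proof
    fix s
    show "indicator {t - \<delta>..t} s *\<^sub>R (indicator {-\<delta>..T} s *\<^sub>R (kernel P t s \<omega> *\<^sub>R x s \<omega>)) = ?g s"
      using sub by (cases "s \<in> {t - \<delta>..t}") auto
  qed
  finally have g: "?g \<in> borel_measurable lborel" .
  have "delayed P x t \<omega> = (\<integral>s. delay_density P s *\<^sub>R ?g s \<partial>lborel)"
    unfolding delayed_def set_lebesgue_integral_def dmeas_density
    using g by (subst integral_density) auto
  also have "\<dots> = (\<integral>s. indicator {-\<delta>..T} s *\<^sub>R (delay_weight t s \<omega> *\<^sub>R x s \<omega>) \<partial>lborel)"
    using sub by (intro Bochner_Integration.integral_cong) (auto simp: delay_weight_def indicator_def)
  also have "\<dots> = (\<integral>s. delay_weight t s \<omega> *\<^sub>R x s \<omega> \<partial>time_measure (-\<delta>) T)"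
    unfolding integral_time_measure set_lebesgue_integral_def ..
  finally show "delayed P x t \<omega> = (\<integral>s. delay_weight t s \<omega> *\<^sub>R x s \<omega> \<partial>time_measure (-\<delta>) T)" .
  have "(\<integral>\<^sup>+s\<in>{t - \<delta>..t}. ennreal \<bar>kernel P t s \<omega> * norm (x s \<omega>)\<bar> \<partial>dmeas P) = (\<integral>\<^sup>+s. ennreal (norm (?g s)) \<partial>dmeas P)"
    by (intro nn_integral_cong) (auto simp: indicator_def abs_mult)
  also have "\<dots> = (\<integral>\<^sup>+s. ennreal (delay_density P s) * ennreal (norm (?g s)) \<partial>lborel)"
    unfolding dmeas_density
  proof (rule nn_integral_density)
    show "(\<lambda>s. ennreal (norm (?g s))) \<in> borel_measurable lborel"
      by (rule measurable_compose[OF measurable_compose[OF g borel_measurable_norm] measurable_ennreal])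
    show "(\<lambda>s. ennreal (delay_density P s)) \<in> borel_measurable lborel" by simp
  qed
  also have "\<dots> = (\<integral>\<^sup>+s\<in>{-\<delta>..T}. ennreal (norm (delay_weight t s \<omega> *\<^sub>R x s \<omega>)) \<partial>lborel)"
    using sub by (intro nn_integral_cong) (auto simp: delay_weight_def indicator_def ennreal_mult[symmetric] abs_mult)
  finally show "(\<integral>\<^sup>+s\<in>{t - \<delta>..t}. ennreal \<bar>kernel P t s \<omega> * norm (x s \<omega>)\<bar> \<partial>dmeas P)
      = (\<integral>\<^sup>+s. ennreal (norm (delay_weight t s \<omega> *\<^sub>R x s \<omega>)) \<partial>time_measure (-\<delta>) T)"
    unfolding nn_integral_time_measure .
qed

text \<open>
  The delay integral of the absolute values. It takes values in \<open>[0, \<infinity>]\<close>, since its finiteness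
  almost everywhere is a consequence of the assumption on the delay.
\<close>

definition delayed_norm :: "(real \<Rightarrow> 'w \<Rightarrow> 'h::euclidean_space) \<Rightarrow> real \<times> 'w \<Rightarrow> ennreal" where
  "delayed_norm x = (\<lambda>(t, \<omega>). \<integral>\<^sup>+s. ennreal (norm (delay_weight t s \<omega> *\<^sub>R x s \<omega>)) \<partial>time_measure (-\<delta>) T)"

lemma weighted_measurable:
  fixes x :: "real \<Rightarrow> 'w \<Rightarrow> 'h::euclidean_space"
  assumes x: "jointly_measurable (-\<delta>) T x"
  shows "(\<lambda>((t, \<omega>), s). delay_weight t s \<omega> *\<^sub>R x s \<omega>) \<in> borel_measurable (PM 0 T \<Otimes>\<^sub>M time_measure (-\<delta>) T)"
proof -
  have "(\<lambda>p. delay_weight (fst (fst p)) (snd p) (snd (fst p)) *\<^sub>R x (snd p) (snd (fst p)))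
      \<in> borel_measurable (PM 0 T \<Otimes>\<^sub>M time_measure (-\<delta>) T)"
    by (intro borel_measurable_scaleR delay_weight_measurable measurable_curried[OF x]) measurable
  then show ?thesis by (simp add: split_def)
qed

lemma delayed_measurable:
  fixes x :: "real \<Rightarrow> 'w \<Rightarrow> 'h::euclidean_space"
  assumes x: "jointly_measurable (-\<delta>) T x"
  shows "jointly_measurable 0 T (delayed P x)"
    and "delayed_norm x \<in> borel_measurable (PM 0 T)"
proof -
  interpret S: sigma_finite_measure "time_measure (-\<delta>) T" by (rule sigma_finite_time_measure)
  note w = weighted_measurable[OF x]
  have "(\<lambda>p. \<integral>s. (case p of (t, \<omega>) \<Rightarrow> delay_weight t s \<omega> *\<^sub>R x s \<omega>) \<partial>time_measure (-\<delta>) T) \<in> borel_measurable (PM 0 T)"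
    using w by (intro S.borel_measurable_lebesgue_integral) (simp add: split_def)
  also have "?this \<longleftrightarrow> jointly_measurable 0 T (delayed P x)"
    by (intro measurable_cong) (auto simp: space_PM delayed_eq(1)[OF x])
  finally show "jointly_measurable 0 T (delayed P x)" .
  have "(\<lambda>p. \<integral>\<^sup>+s. ennreal (norm (case p of (t, \<omega>) \<Rightarrow> delay_weight t s \<omega> *\<^sub>R x s \<omega>)) \<partial>time_measure (-\<delta>) T) \<in> borel_measurable (PM 0 T)"
    using measurable_compose[OF measurable_compose[OF w borel_measurable_norm] measurable_ennreal]
    by (intro S.borel_measurable_nn_integral) (simp add: split_def del: norm_scaleR)
  then show "delayed_norm x \<in> borel_measurable (PM 0 T)"
    by (simp add: delayed_norm_def split_def del: norm_scaleR)
qed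

lemma LpF_2_norm: "LpF P 2 I x \<Longrightarrow> LpF P 2 I (\<lambda>t \<omega>. norm (x t \<omega>))"
  unfolding LpF_def measurable_adapted_def by (auto simp: split_def)

text \<open>
  The assumption on the delay concerns scalar processes; it is applied to the norm of \<open>x\<close>.
\<close>

lemma delayed_norm_L2:
  fixes x :: "real \<Rightarrow> 'w \<Rightarrow> 'h::euclidean_space"
  assumes x: "LpF P 2 {-\<delta>..T} x"
  shows "(\<integral>\<^sup>+p. (delayed_norm x p)\<^sup>2 \<partial>PM 0 T) < \<infinity>"
proof -
  have m: "jointly_measurable (-\<delta>) T x"
    using x by (auto simp: LpF_2_iff sq_integrable_def)
  have "delay_well_defined P" using setting unfolding delay_setting_def by blast+
  from this[unfolded delay_well_defined_def, rule_format, OF LpF_2_norm[OF x]]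
  have "(\<integral>\<^sup>+\<omega>. (\<integral>\<^sup>+t\<in>{0..T}. (\<integral>\<^sup>+s\<in>{t - \<delta>..t}. ennreal \<bar>kernel P t s \<omega> * norm (x s \<omega>)\<bar> \<partial>dmeas P)\<^sup>2 \<partial>lborel) \<partial>M) < \<infinity>" .
  also have "(\<integral>\<^sup>+\<omega>. (\<integral>\<^sup>+t\<in>{0..T}. (\<integral>\<^sup>+s\<in>{t - \<delta>..t}. ennreal \<bar>kernel P t s \<omega> * norm (x s \<omega>)\<bar> \<partial>dmeas P)\<^sup>2 \<partial>lborel) \<partial>M)
      = (\<integral>\<^sup>+\<omega>. (\<integral>\<^sup>+t\<in>{0..T}. (delayed_norm x (t, \<omega>))\<^sup>2 \<partial>lborel) \<partial>M)"
  proof (intro nn_integral_cong)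
    fix \<omega> t assume "\<omega> \<in> space M"
    then show "(\<integral>\<^sup>+s\<in>{t - \<delta>..t}. ennreal \<bar>kernel P t s \<omega> * norm (x s \<omega>)\<bar> \<partial>dmeas P)\<^sup>2 * indicator {0..T} t
      = (delayed_norm x (t, \<omega>))\<^sup>2 * indicator {0..T} t"
      using delayed_eq(2)[OF m, of t \<omega>] by (simp add: delayed_norm_def indicator_def)
  qed
  also have "\<dots> = (\<integral>\<^sup>+p. (delayed_norm x p)\<^sup>2 \<partial>PM 0 T)"
    using delayed_measurable(2)[OF m] by (subst nn_integral_PM) (auto simp: split_def)
  finally show ?thesis .
qed

lemma AE_delay_integrable:
  fixes x :: "real \<Rightarrow> 'w \<Rightarrow> 'h::euclidean_space"
  assumes x: "LpF P 2 {-\<delta>..T} x"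
  shows "AE p in PM 0 T. delayed_norm x p < \<infinity> \<and>
    integrable (time_measure (-\<delta>) T) (\<lambda>s. delay_weight (fst p) s (snd p) *\<^sub>R x s (snd p))"
proof -
  have m: "jointly_measurable (-\<delta>) T x"
    using x by (auto simp: LpF_2_iff sq_integrable_def)
  note [measurable] = delayed_measurable(2)[OF m]
  have "AE p in PM 0 T. (delayed_norm x p)\<^sup>2 \<noteq> \<infinity>"
    using delayed_norm_L2[OF x] by (intro nn_integral_PInf_AE) auto
  then show ?thesis using AE_space
  proof eventually_elim
    case (elim p)
    then have fin: "delayed_norm x p < \<infinity>" by (auto simp: less_top power2_eq_square ennreal_mult_eq_top_iff)
    have p: "fst p \<in> {0..T}" "snd p \<in> space M" using elim by (auto simp: space_PM)
    have "(\<lambda>s. delay_weight (fst p) s (snd p) *\<^sub>R x s (snd p)) \<in> borel_measurable (time_measure (-\<delta>) T)"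
      using measurable_compose[OF measurable_Pair1'[OF elim(2)] weighted_measurable[OF m]] by (simp add: split_def)
    with fin show ?case by (auto simp: integrable_iff_bounded delayed_norm_def split_def)
  qed
qed

lemma delayed_sq_integrable:
  fixes x :: "real \<Rightarrow> 'w \<Rightarrow> 'h::euclidean_space"
  assumes x: "LpF P 2 {-\<delta>..T} x"
  shows "sq_process 0 T (delayed P x)"
proof -
  have m: "jointly_measurable (-\<delta>) T x"
    using x by (auto simp: LpF_2_iff sq_integrable_def)
  have "(\<integral>\<^sup>+p. ennreal ((norm ((\<lambda>(t, \<omega>). delayed P x t \<omega>) p))\<^sup>2) \<partial>PM 0 T) \<le> (\<integral>\<^sup>+p. (delayed_norm x p)\<^sup>2 \<partial>PM 0 T)"
  proof (intro nn_integral_mono_AE)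
    show "AE p in PM 0 T. ennreal ((norm ((\<lambda>(t, \<omega>). delayed P x t \<omega>) p))\<^sup>2) \<le> (delayed_norm x p)\<^sup>2"
      using AE_delay_integrable[OF x] AE_space
    proof eventually_elim
      case (elim p)
      obtain t \<omega> where p: "p = (t, \<omega>)" by force
      have "t \<in> {0..T}" "\<omega> \<in> space M" using elim p by (auto simp: space_PM)
      then have "ennreal (norm (delayed P x t \<omega>)) \<le> delayed_norm x p"
        using elim(1) unfolding p delayed_norm_def
        by (simp add: delayed_eq(1)[OF m] integral_norm_bound_ennreal del: norm_scaleR)
      then show ?case by (simp add: p ennreal_power[symmetric] power_mono)
    qed
  qed
  then show ?thesis
    unfolding sq_integrable_iff_nn using delayed_measurable(1)[OF m] delayed_norm_L2[OF x] by auto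
qed

lemma delayed_diff:
  fixes x x' :: "real \<Rightarrow> 'w \<Rightarrow> 'h::euclidean_space"
  assumes x: "LpF P 2 {-\<delta>..T} x" and x': "LpF P 2 {-\<delta>..T} x'"
  shows "AE p in PM 0 T. delayed P (\<lambda>t \<omega>. x' t \<omega> - x t \<omega>) (fst p) (snd p)
     = delayed P x' (fst p) (snd p) - delayed P x (fst p) (snd p)"
  using AE_delay_integrable[OF x] AE_delay_integrable[OF x'] AE_space
proof eventually_elim
  case (elim p)
  have m: "jointly_measurable (-\<delta>) T x" "jointly_measurable (-\<delta>) T x'"
    using x x' by (auto simp: LpF_2_iff sq_integrable_def)
  then have m': "jointly_measurable (-\<delta>) T (\<lambda>t \<omega>. x' t \<omega> - x t \<omega>)"
    using borel_measurable_diff[OF m(2,1)] by (simp add: split_def)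
  have p: "fst p \<in> {0..T}" "snd p \<in> space M" using elim by (auto simp: space_PM)
  show ?case
    using elim unfolding delayed_eq(1)[OF m(1) p] delayed_eq(1)[OF m(2) p] delayed_eq(1)[OF m' p]
    by (simp add: scaleR_diff_right)
qed

text \<open>
  The times at which the delay integral does not converge almost surely have to be excluded. At the
  other times it runs over \<open>s \<le> t\<close>, where both the kernel and \<open>x(s)\<close> are \<open>\<F>\<^sub>t\<close>-measurable.
\<close>

lemma delayed_adapted:
  fixes x :: "real \<Rightarrow> 'w \<Rightarrow> 'h::euclidean_space"
  assumes x: "LpF P 2 {-\<delta>..T} x"
  shows "AE t in time_measure 0 T. delayed P x t \<in> borel_measurable (filt P t)"
proof -
  interpret pair_sigma_finite "time_measure 0 T" M by (rule pair_time)
  interpret S: pair_sigma_finite "time_measure (-\<delta>) T" M by (rule pair_time)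
  have m: "jointly_measurable (-\<delta>) T x" and ad: "\<And>s. s \<in> {-\<delta>..T} \<Longrightarrow> x s \<in> borel_measurable (filt P s)"
    using x by (auto simp: LpF_2_iff sq_integrable_def)
  note [measurable] = delayed_measurable(2)[OF m]
  have "(\<integral>\<^sup>+t. (\<integral>\<^sup>+\<omega>. (delayed_norm x (t, \<omega>))\<^sup>2 \<partial>M) \<partial>time_measure 0 T) < \<infinity>"
    using delayed_norm_L2[OF x] nn_integral_PM_fst[of "\<lambda>p. (delayed_norm x p)\<^sup>2" 0 T] by simp
  then have "AE t in time_measure 0 T. (\<integral>\<^sup>+\<omega>. (delayed_norm x (t, \<omega>))\<^sup>2 \<partial>M) \<noteq> \<infinity>"
    by (intro nn_integral_PInf_AE) auto
  then show ?thesis using AE_space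
  proof eventually_elim
    case (elim t)
    then have t: "t \<in> {0..T}" by simp
    let ?F = "\<lambda>(s, \<omega>). delay_weight t s \<omega> *\<^sub>R x s \<omega>"
    have "(\<lambda>p. delay_weight t (fst p) (snd p) *\<^sub>R x (fst p) (snd p)) \<in> borel_measurable (PM (-\<delta>) T)"
      using t by (intro borel_measurable_scaleR delay_weight_measurable measurable_curried[OF m]) auto
    then have F: "?F \<in> borel_measurable (PM (-\<delta>) T)" by (simp add: split_def)
    have mt[measurable]: "(\<lambda>\<omega>. delayed_norm x (t, \<omega>)) \<in> borel_measurable M"
      using measurable_compose[OF measurable_Pair1'[of t "time_measure 0 T"] delayed_measurable(2)[OF m]] t by simp
    have "(\<integral>\<^sup>+p. ennreal (norm (?F p)) \<partial>PM (-\<delta>) T) = (\<integral>\<^sup>+\<omega>. (\<integral>\<^sup>+s. ennreal (norm (?F (s, \<omega>))) \<partial>time_measure (-\<delta>) T) \<partial>M)"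
      using F by (intro S.nn_integral_snd[symmetric]) auto
    also have "\<dots> = (\<integral>\<^sup>+\<omega>. delayed_norm x (t, \<omega>) \<partial>M)" by (simp add: delayed_norm_def)
    also have "\<dots> \<le> (\<integral>\<^sup>+\<omega>. (delayed_norm x (t, \<omega>))\<^sup>2 + 1 \<partial>M)"
    proof (intro nn_integral_mono)
      fix \<omega>
      show "delayed_norm x (t, \<omega>) \<le> (delayed_norm x (t, \<omega>))\<^sup>2 + 1"
      proof (cases "delayed_norm x (t, \<omega>) \<le> 1")
        case False
        then have "delayed_norm x (t, \<omega>) * 1 \<le> delayed_norm x (t, \<omega>) * delayed_norm x (t, \<omega>)"
          by (intro mult_mono) auto
        then show ?thesis by (simp add: power2_eq_square add_increasing2)
      qed (simp add: add_increasing)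
    qed
    also have "\<dots> = (\<integral>\<^sup>+\<omega>. (delayed_norm x (t, \<omega>))\<^sup>2 \<partial>M) + 1"
      by (subst nn_integral_add) (auto simp: emeasure_space_1)
    also have "\<dots> < \<infinity>" using elim by (simp add: less_top)
    finally have int: "integrable (PM (-\<delta>) T) ?F" using F by (simp add: integrable_iff_bounded)
    let ?Y = "\<lambda>\<omega>. \<integral>s. delay_weight t s \<omega> *\<^sub>R x s \<omega> \<partial>time_measure (-\<delta>) T"
    have "?Y \<in> borel_measurable (filt P t)"
    proof (rule time_integral_adapted[OF int])
      fix s assume s: "s \<in> {-\<delta>..T}"
      show "(\<lambda>\<omega>. delay_weight t s \<omega> *\<^sub>R x s \<omega>) \<in> borel_measurable (filt P t)"
      proof (cases "s \<le> t")
        case True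
        have "kernel P t s \<in> borel_measurable (filt P s)"
          using setting s t unfolding delay_setting_def by blast
        then have [measurable]: "kernel P t s \<in> borel_measurable (filt P t)" "x s \<in> borel_measurable (filt P t)"
          using True ad[OF s] by (auto intro: measurable_filt_mono)
        show ?thesis unfolding delay_weight_def by measurable
      qed (simp add: delay_weight_def)
    qed
    moreover have "delayed P x t \<in> borel_measurable (filt P t) \<longleftrightarrow> ?Y \<in> borel_measurable (filt P t)"
      by (intro measurable_cong) (simp add: delayed_eq(1)[OF m t])
    ultimately show ?case by simp
  qed
qed

end

section \<open>Gradients\<close>

lemma grad_inner:
  fixes g :: "'h::euclidean_space \<Rightarrow> real"
  assumes g: "(g has_derivative g') (at x)"
  shows "grad g x \<bullet> e = g' e"
proof -
  define D where "D = (\<Sum>b\<in>Basis. g' b *\<^sub>R b)"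
  have lin: "linear g'" using has_derivative_linear[OF g] .
  have D: "h \<bullet> D = g' h" for h
  proof -
    have "g' h = g' (\<Sum>b\<in>Basis. (h \<bullet> b) *\<^sub>R b)" by (simp add: euclidean_representation)
    also have "\<dots> = (\<Sum>b\<in>Basis. (h \<bullet> b) * g' b)"
      using lin by (simp add: linear_sum linear_cmul)
    finally show ?thesis by (simp add: D_def inner_sum_right mult.commute)
  qed
  have "grad g x = D"
    unfolding grad_def
  proof (rule the_equality)
    show "GDERIV g x :> D" using g by (simp add: gderiv_def D)
    fix D' assume "GDERIV g x :> D'"
    then have "g' = (\<lambda>h. h \<bullet> D')" using g unfolding gderiv_def by (rule has_derivative_unique[OF _, THEN sym])
    then have "h \<bullet> D' = h \<bullet> D" for h by (simp add: D)
    then show "D' = D" by (metis inner_commute vector_eq_ldot)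
  qed
  then show ?thesis by (metis D inner_commute)
qed

lemma directional_difference_quotient:
  fixes g :: "'h::real_normed_vector \<Rightarrow> real"
  assumes g: "(g has_derivative g') (at x)"
  shows "(\<lambda>n. (g (x + inverse (real (Suc n)) *\<^sub>R h) - g x) * real (Suc n)) \<longlonglongrightarrow> g' h"
proof -
  interpret bounded_linear g' using g by (rule has_derivative_bounded_linear)
  have line: "((\<lambda>s. x + s *\<^sub>R h) has_derivative (\<lambda>s. s *\<^sub>R h)) (at (0::real))"
    by (auto intro!: derivative_eq_intros)
  have "(g has_derivative g') (at (x + 0 *\<^sub>R h))" using g by simp
  from has_derivative_compose[OF line this]
  have "((\<lambda>s. g (x + s *\<^sub>R h)) has_derivative (\<lambda>s. g' h * s)) (at (0::real))"
    by (simp add: scaleR mult.commute)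
  then have "((\<lambda>s. g (x + s *\<^sub>R h)) has_field_derivative g' h) (at 0)"
    by (simp add: has_field_derivative_def)
  then have lim: "((\<lambda>s. (g (x + s *\<^sub>R h) - g x) / s) \<longlongrightarrow> g' h) (at 0)"
    by (simp add: DERIV_def)
  have "(\<lambda>n. (g (x + inverse (real (Suc n)) *\<^sub>R h) - g x) / inverse (real (Suc n))) \<longlonglongrightarrow> g' h"
    by (rule filterlim_compose[OF lim]) (auto simp: filterlim_at simp del: of_nat_Suc intro: LIMSEQ_inverse_real_of_nat)
  then show ?thesis by (simp add: divide_inverse del: of_nat_Suc)
qed

text \<open>The inequality of a concave function and its tangent, read off on the segment.\<close>

lemma concave_tangent:
  fixes g :: "'h::real_normed_vector \<Rightarrow> real"
  assumes c: "concave_on UNIV g" and g: "(g has_derivative g') (at x)"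
  shows "g x' - g x \<le> g' (x' - x)"
proof -
  let ?q = "\<lambda>n. (g (x + inverse (real (Suc n)) *\<^sub>R (x' - x)) - g x) * real (Suc n)"
  have "g x' - g x \<le> ?q n" for n
  proof -
    define s where "s = inverse (real (Suc n))"
    have s: "0 < s" "s \<le> 1" "s * real (Suc n) = 1"
      by (auto simp: s_def field_simps)
    have "s * g x' + (1 - s) * g x \<le> g (s *\<^sub>R x' + (1 - s) *\<^sub>R x)"
      using c s unfolding concave_on_iff by (auto dest!: spec)
    also have "s *\<^sub>R x' + (1 - s) *\<^sub>R x = x + s *\<^sub>R (x' - x)" by (simp add: algebra_simps)
    finally have "s * (g x' - g x) \<le> g (x + s *\<^sub>R (x' - x)) - g x" by (simp add: algebra_simps)
    then have "(s * (g x' - g x)) * real (Suc n) \<le> (g (x + s *\<^sub>R (x' - x)) - g x) * real (Suc n)"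
      by (rule mult_right_mono) simp
    moreover have "(s * (g x' - g x)) * real (Suc n) = (s * real (Suc n)) * (g x' - g x)"
      by (simp only: mult_ac)
    ultimately show ?thesis unfolding s(3) by (simp only: mult_1 s_def)
  qed
  then show ?thesis by (intro LIMSEQ_le_const[OF directional_difference_quotient[OF g]]) auto
qed

text \<open>
  The six partial gradients differ only in the embedding of the argument into the tuple of all
  arguments.
\<close>

definition partial_gradient ::
  "((('n::finite, 'd::finite, 'k::finite) args \<Rightarrow> real) \<Rightarrow> ('n, 'd, 'k) args \<Rightarrow> 'h::euclidean_space)
     \<Rightarrow> ('h \<Rightarrow> ('n, 'd, 'k) args) \<Rightarrow> bool" where
  "partial_gradient D \<iota> \<longleftrightarrow> bounded_linear \<iota> \<and>
     (\<forall>g g' x e. (g has_derivative g') (at x) \<longrightarrow> D g x \<bullet> e = g' (\<iota> e))"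

lemma partial_gradientD:
  "partial_gradient D \<iota> \<Longrightarrow> (g has_derivative g') (at x) \<Longrightarrow> D g x \<bullet> e = g' (\<iota> e)"
  unfolding partial_gradient_def by blast

lemma partial_gradientI:
  assumes "bounded_linear \<iota>"
    and "\<And>g g' y yd z zd v vd e. (g has_derivative g') (at (y, yd, z, zd, v, vd)) \<Longrightarrow>
      D g (y, yd, z, zd, v, vd) \<bullet> e = g' (\<iota> e)"
  shows "partial_gradient D \<iota>"
  using assms unfolding partial_gradient_def split_paired_All by blast

lemma slot_derivatives:
  fixes g :: "('n::finite, 'd::finite, 'k::finite) args \<Rightarrow> 'b::real_normed_vector"
  assumes "(g has_derivative g') (at (y, yd, z, zd, v, vd))"
  shows "((\<lambda>a. g (a, yd, z, zd, v, vd)) has_derivative (\<lambda>e. g' (e, 0, 0, 0, 0, 0))) (at y)"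
    and "((\<lambda>a. g (y, a, z, zd, v, vd)) has_derivative (\<lambda>e. g' (0, e, 0, 0, 0, 0))) (at yd)"
    and "((\<lambda>a. g (y, yd, a, zd, v, vd)) has_derivative (\<lambda>e. g' (0, 0, e, 0, 0, 0))) (at z)"
    and "((\<lambda>a. g (y, yd, z, a, v, vd)) has_derivative (\<lambda>e. g' (0, 0, 0, e, 0, 0))) (at zd)"
    and "((\<lambda>a. g (y, yd, z, zd, a, vd)) has_derivative (\<lambda>e. g' (0, 0, 0, 0, e, 0))) (at v)"
    and "((\<lambda>a. g (y, yd, z, zd, v, a)) has_derivative (\<lambda>e. g' (0, 0, 0, 0, 0, e))) (at vd)"
proof -
  have comp: "((\<lambda>a. g (h a)) has_derivative (\<lambda>e. g' (h' e))) (at a)"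
    if "(h has_derivative h') (at a)" "h a = (y, yd, z, zd, v, vd)" for h h' and a :: "'e::real_normed_vector"
    using has_derivative_compose[OF that(1), of g g'] assms that(2) by simp
  note pairs = has_derivative_Pair has_derivative_ident has_derivative_const
  show "((\<lambda>a. g (a, yd, z, zd, v, vd)) has_derivative (\<lambda>e. g' (e, 0, 0, 0, 0, 0))) (at y)"
    by (rule comp) (intro pairs, rule refl)
  show "((\<lambda>a. g (y, a, z, zd, v, vd)) has_derivative (\<lambda>e. g' (0, e, 0, 0, 0, 0))) (at yd)"
    by (rule comp) (intro pairs, rule refl)
  show "((\<lambda>a. g (y, yd, a, zd, v, vd)) has_derivative (\<lambda>e. g' (0, 0, e, 0, 0, 0))) (at z)"
    by (rule comp) (intro pairs, rule refl)
  show "((\<lambda>a. g (y, yd, z, a, v, vd)) has_derivative (\<lambda>e. g' (0, 0, 0, e, 0, 0))) (at zd)"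
    by (rule comp) (intro pairs, rule refl)
  show "((\<lambda>a. g (y, yd, z, zd, a, vd)) has_derivative (\<lambda>e. g' (0, 0, 0, 0, e, 0))) (at v)"
    by (rule comp) (intro pairs, rule refl)
  show "((\<lambda>a. g (y, yd, z, zd, v, a)) has_derivative (\<lambda>e. g' (0, 0, 0, 0, 0, e))) (at vd)"
    by (rule comp) (intro pairs, rule refl)
qed

lemma partial_gradients:
  "partial_gradient grad_y (\<lambda>e. (e, 0, 0, 0, 0, 0))"
  "partial_gradient grad_yd (\<lambda>e. (0, e, 0, 0, 0, 0))"
  "partial_gradient grad_z (\<lambda>e. (0, 0, e, 0, 0, 0))"
  "partial_gradient grad_zd (\<lambda>e. (0, 0, 0, e, 0, 0))"
  "partial_gradient grad_v (\<lambda>e. (0, 0, 0, 0, e, 0))"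
  "partial_gradient grad_vd (\<lambda>e. (0, 0, 0, 0, 0, e))"
proof -
  note bl = bounded_linear_Pair bounded_linear_ident bounded_linear_zero
  show "partial_gradient grad_y (\<lambda>e. (e, 0, 0, 0, 0, 0))"
    by (rule partial_gradientI) (intro bl, simp only: grad_y.simps, intro grad_inner slot_derivatives(1))
  show "partial_gradient grad_yd (\<lambda>e. (0, e, 0, 0, 0, 0))"
    by (rule partial_gradientI) (intro bl, simp only: grad_yd.simps, intro grad_inner slot_derivatives(2))
  show "partial_gradient grad_z (\<lambda>e. (0, 0, e, 0, 0, 0))"
    by (rule partial_gradientI) (intro bl, simp only: grad_z.simps, intro grad_inner slot_derivatives(3))
  show "partial_gradient grad_zd (\<lambda>e. (0, 0, 0, e, 0, 0))"
    by (rule partial_gradientI) (intro bl, simp only: grad_zd.simps, intro grad_inner slot_derivatives(4))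
  show "partial_gradient grad_v (\<lambda>e. (0, 0, 0, 0, e, 0))"
    by (rule partial_gradientI) (intro bl, simp only: grad_v.simps, intro grad_inner slot_derivatives(5))
  show "partial_gradient grad_vd (\<lambda>e. (0, 0, 0, 0, 0, e))"
    by (rule partial_gradientI) (intro bl, simp only: grad_vd.simps, intro grad_inner slot_derivatives(6))
qed

lemma total_derivative_eq_gradients:
  assumes g: "(g has_derivative g') (at x)"
  shows "g' (a1, a2, a3, a4, a5, a6) = grad_y g x \<bullet> a1 + grad_yd g x \<bullet> a2 + grad_z g x \<bullet> a3
    + grad_zd g x \<bullet> a4 + grad_v g x \<bullet> a5 + grad_vd g x \<bullet> a6"
proof -
  have lin: "linear g'" using has_derivative_linear[OF g] .
  have "(a1, a2, a3, a4, a5, a6) = (a1, 0, 0, 0, 0, 0) + (0, a2, 0, 0, 0, 0) + (0, 0, a3, 0, 0, 0)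
      + (0, 0, 0, a4, 0, 0) + (0, 0, 0, 0, a5, 0) + (0, 0, 0, 0, 0, a6)" by simp
  then have "g' (a1, a2, a3, a4, a5, a6) = g' (a1, 0, 0, 0, 0, 0) + g' (0, a2, 0, 0, 0, 0) + g' (0, 0, a3, 0, 0, 0)
      + g' (0, 0, 0, a4, 0, 0) + g' (0, 0, 0, 0, a5, 0) + g' (0, 0, 0, 0, 0, a6)"
    by (simp only: linear_add[OF lin])
  then show ?thesis by (simp only: partial_gradients[THEN partial_gradientD, OF g])
qed

section \<open>Measurability of superpositions\<close>

text \<open>
  For a simple function in place of \<open>X\<close> the claim is immediate, and continuity allows to pass to the
  limit of simple functions.
\<close>

lemma caratheodory_measurable:
  fixes g :: "'a \<Rightarrow> 'x::{metric_space, second_countable_topology} \<Rightarrow> 'y::{metric_space, second_countable_topology}"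
  assumes g: "\<And>x. (\<lambda>\<omega>. g \<omega> x) \<in> borel_measurable F"
    and cont: "\<And>\<omega>. \<omega> \<in> space F \<Longrightarrow> continuous_on UNIV (g \<omega>)"
    and X: "X \<in> borel_measurable F"
  shows "(\<lambda>\<omega>. g \<omega> (X \<omega>)) \<in> borel_measurable F"
proof -
  obtain S where S: "\<And>i. simple_function F (S i)" "\<And>\<omega>. \<omega> \<in> space F \<Longrightarrow> (\<lambda>i. S i \<omega>) \<longlonglongrightarrow> X \<omega>"
    using borel_measurable_implies_sequence_metric[OF X, of undefined] by metis
  show ?thesis
  proof (rule borel_measurable_LIMSEQ_metric)
    show "(\<lambda>i. g \<omega> (S i \<omega>)) \<longlonglongrightarrow> g \<omega> (X \<omega>)" if "\<omega> \<in> space F" for \<omega>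
      by (rule continuous_on_tendsto_compose[OF cont[OF that] S(2)[OF that]]) auto
    fix i
    have fin: "finite (S i ` space F)" and vim: "\<And>A. S i -` A \<inter> space F \<in> sets F"
      using S(1)[of i] simple_functionD by blast+
    show "(\<lambda>\<omega>. g \<omega> (S i \<omega>)) \<in> borel_measurable F"
    proof (rule measurable_compose_countable'[where I="S i ` space F"])
      show "S i \<in> measurable F (count_space (S i ` space F))"
        using vim by (auto simp: measurable_def)
      show "countable (S i ` space F)" using fin by (rule countable_finite)
    qed (rule g)
  qed
qed

text \<open>
  A gradient is a limit of difference quotients, which are superpositions with \<open>g\<close>.
\<close>

lemma gradient_measurable:
  fixes D :: "(('x::euclidean_space \<Rightarrow> real) \<Rightarrow> 'x \<Rightarrow> 'h::euclidean_space)"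
  assumes D: "\<And>g g' x e. (g has_derivative g') (at x) \<Longrightarrow> D g x \<bullet> e = g' (\<iota> e)"
    and diff: "\<And>q. q \<in> space Q \<Longrightarrow> g q differentiable (at (X q))"
    and meas: "\<And>Y. Y \<in> borel_measurable Q \<Longrightarrow> (\<lambda>q. g q (Y q)) \<in> borel_measurable Q"
    and X: "X \<in> borel_measurable Q"
  shows "(\<lambda>q. D (g q) (X q)) \<in> borel_measurable Q"
proof -
  have "(\<lambda>q. D (g q) (X q) \<bullet> e) \<in> borel_measurable Q" for e
  proof (rule borel_measurable_LIMSEQ_real)
    show "(\<lambda>n. (g q (X q + inverse (real (Suc n)) *\<^sub>R \<iota> e) - g q (X q)) * real (Suc n)) \<longlonglongrightarrow> D (g q) (X q) \<bullet> e"
      if q: "q \<in> space Q" for q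
    proof -
      obtain g' where g': "(g q has_derivative g') (at (X q))" using diff[OF q] by (auto simp: differentiable_def)
      show ?thesis using directional_difference_quotient[OF g', of "\<iota> e"] D[OF g', of e] by simp
    qed
    show "(\<lambda>q. (g q (X q + inverse (real (Suc n)) *\<^sub>R \<iota> e) - g q (X q)) * real (Suc n)) \<in> borel_measurable Q" for n
      by (intro borel_measurable_times borel_measurable_diff meas borel_measurable_add X borel_measurable_const)
  qed
  then show ?thesis by (subst borel_measurable_euclidean_space) blast
qed

section \<open>Coefficients\<close>

locale control_model = delay_model P for P :: "('w, 'n::finite, 'd::finite, 'k::finite) delay_problem" +
  assumes A: "assumption_A P" and B: "assumption_B P"
begin

definition Df :: "real \<Rightarrow> 'w \<Rightarrow> ('n, 'd, 'k) args \<Rightarrow> ('n, 'd, 'k) args \<Rightarrow> real^'n" where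
  "Df t \<omega> x = frechet_derivative (driver P t \<omega>) (at x)"

definition Dl :: "real \<Rightarrow> 'w \<Rightarrow> ('n, 'd, 'k) args \<Rightarrow> ('n, 'd, 'k) args \<Rightarrow> real" where
  "Dl t \<omega> x = frechet_derivative (running P t \<omega>) (at x)"

lemma driver_derivative:
  assumes "t \<in> {0..T}" "\<omega> \<in> space M"
  shows "(driver P t \<omega> has_derivative Df t \<omega> x) (at x)"
proof -
  obtain F where "\<forall>x. (driver P t \<omega> has_derivative blinfun_apply (F x)) (at x)"
    using A assms unfolding assumption_A_def by blast
  then have "driver P t \<omega> differentiable (at x)" unfolding differentiable_def by blast
  then show ?thesis unfolding Df_def by (simp add: frechet_derivative_works[symmetric])
qed

lemma running_derivative:
  assumes "t \<in> {0..T}" "\<omega> \<in> space M"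
  shows "(running P t \<omega> has_derivative Dl t \<omega> x) (at x)"
proof -
  have "running P t \<omega> differentiable (at x)"
    using B assms unfolding assumption_B_def by blast
  then show ?thesis unfolding Dl_def by (simp add: frechet_derivative_works[symmetric])
qed

lemma hamiltonian_derivative:
  assumes "t \<in> {0..T}" "\<omega> \<in> space M"
  shows "(hamiltonian P t \<omega> p has_derivative (\<lambda>e. Dl t \<omega> x e - Df t \<omega> x e \<bullet> p)) (at x)"
  unfolding hamiltonian_def[abs_def]
  by (intro has_derivative_diff running_derivative has_derivative_inner_left driver_derivative assms)

text \<open>
  The two bounds give the corresponding gradient of the Hamiltonian linear growth in \<open>p\<close>.
\<close>

definition bounded_gradient ::
  "((('n, 'd, 'k) args \<Rightarrow> real) \<Rightarrow> ('n, 'd, 'k) args \<Rightarrow> 'h::euclidean_space) \<Rightarrow> ('h \<Rightarrow> ('n, 'd, 'k) args) \<Rightarrow> bool" where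
  "bounded_gradient D \<iota> \<longleftrightarrow> partial_gradient D \<iota> \<and>
     (\<exists>C\<ge>0. \<forall>t\<in>{0..T}. \<forall>\<omega>\<in>space M. \<forall>x. (\<forall>e. norm (Df t \<omega> x (\<iota> e)) \<le> C * norm e) \<and> norm (D (running P t \<omega>) x) \<le> C)"

lemma onorm_bound_max:
  assumes "(f has_derivative f') (at a)" "onorm (frechet_derivative f (at a)) \<le> C"
  shows "norm (f' e) \<le> max 0 C * norm e"
proof -
  have "onorm f' \<le> C" using assms(2) frechet_derivative_at[OF assms(1)] by simp
  then have "norm (f' e) \<le> C * norm e"
    using onorm[OF has_derivative_bounded_linear[OF assms(1)], of e] mult_right_mono[of "onorm f'" C "norm e"]
    by simp
  also have "\<dots> \<le> max 0 C * norm e" by (intro mult_right_mono) auto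
  finally show ?thesis .
qed

lemma driver_slot_bounds:
  "\<exists>C\<ge>0. \<forall>t\<in>{0..T}. \<forall>\<omega>\<in>space M. \<forall>x a b c d e f.
    norm (Df t \<omega> x (a, 0, 0, 0, 0, 0)) \<le> C * norm a \<and> norm (Df t \<omega> x (0, b, 0, 0, 0, 0)) \<le> C * norm b
    \<and> norm (Df t \<omega> x (0, 0, c, 0, 0, 0)) \<le> C * norm c \<and> norm (Df t \<omega> x (0, 0, 0, d, 0, 0)) \<le> C * norm d
    \<and> norm (Df t \<omega> x (0, 0, 0, 0, e, 0)) \<le> C * norm e \<and> norm (Df t \<omega> x (0, 0, 0, 0, 0, f)) \<le> C * norm f"
proof -
  obtain C1 where C1: "\<forall>t\<in>{0..T}. \<forall>\<omega>\<in>space M. \<forall>y yd z zd v vd.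
        onorm (frechet_derivative (\<lambda>a. driver P t \<omega> (a, yd, z, zd, v, vd)) (at y)) \<le> C1 \<and>
        onorm (frechet_derivative (\<lambda>a. driver P t \<omega> (y, a, z, zd, v, vd)) (at yd)) \<le> C1 \<and>
        onorm (frechet_derivative (\<lambda>a. driver P t \<omega> (y, yd, a, zd, v, vd)) (at z)) \<le> C1 \<and>
        onorm (frechet_derivative (\<lambda>a. driver P t \<omega> (y, yd, z, a, v, vd)) (at zd)) \<le> C1 \<and>
        onorm (frechet_derivative (\<lambda>a. driver P t \<omega> (y, yd, z, zd, a, vd)) (at v)) \<le> C1 \<and>
        onorm (frechet_derivative (\<lambda>a. driver P t \<omega> (y, yd, z, zd, v, a)) (at vd)) \<le> C1"
    using A unfolding assumption_A_def by (elim conjE exE) (rule that)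
  have slots: "norm (Df t \<omega> x (a, 0, 0, 0, 0, 0)) \<le> max 0 C1 * norm a \<and> norm (Df t \<omega> x (0, b, 0, 0, 0, 0)) \<le> max 0 C1 * norm b
    \<and> norm (Df t \<omega> x (0, 0, c, 0, 0, 0)) \<le> max 0 C1 * norm c \<and> norm (Df t \<omega> x (0, 0, 0, d, 0, 0)) \<le> max 0 C1 * norm d
    \<and> norm (Df t \<omega> x (0, 0, 0, 0, e, 0)) \<le> max 0 C1 * norm e \<and> norm (Df t \<omega> x (0, 0, 0, 0, 0, f)) \<le> max 0 C1 * norm f"
    if t: "t \<in> {0..T}" "\<omega> \<in> space M" for t \<omega> x a b c d e f
  proof -
    obtain y yd z zd v vd where x: "x = (y, yd, z, zd, v, vd)" by (cases x) auto
    note dv = slot_derivatives[OF driver_derivative[OF t, of "(y, yd, z, zd, v, vd)"]]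
    note q = C1[rule_format, OF t]
    note q1 = q[THEN conjunct1] and q2 = q[THEN conjunct2]
    note q3 = q2[THEN conjunct2] note q4 = q3[THEN conjunct2] note q5 = q4[THEN conjunct2]
    show ?thesis
      unfolding x
      by (intro conjI)
        (rule onorm_bound_max[OF dv(1) q1]
              onorm_bound_max[OF dv(2) q2[THEN conjunct1]]
              onorm_bound_max[OF dv(3) q3[THEN conjunct1]]
              onorm_bound_max[OF dv(4) q4[THEN conjunct1]]
              onorm_bound_max[OF dv(5) q5[THEN conjunct1]]
              onorm_bound_max[OF dv(6) q5[THEN conjunct2]])+
  qed
  show ?thesis by (intro exI[of _ "max 0 C1"] conjI[OF max.cobounded1] ballI allI slots)
qed

lemma bounded_gradientI:
  assumes "partial_gradient D \<iota>" "0 \<le> C"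
    and "\<And>t \<omega> x e. t \<in> {0..T} \<Longrightarrow> \<omega> \<in> space M \<Longrightarrow> norm (Df t \<omega> x (\<iota> e)) \<le> C * norm e"
    and "\<And>t \<omega> x. t \<in> {0..T} \<Longrightarrow> \<omega> \<in> space M \<Longrightarrow> norm (D (running P t \<omega>) x) \<le> C"
  shows "bounded_gradient D \<iota>"
  unfolding bounded_gradient_def
  by (intro conjI assms(1) exI[of _ C] assms(2) ballI allI; (rule assms(3) assms(4); assumption))

lemma bounded_gradients:
  "bounded_gradient grad_y (\<lambda>e. (e, 0, 0, 0, 0, 0))"
  "bounded_gradient grad_yd (\<lambda>e. (0, e, 0, 0, 0, 0))"
  "bounded_gradient grad_z (\<lambda>e. (0, 0, e, 0, 0, 0))"
  "bounded_gradient grad_zd (\<lambda>e. (0, 0, 0, e, 0, 0))"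
  "bounded_gradient grad_v (\<lambda>e. (0, 0, 0, 0, e, 0))"
  "bounded_gradient grad_vd (\<lambda>e. (0, 0, 0, 0, 0, e))"
proof -
  obtain C1 where C1: "0 \<le> C1" and slots: "\<forall>t\<in>{0..T}. \<forall>\<omega>\<in>space M. \<forall>x a b c d e f.
    norm (Df t \<omega> x (a, 0, 0, 0, 0, 0)) \<le> C1 * norm a \<and> norm (Df t \<omega> x (0, b, 0, 0, 0, 0)) \<le> C1 * norm b
    \<and> norm (Df t \<omega> x (0, 0, c, 0, 0, 0)) \<le> C1 * norm c \<and> norm (Df t \<omega> x (0, 0, 0, d, 0, 0)) \<le> C1 * norm d
    \<and> norm (Df t \<omega> x (0, 0, 0, 0, e, 0)) \<le> C1 * norm e \<and> norm (Df t \<omega> x (0, 0, 0, 0, 0, f)) \<le> C1 * norm f"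
    using driver_slot_bounds by blast
  obtain C2 where C2: "\<forall>t\<in>{0..T}. \<forall>\<omega>\<in>space M. \<forall>x.
           norm (grad_y (running P t \<omega>) x) \<le> C2 \<and> norm (grad_yd (running P t \<omega>) x) \<le> C2 \<and>
           norm (grad_z (running P t \<omega>) x) \<le> C2 \<and> norm (grad_zd (running P t \<omega>) x) \<le> C2 \<and>
           norm (grad_v (running P t \<omega>) x) \<le> C2 \<and> norm (grad_vd (running P t \<omega>) x) \<le> C2"
    using B unfolding assumption_B_def by (elim conjE exE) (rule that)
  define C where "C = max C1 C2"
  have C: "0 \<le> C" "C1 \<le> C" "C2 \<le> C" using C1 by (auto simp: C_def)
  have le: "r \<le> C1 * norm a \<Longrightarrow> r \<le> C * norm a" for r and a :: "'h::real_normed_vector"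
    using mult_right_mono[OF C(2) norm_ge_zero[of a]] by linarith
  have C2': "norm (grad_y (running P t \<omega>) x) \<le> C \<and> norm (grad_yd (running P t \<omega>) x) \<le> C \<and>
     norm (grad_z (running P t \<omega>) x) \<le> C \<and> norm (grad_zd (running P t \<omega>) x) \<le> C \<and>
     norm (grad_v (running P t \<omega>) x) \<le> C \<and> norm (grad_vd (running P t \<omega>) x) \<le> C"
    if "t \<in> {0..T}" "\<omega> \<in> space M" for t \<omega> x
    using C2[rule_format, OF that, of x] C(3) by simp
  show "bounded_gradient grad_y (\<lambda>e. (e, 0, 0, 0, 0, 0))"
    by (rule bounded_gradientI[OF partial_gradients(1) C(1)])
       (rule le[OF slots[rule_format, THEN conjunct1]], assumption, assumption, rule C2'[THEN conjunct1], assumption)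
  show "bounded_gradient grad_yd (\<lambda>e. (0, e, 0, 0, 0, 0))"
    by (rule bounded_gradientI[OF partial_gradients(2) C(1)])
       (rule le[OF slots[rule_format, THEN conjunct2, THEN conjunct1]], assumption, assumption, rule C2'[THEN conjunct2, THEN conjunct1], assumption)
  show "bounded_gradient grad_z (\<lambda>e. (0, 0, e, 0, 0, 0))"
    by (rule bounded_gradientI[OF partial_gradients(3) C(1)])
       (rule le[OF slots[rule_format, THEN conjunct2, THEN conjunct2, THEN conjunct1]], assumption, assumption, rule C2'[THEN conjunct2, THEN conjunct2, THEN conjunct1], assumption)
  show "bounded_gradient grad_zd (\<lambda>e. (0, 0, 0, e, 0, 0))"
    by (rule bounded_gradientI[OF partial_gradients(4) C(1)])
       (rule le[OF slots[rule_format, THEN conjunct2, THEN conjunct2, THEN conjunct2, THEN conjunct1]], assumption, assumption, rule C2'[THEN conjunct2, THEN conjunct2, THEN conjunct2, THEN conjunct1], assumption)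
  show "bounded_gradient grad_v (\<lambda>e. (0, 0, 0, 0, e, 0))"
    by (rule bounded_gradientI[OF partial_gradients(5) C(1)])
       (rule le[OF slots[rule_format, THEN conjunct2, THEN conjunct2, THEN conjunct2, THEN conjunct2, THEN conjunct1]], assumption, assumption, rule C2'[THEN conjunct2, THEN conjunct2, THEN conjunct2, THEN conjunct2, THEN conjunct1], assumption)
  show "bounded_gradient grad_vd (\<lambda>e. (0, 0, 0, 0, 0, e))"
    by (rule bounded_gradientI[OF partial_gradients(6) C(1)])
       (rule le[OF slots[rule_format, THEN conjunct2, THEN conjunct2, THEN conjunct2, THEN conjunct2, THEN conjunct2]], assumption, assumption, rule C2'[THEN conjunct2, THEN conjunct2, THEN conjunct2, THEN conjunct2, THEN conjunct2], assumption)
qed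

text \<open>
  The six partial derivatives bound the total derivative, and the mean value theorem applies.
\<close>

lemma driver_lipschitz:
  "\<exists>L\<ge>0. \<forall>t\<in>{0..T}. \<forall>\<omega>\<in>space M. \<forall>x x'. norm (driver P t \<omega> x' - driver P t \<omega> x) \<le> L * norm (x' - x)"
proof -
  obtain C where C: "0 \<le> C" and le_all: "\<forall>t\<in>{0..T}. \<forall>\<omega>\<in>space M. \<forall>x a b c d e f.
    norm (Df t \<omega> x (a, 0, 0, 0, 0, 0)) \<le> C * norm a \<and> norm (Df t \<omega> x (0, b, 0, 0, 0, 0)) \<le> C * norm b
    \<and> norm (Df t \<omega> x (0, 0, c, 0, 0, 0)) \<le> C * norm c \<and> norm (Df t \<omega> x (0, 0, 0, d, 0, 0)) \<le> C * norm d
    \<and> norm (Df t \<omega> x (0, 0, 0, 0, e, 0)) \<le> C * norm e \<and> norm (Df t \<omega> x (0, 0, 0, 0, 0, f)) \<le> C * norm f"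
    using driver_slot_bounds by blast
  note le = le_all[rule_format]
  define L where "L = 6 * C"
  have Df: "norm (Df t \<omega> x h) \<le> L * norm h" if t: "t \<in> {0..T}" "\<omega> \<in> space M" for t \<omega> x h
  proof -
    obtain a b c d e f where h: "h = (a, b, c, d, e, f)" by (cases h) auto
    have n: "norm a \<le> norm h" "norm b \<le> norm h" "norm c \<le> norm h" "norm d \<le> norm h" "norm e \<le> norm h" "norm f \<le> norm h"
    proof -
      have "norm (b, c, d, e, f) \<le> norm h" unfolding h by (rule norm_snd_le)
      moreover have "norm (c, d, e, f) \<le> norm (b, c, d, e, f)" by (rule norm_snd_le)
      moreover have "norm (d, e, f) \<le> norm (c, d, e, f)" by (rule norm_snd_le)
      moreover have "norm (e, f) \<le> norm (d, e, f)" by (rule norm_snd_le)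
      moreover have "norm f \<le> norm (e, f)" by (rule norm_snd_le)
      moreover have "norm e \<le> norm (e, f)" by (rule norm_fst_le)
      moreover have "norm d \<le> norm (d, e, f)" by (rule norm_fst_le)
      moreover have "norm c \<le> norm (c, d, e, f)" by (rule norm_fst_le)
      moreover have "norm b \<le> norm (b, c, d, e, f)" by (rule norm_fst_le)
      moreover have "norm a \<le> norm h" unfolding h by (rule norm_fst_le)
      ultimately show "norm a \<le> norm h" "norm b \<le> norm h" "norm c \<le> norm h" "norm d \<le> norm h"
        "norm e \<le> norm h" "norm f \<le> norm h" by linarith+
    qed
    have lin: "linear (Df t \<omega> x)" using has_derivative_linear[OF driver_derivative[OF t]] .
    have eq: "Df t \<omega> x h = Df t \<omega> x ((a, 0, 0, 0, 0, 0) + (0, b, 0, 0, 0, 0) + (0, 0, c, 0, 0, 0)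
      + (0, 0, 0, d, 0, 0) + (0, 0, 0, 0, e, 0) + (0, 0, 0, 0, 0, f))" by (simp add: h)
    have "norm (Df t \<omega> x h) \<le> norm (Df t \<omega> x (a, 0, 0, 0, 0, 0)) + norm (Df t \<omega> x (0, b, 0, 0, 0, 0))
      + norm (Df t \<omega> x (0, 0, c, 0, 0, 0)) + norm (Df t \<omega> x (0, 0, 0, d, 0, 0))
      + norm (Df t \<omega> x (0, 0, 0, 0, e, 0)) + norm (Df t \<omega> x (0, 0, 0, 0, 0, f))"
      unfolding eq linear_add[OF lin] by (intro norm_triangle_mono order_refl)
    also have "\<dots> \<le> C * norm a + C * norm b + C * norm c + C * norm d + C * norm e + C * norm f"
      by (intro add_mono
        le[OF t, THEN conjunct1]
        le[OF t, THEN conjunct2, THEN conjunct1]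
        le[OF t, THEN conjunct2, THEN conjunct2, THEN conjunct1]
        le[OF t, THEN conjunct2, THEN conjunct2, THEN conjunct2, THEN conjunct1]
        le[OF t, THEN conjunct2, THEN conjunct2, THEN conjunct2, THEN conjunct2, THEN conjunct1]
        le[OF t, THEN conjunct2, THEN conjunct2, THEN conjunct2, THEN conjunct2, THEN conjunct2])
    also have "\<dots> \<le> C * norm h + C * norm h + C * norm h + C * norm h + C * norm h + C * norm h"
      by (intro add_mono mult_left_mono n C)
    finally show ?thesis by (simp add: L_def algebra_simps)
  qed
  have "norm (driver P t \<omega> x' - driver P t \<omega> x) \<le> L * norm (x' - x)" if t: "t \<in> {0..T}" "\<omega> \<in> space M" for t \<omega> x x'
  proof (rule differentiable_bound[of UNIV])
    show "(driver P t \<omega> has_derivative Df t \<omega> x) (at x within UNIV)" for x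
      using driver_derivative[OF t] by simp
    show "onorm (Df t \<omega> x) \<le> L" for x by (rule onorm_le[OF Df[OF t]])
  qed auto
  moreover have "0 \<le> L" using C by (simp add: L_def)
  ultimately show ?thesis by blast
qed

lemma hamiltonian_gradient_bound:
  assumes D: "bounded_gradient D \<iota>"
  shows "\<exists>C\<ge>0. \<forall>t\<in>{0..T}. \<forall>\<omega>\<in>space M. \<forall>p x. norm (D (hamiltonian P t \<omega> p) x) \<le> C * (1 + norm p)"
proof -
  have pg: "partial_gradient D \<iota>" using D by (simp add: bounded_gradient_def)
  obtain C where C: "0 \<le> C" and b: "\<forall>t\<in>{0..T}. \<forall>\<omega>\<in>space M. \<forall>x.
      (\<forall>e. norm (Df t \<omega> x (\<iota> e)) \<le> C * norm e) \<and> norm (D (running P t \<omega>) x) \<le> C"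
    using D unfolding bounded_gradient_def by (elim conjE exE) (rule that)
  have "norm (D (hamiltonian P t \<omega> p) x) \<le> C * (1 + norm p)" if t: "t \<in> {0..T}" "\<omega> \<in> space M" for t \<omega> p x
  proof -
    have f: "norm (Df t \<omega> x (\<iota> e)) \<le> C * norm e" for e using b t by blast
    have l: "norm (D (running P t \<omega>) x) \<le> C" using b t by blast
    define d where "d = D (hamiltonian P t \<omega> p) x"
    have "norm d * norm d = D (hamiltonian P t \<omega> p) x \<bullet> d" by (simp add: d_def power2_norm_eq_inner[symmetric] power2_eq_square)
    also have "\<dots> = Dl t \<omega> x (\<iota> d) - Df t \<omega> x (\<iota> d) \<bullet> p"
      by (rule partial_gradientD[OF pg hamiltonian_derivative[OF t]])
    also have "Dl t \<omega> x (\<iota> d) = D (running P t \<omega>) x \<bullet> d"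
      by (rule partial_gradientD[OF pg running_derivative[OF t], symmetric])
    also have "D (running P t \<omega>) x \<bullet> d - Df t \<omega> x (\<iota> d) \<bullet> p \<le> norm (D (running P t \<omega>) x) * norm d + norm (Df t \<omega> x (\<iota> d)) * norm p"
      using Cauchy_Schwarz_ineq2[of "D (running P t \<omega>) x" d] Cauchy_Schwarz_ineq2[of "Df t \<omega> x (\<iota> d)" p] by linarith
    also have "\<dots> \<le> C * norm d + (C * norm d) * norm p"
      by (intro add_mono mult_right_mono f l) auto
    finally have "norm d * norm d \<le> (C * (1 + norm p)) * norm d" by (simp add: algebra_simps)
    moreover have "0 \<le> C * (1 + norm p)" using C by simp
    ultimately show ?thesis unfolding d_def[symmetric] by (cases "norm d = 0") (auto simp: mult_le_cancel_right)
  qed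
  with C show ?thesis by blast
qed

lemma coefficient_measurable:
  fixes g :: "real \<Rightarrow> 'w \<Rightarrow> ('n, 'd, 'k) args \<Rightarrow> 'h::euclidean_space"
  assumes g: "measurable_coefficient P g"
    and f: "f \<in> measurable Q (time_measure 0 T)" and h: "h \<in> measurable Q M" and X: "X \<in> borel_measurable Q"
  shows "(\<lambda>q. g (f q) (h q) (X q)) \<in> borel_measurable Q"
proof -
  have m: "(\<lambda>(t, \<omega>, x). g t \<omega> x) \<in> borel_measurable (restrict_space borel {0..T} \<Otimes>\<^sub>M (M \<Otimes>\<^sub>M borel))"
    using g by (simp add: measurable_coefficient_def)
  have "(\<lambda>q. (f q, h q, X q)) \<in> measurable Q (restrict_space borel {0..T} \<Otimes>\<^sub>M (M \<Otimes>\<^sub>M borel))"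
    using f h X by (intro measurable_Pair) (simp_all add: measurable_cong_sets[OF refl sets_time_measure])
  from measurable_compose[OF this m] show ?thesis by simp
qed

lemma measurable_driver: "measurable_coefficient P (driver P)" and measurable_running: "measurable_coefficient P (running P)"
  using setting unfolding delay_setting_def by blast+

lemma hamiltonian_measurable:
  assumes "f \<in> measurable Q (time_measure 0 T)" "h \<in> measurable Q M" "X \<in> borel_measurable Q" "p \<in> borel_measurable Q"
  shows "(\<lambda>q. hamiltonian P (f q) (h q) (p q) (X q)) \<in> borel_measurable Q"
  unfolding hamiltonian_def
  by (rule borel_measurable_diff[OF coefficient_measurable[OF measurable_running assms(1-3)]
      borel_measurable_inner[OF coefficient_measurable[OF measurable_driver assms(1-3)] assms(4)]])

lemma hamiltonian_gradient_measurable: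
  assumes D: "bounded_gradient D \<iota>"
    and "f \<in> measurable Q (time_measure 0 T)" "h \<in> measurable Q M" "X \<in> borel_measurable Q" "p \<in> borel_measurable Q"
  shows "(\<lambda>q. D (hamiltonian P (f q) (h q) (p q)) (X q)) \<in> borel_measurable Q"
proof (rule gradient_measurable[of D \<iota>])
  show "D g x \<bullet> e = g' (\<iota> e)" if "(g has_derivative g') (at x)" for g g' x e
    using D that by (auto simp: bounded_gradient_def dest: partial_gradientD)
  fix q assume "q \<in> space Q"
  then have "f q \<in> {0..T}" "h q \<in> space M"
    using measurable_space[OF assms(2)] measurable_space[OF assms(3)] by auto
  from hamiltonian_derivative[OF this]
  show "hamiltonian P (f q) (h q) (p q) differentiable (at (X q))" unfolding differentiable_def by blast
next
  show "(\<lambda>q. hamiltonian P (f q) (h q) (p q) (Y q)) \<in> borel_measurable Q" if "Y \<in> borel_measurable Q" for Y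
    by (rule hamiltonian_measurable[OF assms(2,3) that assms(5)])
qed (rule assms(4))

lemma driver_adapted:
  assumes t: "t \<in> {0..T}" and X: "X \<in> borel_measurable (filt P t)"
  shows "(\<lambda>\<omega>. driver P t \<omega> (X \<omega>)) \<in> borel_measurable (filt P t)"
proof (rule caratheodory_measurable[OF _ _ X])
  show "(\<lambda>\<omega>. driver P t \<omega> x) \<in> borel_measurable (filt P t)" for x
    using measurable_driver t unfolding measurable_coefficient_def by blast
  show "continuous_on UNIV (driver P t \<omega>)" if "\<omega> \<in> space (filt P t)" for \<omega>
    by (rule has_derivative_continuous_on[of UNIV _ "Df t \<omega>"])
      (use driver_derivative[OF t, of \<omega>] that in simp)
qed

lemma running_adapted:
  assumes t: "t \<in> {0..T}" and X: "X \<in> borel_measurable (filt P t)"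
  shows "(\<lambda>\<omega>. running P t \<omega> (X \<omega>)) \<in> borel_measurable (filt P t)"
proof (rule caratheodory_measurable[OF _ _ X])
  show "(\<lambda>\<omega>. running P t \<omega> x) \<in> borel_measurable (filt P t)" for x
    using measurable_running t unfolding measurable_coefficient_def by blast
  show "continuous_on UNIV (running P t \<omega>)" if "\<omega> \<in> space (filt P t)" for \<omega>
    by (rule has_derivative_continuous_on[of UNIV _ "Dl t \<omega>"])
      (use running_derivative[OF t, of \<omega>] that in simp)
qed

lemma hamiltonian_gradient_adapted:
  assumes D: "bounded_gradient D \<iota>" and t: "t \<in> {0..T}"
    and X: "X \<in> borel_measurable (filt P t)" and p: "p \<in> borel_measurable (filt P t)"
  shows "(\<lambda>\<omega>. D (hamiltonian P t \<omega> (p \<omega>)) (X \<omega>)) \<in> borel_measurable (filt P t)"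
proof (rule gradient_measurable[of D \<iota>])
  show "D g x \<bullet> e = g' (\<iota> e)" if "(g has_derivative g') (at x)" for g g' x e
    using D that by (auto simp: bounded_gradient_def dest: partial_gradientD)
  show "hamiltonian P t \<omega> (p \<omega>) differentiable (at (X \<omega>))" if "\<omega> \<in> space (filt P t)" for \<omega>
    using hamiltonian_derivative[OF t, of \<omega> "p \<omega>" "X \<omega>"] that unfolding differentiable_def by auto
  show "(\<lambda>\<omega>. hamiltonian P t \<omega> (p \<omega>) (Y \<omega>)) \<in> borel_measurable (filt P t)" if Y: "Y \<in> borel_measurable (filt P t)" for Y
    unfolding hamiltonian_def
    by (rule borel_measurable_diff[OF running_adapted[OF t Y]
        borel_measurable_inner[OF driver_adapted[OF t Y] p]])
qed (rule X)

end

section \<open>Square integrability by duality\<close>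

text \<open>
  Jensen's inequality for the weights \<open>2\<^sup>-\<^sup>k\<close>, whose sum is 2.
\<close>

lemma half_series_square:
  fixes w :: "nat \<Rightarrow> real"
  assumes s1: "summable (\<lambda>k. (1/2)^k * w k)" and s2: "summable (\<lambda>k. (1/2)^k * (w k)\<^sup>2)"
  shows "(\<Sum>k. (1/2)^k * w k)\<^sup>2 \<le> 2 * (\<Sum>k. (1/2)^k * (w k)\<^sup>2)"
proof -
  define S where "S = (\<Sum>k. (1/2)^k * w k)"
  have g: "summable (\<lambda>k. (1/2::real)^k)" "(\<Sum>k. (1/2::real)^k) = 2"
    by (simp_all add: summable_geometric suminf_geometric)
  have sm: "summable (\<lambda>k. (1/2)^k * (w k)\<^sup>2 - S * ((1/2)^k * w k) + (S/2)\<^sup>2 * (1/2)^k)"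
    by (intro summable_add summable_diff summable_mult s1 s2 g)
  have "0 \<le> (\<Sum>k. (1/2)^k * (w k - S/2)\<^sup>2)"
  proof (rule suminf_nonneg)
    have "(\<lambda>k. (1/2)^k * (w k - S/2)\<^sup>2) = (\<lambda>k. (1/2)^k * (w k)\<^sup>2 - S * ((1/2)^k * w k) + (S/2)\<^sup>2 * (1/2)^k)"
      by (auto simp: fun_eq_iff power2_diff algebra_simps)
    then show "summable (\<lambda>k. (1/2)^k * (w k - S/2)\<^sup>2)" using sm by simp
  qed simp
  also have "(\<Sum>k. (1/2)^k * (w k - S/2)\<^sup>2) = (\<Sum>k. (1/2)^k * (w k)\<^sup>2 - S * ((1/2)^k * w k) + (S/2)\<^sup>2 * (1/2)^k)"
    by (intro suminf_cong) (auto simp: power2_diff algebra_simps)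
  also have "\<dots> = (\<Sum>k. (1/2)^k * (w k)\<^sup>2) - S * S + (S/2)\<^sup>2 * 2"
    using s1 s2 g by (simp add: suminf_add[symmetric] suminf_diff[symmetric] suminf_mult summable_mult summable_diff S_def)
  finally show ?thesis unfolding S_def[symmetric] by (simp add: power2_eq_square field_simps)
qed

text \<open>
  Suppose that \<open>a\<close> is not square integrable. Then the norms of the truncations \<open>min a n\<close> are unbounded, and
  one can select truncations with \<open>L\<^sup>2\<close>-norms \<open>s\<^sub>k \<ge> 4\<^sup>k\<close>. Let \<open>w\<^sub>k\<close> be such a truncation divided by its
  norm. The function \<open>\<Sum>\<^sub>k 2\<^sup>-\<^sup>k w\<^sub>k\<close> of \<open>a\<close> is square integrable, but its integral against \<open>a\<close> is at least
  \<open>2\<^sup>-\<^sup>k s\<^sub>k \<ge> 2\<^sup>k\<close> for every \<open>k\<close>.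
\<close>

lemma square_integrable_by_duality:
  fixes a :: "'a \<Rightarrow> real"
  assumes fin: "finite_measure N" and a[measurable]: "a \<in> borel_measurable N" and a0: "\<And>x. 0 \<le> a x"
    and dual: "\<And>\<Psi>. \<Psi> \<in> borel_measurable borel \<Longrightarrow> (\<And>r. 0 \<le> \<Psi> r) \<Longrightarrow>
      (\<integral>\<^sup>+x. ennreal ((\<Psi> (a x))\<^sup>2) \<partial>N) < \<infinity> \<Longrightarrow> (\<integral>\<^sup>+x. ennreal (a x * \<Psi> (a x)) \<partial>N) < \<infinity>"
  shows "(\<integral>\<^sup>+x. ennreal ((a x)\<^sup>2) \<partial>N) < \<infinity>"
proof (rule ccontr)
  interpret finite_measure N by fact
  assume "\<not> ?thesis"
  then have inf: "(\<integral>\<^sup>+x. ennreal ((a x)\<^sup>2) \<partial>N) = \<infinity>" by (simp add: less_top[symmetric])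
  define c where "c n = (\<integral>\<^sup>+x. ennreal ((min (a x) (real n))\<^sup>2) \<partial>N)" for n :: nat
  have c_fin: "c n < \<infinity>" for n
  proof -
    have "c n \<le> (\<integral>\<^sup>+x. ennreal ((real n)\<^sup>2) \<partial>N)"
      unfolding c_def using a0 by (intro nn_integral_mono ennreal_leI power_mono) auto
    also have "\<dots> < \<infinity>"
      using emeasure_finite[of "space N", unfolded less_top] by (simp add: ennreal_mult_less_top)
    finally show ?thesis .
  qed
  have sup: "(SUP n. c n) = \<infinity>"
  proof -
    have "(\<integral>\<^sup>+x. ennreal ((a x)\<^sup>2) \<partial>N) = (\<integral>\<^sup>+x. (SUP n. ennreal ((min (a x) (real n))\<^sup>2)) \<partial>N)"
    proof (intro nn_integral_cong)
      fix x
      obtain n where n: "a x \<le> real n" using real_arch_simple by blast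
      show "ennreal ((a x)\<^sup>2) = (SUP n. ennreal ((min (a x) (real n))\<^sup>2))"
      proof (rule antisym)
        have "ennreal ((a x)\<^sup>2) = ennreal ((min (a x) (real n))\<^sup>2)" using n by (simp add: min_absorb1)
        then show "ennreal ((a x)\<^sup>2) \<le> (SUP n. ennreal ((min (a x) (real n))\<^sup>2))"
          by (metis SUP_upper UNIV_I)
        show "(SUP n. ennreal ((min (a x) (real n))\<^sup>2)) \<le> ennreal ((a x)\<^sup>2)"
          using a0 by (intro SUP_least ennreal_leI power_mono) auto
      qed
    qed
    also have "\<dots> = (SUP n. c n)"
      unfolding c_def
    proof (rule nn_integral_monotone_convergence_SUP)
      show "incseq (\<lambda>n x. ennreal ((min (a x) (real n))\<^sup>2))"
        using a0 by (auto simp: incseq_def le_fun_def intro!: ennreal_leI power_mono)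
    qed measurable
    finally show ?thesis using inf by simp
  qed
  have "\<exists>n. ennreal (16 ^ k) \<le> c n" for k
  proof -
    have "ennreal (16 ^ k) < (SUP n. c n)" unfolding sup by simp
    then show ?thesis by (auto simp: less_SUP_iff intro: less_imp_le)
  qed
  then obtain n where n: "\<And>k. ennreal (16 ^ k) \<le> c (n k)" by metis
  define s where "s k = sqrt (enn2real (c (n k)))" for k
  have c_s: "c (n k) = ennreal ((s k)\<^sup>2)" for k using c_fin[of "n k"] by (simp add: s_def)
  have s_ge: "4 ^ k \<le> s k" for k
  proof -
    have "ennreal (16 ^ k) \<le> ennreal ((s k)\<^sup>2)" using n[of k] c_s by simp
    then have "(4 ^ k)\<^sup>2 \<le> (s k)\<^sup>2" by (simp add: power_mult[symmetric] mult.commute[of k] power_mult power2_eq_square[of 4])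
    then show ?thesis by (rule power2_le_imp_le) (simp add: s_def)
  qed
  have s_pos: "1 \<le> s k" "0 < s k" for k
    using s_ge[of k] one_le_power[of "4::real" k] by linarith+
  define w where "w k r = min (max r 0) (real (n k)) / s k" for k and r :: real
  have w0: "0 \<le> w k r" for k r using s_pos[of k] by (simp add: w_def)
  have w_le: "w k r \<le> max r 0" for k r
  proof -
    have "w k r \<le> max r 0 / s k" unfolding w_def using s_pos[of k] by (intro divide_right_mono) auto
    also have "\<dots> \<le> max r 0 / 1" using s_pos[of k] by (intro divide_left_mono) auto
    finally show ?thesis by simp
  qed
  have g: "summable (\<lambda>k. (1/2::real)^k)" by (simp add: summable_geometric)
  have sm1: "summable (\<lambda>k. (1/2)^k * w k r)" for r
    by (rule summable_comparison_test'[OF summable_mult2[OF g, of "max r 0"], of 0])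
       (use w0 w_le in \<open>auto intro!: mult_left_mono\<close>)
  have sm2: "summable (\<lambda>k. (1/2)^k * (w k r)\<^sup>2)" for r
    by (rule summable_comparison_test'[OF summable_mult2[OF g, of "(max r 0)\<^sup>2"], of 0])
       (use w0 w_le in \<open>auto intro!: mult_left_mono power_mono\<close>)
  define \<Psi> where "\<Psi> r = (\<Sum>k. (1/2)^k * w k r)" for r
  have w_meas[measurable]: "w k \<in> borel_measurable borel" for k unfolding w_def[abs_def] by measurable
  have \<Psi>_meas: "\<Psi> \<in> borel_measurable borel" unfolding \<Psi>_def[abs_def] by measurable
  have \<Psi>0: "0 \<le> \<Psi> r" for r unfolding \<Psi>_def using w0 sm1 by (intro suminf_nonneg) auto
  have wk: "(\<integral>\<^sup>+x. ennreal ((w k (a x))\<^sup>2) \<partial>N) = 1" for k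
  proof -
    have "(\<integral>\<^sup>+x. ennreal ((w k (a x))\<^sup>2) \<partial>N) = (\<integral>\<^sup>+x. ennreal (1 / (s k)\<^sup>2) * ennreal ((min (a x) (real (n k)))\<^sup>2) \<partial>N)"
      using a0 by (intro nn_integral_cong) (auto simp: w_def max_absorb1 power_divide ennreal_mult[symmetric])
    also have "\<dots> = ennreal (1 / (s k)\<^sup>2) * c (n k)" unfolding c_def by (rule nn_integral_cmult) measurable
    also have "\<dots> = 1" using s_pos[of k] by (simp add: c_s ennreal_mult[symmetric])
    finally show ?thesis .
  qed
  have "(\<integral>\<^sup>+x. ennreal ((\<Psi> (a x))\<^sup>2) \<partial>N) \<le> (\<integral>\<^sup>+x. ennreal 2 * (\<Sum>k. ennreal ((1/2)^k * (w k (a x))\<^sup>2)) \<partial>N)"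
  proof (intro nn_integral_mono)
    fix x
    have "ennreal ((\<Psi> (a x))\<^sup>2) \<le> ennreal (2 * (\<Sum>k. (1/2)^k * (w k (a x))\<^sup>2))"
      unfolding \<Psi>_def by (intro ennreal_leI half_series_square sm1 sm2)
    also have "\<dots> = ennreal 2 * (\<Sum>k. ennreal ((1/2)^k * (w k (a x))\<^sup>2))"
    proof -
      have "(\<Sum>k. ennreal ((1/2)^k * (w k (a x))\<^sup>2)) = ennreal (\<Sum>k. (1/2)^k * (w k (a x))\<^sup>2)"
        by (rule suminf_ennreal2[OF _ sm2]) simp
      moreover have "ennreal (2 * (\<Sum>k. (1/2)^k * (w k (a x))\<^sup>2)) = ennreal 2 * ennreal (\<Sum>k. (1/2)^k * (w k (a x))\<^sup>2)"
        by (rule ennreal_mult) (auto intro!: suminf_nonneg sm2)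
      ultimately show ?thesis by (simp only:)
    qed
    finally show "ennreal ((\<Psi> (a x))\<^sup>2) \<le> ennreal 2 * (\<Sum>k. ennreal ((1/2)^k * (w k (a x))\<^sup>2))" .
  qed
  also have "\<dots> = ennreal 2 * (\<Sum>k. \<integral>\<^sup>+x. ennreal ((1/2)^k * (w k (a x))\<^sup>2) \<partial>N)"
    by (simp add: nn_integral_cmult nn_integral_suminf)
  also have "\<dots> = ennreal 2 * (\<Sum>k. ennreal ((1/2)^k))"
    using wk by (simp add: ennreal_mult nn_integral_cmult)
  also have "\<dots> < \<infinity>"
    using g by (subst suminf_ennreal2) (auto simp: ennreal_mult_less_top)
  finally have "(\<integral>\<^sup>+x. ennreal (a x * \<Psi> (a x)) \<partial>N) < \<infinity>" by (rule dual[OF \<Psi>_meas \<Psi>0])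
  then have r: "(\<integral>\<^sup>+x. ennreal (a x * \<Psi> (a x)) \<partial>N) = ennreal (enn2real (\<integral>\<^sup>+x. ennreal (a x * \<Psi> (a x)) \<partial>N))"
    by simp
  have le: "ennreal (2 ^ k) \<le> (\<integral>\<^sup>+x. ennreal (a x * \<Psi> (a x)) \<partial>N)" for k
  proof -
    have p: "0 \<le> (1/2) ^ k / s k" using s_pos[of k] by simp
    have "(2::real) ^ k * 2 ^ k = 4 ^ k" by (simp add: power_mult_distrib[symmetric])
    then have "2 ^ k = (1/2) ^ k * (4::real) ^ k" by (simp add: field_simps)
    also have "\<dots> \<le> (1/2) ^ k * s k" using s_ge by (intro mult_left_mono) auto
    also have "\<dots> = ((1/2) ^ k / s k) * (s k)\<^sup>2" using s_pos[of k] by (simp add: power2_eq_square)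
    finally have "ennreal (2 ^ k) \<le> ennreal (((1/2) ^ k / s k) * (s k)\<^sup>2)" by (rule ennreal_leI)
    also have "\<dots> = ennreal ((1/2) ^ k / s k) * c (n k)" unfolding c_s using p by (rule ennreal_mult) simp
    also have "\<dots> = (\<integral>\<^sup>+x. ennreal ((1/2) ^ k / s k) * ennreal ((min (a x) (real (n k)))\<^sup>2) \<partial>N)"
      unfolding c_def by (rule nn_integral_cmult[symmetric]) measurable
    also have "\<dots> \<le> (\<integral>\<^sup>+x. ennreal (a x * \<Psi> (a x)) \<partial>N)"
    proof (intro nn_integral_mono)
      fix x
      have "(1/2)^k * w k (a x) \<le> \<Psi> (a x)"
        unfolding \<Psi>_def using sum_le_suminf[OF sm1[of "a x"], of "{k}"] w0 by auto
      then have 1: "a x * ((1/2)^k * w k (a x)) \<le> a x * \<Psi> (a x)" using a0 by (intro mult_left_mono)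
      have "(min (a x) (real (n k)))\<^sup>2 \<le> a x * min (a x) (real (n k))"
        unfolding power2_eq_square using a0[of x] by (intro mult_right_mono) auto
      then have "((1/2) ^ k / s k) * (min (a x) (real (n k)))\<^sup>2 \<le> ((1/2) ^ k / s k) * (a x * min (a x) (real (n k)))"
        using s_pos[of k] by (intro mult_left_mono) auto
      also have "\<dots> = a x * ((1/2)^k * w k (a x))" using a0[of x] by (simp add: w_def max_absorb1)
      also note 1
      finally have "ennreal (((1/2) ^ k / s k) * (min (a x) (real (n k)))\<^sup>2) \<le> ennreal (a x * \<Psi> (a x))"
        by (rule ennreal_leI)
      then show "ennreal ((1/2) ^ k / s k) * ennreal ((min (a x) (real (n k)))\<^sup>2) \<le> ennreal (a x * \<Psi> (a x))"
        using ennreal_mult[OF p zero_le_power2] by (simp only:)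
    qed
    finally show ?thesis .
  qed
  define r where "r = enn2real (\<integral>\<^sup>+x. ennreal (a x * \<Psi> (a x)) \<partial>N)"
  obtain k where "r < 2 ^ k" using real_arch_pow[of 2 r] by auto
  moreover have "2 ^ k \<le> r"
  proof -
    have "(\<integral>\<^sup>+x. ennreal (a x * \<Psi> (a x)) \<partial>N) = ennreal r" unfolding r_def by (rule r)
    with le[of k] have "ennreal (2 ^ k) \<le> ennreal r" by (simp only:)
    moreover have "0 \<le> r" by (simp add: r_def)
    ultimately show ?thesis by (simp only: ennreal_le_iff)
  qed
  ultimately show False by simp
qed

section \<open>Fubini for two time variables\<close>

context brownian_problem begin

lemma sigma_finite_PM: "sigma_finite_measure (PM a b)"
  by (rule finite_measure.axioms(1)[OF finite_PM])

text \<open>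
  The variables are two times and the scenario. One of the times stays grouped with the scenario,
  because the inner integrals are again processes.
\<close>

lemma fubini_two_times:
  fixes \<Phi> :: "real \<Rightarrow> real \<Rightarrow> 'w \<Rightarrow> real"
  assumes meas: "(\<lambda>((t, \<omega>), s). \<Phi> t s \<omega>) \<in> borel_measurable (PM a b \<Otimes>\<^sub>M time_measure a b)"
    and fin: "(\<integral>\<^sup>+p. (\<integral>\<^sup>+s. ennreal \<bar>\<Phi> (fst p) s (snd p)\<bar> \<partial>time_measure a b) \<partial>PM a b) < \<infinity>"
  shows "(\<integral>\<^sup>+p. (\<integral>\<^sup>+t. ennreal \<bar>\<Phi> t (fst p) (snd p)\<bar> \<partial>time_measure a b) \<partial>PM a b) < \<infinity>"
    and "integrable (PM a b) (\<lambda>(t, \<omega>). \<integral>s. \<Phi> t s \<omega> \<partial>time_measure a b)"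
    and "integrable (PM a b) (\<lambda>(s, \<omega>). \<integral>t. \<Phi> t s \<omega> \<partial>time_measure a b)"
    and "(\<integral>p. (\<integral>s. \<Phi> (fst p) s (snd p) \<partial>time_measure a b) \<partial>PM a b)
       = (\<integral>p. (\<integral>t. \<Phi> t (fst p) (snd p) \<partial>time_measure a b) \<partial>PM a b)"
proof -
  interpret PM: pair_sigma_finite "time_measure a b" M by (rule pair_time)
  interpret R: pair_sigma_finite "PM a b" "time_measure a b"
    using sigma_finite_PM sigma_finite_time_measure by (simp add: pair_sigma_finite_def)
  let ?F = "\<lambda>((t, \<omega>), s). \<Phi> t s \<omega>" and ?G = "\<lambda>((s, \<omega>), t). \<Phi> t s \<omega>"
  have "(\<lambda>q. ((snd q, snd (fst q)), fst (fst q))) \<in> measurable (PM a b \<Otimes>\<^sub>M time_measure a b) (PM a b \<Otimes>\<^sub>M time_measure a b)"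
    by measurable
  from measurable_compose[OF this meas] have measG: "?G \<in> borel_measurable (PM a b \<Otimes>\<^sub>M time_measure a b)"
    by (simp add: split_def)
  have mF: "(\<lambda>q. ennreal \<bar>?F q\<bar>) \<in> borel_measurable (PM a b \<Otimes>\<^sub>M time_measure a b)"
    and mG: "(\<lambda>q. ennreal \<bar>?G q\<bar>) \<in> borel_measurable (PM a b \<Otimes>\<^sub>M time_measure a b)"
    using meas measG by auto
  have inner1: "(\<lambda>p. \<integral>\<^sup>+s. ennreal \<bar>?F (p, s)\<bar> \<partial>time_measure a b) \<in> borel_measurable (PM a b)"
    using sigma_finite_measure.borel_measurable_nn_integral_fst[OF sigma_finite_time_measure mF] .
  have eqF: "(\<integral>\<^sup>+p. (\<integral>\<^sup>+s. ennreal \<bar>\<Phi> (fst p) s (snd p)\<bar> \<partial>time_measure a b) \<partial>PM a b) = (\<integral>\<^sup>+q. ennreal \<bar>?F q\<bar> \<partial>(PM a b \<Otimes>\<^sub>M time_measure a b))"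
    using sigma_finite_measure.nn_integral_fst[OF sigma_finite_time_measure mF] by (simp add: split_def)
  have "(\<integral>\<^sup>+q. ennreal \<bar>?G q\<bar> \<partial>(PM a b \<Otimes>\<^sub>M time_measure a b)) = (\<integral>\<^sup>+t. (\<integral>\<^sup>+p. ennreal \<bar>\<Phi> t (fst p) (snd p)\<bar> \<partial>PM a b) \<partial>time_measure a b)"
    using R.nn_integral_snd[OF mG] by (simp add: split_def)
  also have "\<dots> = (\<integral>\<^sup>+t. (\<integral>\<^sup>+\<omega>. (\<integral>\<^sup>+s. ennreal \<bar>\<Phi> t s \<omega>\<bar> \<partial>time_measure a b) \<partial>M) \<partial>time_measure a b)"
  proof (intro nn_integral_cong)
    fix t assume t: "t \<in> space (time_measure a b)"
    have "(\<lambda>p. ennreal \<bar>?G (p, t)\<bar>) \<in> borel_measurable (PM a b)"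
      using measurable_compose[OF measurable_Pair2'[OF t] mG] by simp
    from PM.nn_integral_snd[OF this]
    show "(\<integral>\<^sup>+p. ennreal \<bar>\<Phi> t (fst p) (snd p)\<bar> \<partial>PM a b) = (\<integral>\<^sup>+\<omega>. (\<integral>\<^sup>+s. ennreal \<bar>\<Phi> t s \<omega>\<bar> \<partial>time_measure a b) \<partial>M)"
      by (simp add: split_def)
  qed
  also have "\<dots> = (\<integral>\<^sup>+p. (\<integral>\<^sup>+s. ennreal \<bar>\<Phi> (fst p) s (snd p)\<bar> \<partial>time_measure a b) \<partial>PM a b)"
    using nn_integral_PM_fst[OF inner1] by (simp add: split_def)
  finally have eqG: "(\<integral>\<^sup>+q. ennreal \<bar>?G q\<bar> \<partial>(PM a b \<Otimes>\<^sub>M time_measure a b))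
      = (\<integral>\<^sup>+p. (\<integral>\<^sup>+s. ennreal \<bar>\<Phi> (fst p) s (snd p)\<bar> \<partial>time_measure a b) \<partial>PM a b)" .
  have eqG': "(\<integral>\<^sup>+p. (\<integral>\<^sup>+t. ennreal \<bar>\<Phi> t (fst p) (snd p)\<bar> \<partial>time_measure a b) \<partial>PM a b) = (\<integral>\<^sup>+q. ennreal \<bar>?G q\<bar> \<partial>(PM a b \<Otimes>\<^sub>M time_measure a b))"
    using sigma_finite_measure.nn_integral_fst[OF sigma_finite_time_measure mG] by (simp add: split_def)
  show "(\<integral>\<^sup>+p. (\<integral>\<^sup>+t. ennreal \<bar>\<Phi> t (fst p) (snd p)\<bar> \<partial>time_measure a b) \<partial>PM a b) < \<infinity>"
    unfolding eqG' eqG by (rule fin)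
  have intF: "integrable (PM a b \<Otimes>\<^sub>M time_measure a b) ?F"
    using fin eqF meas by (simp add: integrable_iff_bounded)
  have intG: "integrable (PM a b \<Otimes>\<^sub>M time_measure a b) ?G"
    using fin eqG measG by (simp add: integrable_iff_bounded)
  show i1: "integrable (PM a b) (\<lambda>(t, \<omega>). \<integral>s. \<Phi> t s \<omega> \<partial>time_measure a b)"
    using R.integrable_fst'[OF intF] by (simp add: split_def)
  show "integrable (PM a b) (\<lambda>(s, \<omega>). \<integral>t. \<Phi> t s \<omega> \<partial>time_measure a b)"
    using R.integrable_fst'[OF intG] by (simp add: split_def)
  have intG': "integrable (PM a b \<Otimes>\<^sub>M time_measure a b) (\<lambda>(p, t). \<Phi> t (fst p) (snd p))"
    using intG by (simp add: split_def)
  interpret R': pair_sigma_finite "time_measure a b" "PM a b" ..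
  have "integrable (time_measure a b \<Otimes>\<^sub>M PM a b) (\<lambda>(t, p). \<Phi> t (fst p) (snd p))"
    using R.integrable_product_swap[OF intG'] by (simp add: split_def)
  from R'.AE_integrable_fst'[OF this]
  have AEt: "AE t in time_measure a b. integrable (PM a b) (\<lambda>p. \<Phi> t (fst p) (snd p))" by simp
  have "(\<integral>p. (\<integral>s. \<Phi> (fst p) s (snd p) \<partial>time_measure a b) \<partial>PM a b)
      = (\<integral>t. (\<integral>\<omega>. (\<integral>s. \<Phi> t s \<omega> \<partial>time_measure a b) \<partial>M) \<partial>time_measure a b)"
    using PM.integral_fst'[OF i1] by (simp add: split_def)
  also have "\<dots> = (\<integral>t. (\<integral>p. \<Phi> t (fst p) (snd p) \<partial>PM a b) \<partial>time_measure a b)"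
  proof (rule integral_cong_AE)
    show "AE t in time_measure a b. (\<integral>\<omega>. (\<integral>s. \<Phi> t s \<omega> \<partial>time_measure a b) \<partial>M) = (\<integral>p. \<Phi> t (fst p) (snd p) \<partial>PM a b)"
      using AEt
    proof eventually_elim
      case (elim t)
      from PM.integral_snd[of "\<lambda>s \<omega>. \<Phi> t s \<omega>"] elim show ?case by (simp add: split_def)
    qed
    show "(\<lambda>t. \<integral>\<omega>. (\<integral>s. \<Phi> t s \<omega> \<partial>time_measure a b) \<partial>M) \<in> borel_measurable (time_measure a b)"
      using PM.integrable_fst'[OF i1] by simp
    show "(\<lambda>t. \<integral>p. \<Phi> t (fst p) (snd p) \<partial>PM a b) \<in> borel_measurable (time_measure a b)"
      using R.integrable_snd[OF intG'] by simp
  qed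
  also have "\<dots> = (\<integral>p. (\<integral>t. \<Phi> t (fst p) (snd p) \<partial>time_measure a b) \<partial>PM a b)"
    by (rule R.Fubini_integral[OF intG'])
  finally show "(\<integral>p. (\<integral>s. \<Phi> (fst p) s (snd p) \<partial>time_measure a b) \<partial>PM a b)
       = (\<integral>p. (\<integral>t. \<Phi> t (fst p) (snd p) \<partial>time_measure a b) \<partial>PM a b)" .
qed

lemma time_integral_sq_integrable:
  fixes G :: "real \<Rightarrow> 'w \<Rightarrow> 'h::euclidean_space"
  assumes G: "sq_process a b G"
  shows "AE \<omega> in M. integrable (time_measure a b) (\<lambda>t. G t \<omega>)"
    and "sq_integrable M (\<lambda>\<omega>. \<integral>t. norm (G t \<omega>) \<partial>time_measure a b)"
    and "sq_integrable M (\<lambda>\<omega>. \<integral>t. G t \<omega> \<partial>time_measure a b)"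
proof -
  interpret pair_sigma_finite "time_measure a b" M by (rule pair_time)
  interpret swap: pair_sigma_finite M "time_measure a b" ..
  interpret fin: finite_measure "time_measure a b" by (rule finite_time_measure)
  note m[measurable] = sq_integrable_measurable[OF G]
  have "integrable (PM a b) (\<lambda>(t, \<omega>). G t \<omega>)"
    by (rule sq_integrable_imp_integrable[OF finite_PM G])
  from integrable_product_swap[OF this]
  have i: "integrable (M \<Otimes>\<^sub>M time_measure a b) (\<lambda>(\<omega>, t). G t \<omega>)" by (simp add: split_def)
  show AE: "AE \<omega> in M. integrable (time_measure a b) (\<lambda>t. G t \<omega>)"
    using swap.AE_integrable_fst'[OF i] by simp
  have sec: "(\<lambda>t. G t \<omega>) \<in> borel_measurable (time_measure a b)" if "\<omega> \<in> space M" for \<omega>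
    using measurable_compose[OF measurable_Pair2'[OF that] m] by simp
  have [measurable]: "(\<lambda>\<omega>. \<integral>t. norm (G t \<omega>) \<partial>time_measure a b) \<in> borel_measurable M"
    "(\<lambda>\<omega>. \<integral>t. G t \<omega> \<partial>time_measure a b) \<in> borel_measurable M" by measurable
  have le: "ennreal ((\<integral>t. norm (G t \<omega>) \<partial>time_measure a b)\<^sup>2)
     \<le> (\<integral>\<^sup>+t. ennreal ((norm (G t \<omega>))\<^sup>2) \<partial>time_measure a b) * emeasure (time_measure a b) {a..b}"
    if w: "\<omega> \<in> space M" and int: "integrable (time_measure a b) (\<lambda>t. G t \<omega>)" for \<omega>
  proof -
    have [measurable]: "(\<lambda>t. G t \<omega>) \<in> borel_measurable (time_measure a b)" by (rule sec[OF w])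
    have "ennreal ((\<integral>t. norm (G t \<omega>) \<partial>time_measure a b)\<^sup>2) = (\<integral>\<^sup>+t. ennreal (norm (G t \<omega>)) * 1 \<partial>time_measure a b)\<^sup>2"
      using nn_integral_eq_integral[OF integrable_norm[OF int]]
      by (simp add: ennreal_power Bochner_Integration.integral_nonneg)
    also have "\<dots> \<le> (\<integral>\<^sup>+t. ennreal (norm (G t \<omega>)) ^ 2 \<partial>time_measure a b) * (\<integral>\<^sup>+t. 1 ^ 2 \<partial>time_measure a b)"
      by (rule Cauchy_Schwarz_nn_integral) auto
    finally show ?thesis by (simp add: ennreal_power)
  qed
  have "(\<integral>\<^sup>+\<omega>. ennreal ((\<integral>t. norm (G t \<omega>) \<partial>time_measure a b)\<^sup>2) \<partial>M)
     \<le> (\<integral>\<^sup>+\<omega>. (\<integral>\<^sup>+t. ennreal ((norm (G t \<omega>))\<^sup>2) \<partial>time_measure a b) * emeasure (time_measure a b) {a..b} \<partial>M)"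
    by (intro nn_integral_mono_AE) (use AE AE_space in eventually_elim, rule le)
  also have "\<dots> = (\<integral>\<^sup>+\<omega>. (\<integral>\<^sup>+t. ennreal ((norm (G t \<omega>))\<^sup>2) \<partial>time_measure a b) \<partial>M) * emeasure (time_measure a b) {a..b}"
    by (rule nn_integral_multc) measurable
  also have "(\<integral>\<^sup>+\<omega>. (\<integral>\<^sup>+t. ennreal ((norm (G t \<omega>))\<^sup>2) \<partial>time_measure a b) \<partial>M) = (\<integral>\<^sup>+p. ennreal ((norm ((\<lambda>(t, \<omega>). G t \<omega>) p))\<^sup>2) \<partial>PM a b)"
    by (subst nn_integral_snd[symmetric]) (auto simp: split_def)
  also have "\<dots> * emeasure (time_measure a b) {a..b} < \<infinity>"
    using G fin.emeasure_finite[of "{a..b}", unfolded less_top] by (auto simp: sq_integrable_iff_nn ennreal_mult_less_top)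
  finally show 1: "sq_integrable M (\<lambda>\<omega>. \<integral>t. norm (G t \<omega>) \<partial>time_measure a b)"
    by (simp add: sq_integrable_iff_nn)
  show "sq_integrable M (\<lambda>\<omega>. \<integral>t. G t \<omega> \<partial>time_measure a b)"
    by (rule sq_integrable_bound[where f="\<lambda>\<omega>. \<integral>t. norm (G t \<omega>) \<partial>time_measure a b"])
      (use 1 in \<open>auto simp: sq_integrable_def\<close>)
qed

end

section \<open>Processes along a trajectory\<close>

lemma sq_integrable_Pair:
  fixes f :: "'a \<Rightarrow> 'b::euclidean_space" and g :: "'a \<Rightarrow> 'c::euclidean_space"
  assumes "sq_integrable Q f" "sq_integrable Q g"
  shows "sq_integrable Q (\<lambda>x. (f x, g x))"
  unfolding sq_integrable_def
proof
  show "(\<lambda>x. (f x, g x)) \<in> borel_measurable Q"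
    by (intro borel_measurable_Pair sq_integrable_measurable assms)
  have "(norm (f x, g x))\<^sup>2 = (norm (f x))\<^sup>2 + (norm (g x))\<^sup>2" for x by (simp add: norm_Pair)
  then show "integrable Q (\<lambda>x. (norm (f x, g x))\<^sup>2)"
    using assms by (simp add: sq_integrable_def)
qed

context delay_model begin

lemma restrict_rectangle:
  assumes h: "(\<lambda>(t, \<omega>). h t \<omega>) \<in> borel_measurable (restrict_space borel J \<Otimes>\<^sub>M M)" and J: "J \<subseteq> {-\<delta>..T}"
  shows "(\<lambda>(t, \<omega>). h t \<omega>) \<in> borel_measurable (restrict_space (PM (-\<delta>) T) (J \<times> space M))"
proof -
  let ?R = "restrict_space (PM (-\<delta>) T) (J \<times> space M)"
  have "fst \<in> borel_measurable ?R"
    by (intro measurable_restrict_space1 measurable_compose[OF measurable_fst time_measure_id])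
  then have 1: "fst \<in> measurable ?R (restrict_space borel J)"
    by (intro measurable_restrict_space2) (auto simp: space_restrict_space)
  have 2: "snd \<in> measurable ?R M" by (intro measurable_restrict_space1) simp
  from measurable_curried[OF h 1 2] show ?thesis by (simp add: split_def)
qed

text \<open>
  A process on \<open>[-\<delta>, T]\<close> arises from an initial path and a process on \<open>[0, T]\<close>. Joint measurability
  is checked on the two rectangles of this partition.
\<close>

lemma LpF_2_glue:
  fixes h h1 :: "real \<Rightarrow> 'w \<Rightarrow> 'h::euclidean_space"
  assumes h1: "LpF P 2 {-\<delta>..<0} h1" and h: "LpF P 2 {0..T} h"
    and eq: "\<And>t \<omega>. t \<in> {-\<delta>..<0} \<Longrightarrow> \<omega> \<in> space M \<Longrightarrow> h t \<omega> = h1 t \<omega>"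
  shows "LpF P 2 {-\<delta>..T} h"
proof -
  have split: "{-\<delta>..T} = {-\<delta>..<0} \<union> {0..T}" using delay_nonneg T_pos by auto
  have m1: "(\<lambda>(t, \<omega>). h1 t \<omega>) \<in> borel_measurable (restrict_space borel {-\<delta>..<0} \<Otimes>\<^sub>M M)"
    and m2: "(\<lambda>(t, \<omega>). h t \<omega>) \<in> borel_measurable (restrict_space borel {0..T} \<Otimes>\<^sub>M M)"
    using h1 h by (auto simp: LpF_def measurable_adapted_def)
  have m1': "(\<lambda>(t, \<omega>). h t \<omega>) \<in> borel_measurable (restrict_space (PM (-\<delta>) T) ({-\<delta>..<0} \<times> space M))"
  proof (subst measurable_cong)
    show "(\<lambda>(t, \<omega>). h1 t \<omega>) \<in> borel_measurable (restrict_space (PM (-\<delta>) T) ({-\<delta>..<0} \<times> space M))"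
      by (rule restrict_rectangle[OF m1]) (use T_pos in auto)
  qed (auto simp: space_restrict_space eq)
  have m2': "(\<lambda>(t, \<omega>). h t \<omega>) \<in> borel_measurable (restrict_space (PM (-\<delta>) T) ({0..T} \<times> space M))"
    by (rule restrict_rectangle[OF m2]) (use delay_nonneg in auto)
  have rect: "J \<inter> {-\<delta>..T} \<in> sets (time_measure (-\<delta>) T)" if "J \<in> sets borel" for J
  proof -
    have "(\<lambda>t. t) -` J \<inter> space (time_measure (-\<delta>) T) \<in> sets (time_measure (-\<delta>) T)"
      by (rule measurable_sets[OF time_measure_id that])
    then show ?thesis by simp
  qed
  have m[measurable]: "jointly_measurable (-\<delta>) T h"
  proof (rule measurable_piecewise_restrict[where C="{{-\<delta>..<0} \<times> space M, {0..T} \<times> space M}"])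
    show "\<Omega> \<inter> space (PM (-\<delta>) T) \<in> sets (PM (-\<delta>) T)" if "\<Omega> \<in> {{-\<delta>..<0} \<times> space M, {0..T} \<times> space M}" for \<Omega>
    proof -
      obtain J where J: "\<Omega> = J \<times> space M" "J \<in> sets borel" using \<open>\<Omega> \<in> _\<close> by auto
      have "\<Omega> \<inter> space (PM (-\<delta>) T) = (J \<inter> {-\<delta>..T}) \<times> space M" by (auto simp: J space_PM)
      then show ?thesis using rect[OF J(2)] by simp
    qed
    show "space (PM (-\<delta>) T) \<subseteq> \<Union>{{-\<delta>..<0} \<times> space M, {0..T} \<times> space M}"
      unfolding space_PM split by auto
    show "(\<lambda>(t, \<omega>). h t \<omega>) \<in> borel_measurable (restrict_space (PM (-\<delta>) T) \<Omega>)"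
      if "\<Omega> \<in> {{-\<delta>..<0} \<times> space M, {0..T} \<times> space M}" for \<Omega>
      using that m1' m2' by blast
  qed simp
  have neg: "jointly_measurable (-\<delta>) T (\<lambda>t \<omega>. indicator {..<0} t :: ennreal)"
    and pos: "jointly_measurable (-\<delta>) T (\<lambda>t \<omega>. indicator {0..} t :: ennreal)"
    using measurable_compose[OF measurable_compose[OF measurable_fst time_measure_id] borel_measurable_indicator, of "{..<0::real}" "-\<delta>" T M]
      measurable_compose[OF measurable_compose[OF measurable_fst time_measure_id] borel_measurable_indicator, of "{0::real..}" "-\<delta>" T M]
    by (simp_all add: split_def)
  let ?f = "\<lambda>(t, \<omega>). ennreal ((norm (h t \<omega>))\<^sup>2)"
  have f: "?f \<in> borel_measurable (PM (-\<delta>) T)" by measurable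
  have "(\<integral>\<^sup>+p. ?f p \<partial>PM (-\<delta>) T) = (\<integral>\<^sup>+p. ?f p * (\<lambda>(t, \<omega>). indicator {..<0} t) p + ?f p * (\<lambda>(t, \<omega>). indicator {0..} t) p \<partial>PM (-\<delta>) T)"
    by (intro nn_integral_cong) (auto simp: indicator_def)
  also have "\<dots> = (\<integral>\<^sup>+p. ?f p * (\<lambda>(t, \<omega>). indicator {..<0} t) p \<partial>PM (-\<delta>) T) + (\<integral>\<^sup>+p. ?f p * (\<lambda>(t, \<omega>). indicator {0..} t) p \<partial>PM (-\<delta>) T)"
    by (intro nn_integral_add borel_measurable_times_ennreal f neg pos)
  also have "(\<integral>\<^sup>+p. ?f p * (\<lambda>(t, \<omega>). indicator {..<0} t) p \<partial>PM (-\<delta>) T)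
      = (\<integral>\<^sup>+\<omega>. (\<integral>\<^sup>+t\<in>{-\<delta>..T}. ennreal ((norm (h t \<omega>))\<^sup>2) * indicator {..<0} t \<partial>lborel) \<partial>M)"
  proof (subst nn_integral_PM)
    show "jointly_measurable (-\<delta>) T (\<lambda>t \<omega>. ennreal ((norm (h t \<omega>))\<^sup>2) * indicator {..<0} t)"
      using borel_measurable_times_ennreal[OF f neg] by (simp add: split_def)
  qed (simp add: split_def)
  also have "\<dots> = (\<integral>\<^sup>+\<omega>. (\<integral>\<^sup>+t\<in>{-\<delta>..<0}. ennreal ((norm (h1 t \<omega>))\<^sup>2) \<partial>lborel) \<partial>M)"
    using T_pos by (intro nn_integral_cong) (auto simp: indicator_def eq)
  also have "(\<integral>\<^sup>+p. ?f p * (\<lambda>(t, \<omega>). indicator {0..} t) p \<partial>PM (-\<delta>) T)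
      = (\<integral>\<^sup>+\<omega>. (\<integral>\<^sup>+t\<in>{-\<delta>..T}. ennreal ((norm (h t \<omega>))\<^sup>2) * indicator {0..} t \<partial>lborel) \<partial>M)"
  proof (subst nn_integral_PM)
    show "jointly_measurable (-\<delta>) T (\<lambda>t \<omega>. ennreal ((norm (h t \<omega>))\<^sup>2) * indicator {0..} t)"
      using borel_measurable_times_ennreal[OF f pos] by (simp add: split_def)
  qed (simp add: split_def)
  also have "\<dots> = (\<integral>\<^sup>+\<omega>. (\<integral>\<^sup>+t\<in>{0..T}. ennreal ((norm (h t \<omega>))\<^sup>2) \<partial>lborel) \<partial>M)"
    using delay_nonneg by (intro nn_integral_cong) (auto simp: indicator_def)
  also have "(\<integral>\<^sup>+\<omega>. (\<integral>\<^sup>+t\<in>{-\<delta>..<0}. ennreal ((norm (h1 t \<omega>))\<^sup>2) \<partial>lborel) \<partial>M)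
      + (\<integral>\<^sup>+\<omega>. (\<integral>\<^sup>+t\<in>{0..T}. ennreal ((norm (h t \<omega>))\<^sup>2) \<partial>lborel) \<partial>M) < \<infinity>"
    using h1 h by (simp add: LpF_def)
  finally have "sq_process (-\<delta>) T h"
    using m by (simp add: sq_integrable_iff_nn split_def)
  moreover have "h t \<in> borel_measurable (filt P t)" if t: "t \<in> {-\<delta>..T}" for t
  proof (cases "t < 0")
    case True
    have "h1 t \<in> borel_measurable (filt P t)" using h1 t True by (auto simp: LpF_def measurable_adapted_def)
    then show ?thesis using t True by (subst measurable_cong[where g="h1 t"]) (auto simp: eq)
  qed (use h t in \<open>auto simp: LpF_def measurable_adapted_def\<close>)
  ultimately show ?thesis by (simp add: LpF_2_iff)
qed

lemma LpF_2_zero: "LpF P 2 {-\<delta>..<0} (\<lambda>_ _. 0)"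
  by (simp add: LpF_def measurable_adapted_def)

lemma admissible_LpF:
  assumes v: "v \<in> admissible P"
  shows "LpF P 2 {-\<delta>..T} v"
proof (rule LpF_2_glue)
  show "LpF P 2 {-\<delta>..<0} (vinit P)" using setting unfolding delay_setting_def by blast
qed (use v in \<open>auto simp: admissible_def\<close>)

lemma LpF_2_diff:
  assumes "LpF P 2 {a..b} x" "LpF P 2 {a..b} y"
  shows "LpF P 2 {a..b} (\<lambda>t \<omega>. x t \<omega> - y t \<omega>)"
  using assms sq_integrable_diff[of "PM a b" "\<lambda>(t, \<omega>). x t \<omega>" "\<lambda>(t, \<omega>). y t \<omega>"]
  by (auto simp: LpF_2_iff split_def intro!: borel_measurable_diff)

lemma args_sq_integrable:
  assumes y: "LpF P 2 {-\<delta>..T} y" and z: "LpF P 2 {-\<delta>..T} z" and v: "LpF P 2 {-\<delta>..T} v"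
  shows "sq_process 0 T (args_at P y z v)"
proof -
  have l: "sq_process 0 T x" if "LpF P 2 {-\<delta>..T} x" for x :: "real \<Rightarrow> 'w \<Rightarrow> 'h::euclidean_space"
    using LpF_2_sub_interval[OF that, of 0 T] delay_nonneg by (simp add: LpF_2_iff)
  have "sq_integrable (PM 0 T) (\<lambda>p. ((\<lambda>(t, \<omega>). y t \<omega>) p, (\<lambda>(t, \<omega>). delayed P y t \<omega>) p, (\<lambda>(t, \<omega>). z t \<omega>) p,
     (\<lambda>(t, \<omega>). delayed P z t \<omega>) p, (\<lambda>(t, \<omega>). v t \<omega>) p, (\<lambda>(t, \<omega>). delayed P v t \<omega>) p))"
    by (intro sq_integrable_Pair l delayed_sq_integrable assms)
  then show ?thesis by (simp add: args_at_def split_def)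
qed

lemma args_adapted:
  assumes y: "LpF P 2 {-\<delta>..T} y" and z: "LpF P 2 {-\<delta>..T} z" and v: "LpF P 2 {-\<delta>..T} v"
  shows "AE t in time_measure 0 T. args_at P y z v t \<in> borel_measurable (filt P t)"
  using delayed_adapted[OF y] delayed_adapted[OF z] delayed_adapted[OF v] AE_space
proof eventually_elim
  case (elim t)
  then have "t \<in> {-\<delta>..T}" using delay_nonneg by auto
  then have "y t \<in> borel_measurable (filt P t)" "z t \<in> borel_measurable (filt P t)" "v t \<in> borel_measurable (filt P t)"
    using y z v by (auto simp: LpF_2_iff)
  with elim have "(\<lambda>\<omega>. (y t \<omega>, delayed P y t \<omega>, z t \<omega>, delayed P z t \<omega>, v t \<omega>, delayed P v t \<omega>)) \<in> borel_measurable (filt P t)"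
    by (intro borel_measurable_Pair)
  then show ?case by (simp add: args_at_def[abs_def])
qed

end

context control_model begin

lemma coefficient_along_measurable:
  fixes g :: "real \<Rightarrow> 'w \<Rightarrow> ('n, 'd, 'k) args \<Rightarrow> 'h::euclidean_space"
  assumes g: "measurable_coefficient P g" and X: "jointly_measurable 0 T X"
  shows "jointly_measurable 0 T (\<lambda>t \<omega>. g t \<omega> (X t \<omega>))"
  using coefficient_measurable[OF g measurable_fst measurable_snd X] by (simp add: split_def)

text \<open>
  The Lipschitz condition reduces this to the arguments and to \<open>f(t, 0)\<close>.
\<close>

lemma driver_sq_integrable:
  assumes X: "sq_process 0 T X"
  shows "sq_process 0 T (\<lambda>t \<omega>. driver P t \<omega> (X t \<omega>))"
proof -
  obtain L where L: "0 \<le> L" "\<forall>t\<in>{0..T}. \<forall>\<omega>\<in>space M. \<forall>x x'. norm (driver P t \<omega> x' - driver P t \<omega> x) \<le> L * norm (x' - x)"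
    using driver_lipschitz by blast
  have "LpF P 2 {0..T} (\<lambda>t \<omega>. driver P t \<omega> 0)" using setting unfolding delay_setting_def by blast
  then have f0: "sq_process 0 T (\<lambda>t \<omega>. driver P t \<omega> 0)" by (simp add: LpF_2_iff)
  have "sq_integrable (PM 0 T) (\<lambda>p. L *\<^sub>R norm ((\<lambda>(t, \<omega>). X t \<omega>) p) + norm ((\<lambda>(t, \<omega>). driver P t \<omega> 0) p))"
    by (intro sq_integrable_add sq_integrable_scaleR_const sq_integrable_norm X f0)
  then have b: "integrable (PM 0 T) (\<lambda>p. (L *\<^sub>R norm ((\<lambda>(t, \<omega>). X t \<omega>) p) + norm ((\<lambda>(t, \<omega>). driver P t \<omega> 0) p))\<^sup>2)"
    by (simp add: sq_integrable_def)
  show ?thesis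
  proof (rule sq_integrable_bound[OF b])
    show "jointly_measurable 0 T (\<lambda>t \<omega>. driver P t \<omega> (X t \<omega>))"
      by (rule coefficient_along_measurable[OF measurable_driver sq_integrable_measurable[OF X]])
    show "AE p in PM 0 T. norm ((\<lambda>(t, \<omega>). driver P t \<omega> (X t \<omega>)) p)
        \<le> L *\<^sub>R norm ((\<lambda>(t, \<omega>). X t \<omega>) p) + norm ((\<lambda>(t, \<omega>). driver P t \<omega> 0) p)"
    proof (rule AE_I2)
      fix p assume "p \<in> space (PM 0 T)"
      then obtain t \<omega> where p: "p = (t, \<omega>)" "t \<in> {0..T}" "\<omega> \<in> space M" by (auto simp: space_PM)
      have "norm (driver P t \<omega> (X t \<omega>)) \<le> norm (driver P t \<omega> (X t \<omega>) - driver P t \<omega> 0) + norm (driver P t \<omega> 0)"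
        using norm_triangle_ineq[of "driver P t \<omega> (X t \<omega>) - driver P t \<omega> 0" "driver P t \<omega> 0"] by simp
      moreover have "norm (driver P t \<omega> (X t \<omega>) - driver P t \<omega> 0) \<le> L * norm (X t \<omega> - 0)" using L(2) p by blast
      ultimately show "norm ((\<lambda>(t, \<omega>). driver P t \<omega> (X t \<omega>)) p)
        \<le> L *\<^sub>R norm ((\<lambda>(t, \<omega>). X t \<omega>) p) + norm ((\<lambda>(t, \<omega>). driver P t \<omega> 0) p)" by (simp add: p(1))
    qed
  qed
qed

lemma H_along_sq_integrable:
  assumes D: "bounded_gradient D \<iota>"
    and X: "jointly_measurable 0 T (args_at P y z v)" and p: "LpF P 2 {0..T} p"
  shows "sq_process 0 T (H_along P D y z v p)"
proof -
  obtain C where C: "0 \<le> C" "\<forall>t\<in>{0..T}. \<forall>\<omega>\<in>space M. \<forall>p x. norm (D (hamiltonian P t \<omega> p) x) \<le> C * (1 + norm p)"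
    using hamiltonian_gradient_bound[OF D] by blast
  have p': "sq_process 0 T p" using p by (simp add: LpF_2_iff)
  have "sq_integrable (PM 0 T) (\<lambda>q. C *\<^sub>R ((1::real) + norm ((\<lambda>(t, \<omega>). p t \<omega>) q)))"
    by (intro sq_integrable_scaleR_const sq_integrable_add sq_integrable_const finite_PM sq_integrable_norm p')
  then have b: "integrable (PM 0 T) (\<lambda>q. (C *\<^sub>R (1 + norm ((\<lambda>(t, \<omega>). p t \<omega>) q)))\<^sup>2)"
    by (simp add: sq_integrable_def)
  show ?thesis
  proof (rule sq_integrable_bound[OF b])
    show "jointly_measurable 0 T (H_along P D y z v p)"
      using hamiltonian_gradient_measurable[OF D measurable_fst measurable_snd X sq_integrable_measurable[OF p']]
      by (simp add: H_along_def split_def)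
    show "AE q in PM 0 T. norm ((\<lambda>(t, \<omega>). H_along P D y z v p t \<omega>) q) \<le> C *\<^sub>R (1 + norm ((\<lambda>(t, \<omega>). p t \<omega>) q))"
    proof (rule AE_I2)
      fix q assume "q \<in> space (PM 0 T)"
      then obtain t \<omega> where q: "q = (t, \<omega>)" "t \<in> {0..T}" "\<omega> \<in> space M" by (auto simp: space_PM)
      have "norm (D (hamiltonian P t \<omega> (p t \<omega>)) (args_at P y z v t \<omega>)) \<le> C * (1 + norm (p t \<omega>))"
        using C(2) q(2,3) by blast
      then show "norm ((\<lambda>(t, \<omega>). H_along P D y z v p t \<omega>) q) \<le> C *\<^sub>R (1 + norm ((\<lambda>(t, \<omega>). p t \<omega>) q))"
        by (simp add: q(1) H_along_def)
    qed
  qed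
qed

lemma H_along_adapted:
  assumes D: "bounded_gradient D \<iota>"
    and X: "AE t in time_measure 0 T. args_at P y z v t \<in> borel_measurable (filt P t)" and p: "LpF P 2 {0..T} p"
  shows "AE t in time_measure 0 T. H_along P D y z v p t \<in> borel_measurable (filt P t)"
  using X AE_space
proof eventually_elim
  case (elim t)
  then have t: "t \<in> {0..T}" by simp
  then have "p t \<in> borel_measurable (filt P t)" using p by (auto simp: LpF_2_iff)
  from hamiltonian_gradient_adapted[OF D t elim(1) this] show ?case by (simp add: H_along_def[abs_def])
qed

end

section \<open>Duality of delay and anticipation\<close>

context delay_model begin

definition kernel_bound :: real where
  "kernel_bound = (SOME K. 0 < K \<and> (\<forall>t\<in>{0..T}. \<forall>s\<in>{-\<delta>..T}. \<forall>\<omega>\<in>space M. \<bar>kernel P t s \<omega>\<bar> \<le> K))"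

lemma kernel_bound:
  "0 < kernel_bound" "t \<in> {0..T} \<Longrightarrow> s \<in> {-\<delta>..T} \<Longrightarrow> \<omega> \<in> space M \<Longrightarrow> \<bar>kernel P t s \<omega>\<bar> \<le> kernel_bound"
proof -
  have "\<exists>K. 0 < K \<and> (\<forall>t\<in>{0..T}. \<forall>s\<in>{-\<delta>..T}. \<forall>\<omega>\<in>space M. \<bar>kernel P t s \<omega>\<bar> \<le> K)"
    using setting unfolding delay_setting_def by blast
  from someI_ex[OF this] have *: "0 < kernel_bound \<and> (\<forall>t\<in>{0..T}. \<forall>s\<in>{-\<delta>..T}. \<forall>\<omega>\<in>space M. \<bar>kernel P t s \<omega>\<bar> \<le> kernel_bound)"
    unfolding kernel_bound_def .
  then show "0 < kernel_bound" by blast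
  show "\<bar>kernel P t s \<omega>\<bar> \<le> kernel_bound" if "t \<in> {0..T}" "s \<in> {-\<delta>..T}" "\<omega> \<in> space M" using * that by blast
qed

text \<open>
  The kernel on the delay window, which serves both as a function of \<open>s\<close> for the delay and as a
  function of \<open>t\<close> for the anticipation.
\<close>

definition window_kernel :: "real \<Rightarrow> real \<Rightarrow> 'w \<Rightarrow> real" where
  "window_kernel t s \<omega> = indicator {t - \<delta>..t} s * kernel P t s \<omega>"

lemma delay_weight_window: "delay_weight t s \<omega> = delay_density P s * window_kernel t s \<omega>"
  by (simp add: delay_weight_def window_kernel_def)

lemma window_kernel_bound:
  "t \<in> {0..T} \<Longrightarrow> s \<in> {-\<delta>..T} \<Longrightarrow> \<omega> \<in> space M \<Longrightarrow> \<bar>window_kernel t s \<omega>\<bar> \<le> kernel_bound"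
  using kernel_bound(2)[of t s \<omega>] kernel_bound(1) by (auto simp: window_kernel_def indicator_def)

lemma window_kernel_measurable:
  assumes "f \<in> measurable Q (time_measure 0 T)" "g \<in> measurable Q (time_measure (-\<delta>) T)" and h: "h \<in> measurable Q M"
  shows "(\<lambda>x. window_kernel (f x) (g x) (h x)) \<in> borel_measurable Q"
proof -
  have [measurable]: "f \<in> borel_measurable Q" "g \<in> borel_measurable Q"
    using measurable_compose[OF assms(1) time_measure_id] measurable_compose[OF assms(2) time_measure_id] by auto
  have [measurable]: "(\<lambda>x. kernel P (f x) (g x) (h x)) \<in> borel_measurable Q"
    by (rule kernel_measurable[OF assms])
  have "(\<lambda>x. (if f x - \<delta> \<le> g x \<and> g x \<le> f x then 1 else 0) * kernel P (f x) (g x) (h x)) \<in> borel_measurable Q"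
    by measurable
  then show ?thesis by (simp add: window_kernel_def indicator_def cong: if_cong)
qed

text \<open>The time \<open>s\<close> lies in \<open>[t - \<delta>, t]\<close> iff \<open>t\<close> lies in \<open>[s, s + \<delta>]\<close>.\<close>

lemma anticipated_eq:
  fixes G :: "real \<Rightarrow> 'w \<Rightarrow> 'h::euclidean_space"
  assumes s: "s \<in> {0..T}"
  shows "anticipated P G s \<omega> = (\<integral>t. window_kernel t s \<omega> *\<^sub>R G t \<omega> \<partial>time_measure 0 T)"
  unfolding anticipated_def integral_time_measure set_lebesgue_integral_def
  by (intro Bochner_Integration.integral_cong refl) (auto simp: window_kernel_def indicator_def)

lemma window_measurable:
  "(\<lambda>((t, \<omega>), s). window_kernel t s \<omega>) \<in> borel_measurable (PM 0 T \<Otimes>\<^sub>M time_measure 0 T)"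
proof -
  have "(\<lambda>p. window_kernel (fst (fst p)) (snd p) (snd (fst p))) \<in> borel_measurable (PM 0 T \<Otimes>\<^sub>M time_measure 0 T)"
    using delay_nonneg
    by (intro window_kernel_measurable measurable_compose[OF measurable_snd measurable_time_mono]) auto
  then show ?thesis by (simp add: split_def)
qed

lemma anticipated_measurable:
  fixes G :: "real \<Rightarrow> 'w \<Rightarrow> 'h::euclidean_space"
  assumes G: "jointly_measurable 0 T G"
  shows "jointly_measurable 0 T (anticipated P G)"
proof -
  have "(\<lambda>q. window_kernel (snd q) (fst (fst q)) (snd (fst q)) *\<^sub>R G (snd q) (snd (fst q)))
      \<in> borel_measurable (PM 0 T \<Otimes>\<^sub>M time_measure 0 T)"
  proof (rule borel_measurable_scaleR)
    show "(\<lambda>q. window_kernel (snd q) (fst (fst q)) (snd (fst q))) \<in> borel_measurable (PM 0 T \<Otimes>\<^sub>M time_measure 0 T)"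
    proof (rule window_kernel_measurable)
      show "(\<lambda>q. fst (fst q)) \<in> measurable (PM 0 T \<Otimes>\<^sub>M time_measure 0 T) (time_measure (-\<delta>) T)"
        using delay_nonneg
        by (intro measurable_compose[OF measurable_compose[OF measurable_fst measurable_fst] measurable_time_mono]) auto
    qed measurable
    show "(\<lambda>q. G (snd q) (snd (fst q))) \<in> borel_measurable (PM 0 T \<Otimes>\<^sub>M time_measure 0 T)"
      by (rule measurable_curried[OF G]) measurable
  qed
  then have "(\<lambda>p. \<integral>t. window_kernel t (fst p) (snd p) *\<^sub>R G t (snd p) \<partial>time_measure 0 T) \<in> borel_measurable (PM 0 T)"
    by (intro sigma_finite_measure.borel_measurable_lebesgue_integral[OF sigma_finite_time_measure]) (simp add: split_def)
  also have "?this \<longleftrightarrow> jointly_measurable 0 T (anticipated P G)"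
    by (intro measurable_cong) (auto simp: space_PM anticipated_eq)
  finally show ?thesis .
qed

lemma anticipated_sq_integrable:
  fixes G :: "real \<Rightarrow> 'w \<Rightarrow> 'h::euclidean_space"
  assumes G: "sq_process 0 T G" and s: "s \<in> {0..T}"
  shows "sq_integrable M (anticipated P G s)"
    and "AE \<omega> in M. integrable (time_measure 0 T) (\<lambda>t. window_kernel t s \<omega> *\<^sub>R G t \<omega>)"
proof -
  note I = time_integral_sq_integrable[OF G]
  have m: "(\<lambda>t. window_kernel t s \<omega> *\<^sub>R G t \<omega>) \<in> borel_measurable (time_measure 0 T)" if "\<omega> \<in> space M" for \<omega>
    using s that delay_nonneg section_measurable(1)[OF sq_integrable_measurable[OF G] that]
    by (intro borel_measurable_scaleR window_kernel_measurable) auto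
  have le: "norm (window_kernel t s \<omega> *\<^sub>R G t \<omega>) \<le> kernel_bound * norm (G t \<omega>)" if "\<omega> \<in> space M" "t \<in> {0..T}" for t \<omega>
    using window_kernel_bound[of t s \<omega>] s that delay_nonneg by (auto intro!: mult_right_mono)
  show int: "AE \<omega> in M. integrable (time_measure 0 T) (\<lambda>t. window_kernel t s \<omega> *\<^sub>R G t \<omega>)"
    using I(1) AE_space
  proof eventually_elim
    case (elim \<omega>)
    have "integrable (time_measure 0 T) (\<lambda>t. kernel_bound * norm (G t \<omega>))" using elim by auto
    then show ?case
      by (rule Bochner_Integration.integrable_bound) (use m le elim kernel_bound(1) in \<open>auto intro!: AE_I2\<close>)
  qed
  have "sq_integrable M (\<lambda>\<omega>. kernel_bound *\<^sub>R (\<integral>t. norm (G t \<omega>) \<partial>time_measure 0 T))"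
    by (intro sq_integrable_scaleR_const I)
  then have b: "integrable M (\<lambda>\<omega>. (kernel_bound *\<^sub>R (\<integral>t. norm (G t \<omega>) \<partial>time_measure 0 T))\<^sup>2)"
    by (simp add: sq_integrable_def)
  show "sq_integrable M (anticipated P G s)"
  proof (rule sq_integrable_bound[OF b])
    show "anticipated P G s \<in> borel_measurable M"
      by (rule section_measurable(2)[OF anticipated_measurable[OF sq_integrable_measurable[OF G]] s])
    show "AE \<omega> in M. norm (anticipated P G s \<omega>) \<le> kernel_bound *\<^sub>R (\<integral>t. norm (G t \<omega>) \<partial>time_measure 0 T)"
      using I(1) int AE_space
    proof eventually_elim
      case (elim \<omega>)
      have "norm (anticipated P G s \<omega>) \<le> (\<integral>t. norm (window_kernel t s \<omega> *\<^sub>R G t \<omega>) \<partial>time_measure 0 T)"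
        unfolding anticipated_eq[OF s] by (rule integral_norm_bound)
      also have "\<dots> \<le> (\<integral>t. kernel_bound * norm (G t \<omega>) \<partial>time_measure 0 T)"
      proof (rule integral_mono)
        show "integrable (time_measure 0 T) (\<lambda>t. norm (window_kernel t s \<omega> *\<^sub>R G t \<omega>))"
          by (rule integrable_norm[OF elim(2)])
        show "integrable (time_measure 0 T) (\<lambda>t. kernel_bound * norm (G t \<omega>))"
          by (intro integrable_mult_right integrable_norm elim(1))
      qed (rule le[OF elim(3)], simp)
      finally show ?case by simp
    qed
  qed
qed

end

context brownian_problem begin

lemma expectation_measurable:
  fixes F :: "real \<Rightarrow> 'w \<Rightarrow> real"
  shows "jointly_measurable a b F \<Longrightarrow>
    (\<lambda>t. expectation (F t)) \<in> borel_measurable (time_measure a b)"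
  by (rule borel_measurable_lebesgue_integral)

lemma AE_PM_snd:
  assumes "AE \<omega> in M. Q \<omega>"
  shows "AE p in PM a b. Q (snd p)"
proof -
  obtain N where N: "{\<omega> \<in> space M. \<not> Q \<omega>} \<subseteq> N" "N \<in> null_sets M"
    using AE_E[OF assms] by (metis null_setsI)
  have "{a..b} \<times> N \<in> null_sets (PM a b)"
    using sets.top[of "time_measure a b"] by (intro times_in_null_sets2 N(2)) simp
  then show ?thesis by (rule AE_I') (use N(1) in \<open>auto simp: space_PM\<close>)
qed

lemma cond_expectation_measurable [measurable]:
  "cond_expectation M (filt P t) Y \<in> borel_measurable (filt P t)"
  unfolding cond_expectation_def[abs_def] by measurable

lemma cond_expectation_inner_basis:
  "b \<in> Basis \<Longrightarrow> cond_expectation M F Y \<omega> \<bullet> b = real_cond_exp M F (\<lambda>\<omega>. Y \<omega> \<bullet> b) \<omega>"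
  unfolding cond_expectation_def by (simp add: inner_sum_left inner_Basis if_distrib sum.delta cong: if_cong)

text \<open>In each coordinate this is the defining property of the conditional expectation.\<close>

lemma cond_expectation_pairing:
  fixes X Y :: "'w \<Rightarrow> 'h::euclidean_space"
  assumes Y: "sq_integrable M Y" and X: "sq_integrable M X" "X \<in> borel_measurable (filt P t)"
  shows "integrable M (\<lambda>\<omega>. cond_expectation M (filt P t) Y \<omega> \<bullet> X \<omega>)"
    and "expectation (\<lambda>\<omega>. cond_expectation M (filt P t) Y \<omega> \<bullet> X \<omega>) = expectation (\<lambda>\<omega>. Y \<omega> \<bullet> X \<omega>)"
proof -
  interpret cond: sigma_finite_subalgebra M "filt P t" by (rule sigma_finite_subalgebra_filt)
  have i: "integrable M (\<lambda>\<omega>. (X \<omega> \<bullet> b) * (Y \<omega> \<bullet> b))" for b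
    by (intro integrable_mult_sq sq_integrable_inner_const X Y)
  have m: "(\<lambda>\<omega>. X \<omega> \<bullet> b) \<in> borel_measurable (filt P t)" "(\<lambda>\<omega>. Y \<omega> \<bullet> b) \<in> borel_measurable M" for b
    using X(2) sq_integrable_measurable[OF Y] by auto
  note c = cond.real_cond_exp_intg[OF i m]
  have e: "cond_expectation M (filt P t) Y \<omega> \<bullet> X \<omega>
      = (\<Sum>b\<in>Basis. (X \<omega> \<bullet> b) * real_cond_exp M (filt P t) (\<lambda>\<omega>. Y \<omega> \<bullet> b) \<omega>)" for \<omega>
    by (subst euclidean_inner) (simp add: cond_expectation_inner_basis mult.commute)
  show "integrable M (\<lambda>\<omega>. cond_expectation M (filt P t) Y \<omega> \<bullet> X \<omega>)"
    unfolding e by (intro Bochner_Integration.integrable_sum c(1))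
  have "expectation (\<lambda>\<omega>. cond_expectation M (filt P t) Y \<omega> \<bullet> X \<omega>)
      = (\<Sum>b\<in>Basis. expectation (\<lambda>\<omega>. (X \<omega> \<bullet> b) * real_cond_exp M (filt P t) (\<lambda>\<omega>. Y \<omega> \<bullet> b) \<omega>))"
    unfolding e by (intro Bochner_Integration.integral_sum c(1))
  also have "\<dots> = (\<Sum>b\<in>Basis. expectation (\<lambda>\<omega>. (X \<omega> \<bullet> b) * (Y \<omega> \<bullet> b)))"
    by (intro sum.cong refl c(2))
  also have "\<dots> = expectation (\<lambda>\<omega>. \<Sum>b\<in>Basis. (X \<omega> \<bullet> b) * (Y \<omega> \<bullet> b))"
    by (intro Bochner_Integration.integral_sum[symmetric] i)
  also have "\<dots> = expectation (\<lambda>\<omega>. Y \<omega> \<bullet> X \<omega>)"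
    by (intro Bochner_Integration.integral_cong refl) (subst euclidean_inner[of "Y _"], simp add: mult.commute)
  finally show "expectation (\<lambda>\<omega>. cond_expectation M (filt P t) Y \<omega> \<bullet> X \<omega>) = expectation (\<lambda>\<omega>. Y \<omega> \<bullet> X \<omega>)" .
qed

end

context delay_model begin

text \<open>
  Differences of two trajectories, or of two controls, have this property because the initial paths
  agree. The delay integral of such a process involves only times in \<open>[0, T]\<close>.
\<close>

definition vanishes_before_0 :: "(real \<Rightarrow> 'w \<Rightarrow> 'h::zero) \<Rightarrow> bool" where
  "vanishes_before_0 x \<longleftrightarrow> (\<forall>t\<in>{-\<delta>..<0}. \<forall>\<omega>\<in>space M. x t \<omega> = 0)"

lemma delayed_norm_eq:
  fixes x :: "real \<Rightarrow> 'w \<Rightarrow> 'h::euclidean_space"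
  assumes x0: "vanishes_before_0 x" and w: "\<omega> \<in> space M"
  shows "delayed_norm x (t, \<omega>) = (\<integral>\<^sup>+s. ennreal (norm (delay_weight t s \<omega> *\<^sub>R x s \<omega>)) \<partial>time_measure 0 T)"
  unfolding delayed_norm_def nn_integral_time_measure prod.case
  using x0 w delay_nonneg by (intro nn_integral_cong) (auto simp: indicator_def vanishes_before_0_def)

lemma delayed_eq_0:
  fixes x :: "real \<Rightarrow> 'w \<Rightarrow> 'h::euclidean_space"
  assumes x: "LpF P 2 {-\<delta>..T} x" and x0: "vanishes_before_0 x" and t: "t \<in> {0..T}" and w: "\<omega> \<in> space M"
  shows "delayed P x t \<omega> = (\<integral>s. delay_weight t s \<omega> *\<^sub>R x s \<omega> \<partial>time_measure 0 T)"
proof -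
  have m: "jointly_measurable (-\<delta>) T x"
    using x by (auto simp: LpF_2_iff sq_integrable_def)
  show ?thesis
    unfolding delayed_eq(1)[OF m t w] integral_time_measure set_lebesgue_integral_def
    using x0 w delay_nonneg by (intro Bochner_Integration.integral_cong) (auto simp: indicator_def vanishes_before_0_def)
qed

text \<open>
  The hypotheses of Fubini's theorem for the adjointness below: the integral of the absolute values is
  at most the pairing of \<open>|G|\<close> with the square-integrable delay integral of \<open>|x|\<close>.
\<close>

lemma delay_swap:
  fixes G x :: "real \<Rightarrow> 'w \<Rightarrow> 'h::euclidean_space"
  assumes G: "sq_process 0 T G"
    and x: "LpF P 2 {-\<delta>..T} x" and x0: "vanishes_before_0 x"
  defines "\<Phi> \<equiv> \<lambda>t s \<omega>. delay_weight t s \<omega> * (G t \<omega> \<bullet> x s \<omega>)"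
  shows "(\<lambda>((t, \<omega>), s). \<Phi> t s \<omega>) \<in> borel_measurable (PM 0 T \<Otimes>\<^sub>M time_measure 0 T)"
    and "(\<integral>\<^sup>+p. (\<integral>\<^sup>+s. ennreal \<bar>\<Phi> (fst p) s (snd p)\<bar> \<partial>time_measure 0 T) \<partial>PM 0 T) < \<infinity>"
proof -
  note Gm = sq_integrable_measurable[OF G]
  have xs: "sq_process 0 T x"
    using LpF_2_sub_interval[OF x, of 0 T] delay_nonneg by (simp add: LpF_2_iff)
  note xm = sq_integrable_measurable[OF xs]
  have m: "jointly_measurable (-\<delta>) T x"
    using x by (auto simp: LpF_2_iff sq_integrable_def)
  have dens: "(\<lambda>q. delay_density P (snd q)) \<in> borel_measurable (PM 0 T \<Otimes>\<^sub>M time_measure 0 T)"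
    by (intro measurable_compose[OF measurable_compose[OF measurable_snd time_measure_id] delay_density_measurable])
  have "(\<lambda>q. G (fst (fst q)) (snd (fst q)) \<bullet> x (snd q) (snd (fst q))) \<in> borel_measurable (PM 0 T \<Otimes>\<^sub>M time_measure 0 T)"
    by (rule borel_measurable_inner; rule measurable_curried[OF Gm] measurable_curried[OF xm]; measurable)
  with dens window_measurable
  have "(\<lambda>q. delay_density P (snd q) * (\<lambda>((t, \<omega>), s). window_kernel t s \<omega>) q * (G (fst (fst q)) (snd (fst q)) \<bullet> x (snd q) (snd (fst q))))
      \<in> borel_measurable (PM 0 T \<Otimes>\<^sub>M time_measure 0 T)"
    by (intro borel_measurable_times)
  then show "(\<lambda>((t, \<omega>), s). \<Phi> t s \<omega>) \<in> borel_measurable (PM 0 T \<Otimes>\<^sub>M time_measure 0 T)"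
    by (simp add: \<Phi>_def delay_weight_window split_def)
  have "(\<integral>\<^sup>+p. (\<integral>\<^sup>+s. ennreal \<bar>\<Phi> (fst p) s (snd p)\<bar> \<partial>time_measure 0 T) \<partial>PM 0 T)
      \<le> (\<integral>\<^sup>+p. ennreal (norm ((\<lambda>(t, \<omega>). G t \<omega>) p)) * delayed_norm x p \<partial>PM 0 T)"
  proof (intro nn_integral_mono)
    fix p assume "p \<in> space (PM 0 T)"
    then obtain t \<omega> where p: "p = (t, \<omega>)" "t \<in> {0..T}" "\<omega> \<in> space M" by (auto simp: space_PM)
    have sm: "(\<lambda>s. ennreal (norm (delay_weight t s \<omega> *\<^sub>R x s \<omega>))) \<in> borel_measurable (time_measure 0 T)"
    proof -
      have "(\<lambda>s. delay_weight t s \<omega>) \<in> borel_measurable (time_measure 0 T)"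
        using p delay_nonneg by (intro delay_weight_measurable measurable_time_mono) auto
      then have "(\<lambda>s. delay_weight t s \<omega> *\<^sub>R x s \<omega>) \<in> borel_measurable (time_measure 0 T)"
        using section_measurable(1)[OF xm p(3)] by measurable
      then show ?thesis by (intro measurable_compose[OF measurable_compose[OF _ borel_measurable_norm] measurable_ennreal])
    qed
    have "(\<integral>\<^sup>+s. ennreal \<bar>\<Phi> t s \<omega>\<bar> \<partial>time_measure 0 T)
        \<le> (\<integral>\<^sup>+s. ennreal (norm (G t \<omega>)) * ennreal (norm (delay_weight t s \<omega> *\<^sub>R x s \<omega>)) \<partial>time_measure 0 T)"
    proof (intro nn_integral_mono)
      fix s
      have "\<bar>\<Phi> t s \<omega>\<bar> \<le> \<bar>delay_weight t s \<omega>\<bar> * (norm (G t \<omega>) * norm (x s \<omega>))"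
        unfolding \<Phi>_def abs_mult by (intro mult_left_mono Cauchy_Schwarz_ineq2) auto
      also have "\<dots> = norm (G t \<omega>) * norm (delay_weight t s \<omega> *\<^sub>R x s \<omega>)" by simp
      finally show "ennreal \<bar>\<Phi> t s \<omega>\<bar> \<le> ennreal (norm (G t \<omega>)) * ennreal (norm (delay_weight t s \<omega> *\<^sub>R x s \<omega>))"
        by (simp add: ennreal_mult[symmetric] ennreal_leI del: norm_scaleR)
    qed
    also have "\<dots> = ennreal (norm (G t \<omega>)) * delayed_norm x (t, \<omega>)"
      unfolding delayed_norm_eq[OF x0 p(3)] by (rule nn_integral_cmult[OF sm])
    finally show "(\<integral>\<^sup>+s. ennreal \<bar>\<Phi> (fst p) s (snd p)\<bar> \<partial>time_measure 0 T) \<le> ennreal (norm ((\<lambda>(t, \<omega>). G t \<omega>) p)) * delayed_norm x p"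
      by (simp add: p(1))
  qed
  also have "\<dots> < \<infinity>"
  proof -
    have nm: "(\<lambda>p. ennreal (norm ((\<lambda>(t, \<omega>). G t \<omega>) p))) \<in> borel_measurable (PM 0 T)"
      by (intro measurable_compose[OF measurable_compose[OF Gm borel_measurable_norm] measurable_ennreal])
    have "(\<integral>\<^sup>+p. ennreal (norm ((\<lambda>(t, \<omega>). G t \<omega>) p)) * delayed_norm x p \<partial>PM 0 T)\<^sup>2
        \<le> (\<integral>\<^sup>+p. ennreal (norm ((\<lambda>(t, \<omega>). G t \<omega>) p)) ^ 2 \<partial>PM 0 T) * (\<integral>\<^sup>+p. (delayed_norm x p) ^ 2 \<partial>PM 0 T)"
      by (rule Cauchy_Schwarz_nn_integral[OF nm delayed_measurable(2)[OF m]])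
    also have "\<dots> < \<infinity>"
      using G delayed_norm_L2[OF x] by (auto simp: sq_integrable_iff_nn ennreal_power ennreal_mult_less_top)
    finally show ?thesis by (simp add: power_less_top_ennreal)
  qed
  finally show "(\<integral>\<^sup>+p. (\<integral>\<^sup>+s. ennreal \<bar>\<Phi> (fst p) s (snd p)\<bar> \<partial>time_measure 0 T) \<partial>PM 0 T) < \<infinity>" .
qed

text \<open>
  Interchanging the two times, which \<open>delay_swap\<close> justifies, moves the kernel from \<open>x\<close> to \<open>G\<close>: the delay
  operator \<open>x \<mapsto> x\<^sub>\<delta>\<close> and the anticipating operator \<open>G \<mapsto> (\<alpha>(dt)/dt) \<integral> \<phi>(s,t) G(s) ds\<close> are adjoint.
\<close>

lemma delay_anticipation_adjoint:
  fixes G x :: "real \<Rightarrow> 'w \<Rightarrow> 'h::euclidean_space"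
  assumes G: "sq_process 0 T G"
    and x: "LpF P 2 {-\<delta>..T} x" and x0: "vanishes_before_0 x"
  shows "pairing 0 T G (delayed P x)
      = (\<integral>s. delay_density P s * expectation (\<lambda>\<omega>. anticipated P G s \<omega> \<bullet> x s \<omega>) \<partial>time_measure 0 T)"
    and "integrable (time_measure 0 T) (\<lambda>s. delay_density P s * expectation (\<lambda>\<omega>. anticipated P G s \<omega> \<bullet> x s \<omega>))"
proof -
  interpret pair_sigma_finite "time_measure 0 T" M by (rule pair_time)
  define \<Phi> where "\<Phi> t s \<omega> = delay_weight t s \<omega> * (G t \<omega> \<bullet> x s \<omega>)" for t s \<omega>
  note sw = delay_swap[OF G x x0, folded \<Phi>_def]
  note fub = fubini_two_times[OF sw]
  have dm: "jointly_measurable 0 T (delayed P x)"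
    by (rule sq_integrable_measurable[OF delayed_sq_integrable[OF x]])
  have per_time: "(\<integral>\<omega>. (\<integral>t. \<Phi> t s \<omega> \<partial>time_measure 0 T) \<partial>M) = delay_density P s * expectation (\<lambda>\<omega>. anticipated P G s \<omega> \<bullet> x s \<omega>)"
    if s: "s \<in> {0..T}" for s
  proof -
    have xm: "x s \<in> borel_measurable M"
      using x s delay_nonneg by (auto simp: LpF_2_iff intro!: filt_measurable)
    have "(\<integral>\<omega>. (\<integral>t. \<Phi> t s \<omega> \<partial>time_measure 0 T) \<partial>M) = (\<integral>\<omega>. delay_density P s * (anticipated P G s \<omega> \<bullet> x s \<omega>) \<partial>M)"
    proof (rule integral_cong_AE)
      show "(\<lambda>\<omega>. \<integral>t. \<Phi> t s \<omega> \<partial>time_measure 0 T) \<in> borel_measurable M"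
        using section_measurable(2)[OF borel_measurable_integrable[OF fub(3)] s] .
      show "(\<lambda>\<omega>. delay_density P s * (anticipated P G s \<omega> \<bullet> x s \<omega>)) \<in> borel_measurable M"
        using sq_integrable_measurable[OF anticipated_sq_integrable(1)[OF G s]] xm by measurable
      show "AE \<omega> in M. (\<integral>t. \<Phi> t s \<omega> \<partial>time_measure 0 T) = delay_density P s * (anticipated P G s \<omega> \<bullet> x s \<omega>)"
        using anticipated_sq_integrable(2)[OF G s]
      proof eventually_elim
        case (elim \<omega>)
        have "(\<integral>t. \<Phi> t s \<omega> \<partial>time_measure 0 T) = (\<integral>t. delay_density P s * ((window_kernel t s \<omega> *\<^sub>R G t \<omega>) \<bullet> x s \<omega>) \<partial>time_measure 0 T)"
          by (simp add: \<Phi>_def delay_weight_window mult.assoc)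
        also have "\<dots> = delay_density P s * (anticipated P G s \<omega> \<bullet> x s \<omega>)"
          unfolding anticipated_eq[OF s] using elim by (simp only: integral_mult_right_zero integral_inner_left)
        finally show ?case .
      qed
    qed
    then show "(\<integral>\<omega>. (\<integral>t. \<Phi> t s \<omega> \<partial>time_measure 0 T) \<partial>M) = delay_density P s * expectation (\<lambda>\<omega>. anticipated P G s \<omega> \<bullet> x s \<omega>)"
      by simp
  qed
  show "integrable (time_measure 0 T) (\<lambda>s. delay_density P s * expectation (\<lambda>\<omega>. anticipated P G s \<omega> \<bullet> x s \<omega>))"
    by (rule Bochner_Integration.integrable_cong[THEN iffD1, OF refl _ integrable_fst'[OF fub(3)]]) (simp add: per_time)
  have "pairing 0 T G (delayed P x) = (\<integral>p. (\<integral>s. \<Phi> (fst p) s (snd p) \<partial>time_measure 0 T) \<partial>PM 0 T)"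
  proof (rule integral_cong_AE)
    show "(\<lambda>p. G (fst p) (snd p) \<bullet> delayed P x (fst p) (snd p)) \<in> borel_measurable (PM 0 T)"
      using borel_measurable_inner[OF sq_integrable_measurable[OF G] dm] by (simp add: split_def)
    show "(\<lambda>p. \<integral>s. \<Phi> (fst p) s (snd p) \<partial>time_measure 0 T) \<in> borel_measurable (PM 0 T)"
      using borel_measurable_integrable[OF fub(2)] by (simp add: split_def)
    show "AE p in PM 0 T. G (fst p) (snd p) \<bullet> delayed P x (fst p) (snd p) = (\<integral>s. \<Phi> (fst p) s (snd p) \<partial>time_measure 0 T)"
      using AE_delay_integrable[OF x] AE_space
    proof eventually_elim
      case (elim p)
      have p: "fst p \<in> {0..T}" "snd p \<in> space M" using elim(2) by (auto simp: space_PM)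
      have "integrable (time_measure 0 T) (\<lambda>s. delay_weight (fst p) s (snd p) *\<^sub>R x s (snd p))"
      proof -
        have sub: "set_integrable lborel {-\<delta>..T} (\<lambda>s. delay_weight (fst p) s (snd p) *\<^sub>R x s (snd p))"
          using elim(1) unfolding time_measure_def set_integrable_def by (subst (asm) integrable_restrict_space) auto
        have "set_integrable lborel {0..T} (\<lambda>s. delay_weight (fst p) s (snd p) *\<^sub>R x s (snd p))"
          by (rule set_integrable_subset[OF sub]) (use delay_nonneg in auto)
        then show ?thesis
          unfolding time_measure_def set_integrable_def by (subst integrable_restrict_space) auto
      qed
      then show ?case
        unfolding delayed_eq_0[OF x x0 p] \<Phi>_def by (simp add: integral_inner_right[symmetric])
    qed
  qed
  also have "\<dots> = (\<integral>p. (\<integral>t. \<Phi> t (fst p) (snd p) \<partial>time_measure 0 T) \<partial>PM 0 T)" by (rule fub(4))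
  also have "\<dots> = (\<integral>s. (\<integral>\<omega>. (\<integral>t. \<Phi> t s \<omega> \<partial>time_measure 0 T) \<partial>M) \<partial>time_measure 0 T)"
    using integral_fst'[OF fub(3)] by (simp add: split_def)
  also have "\<dots> = (\<integral>s. delay_density P s * expectation (\<lambda>\<omega>. anticipated P G s \<omega> \<bullet> x s \<omega>) \<partial>time_measure 0 T)"
    by (rule Bochner_Integration.integral_cong[OF refl]) (simp add: per_time)
  finally show "pairing 0 T G (delayed P x)
      = (\<integral>s. delay_density P s * expectation (\<lambda>\<omega>. anticipated P G s \<omega> \<bullet> x s \<omega>) \<partial>time_measure 0 T)" .
qed

lemma section_sq_adapted:
  assumes x: "LpF P 2 {-\<delta>..T} x"
  shows "AE s in time_measure 0 T. s \<in> {0..T} \<and> sq_integrable M (x s) \<and> x s \<in> borel_measurable (filt P s)"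
proof -
  have "LpF P 2 {0..T} x" using LpF_2_sub_interval[OF x, of 0 T] delay_nonneg by simp
  then have sq: "sq_process 0 T x" and ad: "\<forall>s\<in>{0..T}. x s \<in> borel_measurable (filt P s)"
    by (simp_all add: LpF_2_iff)
  show ?thesis using AE_sections_sq_integrable[OF sq] AE_space
  proof eventually_elim
    case (elim s)
    then show ?case using ad by simp
  qed
qed

text \<open>
  For each coordinate, \<open>square_integrable_by_duality\<close> is applied to the absolute value of this process.
  The test function of it is an adapted square-integrable process \<open>x\<close>; by conditioning, its pairing with
  the absolute value is at most the pairing of \<open>x\<close> with the anticipating integral of \<open>|G|\<close>, and this is
  finite because \<open>x\<^sub>\<delta>\<close> is square integrable.
\<close>

lemma density_cond_exp_sq_integrable:
  fixes G :: "real \<Rightarrow> 'w \<Rightarrow> 'h::euclidean_space"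
  assumes G: "sq_process 0 T G" and q: "cond_exp_process P (anticipated P G) q"
  shows "sq_process 0 T (\<lambda>t \<omega>. delay_density P t *\<^sub>R q t \<omega>)"
proof -
  interpret pair_sigma_finite "time_measure 0 T" M by (rule pair_time)
  have qm: "jointly_measurable 0 T q" and qad: "\<And>t. t \<in> {0..T} \<Longrightarrow> q t \<in> borel_measurable (filt P t)"
    and qc: "\<And>t. t \<in> {0..T} \<Longrightarrow> AE \<omega> in M. q t \<omega> = cond_expectation M (filt P t) (anticipated P G t) \<omega>"
    using q unfolding cond_exp_process_def measurable_adapted_def measurable_PM_iff by blast+
  have dm: "(\<lambda>p. delay_density P (fst p)) \<in> borel_measurable (PM 0 T)"
    by (intro measurable_compose[OF measurable_compose[OF measurable_fst time_measure_id] delay_density_measurable])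
  define a where "a b p = delay_density P (fst p) * \<bar>q (fst p) (snd p) \<bullet> b\<bar>" for b p
  have qm': "(\<lambda>p. q (fst p) (snd p)) \<in> borel_measurable (PM 0 T)" using qm by (simp add: split_def)
  have am: "a b \<in> borel_measurable (PM 0 T)" for b
    unfolding a_def[abs_def] using dm qm' by measurable
  have a0: "0 \<le> a b p" for b p by (simp add: a_def)
  have "(\<integral>\<^sup>+p. ennreal ((a b p)\<^sup>2) \<partial>PM 0 T) < \<infinity>" if b: "b \<in> Basis" for b
  proof (rule square_integrable_by_duality[OF finite_PM am a0])
    fix \<Psi> :: "real \<Rightarrow> real"
    assume \<Psi>[measurable]: "\<Psi> \<in> borel_measurable borel" and \<Psi>0: "\<And>r. 0 \<le> \<Psi> r"
      and fin: "(\<integral>\<^sup>+p. ennreal ((\<Psi> (a b p))\<^sup>2) \<partial>PM 0 T) < \<infinity>"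
    define x where "x t \<omega> = (if 0 \<le> t then \<Psi> (a b (t, \<omega>)) else 0)" for t \<omega>
    have x_nonneg: "0 \<le> x t \<omega>" for t \<omega> using \<Psi>0 by (simp add: x_def)
    have "LpF P 2 {0..T} x"
      unfolding LpF_2_iff
    proof (intro conjI ballI)
      have "sq_integrable (PM 0 T) (\<lambda>p. \<Psi> (a b p))"
        unfolding sq_integrable_iff_nn using fin am by (simp add: measurable_compose[OF am \<Psi>])
      then show "sq_process 0 T x"
      proof (rule sq_integrable_cong_AE)
        show "jointly_measurable 0 T x"
          using measurable_compose[OF am[of b] \<Psi>]
          by (subst measurable_cong[where g="\<lambda>p. \<Psi> (a b p)"]) (auto simp: space_PM x_def)
        show "AE p in PM 0 T. \<Psi> (a b p) = (\<lambda>(t, \<omega>). x t \<omega>) p" by (rule AE_I2) (auto simp: space_PM x_def)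
      qed
      fix t assume t: "t \<in> {0..T}"
      have "(\<lambda>\<omega>. \<Psi> (delay_density P t * \<bar>q t \<omega> \<bullet> b\<bar>)) \<in> borel_measurable (filt P t)"
        using qad[OF t] by measurable
      then show "x t \<in> borel_measurable (filt P t)" using t by (simp add: x_def[abs_def] a_def)
    qed
    then have xL: "LpF P 2 {-\<delta>..T} x" by (rule LpF_2_glue[OF LpF_2_zero]) (auto simp: x_def)
    have x0: "vanishes_before_0 x" by (auto simp: vanishes_before_0_def x_def)
    define \<Phi> where "\<Phi> t s \<omega> = delay_weight t s \<omega> * (norm (G t \<omega>) \<bullet> x s \<omega>)" for t s \<omega>
    have nG: "sq_process 0 T (\<lambda>t \<omega>. norm (G t \<omega>))"
      using sq_integrable_norm[OF G] by (simp add: split_def)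
    note sw = delay_swap[OF nG xL x0, folded \<Phi>_def]
    note fub = fubini_two_times[OF sw]
    define J where "J p = (\<integral>\<^sup>+t. ennreal \<bar>\<Phi> t (fst p) (snd p)\<bar> \<partial>time_measure 0 T)" for p
    have Jm: "J \<in> borel_measurable (PM 0 T)"
    proof -
      have "(\<lambda>q. ((snd q, snd (fst q)), fst (fst q))) \<in> measurable (PM 0 T \<Otimes>\<^sub>M time_measure 0 T) (PM 0 T \<Otimes>\<^sub>M time_measure 0 T)"
        by measurable
      from measurable_compose[OF this sw(1)]
      have "(\<lambda>q. ennreal \<bar>\<Phi> (snd q) (fst (fst q)) (snd (fst q))\<bar>) \<in> borel_measurable (PM 0 T \<Otimes>\<^sub>M time_measure 0 T)"
        by (simp add: split_def)
      from sigma_finite_measure.borel_measurable_nn_integral_fst[OF sigma_finite_time_measure this]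
      show ?thesis by (simp add: J_def[abs_def])
    qed
    have "(\<integral>\<^sup>+p. ennreal (a b p * \<Psi> (a b p)) \<partial>PM 0 T) = (\<integral>\<^sup>+s. (\<integral>\<^sup>+\<omega>. ennreal (a b (s, \<omega>) * \<Psi> (a b (s, \<omega>))) \<partial>M) \<partial>time_measure 0 T)"
    proof (rule nn_integral_PM_fst[symmetric])
      show "(\<lambda>p. ennreal (a b p * \<Psi> (a b p))) \<in> borel_measurable (PM 0 T)" using am[of b] by measurable
    qed
    also have "\<dots> \<le> (\<integral>\<^sup>+s. (\<integral>\<^sup>+\<omega>. J (s, \<omega>) \<partial>M) \<partial>time_measure 0 T)"
    proof (rule nn_integral_mono_AE)
      show "AE s in time_measure 0 T. (\<integral>\<^sup>+\<omega>. ennreal (a b (s, \<omega>) * \<Psi> (a b (s, \<omega>))) \<partial>M) \<le> (\<integral>\<^sup>+\<omega>. J (s, \<omega>) \<partial>M)"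
        using section_sq_adapted[OF xL]
      proof eventually_elim
        case (elim s)
        then have s: "s \<in> {0..T}" and xs: "sq_integrable M (x s)" and xad: "x s \<in> borel_measurable (filt P s)" by auto
        interpret cond: sigma_finite_subalgebra M "filt P s" by (rule sigma_finite_subalgebra_filt)
        define A where "A = anticipated P G s"
        have A: "sq_integrable M A" unfolding A_def by (rule anticipated_sq_integrable(1)[OF G s])
        define c where "c = real_cond_exp M (filt P s) (\<lambda>\<omega>. A \<omega> \<bullet> b)"
        have cm: "c \<in> borel_measurable (filt P s)" by (simp add: c_def)
        have qc': "AE \<omega> in M. q s \<omega> \<bullet> b = c \<omega>"
          using qc[OF s] by eventually_elim (simp add: cond_expectation_inner_basis[OF b] A_def c_def)
        define f where "f \<omega> = sgn (c \<omega>) * x s \<omega>" for \<omega>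
        have fm: "f \<in> borel_measurable (filt P s)" unfolding f_def[abs_def] using cm xad by measurable
        have fsq: "sq_integrable M f"
          by (rule sq_integrable_bound[where f="\<lambda>\<omega>. norm (x s \<omega>)"])
            (use xs filt_measurable[OF fm] in \<open>auto simp: sq_integrable_def f_def abs_mult sgn_if\<close>)
        have fA: "integrable M (\<lambda>\<omega>. f \<omega> * (A \<omega> \<bullet> b))"
          by (intro integrable_mult_sq fsq sq_integrable_inner_const A)
        have Ab: "(\<lambda>\<omega>. A \<omega> \<bullet> b) \<in> borel_measurable M" using sq_integrable_measurable[OF A] by measurable
        note fc = cond.real_cond_exp_intg[OF fA fm Ab, folded c_def]
        have fc_eq: "f \<omega> * c \<omega> = \<bar>c \<omega>\<bar> * x s \<omega>" for \<omega>
          using abs_sgn[of "c \<omega>"] by (simp add: f_def mult_ac)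
        have nA: "integrable M (\<lambda>\<omega>. norm (A \<omega>) * x s \<omega>)"
          using integrable_norm_mult[OF A xs] x_nonneg by simp
        have "(\<integral>\<^sup>+\<omega>. ennreal (a b (s, \<omega>) * \<Psi> (a b (s, \<omega>))) \<partial>M) = (\<integral>\<^sup>+\<omega>. ennreal (delay_density P s) * ennreal (f \<omega> * c \<omega>) \<partial>M)"
        proof (rule nn_integral_cong_AE)
          show "AE \<omega> in M. ennreal (a b (s, \<omega>) * \<Psi> (a b (s, \<omega>))) = ennreal (delay_density P s) * ennreal (f \<omega> * c \<omega>)"
            using qc'
          proof eventually_elim
            case (elim \<omega>)
            have "\<Psi> (a b (s, \<omega>)) = x s \<omega>" using s by (simp add: x_def)
            moreover have "a b (s, \<omega>) = delay_density P s * \<bar>c \<omega>\<bar>" by (simp add: a_def elim)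
            ultimately show ?case
              using x_nonneg[of s \<omega>] by (simp add: fc_eq ennreal_mult[symmetric] mult.assoc)
          qed
        qed
        also have "\<dots> = ennreal (delay_density P s) * (\<integral>\<^sup>+\<omega>. ennreal (f \<omega> * c \<omega>) \<partial>M)"
          by (rule nn_integral_cmult) (use fc(1) in auto)
        also have "(\<integral>\<^sup>+\<omega>. ennreal (f \<omega> * c \<omega>) \<partial>M) = ennreal (expectation (\<lambda>\<omega>. f \<omega> * c \<omega>))"
          using fc(1) x_nonneg by (intro nn_integral_eq_integral) (auto simp: fc_eq)
        also have "expectation (\<lambda>\<omega>. f \<omega> * c \<omega>) = expectation (\<lambda>\<omega>. f \<omega> * (A \<omega> \<bullet> b))" by (rule fc(2))
        also have "ennreal \<dots> \<le> ennreal (expectation (\<lambda>\<omega>. norm (A \<omega>) * x s \<omega>))"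
        proof (intro ennreal_leI integral_mono fA nA)
          fix \<omega>
          have "f \<omega> * (A \<omega> \<bullet> b) \<le> \<bar>f \<omega>\<bar> * \<bar>A \<omega> \<bullet> b\<bar>" by (simp add: abs_mult[symmetric])
          also have "\<dots> \<le> x s \<omega> * norm (A \<omega>)"
            using x_nonneg[of s \<omega>] Basis_le_norm[OF b, of "A \<omega>"]
            by (intro mult_mono) (auto simp: f_def abs_mult sgn_if)
          finally show "f \<omega> * (A \<omega> \<bullet> b) \<le> norm (A \<omega>) * x s \<omega>" by (simp add: mult.commute)
        qed
        also have "ennreal (expectation (\<lambda>\<omega>. norm (A \<omega>) * x s \<omega>)) = (\<integral>\<^sup>+\<omega>. ennreal (norm (A \<omega>) * x s \<omega>) \<partial>M)"
          using nA x_nonneg by (intro nn_integral_eq_integral[symmetric]) auto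
        also have "ennreal (delay_density P s) * (\<integral>\<^sup>+\<omega>. ennreal (norm (A \<omega>) * x s \<omega>) \<partial>M)
            = (\<integral>\<^sup>+\<omega>. ennreal (delay_density P s) * ennreal (norm (A \<omega>) * x s \<omega>) \<partial>M)"
          by (rule nn_integral_cmult[symmetric]) (use nA in auto)
        also have "\<dots> \<le> (\<integral>\<^sup>+\<omega>. J (s, \<omega>) \<partial>M)"
        proof (rule nn_integral_mono_AE)
          show "AE \<omega> in M. ennreal (delay_density P s) * ennreal (norm (A \<omega>) * x s \<omega>) \<le> J (s, \<omega>)"
            using anticipated_sq_integrable(2)[OF G s] AE_space
          proof eventually_elim
            case (elim \<omega>)
            have "ennreal (norm (A \<omega>)) \<le> (\<integral>\<^sup>+t. ennreal (norm (window_kernel t s \<omega> *\<^sub>R G t \<omega>)) \<partial>time_measure 0 T)"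
              unfolding A_def anticipated_eq[OF s] by (rule integral_norm_bound_ennreal[OF elim(1)])
            then have "ennreal (delay_density P s * x s \<omega>) * ennreal (norm (A \<omega>))
                \<le> ennreal (delay_density P s * x s \<omega>) * (\<integral>\<^sup>+t. ennreal (norm (window_kernel t s \<omega> *\<^sub>R G t \<omega>)) \<partial>time_measure 0 T)"
              by (rule mult_left_mono) simp
            also have "\<dots> = (\<integral>\<^sup>+t. ennreal (delay_density P s * x s \<omega>) * ennreal (norm (window_kernel t s \<omega> *\<^sub>R G t \<omega>)) \<partial>time_measure 0 T)"
              by (rule nn_integral_cmult[symmetric])
                (use elim(1) in \<open>intro measurable_compose[OF measurable_compose[OF _ borel_measurable_norm] measurable_ennreal] borel_measurable_integrable\<close>)
            also have "\<dots> = J (s, \<omega>)"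
              unfolding J_def using x_nonneg[of s \<omega>]
              by (intro nn_integral_cong) (simp add: \<Phi>_def delay_weight_window abs_mult ennreal_mult[symmetric] mult_ac)
            finally show ?case using x_nonneg[of s \<omega>] by (simp add: ennreal_mult[symmetric] mult_ac)
          qed
        qed
        finally show ?case by (simp add: mult_left_mono)
      qed
    qed
    also have "\<dots> = (\<integral>\<^sup>+p. J p \<partial>PM 0 T)" by (rule nn_integral_PM_fst[OF Jm])
    also have "\<dots> < \<infinity>" using fub(1) by (simp add: J_def)
    finally show "(\<integral>\<^sup>+p. ennreal (a b p * \<Psi> (a b p)) \<partial>PM 0 T) < \<infinity>" .
  qed
  then have asq: "integrable (PM 0 T) (\<lambda>p. (a b p)\<^sup>2)" if "b \<in> Basis" for b
    using that am[of b] by (simp add: integrable_iff_bounded)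
  have "sq_integrable (PM 0 T) (\<lambda>p. \<Sum>b\<in>Basis. (delay_density P (fst p) * (q (fst p) (snd p) \<bullet> b)) *\<^sub>R b)"
  proof (rule sq_integrable_sum)
    fix b :: 'h assume b: "b \<in> Basis"
    show "sq_integrable (PM 0 T) (\<lambda>p. (delay_density P (fst p) * (q (fst p) (snd p) \<bullet> b)) *\<^sub>R b)"
    proof (rule sq_integrable_bound[OF asq[OF b]])
      show "(\<lambda>p. (delay_density P (fst p) * (q (fst p) (snd p) \<bullet> b)) *\<^sub>R b) \<in> borel_measurable (PM 0 T)"
        using dm qm' by measurable
      show "AE p in PM 0 T. norm ((delay_density P (fst p) * (q (fst p) (snd p) \<bullet> b)) *\<^sub>R b) \<le> a b p"
        using b by (intro AE_I2) (simp add: a_def abs_mult)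
    qed
  qed
  also have "(\<lambda>p. \<Sum>b\<in>Basis. (delay_density P (fst p) * (q (fst p) (snd p) \<bullet> b)) *\<^sub>R b) = (\<lambda>(t, \<omega>). delay_density P t *\<^sub>R q t \<omega>)"
    by (auto simp: fun_eq_iff scaleR_scaleR[symmetric] scaleR_sum_right[symmetric] euclidean_representation simp del: scaleR_scaleR)
  finally show ?thesis .
qed

text \<open>
  Adjointness combined with \<open>cond_expectation_pairing\<close> at almost every time.
\<close>

lemma delay_duality:
  fixes G x q :: "real \<Rightarrow> 'w \<Rightarrow> 'h::euclidean_space"
  assumes G: "sq_process 0 T G" and q: "cond_exp_process P (anticipated P G) q"
    and x: "LpF P 2 {-\<delta>..T} x" and x0: "vanishes_before_0 x"
  shows "pairing 0 T G (delayed P x)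
      = pairing 0 T (\<lambda>t \<omega>. delay_density P t *\<^sub>R q t \<omega>) x"
proof -
  interpret pair_sigma_finite "time_measure 0 T" M by (rule pair_time)
  have xs: "sq_process 0 T x"
    using LpF_2_sub_interval[OF x, of 0 T] delay_nonneg by (simp add: LpF_2_iff)
  have int: "integrable (PM 0 T) (\<lambda>p. (delay_density P (fst p) *\<^sub>R q (fst p) (snd p)) \<bullet> x (fst p) (snd p))"
    using integrable_inner[OF density_cond_exp_sq_integrable[OF G q] xs] by (simp only: split_def)
  have qc: "\<And>t. t \<in> {0..T} \<Longrightarrow> AE \<omega> in M. q t \<omega> = cond_expectation M (filt P t) (anticipated P G t) \<omega>"
    and qad: "\<And>t. t \<in> {0..T} \<Longrightarrow> q t \<in> borel_measurable (filt P t)"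
    using q unfolding cond_exp_process_def measurable_adapted_def by blast+
  have sl: "AE s in time_measure 0 T. delay_density P s * expectation (\<lambda>\<omega>. anticipated P G s \<omega> \<bullet> x s \<omega>)
      = expectation (\<lambda>\<omega>. (delay_density P s *\<^sub>R q s \<omega>) \<bullet> x s \<omega>)"
    using section_sq_adapted[OF x]
  proof eventually_elim
    case (elim s)
    then have s: "s \<in> {0..T}" and xs: "sq_integrable M (x s)" and xad: "x s \<in> borel_measurable (filt P s)" by auto
    have "expectation (\<lambda>\<omega>. anticipated P G s \<omega> \<bullet> x s \<omega>) = expectation (\<lambda>\<omega>. cond_expectation M (filt P s) (anticipated P G s) \<omega> \<bullet> x s \<omega>)"
      by (rule cond_expectation_pairing(2)[OF anticipated_sq_integrable(1)[OF G s] xs xad, symmetric])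
    also have "\<dots> = expectation (\<lambda>\<omega>. q s \<omega> \<bullet> x s \<omega>)"
    proof (rule integral_cong_AE)
      show "(\<lambda>\<omega>. cond_expectation M (filt P s) (anticipated P G s) \<omega> \<bullet> x s \<omega>) \<in> borel_measurable M"
        using filt_measurable[OF cond_expectation_measurable] sq_integrable_measurable[OF xs] by measurable
      show "(\<lambda>\<omega>. q s \<omega> \<bullet> x s \<omega>) \<in> borel_measurable M"
        using filt_measurable[OF qad[OF s]] sq_integrable_measurable[OF xs] by measurable
      show "AE \<omega> in M. cond_expectation M (filt P s) (anticipated P G s) \<omega> \<bullet> x s \<omega> = q s \<omega> \<bullet> x s \<omega>"
        using qc[OF s] by eventually_elim simp
    qed
    finally show ?case by simp
  qed
  have "pairing 0 T G (delayed P x)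
      = (\<integral>s. expectation (\<lambda>\<omega>. (delay_density P s *\<^sub>R q s \<omega>) \<bullet> x s \<omega>) \<partial>time_measure 0 T)"
    unfolding delay_anticipation_adjoint(1)[OF G x x0]
  proof (rule integral_cong_AE[OF _ _ sl])
    show "(\<lambda>s. expectation (\<lambda>\<omega>. (delay_density P s *\<^sub>R q s \<omega>) \<bullet> x s \<omega>)) \<in> borel_measurable (time_measure 0 T)"
      using integrable_fst'[OF int] by simp
    have "jointly_measurable 0 T (\<lambda>s \<omega>. anticipated P G s \<omega> \<bullet> x s \<omega>)"
      using borel_measurable_inner[OF anticipated_measurable[OF sq_integrable_measurable[OF G]] sq_integrable_measurable[OF xs]]
      by (simp add: split_def)
    then have "(\<lambda>s. expectation (\<lambda>\<omega>. anticipated P G s \<omega> \<bullet> x s \<omega>)) \<in> borel_measurable (time_measure 0 T)"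
      by (rule expectation_measurable)
    then show "(\<lambda>s. delay_density P s * expectation (\<lambda>\<omega>. anticipated P G s \<omega> \<bullet> x s \<omega>)) \<in> borel_measurable (time_measure 0 T)"
      by (intro borel_measurable_times measurable_compose[OF time_measure_id delay_density_measurable])
  qed
  also have "\<dots> = pairing 0 T (\<lambda>t \<omega>. delay_density P t *\<^sub>R q t \<omega>) x"
    using integral_fst'[OF int] by simp
  finally show ?thesis .
qed

end

section \<open>Duality between the forward and the backward equation\<close>

context brownian_problem begin

lemma sq_integrable_snd:
  assumes X: "sq_integrable M X"
  shows "sq_integrable (PM a b) (\<lambda>p. X (snd p))"
proof -
  have m: "(\<lambda>p. X (snd p)) \<in> borel_measurable (PM a b)"
    using measurable_compose[OF measurable_snd sq_integrable_measurable[OF X]] .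
  then have "(\<lambda>p. ennreal ((norm (X (snd p)))\<^sup>2)) \<in> borel_measurable (PM a b)" by measurable
  from nn_integral_PM_fst[OF this]
  have "(\<integral>\<^sup>+p. ennreal ((norm (X (snd p)))\<^sup>2) \<partial>PM a b) = (\<integral>\<^sup>+t. (\<integral>\<^sup>+\<omega>. ennreal ((norm (X \<omega>))\<^sup>2) \<partial>M) \<partial>time_measure a b)"
    by simp
  also have "\<dots> < \<infinity>"
    using X finite_measure.emeasure_finite[OF finite_time_measure[of a b], of "{a..b}", unfolded less_top]
    by (simp add: sq_integrable_iff_nn ennreal_mult_less_top)
  finally show ?thesis using m by (simp add: sq_integrable_iff_nn)
qed

lemma integral_PM_iterated:
  fixes F :: "real \<Rightarrow> 'w \<Rightarrow> real"
  assumes "integrable (PM a b) (\<lambda>(t, \<omega>). F t \<omega>)"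
  shows "integrable (time_measure a b) (\<lambda>t. expectation (F t))"
    and "(\<integral>t. expectation (F t) \<partial>time_measure a b) = (\<integral>p. F (fst p) (snd p) \<partial>PM a b)"
proof -
  interpret pair_sigma_finite "time_measure a b" M by (rule pair_time)
  show "integrable (time_measure a b) (\<lambda>t. expectation (F t))"
    using integrable_fst'[OF assms] by simp
  show "(\<integral>t. expectation (F t) \<partial>time_measure a b) = (\<integral>p. F (fst p) (snd p) \<partial>PM a b)"
    using integral_fst'[OF assms] by (simp add: split_def)
qed

lemma integral_PM_inner_const:
  fixes X :: "'w \<Rightarrow> 'h::euclidean_space"
  assumes X: "sq_integrable M X" and G: "sq_process a b G"
  shows "integrable (PM a b) (\<lambda>(t, \<omega>). X \<omega> \<bullet> G t \<omega>)"
    and "(\<integral>t. expectation (\<lambda>\<omega>. X \<omega> \<bullet> G t \<omega>) \<partial>time_measure a b)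
      = expectation (\<lambda>\<omega>. X \<omega> \<bullet> (\<integral>t. G t \<omega> \<partial>time_measure a b))"
proof -
  interpret pair_sigma_finite "time_measure a b" M by (rule pair_time)
  show int: "integrable (PM a b) (\<lambda>(t, \<omega>). X \<omega> \<bullet> G t \<omega>)"
    using integrable_inner[OF sq_integrable_snd[OF X] G] by (simp add: split_def)
  have m: "(\<lambda>\<omega>. \<integral>t. X \<omega> \<bullet> G t \<omega> \<partial>time_measure a b) \<in> borel_measurable M"
    using integrable_snd[OF int] by simp
  have "(\<integral>t. expectation (\<lambda>\<omega>. X \<omega> \<bullet> G t \<omega>) \<partial>time_measure a b) = expectation (\<lambda>\<omega>. \<integral>t. X \<omega> \<bullet> G t \<omega> \<partial>time_measure a b)"
    by (rule Fubini_integral[OF int, symmetric])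
  also have "\<dots> = expectation (\<lambda>\<omega>. X \<omega> \<bullet> (\<integral>t. G t \<omega> \<partial>time_measure a b))"
  proof (rule integral_cong_AE[OF m])
    show "(\<lambda>\<omega>. X \<omega> \<bullet> (\<integral>t. G t \<omega> \<partial>time_measure a b)) \<in> borel_measurable M"
      by (rule borel_measurable_inner[OF sq_integrable_measurable[OF X] sq_integrable_measurable[OF time_integral_sq_integrable(3)[OF G]]])
    show "AE \<omega> in M. (\<integral>t. X \<omega> \<bullet> G t \<omega> \<partial>time_measure a b) = X \<omega> \<bullet> (\<integral>t. G t \<omega> \<partial>time_measure a b)"
      using time_integral_sq_integrable(1)[OF G] by eventually_elim (rule integral_inner_right)
  qed
  finally show "(\<integral>t. expectation (\<lambda>\<omega>. X \<omega> \<bullet> G t \<omega>) \<partial>time_measure a b)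
      = expectation (\<lambda>\<omega>. X \<omega> \<bullet> (\<integral>t. G t \<omega> \<partial>time_measure a b))" .
qed

lemma time_indicator_measurable:
  "(\<lambda>p. indicator J (fst p) :: real) \<in> borel_measurable (PM a b)" if "J \<in> sets borel"
  by (rule measurable_compose[OF measurable_compose[OF measurable_fst time_measure_id] borel_measurable_indicator[OF that]])

lemma sq_integrable_cutoff:
  fixes G :: "real \<Rightarrow> 'w \<Rightarrow> 'h::euclidean_space"
  assumes G: "sq_process a b G" and J: "J \<in> sets borel"
  shows "sq_process a b (\<lambda>t \<omega>. indicator J t *\<^sub>R G t \<omega>)"
proof (rule sq_integrable_bound[where f="\<lambda>p. norm ((\<lambda>(t, \<omega>). G t \<omega>) p)"])
  show "integrable (PM a b) (\<lambda>p. (norm ((\<lambda>(t, \<omega>). G t \<omega>) p))\<^sup>2)" using G by (simp add: sq_integrable_def)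
  show "jointly_measurable a b (\<lambda>t \<omega>. indicator J t *\<^sub>R G t \<omega>)"
    using borel_measurable_scaleR[OF time_indicator_measurable[OF J] sq_integrable_measurable[OF G]]
    by (simp add: split_def)
  show "AE p in PM a b. norm ((\<lambda>(t, \<omega>). indicator J t *\<^sub>R G t \<omega>) p) \<le> norm ((\<lambda>(t, \<omega>). G t \<omega>) p)"
    by (rule AE_I2) (auto simp: indicator_def)
qed

lemma integral_sub_interval:
  fixes h :: "real \<Rightarrow> 'h::euclidean_space"
  assumes "a \<le> a'" "b' \<le> b"
  shows "(\<integral>s. h s \<partial>time_measure a' b') = (\<integral>s. indicator {a'..b'} s *\<^sub>R h s \<partial>time_measure a b)"
  unfolding integral_time_measure set_lebesgue_integral_def
  using assms by (intro Bochner_Integration.integral_cong) (auto simp: indicator_def)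

lemma integrable_time_sub:
  fixes h :: "real \<Rightarrow> 'h::euclidean_space"
  assumes "integrable (time_measure a b) h" "a \<le> a'" "b' \<le> b"
  shows "integrable (time_measure a' b') h"
proof -
  have sub: "set_integrable lborel {a..b} h"
    using assms(1) unfolding time_measure_def set_integrable_def by (subst (asm) integrable_restrict_space) auto
  have "set_integrable lborel {a'..b'} h"
    by (rule set_integrable_subset[OF sub]) (use assms(2,3) in auto)
  then show ?thesis
    unfolding time_measure_def set_integrable_def by (subst integrable_restrict_space) auto
qed

text \<open>
  A backward equation with terminal value \<open>\<xi>\<close> and a forward equation with initial value \<open>p0\<close>, whose
  coefficients are given processes.
\<close>

definition backward_solution ::
  "real \<Rightarrow> ('w \<Rightarrow> real^'n) \<Rightarrow> (real \<Rightarrow> 'w \<Rightarrow> real^'n) \<Rightarrow> (real \<Rightarrow> 'w \<Rightarrow> real^'n) \<Rightarrow> (real \<Rightarrow> 'w \<Rightarrow> real^'d^'n) \<Rightarrow> bool" where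
  "backward_solution T \<xi> f y z \<longleftrightarrow> (\<forall>t\<in>{0..T}. y t \<in> borel_measurable (filt P t) \<and>
     (\<exists>I. has_ito_integral P t T z I \<and> (AE \<omega> in M. y t \<omega> = \<xi> \<omega> + (\<integral>s. f s \<omega> \<partial>time_measure t T) - I \<omega>)))"

definition forward_solution ::
  "real \<Rightarrow> ('w \<Rightarrow> real^'n) \<Rightarrow> (real \<Rightarrow> 'w \<Rightarrow> real^'n) \<Rightarrow> (real \<Rightarrow> 'w \<Rightarrow> real^'d^'n) \<Rightarrow> (real \<Rightarrow> 'w \<Rightarrow> real^'n) \<Rightarrow> bool" where
  "forward_solution T p0 b \<sigma> p \<longleftrightarrow> (\<forall>t\<in>{0..T}.
     (\<exists>I. has_ito_integral P 0 t \<sigma> I \<and> (AE \<omega> in M. p t \<omega> = p0 \<omega> + (\<integral>s. b s \<omega> \<partial>time_measure 0 t) + I \<omega>)))"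

lemma backward_difference:
  assumes f: "sq_process 0 T f" and f': "sq_process 0 T f'"
    and y: "backward_solution T \<xi> f y z" and y': "backward_solution T \<xi> f' y' z'" and t: "t \<in> {0..T}"
  obtains I I' where "has_ito_integral P t T z I" "has_ito_integral P t T z' I'"
    "AE \<omega> in M. y' t \<omega> - y t \<omega> = (\<integral>s. indicator {t..T} s *\<^sub>R (f' s \<omega> - f s \<omega>) \<partial>time_measure 0 T) - (I' \<omega> - I \<omega>)"
proof -
  obtain I where I: "has_ito_integral P t T z I" "AE \<omega> in M. y t \<omega> = \<xi> \<omega> + (\<integral>s. f s \<omega> \<partial>time_measure t T) - I \<omega>"
    using y t unfolding backward_solution_def by blast
  obtain I' where I': "has_ito_integral P t T z' I'" "AE \<omega> in M. y' t \<omega> = \<xi> \<omega> + (\<integral>s. f' s \<omega> \<partial>time_measure t T) - I' \<omega>"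
    using y' t unfolding backward_solution_def by blast
  have "AE \<omega> in M. y' t \<omega> - y t \<omega> = (\<integral>s. indicator {t..T} s *\<^sub>R (f' s \<omega> - f s \<omega>) \<partial>time_measure 0 T) - (I' \<omega> - I \<omega>)"
    using I(2) I'(2) time_integral_sq_integrable(1)[OF f] time_integral_sq_integrable(1)[OF f']
  proof eventually_elim
    case (elim \<omega>)
    have "integrable (time_measure t T) (\<lambda>s. f s \<omega>)" "integrable (time_measure t T) (\<lambda>s. f' s \<omega>)"
      using elim(3,4) t by (auto intro: integrable_time_sub)
    then have "(\<integral>s. f' s \<omega> - f s \<omega> \<partial>time_measure t T) = (\<integral>s. f' s \<omega> \<partial>time_measure t T) - (\<integral>s. f s \<omega> \<partial>time_measure t T)"
      by simp
    moreover have "(\<integral>s. indicator {t..T} s *\<^sub>R (f' s \<omega> - f s \<omega>) \<partial>time_measure 0 T) = (\<integral>s. f' s \<omega> - f s \<omega> \<partial>time_measure t T)"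
      using t by (intro integral_sub_interval[symmetric]) auto
    ultimately show ?case using elim(1,2) by simp
  qed
  from that[OF I(1) I'(1) this] show thesis .
qed

lemma sq_integrable_minus_processes:
  assumes "sq_process a b f" "sq_process a b f'"
  shows "sq_process a b (\<lambda>t \<omega>. f' t \<omega> - f t \<omega>)"
  using sq_integrable_diff[OF assms(2,1)] by (simp add: split_def)

text \<open>
  The difference of the stochastic integrals over \<open>[t, T]\<close> is orthogonal to \<open>X\<close>.
\<close>

lemma backward_difference_pairing:
  assumes f: "sq_process 0 T f" and f': "sq_process 0 T f'"
    and y: "backward_solution T \<xi> f y z" and y': "backward_solution T \<xi> f' y' z'" and t: "t \<in> {0..T}"
    and X: "X \<in> borel_measurable (filt P t)" "sq_integrable M X"
  shows "expectation (\<lambda>\<omega>. X \<omega> \<bullet> (y' t \<omega> - y t \<omega>))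
    = expectation (\<lambda>\<omega>. X \<omega> \<bullet> (\<integral>s. indicator {t..T} s *\<^sub>R (f' s \<omega> - f s \<omega>) \<partial>time_measure 0 T))"
    and "sq_integrable M (\<lambda>\<omega>. y' t \<omega> - y t \<omega>)"
proof -
  obtain I I' where I: "has_ito_integral P t T z I" "has_ito_integral P t T z' I'"
    and eq: "AE \<omega> in M. y' t \<omega> - y t \<omega> = (\<integral>s. indicator {t..T} s *\<^sub>R (f' s \<omega> - f s \<omega>) \<partial>time_measure 0 T) - (I' \<omega> - I \<omega>)"
    by (rule backward_difference[OF f f' y y' t])
  have t0: "0 \<le> t" using t by simp
  define g where "g \<omega> = (\<integral>s. indicator {t..T} s *\<^sub>R (f' s \<omega> - f s \<omega>) \<partial>time_measure 0 T)" for \<omega>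
  have g: "sq_integrable M g"
    unfolding g_def by (rule time_integral_sq_integrable(3)[OF sq_integrable_cutoff[OF sq_integrable_minus_processes[OF f f']]]) simp
  note sq = ito_sq(1)[OF I(1) t0] ito_sq(1)[OF I(2) t0]
  have rhs: "sq_integrable M (\<lambda>\<omega>. g \<omega> - (I' \<omega> - I \<omega>))" by (intro sq_integrable_diff g sq)
  have ym: "(\<lambda>\<omega>. y' t \<omega> - y t \<omega>) \<in> borel_measurable M"
    using y y' t unfolding backward_solution_def by (intro borel_measurable_diff filt_measurable[of _ t]) auto
  have eq': "AE \<omega> in M. y' t \<omega> - y t \<omega> = g \<omega> - (I' \<omega> - I \<omega>)" using eq by (simp add: g_def)
  show "sq_integrable M (\<lambda>\<omega>. y' t \<omega> - y t \<omega>)"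
    by (rule sq_integrable_cong_AE[OF rhs ym]) (use eq' in \<open>eventually_elim, simp\<close>)
  have "expectation (\<lambda>\<omega>. X \<omega> \<bullet> (y' t \<omega> - y t \<omega>)) = expectation (\<lambda>\<omega>. X \<omega> \<bullet> g \<omega> - (X \<omega> \<bullet> I' \<omega> - X \<omega> \<bullet> I \<omega>))"
  proof (rule integral_cong_AE)
    show "(\<lambda>\<omega>. X \<omega> \<bullet> (y' t \<omega> - y t \<omega>)) \<in> borel_measurable M"
      by (rule borel_measurable_inner[OF sq_integrable_measurable[OF X(2)] ym])
    show "(\<lambda>\<omega>. X \<omega> \<bullet> g \<omega> - (X \<omega> \<bullet> I' \<omega> - X \<omega> \<bullet> I \<omega>)) \<in> borel_measurable M"
      by (intro borel_measurable_diff borel_measurable_integrable[OF integrable_inner] X g sq)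
    show "AE \<omega> in M. X \<omega> \<bullet> (y' t \<omega> - y t \<omega>) = X \<omega> \<bullet> g \<omega> - (X \<omega> \<bullet> I' \<omega> - X \<omega> \<bullet> I \<omega>)"
      using eq' by eventually_elim (simp add: inner_diff_right)
  qed
  also have "\<dots> = expectation (\<lambda>\<omega>. X \<omega> \<bullet> g \<omega>) - (expectation (\<lambda>\<omega>. X \<omega> \<bullet> I' \<omega>) - expectation (\<lambda>\<omega>. X \<omega> \<bullet> I \<omega>))"
    using integrable_inner[OF X(2) g] integrable_inner[OF X(2) sq(1)] integrable_inner[OF X(2) sq(2)] by simp
  also have "\<dots> = expectation (\<lambda>\<omega>. X \<omega> \<bullet> g \<omega>)"
    using ito_orthogonal_past[OF I(1) t0 X] ito_orthogonal_past[OF I(2) t0 X] by simp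
  finally show "expectation (\<lambda>\<omega>. X \<omega> \<bullet> (y' t \<omega> - y t \<omega>))
    = expectation (\<lambda>\<omega>. X \<omega> \<bullet> (\<integral>s. indicator {t..T} s *\<^sub>R (f' s \<omega> - f s \<omega>) \<partial>time_measure 0 T))"
    by (simp add: g_def)
qed

text \<open>
  Both sides integrate \<open>\<langle>b(s), g(t)\<rangle>\<close> over \<open>s \<le> t\<close>.
\<close>

lemma causal_fubini:
  fixes b g :: "real \<Rightarrow> 'w \<Rightarrow> 'h::euclidean_space"
  assumes b: "sq_process 0 T b" and g: "sq_process 0 T g"
  shows "integrable (PM 0 T) (\<lambda>(t, \<omega>). (\<integral>s. b s \<omega> \<partial>time_measure 0 t) \<bullet> g t \<omega>)"
    and "(\<integral>s. expectation (\<lambda>\<omega>. b s \<omega> \<bullet> (\<integral>t. indicator {s..T} t *\<^sub>R g t \<omega> \<partial>time_measure 0 T)) \<partial>time_measure 0 T)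
       = (\<integral>t. expectation (\<lambda>\<omega>. (\<integral>s. b s \<omega> \<partial>time_measure 0 t) \<bullet> g t \<omega>) \<partial>time_measure 0 T)"
    and "(\<lambda>s. expectation (\<lambda>\<omega>. b s \<omega> \<bullet> (\<integral>t. indicator {s..T} t *\<^sub>R g t \<omega> \<partial>time_measure 0 T))) \<in> borel_measurable (time_measure 0 T)"
proof -
  define \<Phi> where "\<Phi> t s \<omega> = indicator {s..T} t * (b s \<omega> \<bullet> g t \<omega>)" for t s \<omega>
  note bm = sq_integrable_measurable[OF b] and gm = sq_integrable_measurable[OF g]
  have meas: "(\<lambda>((t, \<omega>), s). \<Phi> t s \<omega>) \<in> borel_measurable (PM 0 T \<Otimes>\<^sub>M time_measure 0 T)"
  proof -
    have [measurable]: "(\<lambda>q. fst (fst q)) \<in> borel_measurable (PM 0 T \<Otimes>\<^sub>M time_measure 0 T)"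
      "(\<lambda>q. snd q) \<in> borel_measurable (PM 0 T \<Otimes>\<^sub>M time_measure 0 T)"
      by (rule measurable_compose[OF measurable_compose[OF measurable_fst measurable_fst] time_measure_id]
          measurable_compose[OF measurable_snd time_measure_id])+
    have ind: "(\<lambda>q. if snd q \<le> fst (fst q) \<and> fst (fst q) \<le> T then 1 else 0 :: real) \<in> borel_measurable (PM 0 T \<Otimes>\<^sub>M time_measure 0 T)"
      by measurable
    have "(\<lambda>q. b (snd q) (snd (fst q)) \<bullet> g (fst (fst q)) (snd (fst q))) \<in> borel_measurable (PM 0 T \<Otimes>\<^sub>M time_measure 0 T)"
      by (rule borel_measurable_inner; rule measurable_curried[OF bm] measurable_curried[OF gm]; measurable)
    moreover have "(\<lambda>((t, \<omega>), s). \<Phi> t s \<omega>) = (\<lambda>q. (if snd q \<le> fst (fst q) \<and> fst (fst q) \<le> T then 1 else 0)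
        * (b (snd q) (snd (fst q)) \<bullet> g (fst (fst q)) (snd (fst q))))"
      by (auto simp: \<Phi>_def fun_eq_iff indicator_def)
    ultimately show ?thesis using borel_measurable_times[OF ind] by presburger
  qed
  have Tfin: "emeasure (time_measure 0 T) {0..T} < \<infinity>"
    using finite_measure.emeasure_finite[OF finite_time_measure[of 0 T], of "{0..T}", unfolded less_top] by simp
  have bsec: "(\<lambda>s. ennreal ((norm (b s \<omega>))\<^sup>2)) \<in> borel_measurable (time_measure 0 T)" if "\<omega> \<in> space M" for \<omega>
    using section_measurable(1)[OF bm that] by measurable
  define B where "B \<omega> = (\<integral>\<^sup>+s. ennreal ((norm (b s \<omega>))\<^sup>2) \<partial>time_measure 0 T)" for \<omega>
  have bsq: "(\<lambda>p. ennreal ((norm ((\<lambda>(t, \<omega>). b t \<omega>) p))\<^sup>2)) \<in> borel_measurable (PM 0 T)"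
    using bm by measurable
  have Bm: "B \<in> borel_measurable M" and Bint: "(\<integral>\<^sup>+\<omega>. B \<omega> \<partial>M) < \<infinity>"
  proof -
    interpret pair_sigma_finite "time_measure 0 T" M by (rule pair_time)
    show "B \<in> borel_measurable M"
      using sigma_finite_measure.borel_measurable_nn_integral[OF sigma_finite_time_measure measurable_pair_swap[OF bsq]]
      by (simp add: B_def[abs_def])
    show "(\<integral>\<^sup>+\<omega>. B \<omega> \<partial>M) < \<infinity>"
      unfolding B_def using nn_integral_snd[OF bsq] b by (simp add: sq_integrable_iff_nn)
  qed
  have gsq: "(\<lambda>p. ennreal ((norm ((\<lambda>(t, \<omega>). g t \<omega>) p))\<^sup>2)) \<in> borel_measurable (PM 0 T)"
    using gm by measurable
  have Bm': "(\<lambda>p. B (snd p)) \<in> borel_measurable (PM 0 T)" by (rule measurable_compose[OF measurable_snd Bm])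
  have "(\<integral>\<^sup>+p. (\<integral>\<^sup>+s. ennreal \<bar>\<Phi> (fst p) s (snd p)\<bar> \<partial>time_measure 0 T) \<partial>PM 0 T)
      \<le> (\<integral>\<^sup>+p. ennreal ((norm ((\<lambda>(t, \<omega>). g t \<omega>) p))\<^sup>2) * emeasure (time_measure 0 T) {0..T} + B (snd p) \<partial>PM 0 T)"
  proof (intro nn_integral_mono)
    fix p assume "p \<in> space (PM 0 T)"
    then obtain t \<omega> where p: "p = (t, \<omega>)" "\<omega> \<in> space M" by (auto simp: space_PM)
    have "(\<integral>\<^sup>+s. ennreal \<bar>\<Phi> t s \<omega>\<bar> \<partial>time_measure 0 T) \<le> (\<integral>\<^sup>+s. ennreal ((norm (g t \<omega>))\<^sup>2) + ennreal ((norm (b s \<omega>))\<^sup>2) \<partial>time_measure 0 T)"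
    proof (intro nn_integral_mono)
      fix s
      have "\<bar>\<Phi> t s \<omega>\<bar> \<le> \<bar>b s \<omega> \<bullet> g t \<omega>\<bar>" by (simp add: \<Phi>_def indicator_def)
      also have "\<dots> \<le> norm (b s \<omega>) * norm (g t \<omega>)" by (rule Cauchy_Schwarz_ineq2)
      also have "\<dots> \<le> (norm (g t \<omega>))\<^sup>2 + (norm (b s \<omega>))\<^sup>2"
      proof -
        have "2 * (norm (b s \<omega>) * norm (g t \<omega>)) \<le> (norm (b s \<omega>))\<^sup>2 + (norm (g t \<omega>))\<^sup>2"
          using sum_squares_bound[of "norm (b s \<omega>)" "norm (g t \<omega>)"] by (simp add: mult.assoc)
        moreover have "0 \<le> norm (b s \<omega>) * norm (g t \<omega>)" by simp
        ultimately show ?thesis by linarith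
      qed
      finally show "ennreal \<bar>\<Phi> t s \<omega>\<bar> \<le> ennreal ((norm (g t \<omega>))\<^sup>2) + ennreal ((norm (b s \<omega>))\<^sup>2)"
        by (simp add: ennreal_plus[symmetric] ennreal_leI del: ennreal_plus)
    qed
    also have "\<dots> = ennreal ((norm (g t \<omega>))\<^sup>2) * emeasure (time_measure 0 T) {0..T} + B \<omega>"
      unfolding B_def by (subst nn_integral_add[OF borel_measurable_const bsec[OF p(2)]]) simp
    finally show "(\<integral>\<^sup>+s. ennreal \<bar>\<Phi> (fst p) s (snd p)\<bar> \<partial>time_measure 0 T)
        \<le> ennreal ((norm ((\<lambda>(t, \<omega>). g t \<omega>) p))\<^sup>2) * emeasure (time_measure 0 T) {0..T} + B (snd p)"
      by (simp add: p(1))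
  qed
  also have "\<dots> = (\<integral>\<^sup>+p. ennreal ((norm ((\<lambda>(t, \<omega>). g t \<omega>) p))\<^sup>2) \<partial>PM 0 T) * emeasure (time_measure 0 T) {0..T} + (\<integral>\<^sup>+p. B (snd p) \<partial>PM 0 T)"
    using gsq Bm' by (subst nn_integral_add) (auto simp: nn_integral_multc)
  also have "(\<integral>\<^sup>+p. B (snd p) \<partial>PM 0 T) = (\<integral>\<^sup>+\<omega>. B \<omega> \<partial>M) * emeasure (time_measure 0 T) {0..T}"
    using nn_integral_PM_fst[OF Bm'] by simp
  also have "(\<integral>\<^sup>+p. ennreal ((norm ((\<lambda>(t, \<omega>). g t \<omega>) p))\<^sup>2) \<partial>PM 0 T) * emeasure (time_measure 0 T) {0..T}
      + (\<integral>\<^sup>+\<omega>. B \<omega> \<partial>M) * emeasure (time_measure 0 T) {0..T} < \<infinity>"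
    using g Bint Tfin by (simp add: sq_integrable_iff_nn ennreal_mult_less_top)
  finally have fin: "(\<integral>\<^sup>+p. (\<integral>\<^sup>+s. ennreal \<bar>\<Phi> (fst p) s (snd p)\<bar> \<partial>time_measure 0 T) \<partial>PM 0 T) < \<infinity>" .
  note fub = fubini_two_times[OF meas fin]
  have inner_s: "(\<integral>s. \<Phi> t s \<omega> \<partial>time_measure 0 T) = (\<integral>s. b s \<omega> \<partial>time_measure 0 t) \<bullet> g t \<omega>"
    if t: "t \<in> {0..T}" and int: "integrable (time_measure 0 T) (\<lambda>s. b s \<omega>)" and w: "\<omega> \<in> space M" for t \<omega>
  proof -
    have "integrable (time_measure 0 T) (\<lambda>s. indicator {0..t} s *\<^sub>R b s \<omega>)"
      using int t by (intro integrable_mult_indicator) (auto simp: time_measure_def sets_restrict_space_iff)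
    then have "(\<integral>s. (indicator {0..t} s *\<^sub>R b s \<omega>) \<bullet> g t \<omega> \<partial>time_measure 0 T) = (\<integral>s. indicator {0..t} s *\<^sub>R b s \<omega> \<partial>time_measure 0 T) \<bullet> g t \<omega>"
      by (rule integral_inner_left)
    also have "(\<integral>s. indicator {0..t} s *\<^sub>R b s \<omega> \<partial>time_measure 0 T) = (\<integral>s. b s \<omega> \<partial>time_measure 0 t)"
      using t by (intro integral_sub_interval[symmetric]) auto
    finally show ?thesis
      unfolding \<Phi>_def using t by (subst (asm) Bochner_Integration.integral_cong[OF refl, where g="\<lambda>s. indicator {s..T} t * (b s \<omega> \<bullet> g t \<omega>)"])
        (auto simp: indicator_def)
  qed
  have AEb: "AE p in PM 0 T. integrable (time_measure 0 T) (\<lambda>s. b s (snd p))"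
    by (rule AE_PM_snd[OF time_integral_sq_integrable(1)[OF b]])
  have eq_s: "AE p in PM 0 T. (\<lambda>(t, \<omega>). \<integral>s. \<Phi> t s \<omega> \<partial>time_measure 0 T) p = (\<lambda>(t, \<omega>). (\<integral>s. b s \<omega> \<partial>time_measure 0 t) \<bullet> g t \<omega>) p"
    using AEb AE_space
  proof eventually_elim
    case (elim p)
    then show ?case using inner_s[of "fst p" "snd p"] by (auto simp: space_PM split_def)
  qed
  have Bt_m: "jointly_measurable 0 T (\<lambda>t \<omega>. \<integral>s. b s \<omega> \<partial>time_measure 0 t)"
  proof -
    have [measurable]: "(\<lambda>q. fst (fst q)) \<in> borel_measurable (PM 0 T \<Otimes>\<^sub>M time_measure 0 T)"
      "(\<lambda>q. snd q) \<in> borel_measurable (PM 0 T \<Otimes>\<^sub>M time_measure 0 T)"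
      by (rule measurable_compose[OF measurable_compose[OF measurable_fst measurable_fst] time_measure_id]
          measurable_compose[OF measurable_snd time_measure_id])+
    have ind: "(\<lambda>q. if 0 \<le> snd q \<and> snd q \<le> fst (fst q) then 1 else 0 :: real) \<in> borel_measurable (PM 0 T \<Otimes>\<^sub>M time_measure 0 T)"
      by measurable
    have bq: "(\<lambda>q. b (snd q) (snd (fst q))) \<in> borel_measurable (PM 0 T \<Otimes>\<^sub>M time_measure 0 T)"
      by (rule measurable_curried[OF bm]) measurable
    have eq: "(\<lambda>(p, s). indicator {0..fst p} s *\<^sub>R b s (snd p))
        = (\<lambda>q. (if 0 \<le> snd q \<and> snd q \<le> fst (fst q) then 1 else 0 :: real) *\<^sub>R b (snd q) (snd (fst q)))"
      by (auto simp: fun_eq_iff indicator_def)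
    have "(\<lambda>(p, s). indicator {0..fst p} s *\<^sub>R b s (snd p)) \<in> borel_measurable (PM 0 T \<Otimes>\<^sub>M time_measure 0 T)"
      unfolding eq by (rule borel_measurable_scaleR[OF ind bq])
    from sigma_finite_measure.borel_measurable_lebesgue_integral[OF sigma_finite_time_measure this]
    have "(\<lambda>p. \<integral>s. indicator {0..fst p} s *\<^sub>R b s (snd p) \<partial>time_measure 0 T) \<in> borel_measurable (PM 0 T)" .
    also have "?this \<longleftrightarrow> jointly_measurable 0 T (\<lambda>t \<omega>. \<integral>s. b s \<omega> \<partial>time_measure 0 t)"
      by (intro measurable_cong) (auto simp: space_PM intro!: integral_sub_interval[symmetric])
    finally show ?thesis .
  qed
  have m1: "jointly_measurable 0 T (\<lambda>t \<omega>. (\<integral>s. b s \<omega> \<partial>time_measure 0 t) \<bullet> g t \<omega>)"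
    using borel_measurable_inner[OF Bt_m gm] by (simp add: split_def)
  show i1: "integrable (PM 0 T) (\<lambda>(t, \<omega>). (\<integral>s. b s \<omega> \<partial>time_measure 0 t) \<bullet> g t \<omega>)"
    using fub(2) integrable_cong_AE[OF borel_measurable_integrable[OF fub(2)] m1 eq_s] by simp
  have inner_t: "AE \<omega> in M. (\<integral>t. \<Phi> t s \<omega> \<partial>time_measure 0 T) = b s \<omega> \<bullet> (\<integral>t. indicator {s..T} t *\<^sub>R g t \<omega> \<partial>time_measure 0 T)" for s
    using time_integral_sq_integrable(1)[OF sq_integrable_cutoff[OF g, of "{s..T}"]]
  proof (rule AE_mp, simp, intro AE_I2 impI)
    fix \<omega> assume "integrable (time_measure 0 T) (\<lambda>t. indicator {s..T} t *\<^sub>R g t \<omega>)"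
    then have "(\<integral>t. b s \<omega> \<bullet> (indicator {s..T} t *\<^sub>R g t \<omega>) \<partial>time_measure 0 T) = b s \<omega> \<bullet> (\<integral>t. indicator {s..T} t *\<^sub>R g t \<omega> \<partial>time_measure 0 T)"
      by (rule integral_inner_right)
    then show "(\<integral>t. \<Phi> t s \<omega> \<partial>time_measure 0 T) = b s \<omega> \<bullet> (\<integral>t. indicator {s..T} t *\<^sub>R g t \<omega> \<partial>time_measure 0 T)"
      by (simp add: \<Phi>_def)
  qed
  have E_eq: "expectation (\<lambda>\<omega>. b s \<omega> \<bullet> (\<integral>t. indicator {s..T} t *\<^sub>R g t \<omega> \<partial>time_measure 0 T)) = expectation (\<lambda>\<omega>. \<integral>t. \<Phi> t s \<omega> \<partial>time_measure 0 T)"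
    if s: "s \<in> {0..T}" for s
  proof (rule integral_cong_AE)
    show "(\<lambda>\<omega>. b s \<omega> \<bullet> (\<integral>t. indicator {s..T} t *\<^sub>R g t \<omega> \<partial>time_measure 0 T)) \<in> borel_measurable M"
      using sq_integrable_measurable[OF time_integral_sq_integrable(3)[OF sq_integrable_cutoff[OF g, of "{s..T}"]]]
      by (intro borel_measurable_inner section_measurable(2)[OF bm s]) simp
    show "(\<lambda>\<omega>. \<integral>t. \<Phi> t s \<omega> \<partial>time_measure 0 T) \<in> borel_measurable M"
      using section_measurable(2)[OF borel_measurable_integrable[OF fub(3)] s] .
    show "AE \<omega> in M. b s \<omega> \<bullet> (\<integral>t. indicator {s..T} t *\<^sub>R g t \<omega> \<partial>time_measure 0 T) = (\<integral>t. \<Phi> t s \<omega> \<partial>time_measure 0 T)"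
      using inner_t[of s] by eventually_elim simp
  qed
  have it: "integrable (PM 0 T) (\<lambda>(s, \<omega>). \<integral>t. \<Phi> t s \<omega> \<partial>time_measure 0 T)" by (rule fub(3))
  show "(\<lambda>s. expectation (\<lambda>\<omega>. b s \<omega> \<bullet> (\<integral>t. indicator {s..T} t *\<^sub>R g t \<omega> \<partial>time_measure 0 T))) \<in> borel_measurable (time_measure 0 T)"
    using borel_measurable_integrable[OF integral_PM_iterated(1)[OF it]]
    by (rule measurable_cong[OF E_eq, THEN iffD2, rotated]) simp
  have "(\<integral>s. expectation (\<lambda>\<omega>. b s \<omega> \<bullet> (\<integral>t. indicator {s..T} t *\<^sub>R g t \<omega> \<partial>time_measure 0 T)) \<partial>time_measure 0 T)
      = (\<integral>s. expectation (\<lambda>\<omega>. \<integral>t. \<Phi> t s \<omega> \<partial>time_measure 0 T) \<partial>time_measure 0 T)"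
    by (rule Bochner_Integration.integral_cong[OF refl]) (simp add: E_eq)
  also have "\<dots> = (\<integral>p. (\<integral>t. \<Phi> t (fst p) (snd p) \<partial>time_measure 0 T) \<partial>PM 0 T)"
    by (rule integral_PM_iterated(2)[OF it])
  also have "\<dots> = (\<integral>p. (\<integral>s. \<Phi> (fst p) s (snd p) \<partial>time_measure 0 T) \<partial>PM 0 T)" by (rule fub(4)[symmetric])
  also have "\<dots> = pairing 0 T (\<lambda>t \<omega>. \<integral>s. b s \<omega> \<partial>time_measure 0 t) g"
  proof (rule integral_cong_AE)
    show "(\<lambda>p. \<integral>s. \<Phi> (fst p) s (snd p) \<partial>time_measure 0 T) \<in> borel_measurable (PM 0 T)"
      using borel_measurable_integrable[OF fub(2)] by (simp add: split_def)
    show "(\<lambda>p. (\<integral>s. b s (snd p) \<partial>time_measure 0 (fst p)) \<bullet> g (fst p) (snd p)) \<in> borel_measurable (PM 0 T)"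
      using m1 by (simp add: split_def)
    show "AE p in PM 0 T. (\<integral>s. \<Phi> (fst p) s (snd p) \<partial>time_measure 0 T) = (\<integral>s. b s (snd p) \<partial>time_measure 0 (fst p)) \<bullet> g (fst p) (snd p)"
      using eq_s by (simp add: split_def)
  qed
  also have "\<dots> = (\<integral>t. expectation (\<lambda>\<omega>. (\<integral>s. b s \<omega> \<partial>time_measure 0 t) \<bullet> g t \<omega>) \<partial>time_measure 0 T)"
    by (rule integral_PM_iterated(2)[OF i1, symmetric])
  finally show "(\<integral>s. expectation (\<lambda>\<omega>. b s \<omega> \<bullet> (\<integral>t. indicator {s..T} t *\<^sub>R g t \<omega> \<partial>time_measure 0 T)) \<partial>time_measure 0 T)
       = (\<integral>t. expectation (\<lambda>\<omega>. (\<integral>s. b s \<omega> \<partial>time_measure 0 t) \<bullet> g t \<omega>) \<partial>time_measure 0 T)" .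
qed

text \<open>
  The expectation of Ito's product formula for \<open>\<langle>p, y' - y\<rangle>\<close>, obtained without the formula itself:
  \<open>y'(s) - y(s)\<close> may be replaced by the integral of \<open>f' - f\<close> over \<open>[s, T]\<close> when it is paired with
  \<open>b(s)\<close>, Fubini turns this into a pairing of \<open>f' - f\<close> with the integral of \<open>b\<close>, that is with \<open>p\<close> minus
  its initial value and its martingale part, and the martingale part contributes \<open>\<langle>\<sigma>, z' - z\<rangle>\<close> by the
  isometry.
\<close>

lemma forward_backward_duality:
  assumes T: "0 \<le> T"
    and p0: "p0 \<in> borel_measurable (filt P 0)" "sq_integrable M p0"
    and b: "sq_process 0 T b" "AE t in time_measure 0 T. b t \<in> borel_measurable (filt P t)"
    and p: "sq_process 0 T p" "forward_solution T p0 b \<sigma> p"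
    and f: "sq_process 0 T f" "AE t in time_measure 0 T. f t \<in> borel_measurable (filt P t)"
    and f': "sq_process 0 T f'" "AE t in time_measure 0 T. f' t \<in> borel_measurable (filt P t)"
    and y: "sq_process 0 T y" "backward_solution T \<xi> f y z"
    and y': "sq_process 0 T y'" "backward_solution T \<xi> f' y' z'"
  shows "expectation (\<lambda>\<omega>. p0 \<omega> \<bullet> (y' 0 \<omega> - y 0 \<omega>))
    = pairing 0 T p (\<lambda>t \<omega>. f' t \<omega> - f t \<omega>)
    - pairing 0 T b (\<lambda>t \<omega>. y' t \<omega> - y t \<omega>)
    - pairing 0 T \<sigma> (\<lambda>t \<omega>. z' t \<omega> - z t \<omega>)"
proof -
  define g where "g t \<omega> = f' t \<omega> - f t \<omega>" for t \<omega>
  have g: "sq_process 0 T g"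
    unfolding g_def by (rule sq_integrable_minus_processes[OF f(1) f'(1)])
  have T': "T \<in> {0..T}" and O': "0 \<in> {0..T}" using T by auto
  obtain N where N: "has_ito_integral P 0 T \<sigma> N"
    using p(2) T' unfolding forward_solution_def by blast
  note Nsq = ito_sq[OF N order_refl]
  note diff = backward_difference_pairing[OF f(1) f'(1) y(2) y'(2), folded g_def]
  \<comment> \<open>\<open>b(s)\<close> is known at time \<open>s\<close>, so only the drift part of \<open>y'(s) - y(s)\<close> contributes\<close>
  have by_int: "integrable (PM 0 T) (\<lambda>(s, \<omega>). b s \<omega> \<bullet> (y' s \<omega> - y s \<omega>))"
    using integrable_inner[OF b(1) sq_integrable_minus_processes[OF y(1) y'(1)]] by (simp add: split_def)
  have "pairing 0 T b (\<lambda>t \<omega>. y' t \<omega> - y t \<omega>)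
      = (\<integral>s. expectation (\<lambda>\<omega>. b s \<omega> \<bullet> (y' s \<omega> - y s \<omega>)) \<partial>time_measure 0 T)"
    by (rule integral_PM_iterated(2)[OF by_int, symmetric])
  also have "\<dots> = (\<integral>s. expectation (\<lambda>\<omega>. b s \<omega> \<bullet> (\<integral>t. indicator {s..T} t *\<^sub>R g t \<omega> \<partial>time_measure 0 T)) \<partial>time_measure 0 T)"
  proof (rule integral_cong_AE)
    show "AE s in time_measure 0 T. expectation (\<lambda>\<omega>. b s \<omega> \<bullet> (y' s \<omega> - y s \<omega>))
        = expectation (\<lambda>\<omega>. b s \<omega> \<bullet> (\<integral>t. indicator {s..T} t *\<^sub>R g t \<omega> \<partial>time_measure 0 T))"
      using b(2) AE_sections_sq_integrable[OF b(1)] AE_space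
    proof eventually_elim
      case (elim s)
      then show ?case by (intro diff(1)) auto
    qed
    show "(\<lambda>s. expectation (\<lambda>\<omega>. b s \<omega> \<bullet> (y' s \<omega> - y s \<omega>))) \<in> borel_measurable (time_measure 0 T)"
      by (rule borel_measurable_integrable[OF integral_PM_iterated(1)[OF by_int]])
  qed (rule causal_fubini(3)[OF b(1) g])
  also have "\<dots> = (\<integral>t. expectation (\<lambda>\<omega>. (\<integral>s. b s \<omega> \<partial>time_measure 0 t) \<bullet> g t \<omega>) \<partial>time_measure 0 T)"
    by (rule causal_fubini(2)[OF b(1) g])
  finally have drift: "pairing 0 T b (\<lambda>t \<omega>. y' t \<omega> - y t \<omega>)
      = (\<integral>t. expectation (\<lambda>\<omega>. (\<integral>s. b s \<omega> \<partial>time_measure 0 t) \<bullet> g t \<omega>) \<partial>time_measure 0 T)" .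
  \<comment> \<open>\<open>p(t)\<close> is replaced by its equation; its martingale part may be replaced by the terminal value \<open>N\<close>, since \<open>g(t)\<close> is known at time \<open>t\<close>\<close>
  have pg_int: "integrable (PM 0 T) (\<lambda>(t, \<omega>). p t \<omega> \<bullet> g t \<omega>)"
    using integrable_inner[OF p(1) g] by (simp add: split_def)
  note p0g = integral_PM_inner_const[OF p0(2) g] and Ng = integral_PM_inner_const[OF Nsq(1) g]
  note bg = causal_fubini(1)[OF b(1) g]
  have "pairing 0 T p g = (\<integral>t. expectation (\<lambda>\<omega>. p t \<omega> \<bullet> g t \<omega>) \<partial>time_measure 0 T)"
    by (rule integral_PM_iterated(2)[OF pg_int, symmetric])
  also have "\<dots> = (\<integral>t. expectation (\<lambda>\<omega>. p0 \<omega> \<bullet> g t \<omega>) + expectation (\<lambda>\<omega>. (\<integral>s. b s \<omega> \<partial>time_measure 0 t) \<bullet> g t \<omega>)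
      + expectation (\<lambda>\<omega>. N \<omega> \<bullet> g t \<omega>) \<partial>time_measure 0 T)"
  proof (rule integral_cong_AE)
    show "(\<lambda>t. expectation (\<lambda>\<omega>. p t \<omega> \<bullet> g t \<omega>)) \<in> borel_measurable (time_measure 0 T)"
      by (rule borel_measurable_integrable[OF integral_PM_iterated(1)[OF pg_int]])
    show "(\<lambda>t. expectation (\<lambda>\<omega>. p0 \<omega> \<bullet> g t \<omega>) + expectation (\<lambda>\<omega>. (\<integral>s. b s \<omega> \<partial>time_measure 0 t) \<bullet> g t \<omega>)
      + expectation (\<lambda>\<omega>. N \<omega> \<bullet> g t \<omega>)) \<in> borel_measurable (time_measure 0 T)"
      by (rule borel_measurable_integrable)
        (intro Bochner_Integration.integrable_add integral_PM_iterated(1) p0g(1) bg Ng(1))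
    show "AE t in time_measure 0 T. expectation (\<lambda>\<omega>. p t \<omega> \<bullet> g t \<omega>)
       = expectation (\<lambda>\<omega>. p0 \<omega> \<bullet> g t \<omega>) + expectation (\<lambda>\<omega>. (\<integral>s. b s \<omega> \<partial>time_measure 0 t) \<bullet> g t \<omega>) + expectation (\<lambda>\<omega>. N \<omega> \<bullet> g t \<omega>)"
      using f(2) f'(2) AE_sections_sq_integrable[OF g] AE_sections_sq_integrable[OF p(1)] AE_space
    proof eventually_elim
      case (elim t)
      then have t: "t \<in> {0..T}" by simp
      have gad: "g t \<in> borel_measurable (filt P t)" using elim(1,2) by (auto simp: g_def[abs_def])
      obtain I where I: "has_ito_integral P 0 t \<sigma> I" "AE \<omega> in M. p t \<omega> = p0 \<omega> + (\<integral>s. b s \<omega> \<partial>time_measure 0 t) + I \<omega>"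
        using p(2) t unfolding forward_solution_def by blast
      have Isq: "sq_integrable M I" by (rule ito_sq(1)[OF I(1) order_refl])
      have Bsq: "sq_integrable M (\<lambda>\<omega>. \<integral>s. b s \<omega> \<partial>time_measure 0 t)"
        using time_integral_sq_integrable(3)[OF sq_integrable_cutoff[OF b(1), of "{0..t}"]] t
        by (simp add: integral_sub_interval[of 0 0 t T])
      have "expectation (\<lambda>\<omega>. p t \<omega> \<bullet> g t \<omega>) = expectation (\<lambda>\<omega>. p0 \<omega> \<bullet> g t \<omega> + (\<integral>s. b s \<omega> \<partial>time_measure 0 t) \<bullet> g t \<omega> + I \<omega> \<bullet> g t \<omega>)"
      proof (rule integral_cong_AE)
        show "(\<lambda>\<omega>. p t \<omega> \<bullet> g t \<omega>) \<in> borel_measurable M"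
          by (rule borel_measurable_integrable[OF integrable_inner[OF elim(4) elim(3)]])
        show "(\<lambda>\<omega>. p0 \<omega> \<bullet> g t \<omega> + (\<integral>s. b s \<omega> \<partial>time_measure 0 t) \<bullet> g t \<omega> + I \<omega> \<bullet> g t \<omega>) \<in> borel_measurable M"
          by (rule borel_measurable_integrable)
            (intro Bochner_Integration.integrable_add integrable_inner p0(2) elim(3) Bsq Isq)
        show "AE \<omega> in M. p t \<omega> \<bullet> g t \<omega> = p0 \<omega> \<bullet> g t \<omega> + (\<integral>s. b s \<omega> \<partial>time_measure 0 t) \<bullet> g t \<omega> + I \<omega> \<bullet> g t \<omega>"
          using I(2) by eventually_elim (simp add: inner_add_left)
      qed
      also have "\<dots> = expectation (\<lambda>\<omega>. p0 \<omega> \<bullet> g t \<omega>) + expectation (\<lambda>\<omega>. (\<integral>s. b s \<omega> \<partial>time_measure 0 t) \<bullet> g t \<omega>) + expectation (\<lambda>\<omega>. I \<omega> \<bullet> g t \<omega>)"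
        using integrable_inner[OF p0(2) elim(3)] integrable_inner[OF Bsq elim(3)] integrable_inner[OF Isq elim(3)] by simp
      also have "expectation (\<lambda>\<omega>. I \<omega> \<bullet> g t \<omega>) = expectation (\<lambda>\<omega>. N \<omega> \<bullet> g t \<omega>)"
        using ito_martingale[OF N I(1) _ _ gad elim(3)] t by (simp add: inner_commute)
      finally show ?case .
    qed
  qed
  also have "\<dots> = (\<integral>t. expectation (\<lambda>\<omega>. p0 \<omega> \<bullet> g t \<omega>) \<partial>time_measure 0 T)
      + (\<integral>t. expectation (\<lambda>\<omega>. (\<integral>s. b s \<omega> \<partial>time_measure 0 t) \<bullet> g t \<omega>) \<partial>time_measure 0 T)
      + (\<integral>t. expectation (\<lambda>\<omega>. N \<omega> \<bullet> g t \<omega>) \<partial>time_measure 0 T)"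
    using integral_PM_iterated(1)[OF p0g(1)] integral_PM_iterated(1)[OF bg] integral_PM_iterated(1)[OF Ng(1)] by simp
  finally have split: "pairing 0 T p g
      = expectation (\<lambda>\<omega>. p0 \<omega> \<bullet> (\<integral>t. g t \<omega> \<partial>time_measure 0 T))
      + pairing 0 T b (\<lambda>t \<omega>. y' t \<omega> - y t \<omega>)
      + expectation (\<lambda>\<omega>. N \<omega> \<bullet> (\<integral>t. g t \<omega> \<partial>time_measure 0 T))"
    unfolding drift p0g(2) Ng(2) .
  have full: "(\<integral>t. indicator {0..T} t *\<^sub>R g t \<omega> \<partial>time_measure 0 T) = (\<integral>t. g t \<omega> \<partial>time_measure 0 T)" for \<omega>
    using integral_sub_interval[of 0 0 T T "\<lambda>t. g t \<omega>"] by simp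
  have initial: "expectation (\<lambda>\<omega>. p0 \<omega> \<bullet> (y' 0 \<omega> - y 0 \<omega>)) = expectation (\<lambda>\<omega>. p0 \<omega> \<bullet> (\<integral>t. g t \<omega> \<partial>time_measure 0 T))"
    using diff(1)[OF O' p0] by (simp add: full)
  \<comment> \<open>the integral of \<open>g\<close> over \<open>[0, T]\<close> equals \<open>y'(0) - y(0)\<close>, to which \<open>N\<close> is orthogonal, plus a difference of Ito integrals\<close>
  obtain I I' where I: "has_ito_integral P 0 T z I" "has_ito_integral P 0 T z' I'"
    and eq: "AE \<omega> in M. y' 0 \<omega> - y 0 \<omega> = (\<integral>s. indicator {0..T} s *\<^sub>R (f' s \<omega> - f s \<omega>) \<partial>time_measure 0 T) - (I' \<omega> - I \<omega>)"
    by (rule backward_difference[OF f(1) f'(1) y(2) y'(2) O'])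
  have y0sq: "sq_integrable M (\<lambda>\<omega>. y' 0 \<omega> - y 0 \<omega>)" by (rule diff(2)[OF O' p0])
  have y0ad: "(\<lambda>\<omega>. y' 0 \<omega> - y 0 \<omega>) \<in> borel_measurable (filt P 0)"
    using y(2) y'(2) O' unfolding backward_solution_def by (intro borel_measurable_diff) auto
  note Isq = ito_sq[OF I(1) order_refl] ito_sq[OF I(2) order_refl]
  have "expectation (\<lambda>\<omega>. N \<omega> \<bullet> (\<integral>t. g t \<omega> \<partial>time_measure 0 T))
      = expectation (\<lambda>\<omega>. (y' 0 \<omega> - y 0 \<omega>) \<bullet> N \<omega> + (N \<omega> \<bullet> I' \<omega> - N \<omega> \<bullet> I \<omega>))"
  proof (rule integral_cong_AE)
    show "(\<lambda>\<omega>. N \<omega> \<bullet> (\<integral>t. g t \<omega> \<partial>time_measure 0 T)) \<in> borel_measurable M"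
      by (rule borel_measurable_integrable[OF integrable_inner[OF Nsq(1) time_integral_sq_integrable(3)[OF g]]])
    show "(\<lambda>\<omega>. (y' 0 \<omega> - y 0 \<omega>) \<bullet> N \<omega> + (N \<omega> \<bullet> I' \<omega> - N \<omega> \<bullet> I \<omega>)) \<in> borel_measurable M"
      by (rule borel_measurable_integrable)
        (intro Bochner_Integration.integrable_add Bochner_Integration.integrable_diff integrable_inner y0sq Nsq(1) Isq(1) Isq(3))
    show "AE \<omega> in M. N \<omega> \<bullet> (\<integral>t. g t \<omega> \<partial>time_measure 0 T) = (y' 0 \<omega> - y 0 \<omega>) \<bullet> N \<omega> + (N \<omega> \<bullet> I' \<omega> - N \<omega> \<bullet> I \<omega>)"
      using eq
    proof eventually_elim
      case (elim \<omega>)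
      then have "(\<integral>t. g t \<omega> \<partial>time_measure 0 T) = (y' 0 \<omega> - y 0 \<omega>) + (I' \<omega> - I \<omega>)"
        using full[of \<omega>] by (simp add: g_def)
      then show ?case by (simp add: inner_add_right inner_diff_right inner_commute)
    qed
  qed
  also have "\<dots> = expectation (\<lambda>\<omega>. (y' 0 \<omega> - y 0 \<omega>) \<bullet> N \<omega>) + (expectation (\<lambda>\<omega>. N \<omega> \<bullet> I' \<omega>) - expectation (\<lambda>\<omega>. N \<omega> \<bullet> I \<omega>))"
    using integrable_inner[OF y0sq Nsq(1)] integrable_inner[OF Nsq(1) Isq(1)] integrable_inner[OF Nsq(1) Isq(3)] by simp
  also have "expectation (\<lambda>\<omega>. (y' 0 \<omega> - y 0 \<omega>) \<bullet> N \<omega>) = 0"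
    by (rule ito_orthogonal_past[OF N order_refl y0ad y0sq])
  also have "expectation (\<lambda>\<omega>. N \<omega> \<bullet> I' \<omega>) - expectation (\<lambda>\<omega>. N \<omega> \<bullet> I \<omega>)
      = pairing 0 T \<sigma> (\<lambda>t \<omega>. z' t \<omega> - z t \<omega>)"
    unfolding ito_isometry[OF N I(1) order_refl] ito_isometry[OF N I(2) order_refl]
    using integrable_inner[OF Nsq(2) Isq(2)] integrable_inner[OF Nsq(2) Isq(4)]
    by (simp add: split_def inner_diff_right)
  finally have martingale: "expectation (\<lambda>\<omega>. N \<omega> \<bullet> (\<integral>t. g t \<omega> \<partial>time_measure 0 T))
      = pairing 0 T \<sigma> (\<lambda>t \<omega>. z' t \<omega> - z t \<omega>)" by simp
  show ?thesis using split[unfolded martingale] initial unfolding g_def by linarith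
qed

end

section \<open>Trajectories and the gain of a control\<close>

lemma AE_zero_if_inner_integral_zero:
  assumes f: "sq_integrable Q f" and zero: "(\<integral>x. f x \<bullet> f x \<partial>Q) = 0"
  shows "AE x in Q. f x = 0"
  using integral_nonneg_eq_0_iff_AE[OF integrable_inner[OF f f]] zero by simp

lemma AE_AE_mono:
  assumes "AE t in A. AE \<omega> in B. Q t \<omega>" and "\<And>t \<omega>. Q t \<omega> \<Longrightarrow> R t \<omega>"
  shows "AE t in A. AE \<omega> in B. R t \<omega>"
  using assms(1) by (rule eventually_mono) (erule eventually_mono, rule assms(2))

lemma AE_AE_conj:
  assumes "AE t in A. AE \<omega> in B. Q t \<omega>" and "AE t in A. AE \<omega> in B. R t \<omega>"
  shows "AE t in A. AE \<omega> in B. Q t \<omega> \<and> R t \<omega>"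
  using assms by (rule eventually_elim2) (rule eventually_conj)

lemma AE_time_measure: "(AE t in time_measure a b. Q t) \<longleftrightarrow> (AE t in lborel. t \<in> {a..b} \<longrightarrow> Q t)"
  unfolding time_measure_def by (rule AE_restrict_space_iff) simp

context brownian_problem begin

lemma AE_sections:
  "AE p in PM a b. Q (fst p) (snd p) \<Longrightarrow> AE t in time_measure a b. AE \<omega> in M. Q t \<omega>"
  using pair_sigma_finite.AE_pair[OF pair_time, where Q="\<lambda>p. Q (fst p) (snd p)"] by simp

text \<open>
  An inequality that holds almost surely at almost every time need not define a measurable set of
  pairs \<open>(t, \<omega>)\<close>; concavity of a random function is such a condition. Comparing the expectations at
  each time avoids the question.
\<close>

lemma integral_PM_mono_sections:
  fixes F G :: "real \<Rightarrow> 'w \<Rightarrow> real"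
  assumes F: "integrable (PM a b) (\<lambda>(t, \<omega>). F t \<omega>)" and G: "integrable (PM a b) (\<lambda>(t, \<omega>). G t \<omega>)"
    and le: "AE t in time_measure a b. AE \<omega> in M. F t \<omega> \<le> G t \<omega>"
  shows "(\<integral>p. F (fst p) (snd p) \<partial>PM a b) \<le> (\<integral>p. G (fst p) (snd p) \<partial>PM a b)"
proof -
  interpret pair_sigma_finite "time_measure a b" M by (rule pair_time)
  have "AE t in time_measure a b. expectation (F t) \<le> expectation (G t)"
    using AE_integrable_fst'[OF F] AE_integrable_fst'[OF G] le
  proof eventually_elim
    case (elim t)
    show ?case by (rule integral_mono_AE) (use elim in simp_all)
  qed
  from integral_mono_AE[OF integral_PM_iterated(1)[OF F] integral_PM_iterated(1)[OF G] this]
  show ?thesis unfolding integral_PM_iterated(2)[OF F] integral_PM_iterated(2)[OF G] .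
qed

end

context delay_model begin

text \<open>
  By adjointness the integral of \<open>|x\<^sub>\<delta>|\<^sup>2\<close> is a pairing with \<open>x\<close>.
\<close>

lemma delayed_AE_zero:
  fixes x :: "real \<Rightarrow> 'w \<Rightarrow> 'h::euclidean_space"
  assumes x: "LpF P 2 {-\<delta>..T} x" and x0: "vanishes_before_0 x"
    and zero: "AE t in time_measure 0 T. AE \<omega> in M. x t \<omega> = 0"
  shows "AE p in PM 0 T. delayed P x (fst p) (snd p) = 0"
proof -
  have G: "sq_process 0 T (delayed P x)" by (rule delayed_sq_integrable[OF x])
  have "pairing 0 T (delayed P x) (delayed P x)
      = (\<integral>s. delay_density P s * expectation (\<lambda>\<omega>. anticipated P (delayed P x) s \<omega> \<bullet> x s \<omega>) \<partial>time_measure 0 T)"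
    by (rule delay_anticipation_adjoint(1)[OF G x x0])
  also have "\<dots> = 0"
  proof (rule integral_eq_zero_AE)
    show "AE s in time_measure 0 T. delay_density P s * expectation (\<lambda>\<omega>. anticipated P (delayed P x) s \<omega> \<bullet> x s \<omega>) = 0"
      using zero
    proof eventually_elim
      case (elim s)
      have "expectation (\<lambda>\<omega>. anticipated P (delayed P x) s \<omega> \<bullet> x s \<omega>) = 0"
        by (rule integral_eq_zero_AE) (use elim in \<open>eventually_elim, simp\<close>)
      then show ?case by simp
    qed
  qed
  finally have "(\<integral>p. (\<lambda>(t, \<omega>). delayed P x t \<omega>) p \<bullet> (\<lambda>(t, \<omega>). delayed P x t \<omega>) p \<partial>PM 0 T) = 0"
    by (simp add: split_def)
  from AE_zero_if_inner_integral_zero[OF G this] show ?thesis by (simp add: split_def)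
qed

end

context control_model begin

lemma initial_derivative: "(initial P has_derivative (\<lambda>e. grad (initial P) a \<bullet> e)) (at a)"
proof -
  have "initial P differentiable (at a)" using B unfolding assumption_B_def by blast
  then obtain g' where g': "(initial P has_derivative g') (at a)" unfolding differentiable_def by blast
  have "g' = (\<lambda>e. grad (initial P) a \<bullet> e)" using grad_inner[OF g'] by auto
  then show ?thesis using g' by simp
qed

lemma initial_gradient_bound: "\<exists>C\<ge>0. \<forall>a. norm (grad (initial P) a) \<le> C"
proof -
  obtain C where C: "\<forall>a. norm (grad (initial P) a) \<le> C" using B unfolding assumption_B_def by blast
  then have "0 \<le> C" using norm_ge_zero order_trans by blast
  then show ?thesis using C by blast
qed

text \<open>
  Bounded gradients make \<open>\<gamma>\<close> Lipschitz.
\<close>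

lemma initial_growth: "\<exists>C\<ge>0. \<forall>a. norm (initial P a) \<le> norm (initial P 0) + C * norm a"
proof -
  obtain C where C: "0 \<le> C" "\<forall>a. norm (grad (initial P) a) \<le> C" using initial_gradient_bound by blast
  have "norm (initial P a - initial P 0) \<le> C * norm (a - 0)" for a
  proof (rule differentiable_bound[of UNIV])
    show "(initial P has_derivative (\<lambda>e. grad (initial P) x \<bullet> e)) (at x within UNIV)" for x
      using initial_derivative by simp
    show "onorm (\<lambda>e. grad (initial P) x \<bullet> e) \<le> C" for x
    proof (rule onorm_le)
      fix e
      have "norm (grad (initial P) x \<bullet> e) \<le> norm (grad (initial P) x) * norm e" by (simp add: Cauchy_Schwarz_ineq2)
      then show "norm (grad (initial P) x \<bullet> e) \<le> C * norm e"
        using C(2) mult_right_mono[of "norm (grad (initial P) x)" C "norm e"] by (smt (verit) norm_ge_zero)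
    qed
  qed auto
  then have "norm (initial P a) \<le> norm (initial P 0) + C * norm a" for a
    by (smt (verit) diff_zero norm_triangle_sub)
  then show ?thesis using C(1) by blast
qed

lemma initial_measurable:
  assumes "X \<in> borel_measurable Q"
  shows "(\<lambda>q. initial P (X q)) \<in> borel_measurable Q"
proof -
  have "continuous_on UNIV (initial P)"
    using initial_derivative by (meson continuous_at_imp_continuous_on has_derivative_continuous)
  from measurable_compose[OF assms borel_measurable_continuous_onI[OF this]] show ?thesis .
qed

context
  fixes v y z
  assumes v: "v \<in> admissible P" and state: "state_solution P v y z"
begin

lemma state_LpF: "LpF P 2 {-\<delta>..T} y" "LpF P 2 {-\<delta>..T} z" "LpF P 2 {-\<delta>..T} v"
  using state admissible_LpF[OF v] unfolding state_solution_def by blast+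

lemma state_LpF_0: "LpF P 2 {0..T} y" "LpF P 2 {0..T} z" "LpF P 2 {0..T} v"
  using state_LpF delay_nonneg by (auto intro: LpF_2_sub_interval)

lemma state_sq_integrable:
  "sq_process 0 T y" "sq_process 0 T z"
  using state_LpF_0 by (simp_all add: LpF_2_iff)

lemma state_args:
  "sq_process 0 T (args_at P y z v)"
  "AE t in time_measure 0 T. args_at P y z v t \<in> borel_measurable (filt P t)"
  using args_sq_integrable[OF state_LpF] args_adapted[OF state_LpF] by blast+

lemma state_driver_sq_integrable: "sq_process 0 T (\<lambda>t \<omega>. driver P t \<omega> (args_at P y z v t \<omega>))"
  by (rule driver_sq_integrable[OF state_args(1)])

lemma state_driver_adapted:
  "AE t in time_measure 0 T. (\<lambda>\<omega>. driver P t \<omega> (args_at P y z v t \<omega>)) \<in> borel_measurable (filt P t)"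
  using state_args(2) AE_space
proof eventually_elim
  case (elim t)
  show ?case by (rule driver_adapted) (use elim in auto)
qed

lemma state_backward:
  "backward_solution T (terminal P) (\<lambda>t \<omega>. driver P t \<omega> (args_at P y z v t \<omega>)) y z"
  unfolding backward_solution_def integral_time_measure
  using state state_LpF_0(1) unfolding state_solution_def LpF_2_iff by blast

lemma state_running_integrable: "integrable (PM 0 T) (\<lambda>(t, \<omega>). running P t \<omega> (args_at P y z v t \<omega>))"
proof -
  define r where "r t \<omega> = running P t \<omega> (args_at P y z v t \<omega>)" for t \<omega>
  have "LpF P 1 {0..T} r"
    using B v state unfolding assumption_B_def r_def[abs_def] by blast
  then have m: "jointly_measurable 0 T r"
    and fin: "(\<integral>\<^sup>+\<omega>. (\<integral>\<^sup>+t\<in>{0..T}. ennreal (norm (r t \<omega>)) \<partial>lborel) \<partial>M) < \<infinity>"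
    unfolding LpF_def measurable_adapted_def measurable_PM_iff by simp_all
  have m': "jointly_measurable 0 T (\<lambda>t \<omega>. ennreal (norm (r t \<omega>)))"
    using measurable_compose[OF measurable_compose[OF m borel_measurable_norm] measurable_ennreal] by (simp add: split_def)
  have "integrable (PM 0 T) (\<lambda>(t, \<omega>). r t \<omega>)"
    using fin unfolding nn_integral_PM[OF m'] by (intro integrableI_bounded[OF m]) (simp add: split_def)
  then show ?thesis by (simp add: r_def)
qed

text \<open>
  Membership in \<open>L\<^sup>2\<close> of the process says nothing about the single time 0. There the state equation
  itself shows the square integrability.
\<close>

lemma state_initial_sq_integrable: "sq_integrable M (y 0)"
proof -
  have T0: "0 \<in> {0..T}" using T_pos by simp
  have ad: "y 0 \<in> borel_measurable (filt P 0)" using state_LpF_0(1) T0 by (simp add: LpF_2_iff)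
  obtain I where I: "has_ito_integral P 0 T z I"
    "AE \<omega> in M. y 0 \<omega> = terminal P \<omega> + (\<integral>s. driver P s \<omega> (args_at P y z v s \<omega>) \<partial>time_measure 0 T) - I \<omega>"
    using state_backward T0 unfolding backward_solution_def by blast
  have "terminal P \<in> borel_measurable (filt P T) \<and> (\<integral>\<^sup>+\<omega>. ennreal ((norm (terminal P \<omega>))\<^sup>2) \<partial>M) < \<infinity>"
    using setting unfolding delay_setting_def by blast
  then have \<xi>: "sq_integrable M (terminal P)" by (auto simp: sq_integrable_iff_nn intro: filt_measurable)
  have rhs: "sq_integrable M (\<lambda>\<omega>. terminal P \<omega> + (\<integral>s. driver P s \<omega> (args_at P y z v s \<omega>) \<partial>time_measure 0 T) - I \<omega>)"
    by (rule sq_integrable_diff[OF sq_integrable_add[OF \<xi> time_integral_sq_integrable(3)[OF state_driver_sq_integrable]] ito_sq(1)[OF I(1) order_refl]])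
  show ?thesis
    by (rule sq_integrable_cong_AE[OF rhs filt_measurable[OF ad]]) (use I(2) in \<open>eventually_elim, simp\<close>)
qed

lemma state_initial_integrable: "integrable M (\<lambda>\<omega>. initial P (y 0 \<omega>))"
proof -
  obtain C where C: "0 \<le> C" "\<forall>a. norm (initial P a) \<le> norm (initial P 0) + C * norm a" using initial_growth by blast
  have "integrable M (\<lambda>\<omega>. norm (initial P 0) + C * norm (y 0 \<omega>))"
    using sq_integrable_imp_integrable[OF _ state_initial_sq_integrable] finite_measure_axioms by simp
  then show ?thesis
  proof (rule Bochner_Integration.integrable_bound)
    show "(\<lambda>\<omega>. initial P (y 0 \<omega>)) \<in> borel_measurable M"
      by (rule initial_measurable[OF sq_integrable_measurable[OF state_initial_sq_integrable]])
    show "AE \<omega> in M. norm (initial P (y 0 \<omega>)) \<le> norm (norm (initial P 0) + C * norm (y 0 \<omega>))"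
      using C by (intro AE_I2) (smt (verit) norm_ge_zero real_norm_def)
  qed
qed

lemma state_payoff:
  "expectation (\<lambda>\<omega>. (LINT t:{0..T}|lborel. running P t \<omega> (args_at P y z v t \<omega>)) + initial P (y 0 \<omega>))
    = (\<integral>q. running P (fst q) (snd q) (args_at P y z v (fst q) (snd q)) \<partial>PM 0 T) + expectation (\<lambda>\<omega>. initial P (y 0 \<omega>))"
proof -
  interpret pair_sigma_finite "time_measure 0 T" M by (rule pair_time)
  have "integrable M (\<lambda>\<omega>. \<integral>t. running P t \<omega> (args_at P y z v t \<omega>) \<partial>time_measure 0 T)"
    using integrable_snd[OF state_running_integrable] by simp
  moreover have "(\<integral>\<omega>. (\<integral>t. running P t \<omega> (args_at P y z v t \<omega>) \<partial>time_measure 0 T) \<partial>M)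
      = (\<integral>q. running P (fst q) (snd q) (args_at P y z v (fst q) (snd q)) \<partial>PM 0 T)"
    using integral_snd[OF state_running_integrable] by (simp add: split_def)
  ultimately show ?thesis
    using state_initial_integrable unfolding integral_time_measure[symmetric] by simp
qed

end

lemma states_vanish_before_0:
  assumes "state_solution P v y z" "state_solution P v' y' z'"
  shows "vanishes_before_0 (\<lambda>t \<omega>. y' t \<omega> - y t \<omega>)" "vanishes_before_0 (\<lambda>t \<omega>. z' t \<omega> - z t \<omega>)"
  using assms unfolding state_solution_def vanishes_before_0_def by simp_all

lemma controls_vanish_before_0:
  assumes "v \<in> admissible P" "v' \<in> admissible P"
  shows "vanishes_before_0 (\<lambda>t \<omega>. v' t \<omega> - v t \<omega>)"
  using assms unfolding admissible_def vanishes_before_0_def by simp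

text \<open>
  Uniqueness of the trajectory is understood almost everywhere. It passes to the delayed
  processes by \<open>delayed_AE_zero\<close> and hence to the drivers and running gains. For the values at time 0,
  the difference \<open>X = y'(0) - y(0)\<close> satisfies \<open>E|X|\<^sup>2 = E\<langle>X, \<integral> (f' - f) dt\<rangle> = 0\<close>.
\<close>

lemma payoff_unique:
  assumes v: "v \<in> admissible P" and s: "state_solution P v y z" and s': "state_solution P v y' z'"
  shows "expectation (\<lambda>\<omega>. (LINT t:{0..T}|lborel. running P t \<omega> (args_at P y' z' v t \<omega>)) + initial P (y' 0 \<omega>))
    = expectation (\<lambda>\<omega>. (LINT t:{0..T}|lborel. running P t \<omega> (args_at P y z v t \<omega>)) + initial P (y 0 \<omega>))"
proof -
  have wp: "state_well_posed P" using setting unfolding delay_setting_def by blast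
  have same: "AE t in time_measure 0 T. AE \<omega> in M. y t \<omega> = y' t \<omega> \<and> z t \<omega> = z' t \<omega>"
    using wp v s s' unfolding state_well_posed_def AE_time_measure by blast
  note L = state_LpF[OF v s] and L' = state_LpF[OF v s'] and van = states_vanish_before_0[OF s s']
  have yd: "AE t in time_measure 0 T. AE \<omega> in M. delayed P y' t \<omega> = delayed P y t \<omega>"
  proof (rule AE_sections)
    have "AE t in time_measure 0 T. AE \<omega> in M. y' t \<omega> - y t \<omega> = 0"
      by (rule AE_AE_mono[OF same]) simp
    from delayed_AE_zero[OF LpF_2_diff[OF L'(1) L(1)] van(1) this] delayed_diff[OF L(1) L'(1)]
    show "AE p in PM 0 T. delayed P y' (fst p) (snd p) = delayed P y (fst p) (snd p)" by eventually_elim simp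
  qed
  have zd: "AE t in time_measure 0 T. AE \<omega> in M. delayed P z' t \<omega> = delayed P z t \<omega>"
  proof (rule AE_sections)
    have "AE t in time_measure 0 T. AE \<omega> in M. z' t \<omega> - z t \<omega> = 0"
      by (rule AE_AE_mono[OF same]) simp
    from delayed_AE_zero[OF LpF_2_diff[OF L'(2) L(2)] van(2) this] delayed_diff[OF L(2) L'(2)]
    show "AE p in PM 0 T. delayed P z' (fst p) (snd p) = delayed P z (fst p) (snd p)" by eventually_elim simp
  qed
  have args: "AE t in time_measure 0 T. AE \<omega> in M. args_at P y' z' v t \<omega> = args_at P y z v t \<omega>"
    by (rule AE_AE_mono[OF AE_AE_conj[OF same AE_AE_conj[OF yd zd]]]) (simp add: args_at_def)
  have "(\<integral>q. running P (fst q) (snd q) (args_at P y' z' v (fst q) (snd q)) \<partial>PM 0 T)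
      = (\<integral>q. running P (fst q) (snd q) (args_at P y z v (fst q) (snd q)) \<partial>PM 0 T)"
  proof (rule antisym)
    show "(\<integral>q. running P (fst q) (snd q) (args_at P y' z' v (fst q) (snd q)) \<partial>PM 0 T)
      \<le> (\<integral>q. running P (fst q) (snd q) (args_at P y z v (fst q) (snd q)) \<partial>PM 0 T)"
      by (rule integral_PM_mono_sections[OF state_running_integrable[OF v s'] state_running_integrable[OF v s]])
        (rule AE_AE_mono[OF args], simp)
    show "(\<integral>q. running P (fst q) (snd q) (args_at P y z v (fst q) (snd q)) \<partial>PM 0 T)
      \<le> (\<integral>q. running P (fst q) (snd q) (args_at P y' z' v (fst q) (snd q)) \<partial>PM 0 T)"
      by (rule integral_PM_mono_sections[OF state_running_integrable[OF v s] state_running_integrable[OF v s']])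
        (rule AE_AE_mono[OF args], simp)
  qed
  moreover have "AE \<omega> in M. y' 0 \<omega> = y 0 \<omega>"
  proof -
    define X where "X \<omega> = y' 0 \<omega> - y 0 \<omega>" for \<omega>
    define G where "G t \<omega> = indicator {0..T} t *\<^sub>R
      (driver P t \<omega> (args_at P y' z' v t \<omega>) - driver P t \<omega> (args_at P y z v t \<omega>))" for t \<omega>
    have O': "0 \<in> {0..T}" using T_pos by simp
    have Xsq: "sq_integrable M X" unfolding X_def
      by (rule sq_integrable_diff[OF state_initial_sq_integrable[OF v s'] state_initial_sq_integrable[OF v s]])
    have Xad: "X \<in> borel_measurable (filt P 0)"
      using state_LpF_0(1)[OF v s] state_LpF_0(1)[OF v s'] O' unfolding X_def LpF_2_iff by (intro borel_measurable_diff) auto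
    have Gsq: "sq_process 0 T G" unfolding G_def
      by (rule sq_integrable_cutoff[OF sq_integrable_minus_processes[OF state_driver_sq_integrable[OF v s] state_driver_sq_integrable[OF v s']]]) simp
    have "expectation (\<lambda>\<omega>. X \<omega> \<bullet> X \<omega>) = expectation (\<lambda>\<omega>. X \<omega> \<bullet> (\<integral>t. G t \<omega> \<partial>time_measure 0 T))"
      using backward_difference_pairing(1)[OF state_driver_sq_integrable[OF v s] state_driver_sq_integrable[OF v s']
          state_backward[OF v s] state_backward[OF v s'] O' Xad Xsq]
      by (simp add: X_def G_def)
    also have "\<dots> = (\<integral>t. expectation (\<lambda>\<omega>. X \<omega> \<bullet> G t \<omega>) \<partial>time_measure 0 T)"
      by (rule integral_PM_inner_const(2)[OF Xsq Gsq, symmetric])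
    also have "\<dots> = 0"
    proof (rule integral_eq_zero_AE)
      show "AE t in time_measure 0 T. expectation (\<lambda>\<omega>. X \<omega> \<bullet> G t \<omega>) = 0"
        using args
      proof eventually_elim
        case (elim t)
        show ?case by (rule integral_eq_zero_AE) (use elim in \<open>eventually_elim, simp add: G_def\<close>)
      qed
    qed
    finally show ?thesis using AE_zero_if_inner_integral_zero[OF Xsq] by (simp add: X_def)
  qed
  then have "expectation (\<lambda>\<omega>. initial P (y' 0 \<omega>)) = expectation (\<lambda>\<omega>. initial P (y 0 \<omega>))"
    by (intro integral_cong_AE initial_measurable sq_integrable_measurable[OF state_initial_sq_integrable[OF v s]]
        sq_integrable_measurable[OF state_initial_sq_integrable[OF v s']]) (erule eventually_mono, simp)
  ultimately show ?thesis unfolding state_payoff[OF v s] state_payoff[OF v s'] by simp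
qed

end

section \<open>The variational inequality\<close>

context control_model begin

text \<open>
  The tangent inequality for \<open>H\<close>, rewritten with \<open>l = H + \<langle>f, p\<rangle>\<close>.
\<close>

lemma hamiltonian_gap:
  assumes "t \<in> {0..T}" "\<omega> \<in> space M" and conc: "concave_on UNIV (hamiltonian P t \<omega> (p t \<omega>))"
  shows "running P t \<omega> (args_at P y' z' v t \<omega>) - running P t \<omega> (args_at P y z u t \<omega>)
    \<le> p t \<omega> \<bullet> (driver P t \<omega> (args_at P y' z' v t \<omega>) - driver P t \<omega> (args_at P y z u t \<omega>))
      + (H_along P grad_y y z u p t \<omega> \<bullet> (y' t \<omega> - y t \<omega>)
       + H_along P grad_yd y z u p t \<omega> \<bullet> (delayed P y' t \<omega> - delayed P y t \<omega>)
       + H_along P grad_z y z u p t \<omega> \<bullet> (z' t \<omega> - z t \<omega>)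
       + H_along P grad_zd y z u p t \<omega> \<bullet> (delayed P z' t \<omega> - delayed P z t \<omega>)
       + H_along P grad_v y z u p t \<omega> \<bullet> (v t \<omega> - u t \<omega>)
       + H_along P grad_vd y z u p t \<omega> \<bullet> (delayed P v t \<omega> - delayed P u t \<omega>))"
proof -
  note der = hamiltonian_derivative[OF assms(1,2), of "p t \<omega>" "args_at P y z u t \<omega>"]
  have diff: "args_at P y' z' v t \<omega> - args_at P y z u t \<omega> = (y' t \<omega> - y t \<omega>, delayed P y' t \<omega> - delayed P y t \<omega>,
      z' t \<omega> - z t \<omega>, delayed P z' t \<omega> - delayed P z t \<omega>, v t \<omega> - u t \<omega>, delayed P v t \<omega> - delayed P u t \<omega>)"
    by (simp add: args_at_def)
  from concave_tangent[OF conc der, of "args_at P y' z' v t \<omega>", unfolded diff total_derivative_eq_gradients[OF der]]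
  show ?thesis by (simp add: H_along_def hamiltonian_def inner_diff_right inner_commute)
qed

lemma initial_gap:
  assumes "concave_on UNIV (initial P)"
  shows "initial P a' - initial P a \<le> grad (initial P) a \<bullet> (a' - a)"
  by (rule concave_tangent[OF assms initial_derivative])

context
  fixes u y z and p :: "real \<Rightarrow> 'w \<Rightarrow> real^'n"
  assumes u: "u \<in> admissible P" and state: "state_solution P u y z" and p: "LpF P 2 {0..T} p"
begin

lemma H_sq_integrable:
  "sq_process 0 T (H_along P D y z u p)" if "bounded_gradient D \<iota>"
  by (rule H_along_sq_integrable[OF that sq_integrable_measurable[OF state_args(1)[OF u state]] p])

text \<open>
  Adjointness moves the delay from \<open>dv\<close> to \<open>H\<^bsub>v\<delta>\<^esub>\<close>. As \<open>dv(s)\<close> is \<open>\<F>\<^sub>s\<close>-measurable, the result may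
  be conditioned on \<open>\<F>\<^sub>s\<close>, and at almost every time the sum becomes the expectation of the control
  gradient paired with \<open>v(s) - u(s)\<close>. This is where \<open>u(s)\<close> has to be a maximiser over \<open>U\<close>.
\<close>

lemma control_variation_nonpos:
  assumes max: "AE t in time_measure 0 T. AE \<omega> in M.
      is_arg_max (\<lambda>v. control_gradient P u y z p t \<omega> \<bullet> v) (\<lambda>v. v \<in> controls P) (u t \<omega>)"
    and v: "v \<in> admissible P"
  defines "dv \<equiv> \<lambda>t \<omega>. v t \<omega> - u t \<omega>"
  shows "pairing 0 T (H_along P grad_v y z u p) dv
    + pairing 0 T (H_along P grad_vd y z u p) (delayed P dv) \<le> 0"
proof -
  let ?Hv = "H_along P grad_v y z u p" and ?Hd = "H_along P grad_vd y z u p"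
  note Hv = H_sq_integrable[OF bounded_gradients(5)] and Hd = H_sq_integrable[OF bounded_gradients(6)]
  have dv: "LpF P 2 {-\<delta>..T} dv" unfolding dv_def
    by (rule LpF_2_diff[OF admissible_LpF[OF v] admissible_LpF[OF u]])
  have dv0: "vanishes_before_0 dv" unfolding dv_def by (rule controls_vanish_before_0[OF u v])
  have dv_sq: "sq_process 0 T dv"
    using LpF_2_sub_interval[OF dv, of 0 T] delay_nonneg by (simp add: LpF_2_iff)
  have int: "integrable (PM 0 T) (\<lambda>(t, \<omega>). ?Hv t \<omega> \<bullet> dv t \<omega>)"
    using integrable_inner[OF Hv dv_sq] by (simp add: split_def)
  define a where "a s = expectation (\<lambda>\<omega>. ?Hv s \<omega> \<bullet> dv s \<omega>)" for s
  define c where "c s = delay_density P s * expectation (\<lambda>\<omega>. anticipated P ?Hd s \<omega> \<bullet> dv s \<omega>)" for s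
  have a: "integrable (time_measure 0 T) a" unfolding a_def by (rule integral_PM_iterated(1)[OF int])
  have c: "integrable (time_measure 0 T) c" unfolding c_def by (rule delay_anticipation_adjoint(2)[OF Hd dv dv0])
  have nonpos: "AE s in time_measure 0 T. a s + c s \<le> 0"
    using section_sq_adapted[OF dv] AE_sections_sq_integrable[OF Hv] max
  proof eventually_elim
    case (elim s)
    then have s: "s \<in> {0..T}" and dvs: "sq_integrable M (dv s)" "dv s \<in> borel_measurable (filt P s)" by auto
    let ?C = "cond_expectation M (filt P s) (anticipated P ?Hd s)"
    note pair = cond_expectation_pairing[OF anticipated_sq_integrable(1)[OF Hd s] dvs]
    note int_v = integrable_inner[OF elim(2) dvs(1)]
    have "a s + c s = expectation (\<lambda>\<omega>. ?Hv s \<omega> \<bullet> dv s \<omega> + delay_density P s * (?C \<omega> \<bullet> dv s \<omega>))"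
      unfolding a_def c_def using int_v pair by simp
    also have "\<dots> = expectation (\<lambda>\<omega>. control_gradient P u y z p s \<omega> \<bullet> dv s \<omega>)"
      by (simp add: control_gradient_def inner_add_left)
    also have "\<dots> \<le> 0"
    proof -
      have "AE \<omega> in M. v s \<omega> \<in> controls P" using v s unfolding admissible_def by blast
      then have "AE \<omega> in M. 0 \<le> - (control_gradient P u y z p s \<omega> \<bullet> dv s \<omega>)"
        using elim(3)
      proof eventually_elim
        case (elim \<omega>)
        then show ?case unfolding is_arg_max_linorder by (simp add: dv_def inner_diff_right)
      qed
      from integral_nonneg_AE[OF this] show ?thesis by simp
    qed
    finally show ?case .
  qed
  have "pairing 0 T (\<lambda>t \<omega>. ?Hv t \<omega>) dv
      + pairing 0 T (\<lambda>t \<omega>. ?Hd t \<omega>) (delayed P dv)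
      = (\<integral>s. a s \<partial>time_measure 0 T) + (\<integral>s. c s \<partial>time_measure 0 T)"
    unfolding a_def c_def integral_PM_iterated(2)[OF int] delay_anticipation_adjoint(1)[OF Hd dv dv0] ..
  also have "\<dots> = (\<integral>s. a s + c s \<partial>time_measure 0 T)" using a c by simp
  also have "\<dots> \<le> (\<integral>s. 0 \<partial>time_measure 0 T)"
    by (rule integral_mono_AE) (use a c nonpos in auto)
  finally show ?thesis by simp
qed

lemma running_variation:
  assumes conc: "AE t in time_measure 0 T. AE \<omega> in M. concave_on UNIV (hamiltonian P t \<omega> (p t \<omega>))"
    and v: "v \<in> admissible P" and state': "state_solution P v y' z'"
  defines "dy \<equiv> \<lambda>t \<omega>. y' t \<omega> - y t \<omega>" and "dz \<equiv> \<lambda>t \<omega>. z' t \<omega> - z t \<omega>" and "dv \<equiv> \<lambda>t \<omega>. v t \<omega> - u t \<omega>"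
  shows "(\<integral>q. running P (fst q) (snd q) (args_at P y' z' v (fst q) (snd q)) \<partial>PM 0 T)
      - (\<integral>q. running P (fst q) (snd q) (args_at P y z u (fst q) (snd q)) \<partial>PM 0 T)
    \<le> pairing 0 T p (\<lambda>t \<omega>. driver P t \<omega> (args_at P y' z' v t \<omega>) - driver P t \<omega> (args_at P y z u t \<omega>))
      + pairing 0 T (H_along P grad_y y z u p) dy
      + pairing 0 T (H_along P grad_yd y z u p) (delayed P dy)
      + pairing 0 T (H_along P grad_z y z u p) dz
      + pairing 0 T (H_along P grad_zd y z u p) (delayed P dz)
      + pairing 0 T (H_along P grad_v y z u p) dv
      + pairing 0 T (H_along P grad_vd y z u p) (delayed P dv)"
proof -
  note L = state_LpF[OF u state] and L' = state_LpF[OF v state']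
  have d: "LpF P 2 {-\<delta>..T} dy" "LpF P 2 {-\<delta>..T} dz" "LpF P 2 {-\<delta>..T} dv"
    unfolding dy_def dz_def dv_def by (intro LpF_2_diff L L')+
  have sq0: "sq_process 0 T x" if "LpF P 2 {-\<delta>..T} x" for x :: "real \<Rightarrow> 'w \<Rightarrow> 'h::euclidean_space"
    using LpF_2_sub_interval[OF that, of 0 T] delay_nonneg by (simp add: LpF_2_iff)
  define df where "df t \<omega> = driver P t \<omega> (args_at P y' z' v t \<omega>) - driver P t \<omega> (args_at P y z u t \<omega>)" for t \<omega>
  have df: "sq_process 0 T df" unfolding df_def
    by (rule sq_integrable_minus_processes[OF state_driver_sq_integrable[OF u state] state_driver_sq_integrable[OF v state']])
  have psq: "sq_process 0 T p" using p by (simp add: LpF_2_iff)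
  have pair: "integrable (PM 0 T) (\<lambda>q. f (fst q) (snd q) \<bullet> g (fst q) (snd q))"
    if "sq_process 0 T f" "sq_process 0 T g"
    for f g :: "real \<Rightarrow> 'w \<Rightarrow> 'h::euclidean_space"
    using integrable_inner[OF that] by (simp add: split_def)
  note H = bounded_gradients[THEN H_sq_integrable]
  note i = pair[OF psq df] pair[OF H(1) sq0[OF d(1)]] pair[OF H(2) delayed_sq_integrable[OF d(1)]]
    pair[OF H(3) sq0[OF d(2)]] pair[OF H(4) delayed_sq_integrable[OF d(2)]]
    pair[OF H(5) sq0[OF d(3)]] pair[OF H(6) delayed_sq_integrable[OF d(3)]]
  define R where "R t \<omega> = p t \<omega> \<bullet> df t \<omega> + H_along P grad_y y z u p t \<omega> \<bullet> dy t \<omega> + H_along P grad_yd y z u p t \<omega> \<bullet> delayed P dy t \<omega>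
      + H_along P grad_z y z u p t \<omega> \<bullet> dz t \<omega> + H_along P grad_zd y z u p t \<omega> \<bullet> delayed P dz t \<omega>
      + H_along P grad_v y z u p t \<omega> \<bullet> dv t \<omega> + H_along P grad_vd y z u p t \<omega> \<bullet> delayed P dv t \<omega>" for t \<omega>
  define D where "D t \<omega> = running P t \<omega> (args_at P y' z' v t \<omega>) - running P t \<omega> (args_at P y z u t \<omega>)" for t \<omega>
  note r = state_running_integrable[OF u state, unfolded split_def] state_running_integrable[OF v state', unfolded split_def]
  have Ri: "integrable (PM 0 T) (\<lambda>(t, \<omega>). R t \<omega>)"
    unfolding R_def split_def by (intro Bochner_Integration.integrable_add i)
  have Di: "integrable (PM 0 T) (\<lambda>(t, \<omega>). D t \<omega>)"
    unfolding D_def split_def by (intro Bochner_Integration.integrable_diff r)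
  have le: "AE t in time_measure 0 T. AE \<omega> in M. D t \<omega> \<le> R t \<omega>"
    using conc AE_sections[OF delayed_diff[OF L(1) L'(1)]] AE_sections[OF delayed_diff[OF L(2) L'(2)]]
      AE_sections[OF delayed_diff[OF L(3) L'(3)]] AE_space
  proof eventually_elim
    case (elim t)
    then have t: "t \<in> {0..T}" by simp
    show ?case using elim(1-4) AE_space
    proof eventually_elim
      case (elim \<omega>)
      show ?case
        using hamiltonian_gap[where p=p and y'=y' and z'=z' and v=v and y=y and z=z and u=u, OF t elim(5) elim(1)] elim(2-4)
        unfolding D_def R_def df_def dy_def dz_def dv_def by simp
    qed
  qed
  have "(\<integral>q. D (fst q) (snd q) \<partial>PM 0 T) \<le> (\<integral>q. R (fst q) (snd q) \<partial>PM 0 T)"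
    by (rule integral_PM_mono_sections[OF Di Ri le])
  moreover have "(\<integral>q. D (fst q) (snd q) \<partial>PM 0 T) = (\<integral>q. running P (fst q) (snd q) (args_at P y' z' v (fst q) (snd q)) \<partial>PM 0 T)
      - (\<integral>q. running P (fst q) (snd q) (args_at P y z u (fst q) (snd q)) \<partial>PM 0 T)"
    unfolding D_def by (rule Bochner_Integration.integral_diff[OF r(2,1)])
  moreover have "(\<integral>q. R (fst q) (snd q) \<partial>PM 0 T)
    = pairing 0 T p df
      + pairing 0 T (H_along P grad_y y z u p) dy
      + pairing 0 T (H_along P grad_yd y z u p) (delayed P dy)
      + pairing 0 T (H_along P grad_z y z u p) dz
      + pairing 0 T (H_along P grad_zd y z u p) (delayed P dz)
      + pairing 0 T (H_along P grad_v y z u p) dv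
      + pairing 0 T (H_along P grad_vd y z u p) (delayed P dv)"
    unfolding R_def
    by (simp only: Bochner_Integration.integral_add[OF _ i(7)] Bochner_Integration.integral_add[OF _ i(6)]
        Bochner_Integration.integral_add[OF _ i(5)] Bochner_Integration.integral_add[OF _ i(4)]
        Bochner_Integration.integral_add[OF _ i(3)] Bochner_Integration.integral_add[OF i(1) i(2)]
        Bochner_Integration.integrable_add i)
  ultimately show ?thesis unfolding df_def by linarith
qed

end

text \<open>
  The three dualities turn the bound of \<open>running_variation\<close> into \<open>E\<langle>p(0), y'(0) - y(0)\<rangle>\<close> plus the
  variation in the control, and \<open>p(0)\<close> is minus the gradient of \<open>\<gamma>\<close>, so the initial gain is at most
  the negative of the first term.
\<close>

lemma payoff_le:
  assumes u: "u \<in> admissible P" and state: "state_solution P u y z" and adj: "adjoint_solution P u y z p"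
    and max: "AE t in time_measure 0 T. AE \<omega> in M.
      is_arg_max (\<lambda>v. control_gradient P u y z p t \<omega> \<bullet> v) (\<lambda>v. v \<in> controls P) (u t \<omega>)"
    and conc: "AE t in time_measure 0 T. AE \<omega> in M. concave_on UNIV (hamiltonian P t \<omega> (p t \<omega>))"
    and conc0: "concave_on UNIV (initial P)"
    and v: "v \<in> admissible P" and state': "state_solution P v y' z'"
  shows "expectation (\<lambda>\<omega>. (LINT t:{0..T}|lborel. running P t \<omega> (args_at P y' z' v t \<omega>)) + initial P (y' 0 \<omega>))
    \<le> expectation (\<lambda>\<omega>. (LINT t:{0..T}|lborel. running P t \<omega> (args_at P y z u t \<omega>)) + initial P (y 0 \<omega>))"
proof -
  have p: "LpF P 2 {0..T} p" using adj unfolding adjoint_solution_def by blast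
  then have psq: "sq_process 0 T p" by (simp add: LpF_2_iff)
  define Hy Hz where "Hy = H_along P grad_y y z u p" and "Hz = H_along P grad_z y z u p"
  define Hyd Hzd where "Hyd = H_along P grad_yd y z u p" and "Hzd = H_along P grad_zd y z u p"
  note H = bounded_gradients[THEN H_sq_integrable[OF u state p], folded Hy_def Hz_def Hyd_def Hzd_def]
  obtain q r where q: "cond_exp_process P (anticipated P Hyd) q" and r: "cond_exp_process P (anticipated P Hzd) r"
    and eq: "\<forall>t\<in>{0..T}. \<exists>I. has_ito_integral P 0 t (\<lambda>s \<omega>. - Hz s \<omega> - delay_density P s *\<^sub>R r s \<omega>) I \<and>
      (AE \<omega> in M. p t \<omega> = - grad (initial P) (y 0 \<omega>) + (LINT s:{0..t}|lborel. - Hy s \<omega> - delay_density P s *\<^sub>R q s \<omega>) + I \<omega>)"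
    using adj unfolding adjoint_solution_def Hy_def Hz_def Hyd_def Hzd_def by blast
  define b \<sigma> where "b s \<omega> = - Hy s \<omega> - delay_density P s *\<^sub>R q s \<omega>"
    and "\<sigma> s \<omega> = - Hz s \<omega> - delay_density P s *\<^sub>R r s \<omega>" for s \<omega>
  define p0 where "p0 \<omega> = - grad (initial P) (y 0 \<omega>)" for \<omega>
  define dy dz dv where "dy t \<omega> = y' t \<omega> - y t \<omega>" and "dz t \<omega> = z' t \<omega> - z t \<omega>" and "dv t \<omega> = v t \<omega> - u t \<omega>" for t \<omega>
  have forward: "forward_solution T p0 b \<sigma> p"
    using eq unfolding forward_solution_def integral_time_measure b_def \<sigma>_def p0_def by blast
  note \<rho>q = density_cond_exp_sq_integrable[OF H(2) q] and \<rho>r = density_cond_exp_sq_integrable[OF H(4) r]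
  have b: "sq_process 0 T b"
    using sq_integrable_diff[OF sq_integrable_minus[OF H(1)] \<rho>q] by (simp add: b_def split_def)
  have b_adapted: "AE t in time_measure 0 T. b t \<in> borel_measurable (filt P t)"
    using H_along_adapted[OF bounded_gradients(1) state_args(2)[OF u state] p, folded Hy_def] AE_space
  proof eventually_elim
    case (elim t)
    then have "q t \<in> borel_measurable (filt P t)" using q unfolding cond_exp_process_def measurable_adapted_def by simp
    then show ?case using elim(1) unfolding b_def by measurable
  qed
  have T0: "0 \<in> {0..T}" using T_pos by simp
  have y0: "y 0 \<in> borel_measurable (filt P 0)" using state_LpF_0(1)[OF u state] T0 by (simp add: LpF_2_iff)
  have p0_adapted: "p0 \<in> borel_measurable (filt P 0)"
  proof -
    have "(\<lambda>\<omega>. grad (initial P) (y 0 \<omega>)) \<in> borel_measurable (filt P 0)"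
    proof (rule gradient_measurable[where D=grad and \<iota>="\<lambda>e. e"])
      show "initial P differentiable (at (y 0 \<omega>))" for \<omega>
        using initial_derivative unfolding differentiable_def by blast
    qed (rule grad_inner initial_measurable y0, assumption?)+
    then show ?thesis unfolding p0_def by measurable
  qed
  have p0_sq: "sq_integrable M p0"
  proof -
    obtain C where "\<forall>a. norm (grad (initial P) a) \<le> C" using initial_gradient_bound by blast
    then have "bounded_at 0 p0" using p0_adapted unfolding bounded_at_def p0_def by auto
    then show ?thesis by (rule bounded_at_sq)
  qed
  define F where "F = pairing 0 T p (\<lambda>t \<omega>. driver P t \<omega> (args_at P y' z' v t \<omega>) - driver P t \<omega> (args_at P y z u t \<omega>))"
  have duality: "expectation (\<lambda>\<omega>. p0 \<omega> \<bullet> dy 0 \<omega>) = F - pairing 0 T b dy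
      - pairing 0 T \<sigma> dz"
    unfolding F_def dy_def dz_def
    using forward_backward_duality[OF less_imp_le[OF T_pos] p0_adapted p0_sq b b_adapted psq forward
        state_driver_sq_integrable[OF u state] state_driver_adapted[OF u state]
        state_driver_sq_integrable[OF v state'] state_driver_adapted[OF v state']
        state_sq_integrable(1)[OF u state] state_backward[OF u state]
        state_sq_integrable(1)[OF v state'] state_backward[OF v state']] .
  note L = state_LpF[OF u state] and L' = state_LpF[OF v state'] and van = states_vanish_before_0[OF state state']
  have dyL: "LpF P 2 {-\<delta>..T} dy" and dzL: "LpF P 2 {-\<delta>..T} dz"
    unfolding dy_def dz_def by (intro LpF_2_diff L L')+
  have dysq: "sq_process 0 T dy" and dzsq: "sq_process 0 T dz"
    unfolding dy_def dz_def
    by (rule sq_integrable_minus_processes state_sq_integrable[OF u state] state_sq_integrable[OF v state'])+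
  have van': "vanishes_before_0 dy" "vanishes_before_0 dz" using van unfolding dy_def dz_def .
  have by_eq: "pairing 0 T b dy
      = - pairing 0 T Hy dy - pairing 0 T Hyd (delayed P dy)"
    unfolding delay_duality[OF H(2) q dyL van'(1)] b_def
    using integrable_inner[OF H(1) dysq] integrable_inner[OF \<rho>q dysq]
    by (simp add: split_def inner_diff_left)
  have \<sigma>z_eq: "pairing 0 T \<sigma> dz
      = - pairing 0 T Hz dz - pairing 0 T Hzd (delayed P dz)"
    unfolding delay_duality[OF H(4) r dzL van'(2)] \<sigma>_def
    using integrable_inner[OF H(3) dzsq] integrable_inner[OF \<rho>r dzsq]
    by (simp add: split_def inner_diff_left)
  have dy0: "sq_integrable M (dy 0)" unfolding dy_def
    by (rule sq_integrable_diff[OF state_initial_sq_integrable[OF v state'] state_initial_sq_integrable[OF u state]])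
  have "expectation (\<lambda>\<omega>. initial P (y' 0 \<omega>) - initial P (y 0 \<omega>)) \<le> expectation (\<lambda>\<omega>. - (p0 \<omega> \<bullet> dy 0 \<omega>))"
  proof (rule integral_mono)
    show "integrable M (\<lambda>\<omega>. initial P (y' 0 \<omega>) - initial P (y 0 \<omega>))"
      by (rule Bochner_Integration.integrable_diff[OF state_initial_integrable[OF v state'] state_initial_integrable[OF u state]])
    show "integrable M (\<lambda>\<omega>. - (p0 \<omega> \<bullet> dy 0 \<omega>))" using integrable_inner[OF p0_sq dy0] by simp
    show "initial P (y' 0 \<omega>) - initial P (y 0 \<omega>) \<le> - (p0 \<omega> \<bullet> dy 0 \<omega>)" for \<omega>
      using initial_gap[OF conc0, of "y' 0 \<omega>" "y 0 \<omega>"] by (simp add: p0_def dy_def)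
  qed
  then have initial: "expectation (\<lambda>\<omega>. initial P (y' 0 \<omega>)) - expectation (\<lambda>\<omega>. initial P (y 0 \<omega>))
      \<le> - expectation (\<lambda>\<omega>. p0 \<omega> \<bullet> dy 0 \<omega>)"
    using state_initial_integrable[OF v state'] state_initial_integrable[OF u state] by simp
  note run = running_variation[OF u state p conc v state', folded dy_def dz_def dv_def Hy_def Hz_def Hyd_def Hzd_def, folded F_def]
  note ctrl = control_variation_nonpos[OF u state p max v, folded dv_def]
  show ?thesis
    unfolding state_payoff[OF v state'] state_payoff[OF u state]
    using run ctrl initial duality unfolding by_eq \<sigma>z_eq by linarith
qed

lemma maximum_condition_sufficient:
  assumes u: "u \<in> admissible P" and state: "state_solution P u y z" and adj: "adjoint_solution P u y z p"
    and max: "AE t in time_measure 0 T. AE \<omega> in M.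
      is_arg_max (\<lambda>v. control_gradient P u y z p t \<omega> \<bullet> v) (\<lambda>v. v \<in> controls P) (u t \<omega>)"
    and conc: "AE t in time_measure 0 T. AE \<omega> in M. concave_on UNIV (hamiltonian P t \<omega> (p t \<omega>))"
    and conc0: "concave_on UNIV (initial P)"
  shows "optimal_control P u"
proof -
  let ?J = "\<lambda>v y z. expectation (\<lambda>\<omega>. (LINT t:{0..T}|lborel. running P t \<omega> (args_at P y z v t \<omega>)) + initial P (y 0 \<omega>))"
  have traj: "\<exists>y' z'. state_solution P v y' z' \<and> objective P v = ?J v y' z'" if v: "v \<in> admissible P" for v
  proof -
    have "\<exists>y z. state_solution P v y z"
      using setting v unfolding delay_setting_def state_well_posed_def by blast
    then have "\<exists>yz. (\<lambda>(y, z). state_solution P v y z) yz" by auto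
    then have "(\<lambda>(y, z). state_solution P v y z) (trajectory P v)" unfolding trajectory_def by (rule someI_ex)
    then show ?thesis by (cases "trajectory P v") (auto simp: objective_def)
  qed
  have J_u: "objective P u = ?J u y z"
  proof -
    obtain y' z' where s: "state_solution P u y' z'" "objective P u = ?J u y' z'" using traj[OF u] by blast
    show ?thesis unfolding s(2) by (rule payoff_unique[OF u state s(1)])
  qed
  have "objective P v \<le> objective P u" if v: "v \<in> admissible P" for v
  proof -
    obtain y' z' where s: "state_solution P v y' z'" "objective P v = ?J v y' z'" using traj[OF v] by blast
    show ?thesis unfolding s(2) J_u by (rule payoff_le[OF u state adj max conc conc0 v s(1)])
  qed
  then show ?thesis unfolding optimal_control_def is_arg_max_linorder using u by simp
qed

end

theorem theorem3p2:
  fixes P :: "('w, 'n::finite, 'd::finite, 'k::finite) delay_problem"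
    and u :: "real \<Rightarrow> 'w \<Rightarrow> real^'k"
    and y :: "real \<Rightarrow> 'w \<Rightarrow> real^'n"
    and z :: "real \<Rightarrow> 'w \<Rightarrow> real^'d^'n"
    and p :: "real \<Rightarrow> 'w \<Rightarrow> real^'n"
  assumes "delay_setting P" and "assumption_A P" and "assumption_B P"
    and "u \<in> admissible P" and "state_solution P u y z" and "adjoint_solution P u y z p"
    and "AE t in lborel. t \<in> {0..horizon P} \<longrightarrow> (AE \<omega> in prob P.
           is_arg_max (\<lambda>v. control_gradient P u y z p t \<omega> \<bullet> v) (\<lambda>v. v \<in> controls P) (u t \<omega>))"
    and "AE t in lborel. t \<in> {0..horizon P} \<longrightarrow> (AE \<omega> in prob P.
           concave_on UNIV (hamiltonian P t \<omega> (p t \<omega>)))"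
    and "concave_on UNIV (initial P)"
  shows "optimal_control P u"
proof -
  have "control_model P"
    by (rule control_model.intro[OF delay_model.intro[OF assms(1)] control_model_axioms.intro[OF assms(2,3)]])
  note sufficient = control_model.maximum_condition_sufficient[OF this assms(4-6)]
  have 1: "AE t in time_measure 0 (horizon P). AE \<omega> in prob P.
      is_arg_max (\<lambda>v. control_gradient P u y z p t \<omega> \<bullet> v) (\<lambda>v. v \<in> controls P) (u t \<omega>)"
    unfolding AE_time_measure by (rule assms(7))
  have 2: "AE t in time_measure 0 (horizon P). AE \<omega> in prob P. concave_on UNIV (hamiltonian P t \<omega> (p t \<omega>))"
    unfolding AE_time_measure by (rule assms(8))
  show ?thesis by (rule sufficient[OF 1 2 assms(9)])
qed

end
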